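(* There is a finite template structure $\mathbf{A}$ with $7$ elements that has a Maltsev polymorphism and such that $\mathrm{CSP}(\mathbf{A})$ is solved by none of the following algorithms: (1) $\mathbb{Z}$-affine $k$-consistency, for every function $k\colon\mathbb{N}\to\mathbb{N}_{\geq 1}$ with $k\in o(n)$, where on input $\mathbf{B}$ the width is $k(n)$ for $n=|B|$ the instance size; (2) BLP+AIP; (3) BA$^k$, for every function $k\colon\mathbb{N}\to\mathbb{N}_{\geq 1}$ with $k\in o(n)$, where on input $\mathbf{B}$ the width is $k(n)$ for $n=|B|$ the instance size; (4) CLAP. Hence none of these algorithms solves all tractable CSPs (i.e. all $\mathrm{CSP}(\mathbf{A})$ with $\mathbf{A}$ finite that are decidable in polynomial time).
   Context: All structures are finite relational structures; $\mathbf{A}$, $\mathbf{B}$ have universes $A$, $B$. $\mathrm{CSP}(\mathbf{A})$ is the class of finite structures $\mathbf{B}$ over the vocabulary $\tau$ of the (nonempty) template $\mathbf{A}$ that admit a homomorphism $\mathbf{B}\to\mathbf{A}$; any finite $\tau$-structure is an instance. An algorithm solves $\mathrm{CSP}(\mathbf{A})$ if it accepts exactly those instances that are in $\mathrm{CSP}(\mathbf{A})$. A Maltsev polymorphism is a polymorphism $p\colon A^3\to A$ with $p(x,x,y)=p(y,x,x)=y$ for all $x,y$. $\mathbf{B}[X]$ is the induced substructure on $X$, $\binom{B}{\leq k}$ is the set of subsets of $B$ of size at most $k$, $\mathrm{ar}(R)$ is the arity of $R$. $k$-consistency: $\kappa_k^{\mathbf{A}}[\mathbf{B}]$ is the greatest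 (pointwise w.r.t. inclusion) map $\kappa$ assigning to each $X\in\binom{B}{\leq k}$ a set $\kappa(X)$ of homomorphisms $\mathbf{B}[X]\to\mathbf{A}$ such that for all $Y\subset X\in\binom{B}{\leq k}$: every $f\in\kappa(Y)$ extends to some $g\in\kappa(X)$, and for every $g\in\kappa(X)$ we have $g|_Y\in\kappa(Y)$. $\mathbb{Z}$-affine $k$-consistency: accept $\mathbf{B}$ iff, for $\kappa=\kappa_k^{\mathbf{A}}[\mathbf{B}]$, the following system in variables $z_{X,f}$ ($X\in\binom{B}{\leq k}$, $f\in\kappa(X)$) has an integer solution: $\sum_{f\in\kappa(X)}z_{X,f}=1$ for all $X\in\binom{B}{\leq k}$; $\sum_{f\in\kappa(X),f|_Y=g}z_{X,f}=z_{Y,g}$ for all $Y\subset X\in\binom{B}{\leq k}$, $g\in\kappa(Y)$. System $\mathsf{L}^{k}$: variables $\lambda_{X,f}$ for all $X\in\binom{B}{\leq k}$ and all maps $f\colon X\to A$, and $\mu_{R,\bar b,\bar a}$ for all $R\in\tau$, $\bar b\in R^{\mathbf{B}}$, $\bar a\in R^{\mathbf{A}}$; equations: (B1) $\sum_{f\colon X\to A}\lambda_{X,f}=1$ for all $X\in\binom{B}{\leq k}$; (B2) $\sum_{f\colon X\to A, f|_Y=g}\lambda_{X,f}=\lambda_{Y,g}$ for all $Y\subset X\in\binom{B}{\leq k}$, $g\colon Y\to A$; (B3) for all $R\in\tau$, $\bar b\in R^{\mathbf{B}}$, $\bar a'\in A^k$, $\bar i\in[\mathrm{ar}(R)]^k$: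 $\sum_{\bar a\in R^{\mathbf{A}},\,\bar a_{\bar i}=\bar a'}\mu_{R,\bar b,\bar a}=\lambda_{X(\bar b_{\bar i}),\,\bar b_{\bar i}\mapsto\bar a'}$, where $\bar a_{\bar i}=(a_{i_1},\dots,a_{i_k})$, $\bar b_{\bar i}=(b_{i_1},\dots,b_{i_k})$, $X(\bar b_{\bar i})$ is the set of entries of $\bar b_{\bar i}$, and $\bar b_{\bar i}\mapsto\bar a'$ is the map sending $b_{i_j}$ to $a'_j$ (the right-hand side is read as $0$ if this is not a well-defined map). $\mathsf{L}^k_{\mathsf{BLP}}$ is this system over the nonnegative rationals, $\mathsf{L}^k_{\mathsf{AIP}}$ is this system over $\mathbb{Z}$. BA$^k$: reject if $\mathsf{L}^k_{\mathsf{BLP}}$ is infeasible. Otherwise take a relative interior point $\Phi$ of its solution polytope (so $\Phi(x)=0$ iff every solution has $x=0$), and accept iff $\mathsf{L}^k_{\mathsf{AIP}}$ together with the constraints $x=0$ for all variables $x$ with $\Phi(x)=0$ has an integer solution. BLP+AIP is BA$^1$. CLAP: (i) for each $R\in\tau$, $\bar b\in R^{\mathbf{B}}$ initialize $S_{\bar b,R}:=R^{\mathbf{A}}$. (ii) Repeat until no set changes: for each $R$, $\bar b\in R^{\mathbf{B}}$, $\bar a\in S_{\bar b,R}$, if $\mathsf{L}^1_{\mathsf{BLP}}$ with the additional constraints $\mu_{R,\bar b,\bar a}=1$ and $\mu_{R',\bar b',\bar a'}=0$ for all $R'\in\tau$, $\bar b'\in R'^{\mathbf{B}}$, $\bar a'\in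 R'^{\mathbf A}\setminus S_{\bar b',R'}$ is infeasible, remove $\bar a$ from $S_{\bar b,R}$. (iii) If some $S_{\bar b,R}=\emptyset$, reject. (iv) If for some $R$, $\bar b\in R^{\mathbf{B}}$, $\bar a\in S_{\bar b,R}$ the algorithm BA$^1$, run with these same additional constraints added to $\mathsf{L}^1_{\mathsf{BLP}}$ (and hence also to $\mathsf{L}^1_{\mathsf{AIP}}$), accepts, then accept; otherwise reject. Instances all of whose relations are empty are accepted. *)

theory Defs
  imports
    Complex_Main
    "HOL-Library.FuncSet"
    "HOL-Library.Landau_Symbols"
    "HOL-Computational_Algebra.Polynomial"
begin

section \<open>Finite relational structures and CSPs\<close>

text \<open>
  A finite vocabulary is the list of the arities of its relation symbols; the symbols themselves
  are the positions \<open>R < length \<tau>\<close>.  As usual for relational structures, arities are positive.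
\<close>

type_synonym vocabulary = "nat list"

definition vocabulary :: "vocabulary \<Rightarrow> bool" where
  "vocabulary \<tau> \<longleftrightarrow> (\<forall>r\<in>set \<tau>. 1 \<le> r)"

record 'a rel_struct =
  univ :: "'a set"
  rels :: "nat \<Rightarrow> 'a list set"

definition fin_struct :: "vocabulary \<Rightarrow> 'a rel_struct \<Rightarrow> bool" where
  "fin_struct \<tau> B \<longleftrightarrow> finite (univ B) \<and>
     (\<forall>R<length \<tau>. \<forall>t\<in>rels B R. length t = \<tau> ! R \<and> set t \<subseteq> univ B)"

definition template :: "vocabulary \<Rightarrow> 'a rel_struct \<Rightarrow> bool" where
  "template \<tau> A \<longleftrightarrow> vocabulary \<tau> \<and> fin_struct \<tau> A \<and> univ A \<noteq> {}"

definition induced :: "'b rel_struct \<Rightarrow> 'b set \<Rightarrow> 'b rel_struct" where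
  "induced B X = \<lparr>univ = X, rels = (\<lambda>R. {t \<in> rels B R. set t \<subseteq> X})\<rparr>"

text \<open>
  Maps with domain \<open>X\<close> are extensional functions, so that distinct elements of \<open>homs\<close> are
  distinct as maps and restriction to \<open>Y\<close> is \<open>restrict f Y\<close>.
\<close>

definition homs :: "vocabulary \<Rightarrow> 'b rel_struct \<Rightarrow> 'a rel_struct \<Rightarrow> ('b \<Rightarrow> 'a) set" where
  "homs \<tau> B A = {f \<in> univ B \<rightarrow>\<^sub>E univ A. \<forall>R<length \<tau>. \<forall>t\<in>rels B R. map f t \<in> rels A R}"

definition CSP :: "vocabulary \<Rightarrow> 'a rel_struct \<Rightarrow> 'b rel_struct set" where
  "CSP \<tau> A = {B. fin_struct \<tau> B \<and> homs \<tau> B A \<noteq> {}}"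

definition ternary_polymorphism ::
  "vocabulary \<Rightarrow> 'a rel_struct \<Rightarrow> ('a \<Rightarrow> 'a \<Rightarrow> 'a \<Rightarrow> 'a) \<Rightarrow> bool" where
  "ternary_polymorphism \<tau> A p \<longleftrightarrow>
     (\<forall>x\<in>univ A. \<forall>y\<in>univ A. \<forall>z\<in>univ A. p x y z \<in> univ A) \<and>
     (\<forall>R<length \<tau>. \<forall>s\<in>rels A R. \<forall>t\<in>rels A R. \<forall>u\<in>rels A R.
        map (\<lambda>i. p (s ! i) (t ! i) (u ! i)) [0..<\<tau> ! R] \<in> rels A R)"

definition has_Maltsev :: "vocabulary \<Rightarrow> 'a rel_struct \<Rightarrow> bool" where
  "has_Maltsev \<tau> A \<longleftrightarrow> (\<exists>p. ternary_polymorphism \<tau> A p \<and>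
     (\<forall>x\<in>univ A. \<forall>y\<in>univ A. p x x y = y \<and> p y x x = y))"

text \<open>
  An algorithm is given by its acceptance behaviour: template vocabulary, template, instance.
\<close>

type_synonym ('a, 'b) csp_algorithm = "vocabulary \<Rightarrow> 'a rel_struct \<Rightarrow> 'b rel_struct \<Rightarrow> bool"

definition solves_CSP :: "('a, 'b) csp_algorithm \<Rightarrow> vocabulary \<Rightarrow> 'a rel_struct \<Rightarrow> bool" where
  "solves_CSP alg \<tau> A \<longleftrightarrow> (\<forall>B. fin_struct \<tau> B \<longrightarrow> (alg \<tau> A B \<longleftrightarrow> B \<in> CSP \<tau> A))"

definition sublinear_width :: "(nat \<Rightarrow> nat) \<Rightarrow> bool" where
  "sublinear_width k \<longleftrightarrow> (\<forall>n. 1 \<le> k n) \<and> (\<lambda>n. real (k n)) \<in> o(\<lambda>n. real n)"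

definition subsets_le :: "nat \<Rightarrow> 'b rel_struct \<Rightarrow> 'b set set" where
  "subsets_le k B = {X. X \<subseteq> univ B \<and> finite X \<and> card X \<le> k}"


section \<open>Affine consistency\<close>

definition k_consistent ::
  "vocabulary \<Rightarrow> nat \<Rightarrow> 'a rel_struct \<Rightarrow> 'b rel_struct \<Rightarrow> ('b set \<Rightarrow> ('b \<Rightarrow> 'a) set) \<Rightarrow> bool" where
  "k_consistent \<tau> k A B \<kappa> \<longleftrightarrow>
     (\<forall>X\<in>subsets_le k B. \<kappa> X \<subseteq> homs \<tau> (induced B X) A) \<and>
     (\<forall>X\<in>subsets_le k B. \<forall>Y. Y \<subset> X \<longrightarrow>
        (\<forall>f\<in>\<kappa> Y. \<exists>g\<in>\<kappa> X. restrict g Y = f) \<and> (\<forall>g\<in>\<kappa> X. restrict g Y \<in> \<kappa> Y))"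

text \<open>
  The order on maps is pointwise inclusion.  Values outside \<open>subsets_le k B\<close> are unconstrained
  (hence \<open>UNIV\<close> in the greatest map) and are never used.
\<close>

definition kappa ::
  "vocabulary \<Rightarrow> nat \<Rightarrow> 'a rel_struct \<Rightarrow> 'b rel_struct \<Rightarrow> 'b set \<Rightarrow> ('b \<Rightarrow> 'a) set" where
  "kappa \<tau> k A B = (GREATEST \<kappa>. k_consistent \<tau> k A B \<kappa>)"

lemma k_consistent_Sup: "k_consistent \<tau> k A B (Sup {\<kappa>. k_consistent \<tau> k A B \<kappa>})"
proof -
  let ?K = "{\<kappa>. k_consistent \<tau> k A B \<kappa>}"
  have mem: "f \<in> (Sup ?K) X \<longleftrightarrow> (\<exists>\<kappa>. k_consistent \<tau> k A B \<kappa> \<and> f \<in> \<kappa> X)" for f X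
    by (simp add: Sup_fun_def)
  have 1: "f \<in> homs \<tau> (induced B X) A"
    if X: "X \<in> subsets_le k B" and f: "f \<in> (Sup ?K) X" for X f
  proof -
    obtain \<kappa> where "k_consistent \<tau> k A B \<kappa>" "f \<in> \<kappa> X"
      using f unfolding mem by blast
    with X show ?thesis unfolding k_consistent_def by blast
  qed
  have 2: "\<exists>g\<in>(Sup ?K) X. restrict g Y = f"
    if X: "X \<in> subsets_le k B" "Y \<subset> X" and f: "f \<in> (Sup ?K) Y" for X Y f
  proof -
    obtain \<kappa> where \<kappa>: "k_consistent \<tau> k A B \<kappa>" "f \<in> \<kappa> Y"
      using f unfolding mem by blast
    then obtain g where "g \<in> \<kappa> X" "restrict g Y = f"
      using X unfolding k_consistent_def by blast
    with \<kappa> show ?thesis unfolding Bex_def mem by blast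
  qed
  have 3: "restrict g Y \<in> (Sup ?K) Y"
    if X: "X \<in> subsets_le k B" "Y \<subset> X" and g: "g \<in> (Sup ?K) X" for X Y g
  proof -
    obtain \<kappa> where \<kappa>: "k_consistent \<tau> k A B \<kappa>" "g \<in> \<kappa> X"
      using g unfolding mem by blast
    then have "restrict g Y \<in> \<kappa> Y"
      using X unfolding k_consistent_def by blast
    with \<kappa> show ?thesis unfolding mem by blast
  qed
  show ?thesis
    by (subst k_consistent_def) (use 1 2 3 in blast)
qed

lemma kappa_eq_Sup: "kappa \<tau> k A B = Sup {\<kappa>. k_consistent \<tau> k A B \<kappa>}"
  unfolding kappa_def
proof (rule Greatest_equality)
  show "k_consistent \<tau> k A B (Sup {\<kappa>. k_consistent \<tau> k A B \<kappa>})"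
    by (rule k_consistent_Sup)
  show "\<kappa> \<le> Sup {\<kappa>. k_consistent \<tau> k A B \<kappa>}" if "k_consistent \<tau> k A B \<kappa>" for \<kappa>
    using that by (intro Sup_upper CollectI)
qed

lemma k_consistent_kappa: "k_consistent \<tau> k A B (kappa \<tau> k A B)"
  by (simp add: kappa_eq_Sup k_consistent_Sup)

lemma kappa_greatest: "k_consistent \<tau> k A B \<kappa> \<Longrightarrow> \<kappa> \<le> kappa \<tau> k A B"
  by (simp add: kappa_eq_Sup Sup_upper)

definition Z_affine_accepts ::
  "vocabulary \<Rightarrow> nat \<Rightarrow> 'a rel_struct \<Rightarrow> 'b rel_struct \<Rightarrow> bool" where
  "Z_affine_accepts \<tau> k A B \<longleftrightarrow> (let \<kappa> = kappa \<tau> k A B in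
     \<exists>z :: 'b set \<Rightarrow> ('b \<Rightarrow> 'a) \<Rightarrow> int.
       (\<forall>X\<in>subsets_le k B. (\<Sum>f\<in>\<kappa> X. z X f) = 1) \<and>
       (\<forall>X\<in>subsets_le k B. \<forall>Y. Y \<subset> X \<longrightarrow>
          (\<forall>g\<in>\<kappa> Y. (\<Sum>f\<in>{f \<in> \<kappa> X. restrict f Y = g}. z X f) = z Y g)))"

definition Z_affine_consistency :: "(nat \<Rightarrow> nat) \<Rightarrow> ('a, 'b) csp_algorithm" where
  "Z_affine_consistency k \<tau> A B = Z_affine_accepts \<tau> (k (card (univ B))) A B"


section \<open>The algorithms based on BLP and AIP\<close>

datatype ('a, 'b) lvar =
    Lam "'b set" "'b \<Rightarrow> 'a"
  | Mu nat "'b list" "'a list"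

definition L_vars ::
  "vocabulary \<Rightarrow> nat \<Rightarrow> 'a rel_struct \<Rightarrow> 'b rel_struct \<Rightarrow> ('a, 'b) lvar set" where
  "L_vars \<tau> k A B =
     {Lam X f | X f. X \<in> subsets_le k B \<and> f \<in> X \<rightarrow>\<^sub>E univ A} \<union>
     {Mu R b a | R b a. R < length \<tau> \<and> b \<in> rels B R \<and> a \<in> rels A R}"

text \<open>
  The map sending the \<open>j\<close>-th entry of \<open>bs\<close> to the \<open>j\<close>-th entry of \<open>as\<close>.  On a repeated entry of
  \<open>bs\<close> the first occurrence counts, so the assignment is a well-defined map iff
  \<open>map (tuple_map bs as) bs = as\<close>.
\<close>

definition tuple_map :: "'b list \<Rightarrow> 'a list \<Rightarrow> 'b \<Rightarrow> 'a" where
  "tuple_map bs as = restrict (\<lambda>x. the (map_of (zip bs as) x)) (set bs)"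

text \<open>
  The conjuncts are (B1), (B2), (B3); index tuples \<open>i\<close> are 0-based.
\<close>

definition L_system ::
  "vocabulary \<Rightarrow> nat \<Rightarrow> 'a rel_struct \<Rightarrow> 'b rel_struct \<Rightarrow> (('a, 'b) lvar \<Rightarrow> 'n::comm_ring_1) \<Rightarrow> bool"
where
  "L_system \<tau> k A B v \<longleftrightarrow>
     (\<forall>X\<in>subsets_le k B. (\<Sum>f\<in>X \<rightarrow>\<^sub>E univ A. v (Lam X f)) = 1) \<and>
     (\<forall>X\<in>subsets_le k B. \<forall>Y. Y \<subset> X \<longrightarrow> (\<forall>g\<in>Y \<rightarrow>\<^sub>E univ A.
        (\<Sum>f\<in>{f \<in> X \<rightarrow>\<^sub>E univ A. restrict f Y = g}. v (Lam X f)) = v (Lam Y g))) \<and>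
     (\<forall>R<length \<tau>. \<forall>b\<in>rels B R. \<forall>a' i.
        length a' = k \<and> set a' \<subseteq> univ A \<and> length i = k \<and> set i \<subseteq> {..<\<tau> ! R} \<longrightarrow>
        (let b' = map ((!) b) i in
          (\<Sum>a\<in>{a \<in> rels A R. map ((!) a) i = a'}. v (Mu R b a)) =
          (if map (tuple_map b' a') b' = a' then v (Lam (set b') (tuple_map b' a')) else 0)))"

text \<open>
  Additional constraints fixing a variable to a constant: \<open>(x, c)\<close> stands for \<open>x = c\<close>.
\<close>

type_synonym ('a, 'b) constraints = "(('a, 'b) lvar \<times> int) set"

definition satisfies :: "(('a, 'b) lvar \<Rightarrow> 'n::comm_ring_1) \<Rightarrow> ('a, 'b) constraints \<Rightarrow> bool" where
  "satisfies v C \<longleftrightarrow> (\<forall>(x, c)\<in>C. v x = of_int c)"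

definition BLP_solutions ::
  "vocabulary \<Rightarrow> nat \<Rightarrow> ('a, 'b) constraints \<Rightarrow> 'a rel_struct \<Rightarrow> 'b rel_struct \<Rightarrow>
     (('a, 'b) lvar \<Rightarrow> rat) set" where
  "BLP_solutions \<tau> k C A B =
     {v. L_system \<tau> k A B v \<and> (\<forall>x\<in>L_vars \<tau> k A B. 0 \<le> v x) \<and> satisfies v C}"

definition rat_affine_hull :: "('x \<Rightarrow> rat) set \<Rightarrow> ('x \<Rightarrow> rat) set" where
  "rat_affine_hull P = {(\<lambda>x. \<Sum>w\<in>F. u w * w x) | F u. finite F \<and> F \<subseteq> P \<and> sum u F = 1}"

text \<open>
  Relative interior: interior relative to the affine hull, for the maximum distance on the
  (finitely many) coordinates in \<open>V\<close>.
\<close>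

definition relative_interior :: "'x set \<Rightarrow> ('x \<Rightarrow> rat) set \<Rightarrow> ('x \<Rightarrow> rat) set" where
  "relative_interior V P =
     {v \<in> P. \<exists>\<epsilon>>0. \<forall>w\<in>rat_affine_hull P. (\<forall>x\<in>V. \<bar>w x - v x\<bar> < \<epsilon>) \<longrightarrow> w \<in> P}"

text \<open>
  The relative interior is empty iff the system is infeasible, and all its points have the same
  zero coordinates, so the choice of \<open>\<Phi>\<close> does not affect the outcome.
\<close>

definition BA_accepts ::
  "vocabulary \<Rightarrow> nat \<Rightarrow> ('a, 'b) constraints \<Rightarrow> 'a rel_struct \<Rightarrow> 'b rel_struct \<Rightarrow> bool" where
  "BA_accepts \<tau> k C A B \<longleftrightarrow> BLP_solutions \<tau> k C A B \<noteq> {} \<and>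
     (\<exists>\<Phi>\<in>relative_interior (L_vars \<tau> k A B) (BLP_solutions \<tau> k C A B).
        \<exists>v :: ('a, 'b) lvar \<Rightarrow> int. L_system \<tau> k A B v \<and> satisfies v C \<and>
          (\<forall>x\<in>L_vars \<tau> k A B. \<Phi> x = 0 \<longrightarrow> v x = 0))"

definition BA :: "(nat \<Rightarrow> nat) \<Rightarrow> ('a, 'b) csp_algorithm" where
  "BA k \<tau> A B = BA_accepts \<tau> (k (card (univ B))) {} A B"

definition BLP_AIP :: "('a, 'b) csp_algorithm" where
  "BLP_AIP = BA (\<lambda>_. 1)"

text \<open>
  In CLAP, the state \<open>S R b\<close> is the current set for the relation symbol \<open>R\<close> and the tuple \<open>b\<close>.
\<close>

definition CLAP_constraints ::
  "vocabulary \<Rightarrow> 'a rel_struct \<Rightarrow> 'b rel_struct \<Rightarrow> (nat \<Rightarrow> 'b list \<Rightarrow> 'a list set) \<Rightarrow>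
     nat \<Rightarrow> 'b list \<Rightarrow> 'a list \<Rightarrow> ('a, 'b) constraints" where
  "CLAP_constraints \<tau> A B S R b a = insert (Mu R b a, 1)
     {(Mu R' b' a', 0) | R' b' a'. R' < length \<tau> \<and> b' \<in> rels B R' \<and> a' \<in> rels A R' - S R' b'}"

inductive CLAP_step ::
  "vocabulary \<Rightarrow> 'a rel_struct \<Rightarrow> 'b rel_struct \<Rightarrow>
     (nat \<Rightarrow> 'b list \<Rightarrow> 'a list set) \<Rightarrow> (nat \<Rightarrow> 'b list \<Rightarrow> 'a list set) \<Rightarrow> bool"
  for \<tau> A B where
  "\<lbrakk>R < length \<tau>; b \<in> rels B R; a \<in> S R b;
    BLP_solutions \<tau> 1 (CLAP_constraints \<tau> A B S R b a) A B = {}\<rbrakk>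
   \<Longrightarrow> CLAP_step \<tau> A B S (S(R := (S R)(b := S R b - {a})))"

text \<open>
  The tuples may be examined in any order: removing tuples only adds constraints, so a removable
  tuple stays removable and the final state does not depend on the order.
\<close>

definition CLAP_final ::
  "vocabulary \<Rightarrow> 'a rel_struct \<Rightarrow> 'b rel_struct \<Rightarrow> (nat \<Rightarrow> 'b list \<Rightarrow> 'a list set) \<Rightarrow> bool" where
  "CLAP_final \<tau> A B S \<longleftrightarrow>
     (CLAP_step \<tau> A B)\<^sup>*\<^sup>* (\<lambda>R b. rels A R) S \<and> (\<nexists>S'. CLAP_step \<tau> A B S S')"

definition CLAP :: "('a, 'b) csp_algorithm" where
  "CLAP \<tau> A B \<longleftrightarrow> (\<forall>R<length \<tau>. rels B R = {}) \<or>
     (\<exists>S. CLAP_final \<tau> A B S \<and>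
        (\<forall>R<length \<tau>. \<forall>b\<in>rels B R. S R b \<noteq> {}) \<and>
        (\<exists>R<length \<tau>. \<exists>b\<in>rels B R. \<exists>a\<in>S R b.
           BA_accepts \<tau> 1 (CLAP_constraints \<tau> A B S R b a) A B))"


section \<open>Polynomial time\<close>

text \<open>
  Deterministic multi-tape Turing machines with two-way infinite tapes.  States are
  \<open>0, \<dots>, num_states - 1\<close> with initial state 0, accepting state 1 and rejecting state 2.  Tape
  symbols are \<open>0, \<dots>, num_symbols - 1\<close> with blank 0; the input bits 0 and 1 are written as the
  symbols 1 and 2.  The transition function maps a state and the list of scanned symbols to the
  new state and, for each tape, the symbol to be written and the head movement.
\<close>

record turing_machine =
  num_tapes :: nat
  num_states :: nat
  num_symbols :: nat
  transition :: "nat \<Rightarrow> nat list \<Rightarrow> nat \<times> (nat \<times> int) list"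

definition wf_tm :: "turing_machine \<Rightarrow> bool" where
  "wf_tm M \<longleftrightarrow> 1 \<le> num_tapes M \<and> 3 \<le> num_states M \<and> 3 \<le> num_symbols M \<and>
     (\<forall>q<num_states M. \<forall>ss. length ss = num_tapes M \<and> set ss \<subseteq> {..<num_symbols M} \<longrightarrow>
        (case transition M q ss of (q', acts) \<Rightarrow>
           q' < num_states M \<and> length acts = num_tapes M \<and>
           set acts \<subseteq> {..<num_symbols M} \<times> {-1, 0, 1}))"

text \<open>
  A configuration consists of the state and, for each tape, head position and contents.
\<close>

type_synonym tm_config = "nat \<times> (int \<times> (int \<Rightarrow> nat)) list"

definition tm_step :: "turing_machine \<Rightarrow> tm_config \<Rightarrow> tm_config" where
  "tm_step M = (\<lambda>(q, tps). if q \<in> {1, 2} then (q, tps) else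
     (case transition M q (map (\<lambda>(h, c). c h) tps) of (q', acts) \<Rightarrow>
        (q', map2 (\<lambda>(h, c) (s, d). (h + d, c(h := s))) tps acts)))"

definition tm_init :: "turing_machine \<Rightarrow> bool list \<Rightarrow> tm_config" where
  "tm_init M w = (0,
     (0, \<lambda>p. if 0 \<le> p \<and> p < int (length w) then (if w ! nat p then 2 else 1) else 0) #
     replicate (num_tapes M - 1) (0, \<lambda>_. 0))"

definition tm_state_after :: "turing_machine \<Rightarrow> nat \<Rightarrow> bool list \<Rightarrow> nat" where
  "tm_state_after M t w = fst ((tm_step M ^^ t) (tm_init M w))"

text \<open>
  The standard binary encoding of a structure over an ordered universe: the size of the universe
  in unary, a separator, and for each relation symbol the characteristic bit string of its
  relation on the list of all tuples of the right length.
\<close>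

definition encode :: "vocabulary \<Rightarrow> nat rel_struct \<Rightarrow> bool list" where
  "encode \<tau> B = replicate (card (univ B)) False @ [True] @
     concat (map (\<lambda>R. map (\<lambda>t. t \<in> rels B R)
       (List.n_lists (\<tau> ! R) (sorted_list_of_set (univ B)))) [0..<length \<tau>])"

definition tractable_CSP :: "vocabulary \<Rightarrow> 'a rel_struct \<Rightarrow> bool" where
  "tractable_CSP \<tau> A \<longleftrightarrow> (\<exists>M (p :: nat poly). wf_tm M \<and>
     (\<forall>B. fin_struct \<tau> B \<longrightarrow>
        tm_state_after M (poly p (length (encode \<tau> B))) (encode \<tau> B) =
          (if B \<in> CSP \<tau> A then 1 else 2)))"

definition solves_all_tractable_CSPs :: "(nat, nat) csp_algorithm \<Rightarrow> bool" where
  "solves_all_tractable_CSPs alg \<longleftrightarrow>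
     (\<forall>\<tau> A. template \<tau> A \<and> tractable_CSP \<tau> A \<longrightarrow> solves_CSP alg \<tau> A)"

end

theory Submission imports Defs "HOL-Number_Theory.Cong" begin

text \<open>
  The template encodes ``either a linear equation over \<open>Z\<^sub>2\<close> on the left half
  of the tuple or one over \<open>Z\<^sub>3\<close> on the right half''. A connected instance
  whose left and right halves share no element is solvable iff the left system is solvable modulo
  2 or the right one modulo 3. Take both systems unsolvable and supported by the same random
  expander. On linearly many variables an expanding system looks solvable: the uniform measures on
  solutions of small subsystems are consistent, with total mass \<open>2 ^ N\<close> and
  \<open>3 ^ N\<close> respectively. A Bezout combination of the two is an integer solution, and either
  normalised measure is a rational one, so that the affine, BLP-based and consistency-based
  relaxations all accept. For CLAP an isolated tuple is added: fixing its value says nothing about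
  which half is active elsewhere.

  The template is tractable because homomorphisms can be found one component at a time.  The
  component of an element \<open>c\<close> is captured by linear algebra: a homogenising variable \<open>s\<^sub>b\<close> per element,
  constant along tuples, multiplies the right-hand sides, and \<open>s\<^sub>c = 1\<close> is imposed.  Gaussian
  elimination for these systems is carried out by a while program that is compiled to a Turing machine.
\<close>

section \<open>Expanding systems of five-variable equations\<close>

text \<open>Five variables per equation are dictated by two exponents. If every small
  \<open>S\<close> has more than \<open>3 * card S\<close> neighbours, double counting leaves more
  than \<open>(2 * 3 - 5) * card S\<close> private variables; and the union bound over
  \<open>S\<close> and a confining set of size \<open>3 * card S\<close> decays with
  \<open>N\<close> because \<open>1 + 3 - 5 < 0\<close>. The sixth entry of a tuple half exists
  because the template has no constants: two extra elements \<open>N\<close> and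
  \<open>N + 1\<close> carry the right-hand sides. Arity 6 is zero modulo 2 and modulo 3, so one
  extra tuple can force these elements apart in both groups. There are \<open>2 * N\<close>
  equations so that the right-hand sides, \<open>2 ^ (2 * N)\<close> many, outnumber the at most
  \<open>3 ^ (N + 1)\<close> residue assignments. The counting measures stay unnormalised: local
  consistency is then an identity between natural numbers that can be read over the integers as well
  as over the rationals.\<close>

definition nbhd :: "(nat \<Rightarrow> nat \<Rightarrow> nat) \<Rightarrow> nat set \<Rightarrow> nat set" where
  "nbhd e S = (\<lambda>(i, j). e i j) ` (S \<times> {..<5})"

text \<open>Occurrences are counted with multiplicity: a boundary element has coefficient 1 in the
  only equation of \<open>S\<close> that contains it, so that equation can be solved for it modulo
  any \<open>p\<close>.\<close>

definition boundary :: "(nat \<Rightarrow> nat \<Rightarrow> nat) \<Rightarrow> nat set \<Rightarrow> nat set" where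
  "boundary e S = {x. \<exists>i\<in>S. \<exists>j<5. e i j = x \<and>
     (\<forall>k\<in>S. \<forall>l<5. e k l = x \<longrightarrow> k = i \<and> l = j)}"

definition expander :: "nat \<Rightarrow> nat \<Rightarrow> nat \<Rightarrow> (nat \<Rightarrow> nat \<Rightarrow> nat) \<Rightarrow> bool" where
  "expander N m s e \<longleftrightarrow> (\<forall>i<m. \<forall>j<5. e i j < N) \<and>
     (\<forall>S. S \<subseteq> {..<m} \<and> S \<noteq> {} \<and> card S \<le> s \<longrightarrow> card S < card (boundary e S))"

lemma boundary_subset_nbhd: "boundary e S \<subseteq> nbhd e S"
  unfolding boundary_def nbhd_def by blast

text \<open>Double counting of occurrences: every neighbour is hit at least twice, except that
  boundary elements are hit once, and there are \<open>5 * card S\<close> occurrences in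
  total.\<close>

lemma twice_card_nbhd_le:
  assumes "finite S"
  shows "2 * card (nbhd e S) \<le> 5 * card S + card (boundary e S)"
proof -
  let ?P = "S \<times> {..<5::nat}"
  let ?f = "\<lambda>(i, j). e i j"
  let ?d = "\<lambda>x. card {ij \<in> ?P. ?f ij = x}"
  have fin: "finite ?P" using assms by simp
  have finN: "finite (nbhd e S)" unfolding nbhd_def using fin by blast
  have finB: "finite (boundary e S)"
    using boundary_subset_nbhd finN by (rule finite_subset)
  have deg: "2 \<le> ?d x + (if x \<in> boundary e S then 1 else 0)" if "x \<in> nbhd e S" for x
  proof -
    have "{ij \<in> ?P. ?f ij = x} \<noteq> {}" using that unfolding nbhd_def by auto
    then have d0: "?d x \<noteq> 0" using fin by simp
    have "x \<in> boundary e S" if "?d x = 1"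
    proof -
      from that obtain ij where ij: "{ij \<in> ?P. ?f ij = x} = {ij}" by (rule card_1_singletonE)
      obtain i j where "ij = (i, j)" by (cases ij)
      with ij have "(k, l) \<in> {ij \<in> ?P. ?f ij = x} \<longleftrightarrow> (k, l) = (i, j)" for k l
        by (simp only: singleton_iff)
      then have eq: "k \<in> S \<and> l < 5 \<and> e k l = x \<longleftrightarrow> k = i \<and> l = j" for k l
        by simp
      have "i \<in> S" "j < 5" "e i j = x" using eq[of i j] by simp_all
      moreover have "k = i \<and> l = j" if "k \<in> S" "l < 5" "e k l = x" for k l
        using eq[of k l] that by simp
      ultimately show ?thesis unfolding boundary_def by blast
    qed
    then consider "?d x = 1" "x \<in> boundary e S" | "2 \<le> ?d x" using d0 by linarith
    then show ?thesis by cases simp_all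
  qed
  have "2 * card (nbhd e S) = (\<Sum>x\<in>nbhd e S. 2)" by simp
  also have "\<dots> \<le> (\<Sum>x\<in>nbhd e S. ?d x + (if x \<in> boundary e S then 1 else 0))"
    by (rule sum_mono) (rule deg)
  also have "\<dots> = (\<Sum>x\<in>nbhd e S. ?d x) + card (nbhd e S \<inter> boundary e S)"
    using finN by (simp add: sum.distrib sum.If_cases)
  also have "(\<Sum>x\<in>nbhd e S. ?d x) = card ?P"
  proof -
    have "(\<Sum>x\<in>nbhd e S. \<Sum>ij\<in>{ij \<in> ?P. ?f ij = x}. (1::nat)) = (\<Sum>ij\<in>?P. 1)"
      by (rule sum.group[OF fin finN]) (auto simp: nbhd_def)
    then show ?thesis by simp
  qed
  also have "nbhd e S \<inter> boundary e S = boundary e S"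
    using boundary_subset_nbhd by blast
  finally show ?thesis by (simp add: card_cartesian_product mult.commute)
qed

section \<open>Union bound for random incidence functions\<close>

lemma self_power_le_fact: "real k ^ k \<le> 3 ^ k * fact k"
proof -
  have sm: "summable (\<lambda>n. real k ^ n /\<^sub>R fact n)" by (rule summable_exp_generic)
  \<comment> \<open>A single term of the exponential series at \<open>k\<close>.\<close>
  have "real k ^ k / fact k \<le> exp (real k)"
    unfolding exp_def
    using sum_le_suminf[OF sm, of "{k}"] by (simp add: field_simps)
  also have "\<dots> = exp 1 ^ k" by (simp add: exp_of_nat_mult[symmetric])
  also have "\<dots> \<le> 3 ^ k" by (rule power_mono) (use exp_le in auto)
  finally show ?thesis by (simp add: field_simps)
qed

lemma binomial_self_power_le: "real (n choose k) * real k ^ k \<le> (3 * real n) ^ k"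
proof -
  have "real (n choose k) * real k ^ k \<le> real (n choose k) * (3 ^ k * fact k)"
    by (intro mult_left_mono self_power_le_fact) simp
  also have "\<dots> = 3 ^ k * real ((n choose k) * fact k)" by simp
  also have "\<dots> \<le> 3 ^ k * real (n ^ k)"
  proof -
    have "(n choose k) * fact k \<le> n ^ k"
    proof (cases "k \<le> n")
      case True
      have "(fact n :: nat) = ((n choose k) * fact k) * fact (n - k)"
        using binomial_fact_lemma[OF True] by (simp add: ac_simps)
      then have "(n choose k) * fact k = fact n div fact (n - k)" by simp
      with fact_div_fact_le_pow[OF True] show ?thesis by simp
    qed (simp add: binomial_eq_0)
    then show ?thesis by (simp del: of_nat_mult of_nat_power)
  qed
  finally show ?thesis by (simp add: power_mult_distrib)
qed

text \<open>One level of the union bound: the choices of \<open>S\<close>, the choices of a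
  confining set of size \<open>3 * \<sigma>\<close>, and the ways to place all slots of
  \<open>S\<close> inside it. The constant is \<open>5832 = 4 * 6 * 3 ^ 3 * 9\<close>: the 4 yields
  the ratio 1/4, the other factors come from the two binomial estimates and from
  \<open>split\<close>.\<close>

lemma expander_union_bound_term:
  assumes \<sigma>: "0 < \<sigma>" and N: "5832 * \<sigma> \<le> N"
  shows "real ((2 * N) choose \<sigma>) * real (N choose (3 * \<sigma>)) * real (3 * \<sigma>) ^ (5 * \<sigma>)
    \<le> (1 / 4) ^ \<sigma> * real N ^ (5 * \<sigma>)"
proof -
  define x where "x = real \<sigma>"
  define y where "y = real N"
  have x: "x > 0" and xy: "5832 * x \<le> y" and y: "y > 0"
    using assms unfolding x_def y_def by linarith+
  have b1: "real ((2 * N) choose \<sigma>) * x ^ \<sigma> \<le> (6 * y) ^ \<sigma>"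
    using binomial_self_power_le[of "2 * N" \<sigma>] by (simp add: x_def y_def)
  have b2: "real (N choose (3 * \<sigma>)) * (3 * x) ^ (3 * \<sigma>) \<le> (3 * y) ^ (3 * \<sigma>)"
    using binomial_self_power_le[of N "3 * \<sigma>"] by (simp add: x_def y_def)
  \<comment> \<open>The power is factored so that the first two pieces cancel the denominators of
    the two binomial bounds, leaving one factor \<open>9 * x\<close> to be beaten by
    \<open>y\<close>.\<close>
  have split: "(3 * x) ^ (5 * \<sigma>) = x ^ \<sigma> * (3 * x) ^ (3 * \<sigma>) * (9 * x) ^ \<sigma>"
  proof -
    have "(3 * x) ^ (5 * \<sigma>) = ((3 * x) ^ 5) ^ \<sigma>" by (simp add: power_mult)
    also have "(3 * x) ^ 5 = x * (3 * x) ^ 3 * (9 * x)" by (simp add: eval_nat_numeral)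
    finally show ?thesis by (simp only: power_mult power_mult_distrib)
  qed
  have "real ((2 * N) choose \<sigma>) * real (N choose (3 * \<sigma>)) * (3 * x) ^ (5 * \<sigma>)
      = (real ((2 * N) choose \<sigma>) * x ^ \<sigma>) * (real (N choose (3 * \<sigma>)) * (3 * x) ^ (3 * \<sigma>)) * (9 * x) ^ \<sigma>"
    unfolding split by simp
  also have "\<dots> \<le> (6 * y) ^ \<sigma> * (3 * y) ^ (3 * \<sigma>) * (9 * x) ^ \<sigma>"
    by (intro mult_right_mono mult_mono b1 b2) (use x y in auto)
  also have "\<dots> = (6 * y * (3 * y) ^ 3 * (9 * x)) ^ \<sigma>"
    by (simp only: power_mult power_mult_distrib)
  also have "\<dots> \<le> (1 / 4 * y ^ 5) ^ \<sigma>"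
  proof (rule power_mono)
    have "6 * y * (3 * y) ^ 3 * (9 * x) = y ^ 4 * (1458 * x)" by (simp add: eval_nat_numeral)
    also have "\<dots> \<le> y ^ 4 * (1 / 4 * y)" by (intro mult_left_mono) (use xy y in auto)
    finally show "6 * y * (3 * y) ^ 3 * (9 * x) \<le> 1 / 4 * y ^ 5" by (simp add: eval_nat_numeral)
  qed (use x y in simp)
  also have "\<dots> = (1 / 4) ^ \<sigma> * y ^ (5 * \<sigma>)"
    by (simp only: power_mult power_mult_distrib)
  finally show ?thesis by (simp add: x_def y_def)
qed

lemma card_PiE_confined:
  assumes S: "S \<subseteq> {..<m}" and T: "T \<subseteq> {..<N::nat}"
  shows "card {\<phi> \<in> {..<m} \<times> {..<5::nat} \<rightarrow>\<^sub>E {..<N}. \<forall>ij\<in>S \<times> {..<5}. \<phi> ij \<in> T}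
    = card T ^ (5 * card S) * N ^ (5 * (m - card S))"
proof -
  let ?D = "{..<m} \<times> {..<5::nat}" and ?C = "S \<times> {..<5::nat}"
  have fS: "finite S" using S finite_subset by blast
  have sub: "?C \<subseteq> ?D" using S by auto
  have "{\<phi> \<in> ?D \<rightarrow>\<^sub>E {..<N}. \<forall>ij\<in>?C. \<phi> ij \<in> T} = PiE ?D (\<lambda>ij. if ij \<in> ?C then T else {..<N})"
  proof (intro set_eqI iffI)
    fix \<phi> assume \<phi>: "\<phi> \<in> PiE ?D (\<lambda>ij. if ij \<in> ?C then T else {..<N})"
    have "\<phi> \<in> ?D \<rightarrow>\<^sub>E {..<N}"
    proof (rule PiE_I)
      fix ij assume "ij \<in> ?D"
      from PiE_mem[OF \<phi> this] T show "\<phi> ij \<in> {..<N}" by (auto split: if_splits)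
    qed (rule PiE_arb[OF \<phi>])
    moreover have "\<phi> ij \<in> T" if "ij \<in> ?C" for ij
      using PiE_mem[OF \<phi> subsetD[OF sub that]] that by (simp only: if_True)
    ultimately show "\<phi> \<in> {\<phi> \<in> ?D \<rightarrow>\<^sub>E {..<N}. \<forall>ij\<in>?C. \<phi> ij \<in> T}" by blast
  qed (auto simp: PiE_def Pi_def)
  also have "card \<dots> = (\<Prod>ij\<in>?D. card (if ij \<in> ?C then T else {..<N}))"
    by (rule card_PiE) simp
  also have "\<dots> = (\<Prod>ij\<in>?D. if ij \<in> ?C then card T else N)"
    by (rule prod.cong) auto
  also have "\<dots> = card T ^ card (?D \<inter> ?C) * N ^ card (?D - ?C)"
    by (simp add: prod.If_cases Diff_eq)
  also have "?D \<inter> ?C = ?C" using sub by blast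
  also have "card (?D - ?C) = 5 * (m - card S)"
    using card_Diff_subset[of ?C ?D] sub fS by (simp add: card_cartesian_product diff_mult_distrib2 mult.commute)
  finally show ?thesis by (simp add: card_cartesian_product mult.commute)
qed

text \<open>First-moment argument over all incidence functions: for some of them no small
  \<open>S\<close> is confined to a set of size \<open>3 * card S\<close>, and the double count
  turns more than \<open>3 * card S\<close> neighbours into more than \<open>card S\<close> private
  variables. Variables may repeat within an equation.\<close>

lemma expander_exists:
  assumes N: "0 < N" and s: "5832 * s \<le> N"
  shows "\<exists>e. expander N (2 * N) s e"
proof -
  define m where "m = 2 * N"
  let ?\<Omega> = "{..<m} \<times> {..<5::nat} \<rightarrow>\<^sub>E {..<N}"
  define bad where "bad \<sigma> S T = {\<phi> \<in> ?\<Omega>. \<forall>ij\<in>S \<times> {..<5}. \<phi> ij \<in> T}" for \<sigma> :: nat and S T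
  define Ss where "Ss \<sigma> = {S. S \<subseteq> {..<m} \<and> card S = \<sigma>}" for \<sigma>
  define Ts where "Ts \<sigma> = {T. T \<subseteq> {..<N} \<and> card T = 3 * \<sigma>}" for \<sigma>
  define Bad where "Bad = (\<Union>\<sigma>\<in>{1..s}. \<Union>S\<in>Ss \<sigma>. \<Union>T\<in>Ts \<sigma>. bad \<sigma> S T)"
  have fin\<Omega>: "finite ?\<Omega>" by (intro finite_PiE) auto
  have finS: "finite (Ss \<sigma>)" and finT: "finite (Ts \<sigma>)" for \<sigma>
    unfolding Ss_def Ts_def by auto
  have cardS: "card (Ss \<sigma>) = m choose \<sigma>" and cardT: "card (Ts \<sigma>) = N choose (3 * \<sigma>)" for \<sigma>
    unfolding Ss_def Ts_def by (simp_all add: n_subsets)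
  have card\<Omega>: "card ?\<Omega> = N ^ (5 * m)"
    by (simp add: card_PiE card_cartesian_product mult.commute)
  have cb: "card (bad \<sigma> S T) = (3 * \<sigma>) ^ (5 * \<sigma>) * N ^ (5 * (m - \<sigma>))"
    if "S \<in> Ss \<sigma>" "T \<in> Ts \<sigma>" for \<sigma> S T
    using that card_PiE_confined[of S m T N] unfolding Ss_def Ts_def bad_def by auto
  have lvl: "card (\<Union>S\<in>Ss \<sigma>. \<Union>T\<in>Ts \<sigma>. bad \<sigma> S T)
      \<le> (m choose \<sigma>) * (N choose (3 * \<sigma>)) * ((3 * \<sigma>) ^ (5 * \<sigma>) * N ^ (5 * (m - \<sigma>)))" for \<sigma>
  proof -
    have "card (\<Union>S\<in>Ss \<sigma>. \<Union>T\<in>Ts \<sigma>. bad \<sigma> S T) \<le> (\<Sum>S\<in>Ss \<sigma>. \<Sum>T\<in>Ts \<sigma>. card (bad \<sigma> S T))"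
      by (intro order_trans[OF card_UN_le[OF finS]] sum_mono card_UN_le finT)
    also have "\<dots> = (\<Sum>S\<in>Ss \<sigma>. \<Sum>T\<in>Ts \<sigma>. (3 * \<sigma>) ^ (5 * \<sigma>) * N ^ (5 * (m - \<sigma>)))"
      by (intro sum.cong refl cb)
    finally show ?thesis by (simp add: cardS cardT)
  qed
  have "real (card Bad) \<le> (\<Sum>\<sigma>\<in>{1..s}. real (card (\<Union>S\<in>Ss \<sigma>. \<Union>T\<in>Ts \<sigma>. bad \<sigma> S T)))"
    unfolding Bad_def using card_UN_le[of "{1..s}" "\<lambda>\<sigma>. \<Union>S\<in>Ss \<sigma>. \<Union>T\<in>Ts \<sigma>. bad \<sigma> S T"]
    by (simp only: of_nat_sum[symmetric] of_nat_le_iff finite_atLeastAtMost)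
  also have "\<dots> \<le> (\<Sum>\<sigma>\<in>{1..s}. (1 / 4) ^ \<sigma> * real N ^ (5 * m))"
  proof (rule sum_mono)
    fix \<sigma> assume \<sigma>: "\<sigma> \<in> {1..s}"
    then have \<sigma>': "0 < \<sigma>" "5832 * \<sigma> \<le> N" "\<sigma> \<le> m" using s by (auto simp: m_def)
    have "real (card (\<Union>S\<in>Ss \<sigma>. \<Union>T\<in>Ts \<sigma>. bad \<sigma> S T))
        \<le> real ((m choose \<sigma>) * (N choose (3 * \<sigma>)) * ((3 * \<sigma>) ^ (5 * \<sigma>) * N ^ (5 * (m - \<sigma>))))"
      using lvl[of \<sigma>] of_nat_mono by blast
    also have "\<dots> = real ((2 * N) choose \<sigma>) * real (N choose (3 * \<sigma>)) * real (3 * \<sigma>) ^ (5 * \<sigma>) * real N ^ (5 * (m - \<sigma>))"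
      by (simp add: m_def)
    also have "\<dots> \<le> (1 / 4) ^ \<sigma> * real N ^ (5 * \<sigma>) * real N ^ (5 * (m - \<sigma>))"
      by (intro mult_right_mono expander_union_bound_term \<sigma>') simp
    also have "\<dots> = (1 / 4) ^ \<sigma> * real N ^ (5 * m)"
      using \<sigma>' by (simp add: mult.assoc power_add[symmetric] diff_mult_distrib2)
    finally show "real (card (\<Union>S\<in>Ss \<sigma>. \<Union>T\<in>Ts \<sigma>. bad \<sigma> S T)) \<le> (1 / 4) ^ \<sigma> * real N ^ (5 * m)" .
  qed
  also have "\<dots> = (\<Sum>\<sigma>\<in>{1..s}. (1 / 4) ^ \<sigma>) * real N ^ (5 * m)"
    by (simp add: sum_distrib_right)
  also have "\<dots> < 1 * real N ^ (5 * m)"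
  proof (rule mult_strict_right_mono)
    have "3 * (\<Sum>\<sigma>\<in>{1..s}. (1 / 4 :: real) ^ \<sigma>) = 1 - (1 / 4) ^ s"
      by (induction s) (auto simp: algebra_simps)
    moreover have "(0::real) < (1 / 4) ^ s" by simp
    ultimately show "(\<Sum>\<sigma>\<in>{1..s}. (1 / 4 :: real) ^ \<sigma>) < 1" by linarith
  qed (use N in simp)
  finally have "real (card Bad) < real (card ?\<Omega>)" by (simp add: card\<Omega>)
  then have "card Bad < card ?\<Omega>" by simp
  moreover have "Bad \<subseteq> ?\<Omega>" unfolding Bad_def bad_def by blast
  ultimately obtain \<phi> where \<phi>: "\<phi> \<in> ?\<Omega>" "\<phi> \<notin> Bad"
    by (metis less_irrefl subsetI subset_antisym)
  define e where "e i j = \<phi> (i, j)" for i j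
  have eN: "e i j < N" if "i < m" "j < 5" for i j
    using \<phi>(1) that unfolding e_def by (auto simp: PiE_def Pi_def)
  have "card S < card (boundary e S)" if S: "S \<subseteq> {..<m}" "S \<noteq> {}" "card S \<le> s" for S
  proof -
    have fS: "finite S" using S finite_subset by blast
    have sub: "nbhd e S \<subseteq> {..<N}" unfolding nbhd_def using eN S by auto
    have "\<not> card (nbhd e S) \<le> 3 * card S"
    proof
      assume le: "card (nbhd e S) \<le> 3 * card S"
      \<comment> \<open>The neighbourhood is padded to exactly \<open>3 * card S\<close> elements,
        the only size that \<open>Bad\<close> counts.\<close>
      have "3 * card S \<le> card {..<N}" using S s by simp
      then obtain T where T: "nbhd e S \<subseteq> T" "T \<subseteq> {..<N}" "card T = 3 * card S"
        using le sub exists_subset_between[of "nbhd e S" "3 * card S" "{..<N}"] by auto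
      have "\<phi> \<in> bad (card S) S T"
        using \<phi>(1) T(1) unfolding bad_def nbhd_def e_def by auto
      moreover have "card S \<in> {1..s}" using S fS by (simp add: Suc_leI card_gt_0_iff)
      ultimately have "\<phi> \<in> Bad" unfolding Bad_def Ss_def Ts_def using S T by blast
      with \<phi>(2) show False by simp
    qed
    with twice_card_nbhd_le[OF fS, of e] show ?thesis by linarith
  qed
  with eN show ?thesis unfolding expander_def m_def by blast
qed

lemma expander_boundary:
  "expander N m s e \<Longrightarrow> S \<subseteq> {..<m} \<Longrightarrow> S \<noteq> {} \<Longrightarrow> card S \<le> s \<Longrightarrow> card S < card (boundary e S)"
  unfolding expander_def by blast

lemma boundary_Un: "boundary e (S \<union> S') \<subseteq> boundary e S \<union> boundary e S'"
  unfolding boundary_def by blast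

lemma boundary_Diff:
  assumes "x \<in> boundary e S" "\<And>i j. i \<in> S - S' \<Longrightarrow> j < 5 \<Longrightarrow> e i j \<noteq> x" "S' \<subseteq> S"
  shows "x \<in> boundary e S'"
  using assms unfolding boundary_def by blast

section \<open>Local uniform measures on the solutions of an expanding system\<close>

locale expanding_system =
  fixes N m s :: nat and e :: "nat \<Rightarrow> nat \<Rightarrow> nat" and p :: nat and b :: "nat \<Rightarrow> nat"
  assumes expander: "expander N m s e" and p_pos: "0 < p" and s_pos: "0 < s"
begin

definition assignments :: "(nat \<Rightarrow> nat) set" where
  "assignments = {..<N} \<rightarrow>\<^sub>E {..<p}"

definition Sol :: "nat set \<Rightarrow> (nat \<Rightarrow> nat) set" where
  "Sol S = {F \<in> assignments. \<forall>i\<in>S. [(\<Sum>j<5. F (e i j)) = b i] (mod p)}"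

text \<open>The factor compensates for the solutions lost to the equations, so that systems of
  different sizes can assign the same weight to an event.\<close>

definition W :: "nat set \<Rightarrow> ((nat \<Rightarrow> nat) \<Rightarrow> bool) \<Rightarrow> nat" where
  "W S Q = p ^ card S * card {F \<in> Sol S. Q F}"

lemma finite_assignments: "finite assignments"
  unfolding assignments_def by (intro finite_PiE) auto

lemma finite_Sol: "finite {F \<in> Sol S. Q F}"
  by (rule finite_subset[OF _ finite_assignments]) (auto simp: Sol_def)

text \<open>An equation with a private variable \<open>x\<close> that the event ignores is dropped at the cost of exactly a
  factor \<open>p\<close>: its solutions are obtained by solving it for \<open>x\<close>.\<close>

lemma W_peel:
  assumes S: "S \<subseteq> {..<m}" and x: "x \<in> boundary e S" and Q: "\<And>F a. Q (F(x := a)) = Q F"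
  shows "\<exists>i\<in>S. (\<exists>j<5. e i j = x) \<and> (\<forall>i'\<in>S - {i}. \<forall>j<5. e i' j \<noteq> x) \<and> W (S - {i}) Q = W S Q"
proof -
  have fS: "finite S" using S finite_subset by blast
  obtain i j0 where i: "i \<in> S" and j0: "j0 < 5" and ex: "e i j0 = x"
    and uniq: "\<And>k l. k \<in> S \<Longrightarrow> l < 5 \<Longrightarrow> e k l = x \<Longrightarrow> k = i \<and> l = j0"
    using x unfolding boundary_def by blast
  have other: "e i' j \<noteq> x" if "i' \<in> S" "j < 5" "(i', j) \<noteq> (i, j0)" for i' j
    using uniq[of i' j] that by auto
  have xN: "x < N" using expander i j0 ex S unfolding expander_def by auto
  define R where "R F = (\<Sum>j\<in>{..<5} - {j0}. F (e i j))" for F :: "nat \<Rightarrow> nat"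
  have sum_i: "(\<Sum>j<5. F (e i j)) = F x + R F" for F :: "nat \<Rightarrow> nat"
    unfolding R_def using j0 ex by (simp add: sum.remove[of "{..<5}" j0])
  have R_upd: "R (F(x := a)) = R F" for F a
    unfolding R_def by (rule sum.cong) (use other[OF i] in auto)
  have sum_i': "(\<Sum>j<5. (F(x := a)) (e i' j)) = (\<Sum>j<5. F (e i' j))" if "i' \<in> S - {i}" for F i' a
    by (rule sum.cong) (use other[of i'] that in auto)
  \<comment> \<open>The value of \<open>x\<close> that equation \<open>i\<close> forces;
    \<open>p - 1\<close> stands for \<open>-1\<close> in the naturals.\<close>
  define val where "val F = (b i + (p - 1) * R F) mod p" for F :: "nat \<Rightarrow> nat"
  have val: "[val F + R F = b i] (mod p)" for F
  proof -
    have "[val F + R F = (b i + (p - 1) * R F) + R F] (mod p)"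
      unfolding val_def by (intro cong_add cong_refl) (simp add: cong_def)
    also have "(b i + (p - 1) * R F) + R F = b i + p * R F"
      using p_pos by (cases p) auto
    also have "[b i + p * R F = b i] (mod p)" by (simp add: cong_def)
    finally show ?thesis .
  qed
  have val_uniq: "F x = val F" if "[F x + R F = b i] (mod p)" "F x < p" for F
  proof -
    have "[F x + R F = val F + R F] (mod p)"
      using that(1) val cong_sym cong_trans by blast
    then have "[F x = val F] (mod p)" by (simp add: cong_add_rcancel_nat)
    then show ?thesis using that(2) p_pos by (simp add: cong_def val_def)
  qed
  have upd: "F(x := a) \<in> assignments" if "F \<in> assignments" "a < p" for F a
    using that xN unfolding assignments_def by (auto simp: PiE_def Pi_def extensional_def)
  \<comment> \<open>Overwriting \<open>x\<close> with an arbitrary value forgets equation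
    \<open>i\<close>; the inverse recomputes \<open>x\<close> from that equation and remembers the
    value that was there.\<close>
  let ?A = "{F \<in> Sol S. Q F} \<times> {..<p}" and ?B = "{F \<in> Sol (S - {i}). Q F}"
  have "bij_betw (\<lambda>(F, a). F(x := a)) ?A ?B"
  proof (rule bij_betw_byWitness[where f' = "\<lambda>F. (F(x := val F), F x)"])
    show "\<forall>z\<in>?A. (\<lambda>F. (F(x := val F), F x)) ((\<lambda>(F, a). F(x := a)) z) = z"
    proof
      fix z assume "z \<in> ?A"
      then obtain F a where z: "z = (F, a)" "F \<in> Sol S" "a < p" by auto
      have "[(\<Sum>j<5. F (e i j)) = b i] (mod p)" using z(2) i unfolding Sol_def by blast
      then have "[F x + R F = b i] (mod p)" by (simp only: sum_i)
      moreover have "F x < p" using z(2) xN unfolding Sol_def assignments_def by auto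
      ultimately have "F x = val F" by (rule val_uniq)
      moreover have "val (F(x := a)) = val F" unfolding val_def R_upd ..
      ultimately show "(\<lambda>F. (F(x := val F), F x)) ((\<lambda>(F, a). F(x := a)) z) = z"
        using z(1) by (auto simp: fun_eq_iff)
    qed
    show "\<forall>F\<in>?B. (\<lambda>(F, a). F(x := a)) ((\<lambda>F. (F(x := val F), F x)) F) = F" by simp
    show "(\<lambda>(F, a). F(x := a)) ` ?A \<subseteq> ?B"
    proof (rule image_subsetI)
      fix z assume "z \<in> ?A"
      then obtain F a where z: "z = (F, a)" and F: "F \<in> Sol S" "Q F" and a: "a < p" by auto
      have "[(\<Sum>j<5. (F(x := a)) (e i' j)) = b i'] (mod p)" if "i' \<in> S - {i}" for i'
        using F(1) that unfolding sum_i'[OF that] Sol_def by blast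
      then have "F(x := a) \<in> Sol (S - {i})"
        using F(1) upd[OF _ a] unfolding Sol_def by blast
      then show "(\<lambda>(F, a). F(x := a)) z \<in> ?B" using F Q z by simp
    qed
    show "(\<lambda>F. (F(x := val F), F x)) ` ?B \<subseteq> ?A"
    proof (rule image_subsetI)
      fix F assume "F \<in> ?B"
      then have F: "F \<in> Sol (S - {i})" "Q F" by simp_all
      have vp: "val F < p" unfolding val_def using p_pos by simp
      have "[(\<Sum>j<5. (F(x := val F)) (e i' j)) = b i'] (mod p)" if "i' \<in> S" for i'
      proof (cases "i' = i")
        case True
        then show ?thesis using val by (simp only: sum_i R_upd fun_upd_same)
      next
        case False
        then have "i' \<in> S - {i}" using that by blast
        then show ?thesis using F(1) unfolding sum_i'[OF \<open>i' \<in> S - {i}\<close>] Sol_def by blast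
      qed
      then have "F(x := val F) \<in> Sol S"
        using F(1) upd[OF _ vp] unfolding Sol_def by blast
      moreover have "F x \<in> {..<p}" using F(1) xN unfolding Sol_def assignments_def by auto
      ultimately show "(F(x := val F), F x) \<in> ?A" using F(2) Q by simp
    qed
  qed
  then have "card ?A = card ?B" by (rule bij_betw_same_card)
  then have "card ?B = p * card {F \<in> Sol S. Q F}" by (simp add: card_cartesian_product mult.commute)
  moreover have "card S = Suc (card (S - {i}))" using card_Suc_Diff1[OF fS i] by simp
  ultimately have "W (S - {i}) Q = W S Q" unfolding W_def by simp
  then show ?thesis using i j0 ex other by blast
qed

text \<open>By expansion, a small set of equations all of whose private variables lie in \<open>X\<close> has at most
  \<open>card X\<close> members.  The closure of \<open>X\<close> thus stays small, and all other equations can be peeled off.\<close>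

definition sealed :: "nat set \<Rightarrow> nat set \<Rightarrow> bool" where
  "sealed X S \<longleftrightarrow> S \<subseteq> {..<m} \<and> card S \<le> s \<and> boundary e S \<subseteq> X"

definition cl :: "nat set \<Rightarrow> nat set" where
  "cl X = \<Union>{S. sealed X S}"

lemma sealed_card_le:
  assumes "sealed X S" "finite X"
  shows "card S \<le> card X"
proof (cases "S = {}")
  case False
  then have "card S < card (boundary e S)"
    using expander_boundary[OF expander] assms unfolding sealed_def by blast
  also have "\<dots> \<le> card X" using assms unfolding sealed_def by (intro card_mono) auto
  finally show ?thesis by simp
qed simp

text \<open>The union has at most \<open>2 * card X\<close> members, hence stays in the range of the
  expansion. This can be iterated because \<open>sealed_card_le\<close> brings its size back to at
  most \<open>card X\<close>.\<close>

lemma sealed_Un: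
  assumes "sealed X S" "sealed X S'" "finite X" "2 * card X \<le> s"
  shows "sealed X (S \<union> S')"
proof -
  have "card (S \<union> S') \<le> card S + card S'" by (rule card_Un_le)
  then have "card (S \<union> S') \<le> s" using sealed_card_le[OF assms(1,3)] sealed_card_le[OF assms(2,3)] assms(4) by linarith
  then show ?thesis using assms boundary_Un[of e S S'] unfolding sealed_def by blast
qed

lemma boundary_empty: "boundary e {} = {}"
  unfolding boundary_def by simp

lemma sealed_Union:
  assumes "finite \<S>" "\<And>S. S \<in> \<S> \<Longrightarrow> sealed X S" "finite X" "2 * card X \<le> s"
  shows "sealed X (\<Union>\<S>)"
  using assms(1,2)
proof (induction \<S>)
  case empty
  then show ?case by (simp add: sealed_def boundary_empty)
next
  case (insert S \<S>)
  then show ?case using sealed_Un[OF _ _ assms(3,4)] by simp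
qed

lemma sealed_cl:
  assumes "finite X" "2 * card X \<le> s"
  shows "sealed X (cl X)"
  unfolding cl_def
proof (rule sealed_Union)
  show "finite {S. sealed X S}"
    by (rule finite_subset[of _ "Pow {..<m}"]) (auto simp: sealed_def)
qed (use assms in auto)

lemma cl_mono: "X \<subseteq> Y \<Longrightarrow> cl X \<subseteq> cl Y"
  unfolding cl_def sealed_def by blast

lemma cl_empty: "cl {} = {}"
proof -
  have "S = {}" if "sealed {} S" for S
  proof -
    have "finite S" using that finite_subset unfolding sealed_def by blast
    with sealed_card_le[OF that] show ?thesis by simp
  qed
  then show ?thesis unfolding cl_def by auto
qed

text \<open>Such an equation owns no private variable outside \<open>X\<close>. Consequently the
  local measure of \<open>X\<close> charges only assignments that satisfy every equation visible on
  \<open>X\<close>.\<close>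

lemma mem_cl:
  assumes "i < m" "\<And>j. j < 5 \<Longrightarrow> e i j \<in> X"
  shows "i \<in> cl X"
proof -
  have "boundary e {i} \<subseteq> X" unfolding boundary_def using assms(2) by auto
  then have "sealed X {i}" using assms(1) s_pos unfolding sealed_def by simp
  then show ?thesis unfolding cl_def by blast
qed

definition depends_on :: "nat set \<Rightarrow> ((nat \<Rightarrow> nat) \<Rightarrow> bool) \<Rightarrow> bool" where
  "depends_on X Q \<longleftrightarrow> (\<forall>F F'. (\<forall>x\<in>X. F x = F' x) \<longrightarrow> Q F = Q F')"

text \<open>As long as \<open>S\<close> exceeds the closure it is not sealed, so it has a private
  variable outside \<open>X\<close>. The event ignores this variable, and its equation is not in the
  closure, so it can be peeled off.\<close>

lemma W_superset:
  assumes X: "finite X" "2 * card X \<le> s" and Q: "depends_on X Q"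
    and "cl X \<subseteq> S" "S \<subseteq> {..<m}" "card S \<le> s"
  shows "W S Q = W (cl X) Q"
  using assms(4-)
proof (induction "card (S - cl X)" arbitrary: S)
  case 0
  then have "finite S" using finite_subset by blast
  with 0 have "S = cl X" by auto
  then show ?case by simp
next
  case (Suc d)
  have fS: "finite S" using Suc.prems finite_subset by blast
  have ne: "S \<noteq> cl X" using Suc.hyps by auto
  have "\<not> boundary e S \<subseteq> X"
  proof
    assume "boundary e S \<subseteq> X"
    then have "sealed X S" using Suc.prems unfolding sealed_def by simp
    then have "S \<subseteq> cl X" unfolding cl_def by blast
    then show False using ne Suc.prems by blast
  qed
  then obtain x where x: "x \<in> boundary e S" "x \<notin> X" by blast
  have Qx: "Q (F(x := a)) = Q F" for F a
    using Q x(2) unfolding depends_on_def by (metis fun_upd_other)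
  obtain i where i: "i \<in> S" "\<exists>j<5. e i j = x" "\<forall>i'\<in>S - {i}. \<forall>j<5. e i' j \<noteq> x"
    and W: "W (S - {i}) Q = W S Q"
    using W_peel[OF Suc.prems(2) x(1) Qx] by blast
  \<comment> \<open>Otherwise \<open>x\<close>, private in \<open>S\<close>, would be private in the
    closure as well, whose boundary lies in \<open>X\<close>.\<close>
  have "i \<notin> cl X"
  proof
    assume "i \<in> cl X"
    then have "x \<in> boundary e (cl X)"
      using boundary_Diff[OF x(1) _ Suc.prems(1)] i(3) by blast
    then show False using sealed_cl[OF X] x(2) unfolding sealed_def by blast
  qed
  have "d = card (S - {i} - cl X)"
  proof -
    have "S - cl X = insert i (S - {i} - cl X)" using i(1) \<open>i \<notin> cl X\<close> by blast
    then have "card (S - cl X) = Suc (card (S - {i} - cl X))"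
      using fS by (metis Diff_iff card_insert_disjoint finite_Diff insertI1)
    then show ?thesis using Suc.hyps(2) by simp
  qed
  then have "W (S - {i}) Q = W (cl X) Q"
  proof (rule Suc.hyps(1))
    show "cl X \<subseteq> S - {i}" using Suc.prems(1) \<open>i \<notin> cl X\<close> by blast
    show "S - {i} \<subseteq> {..<m}" using Suc.prems by blast
    show "card (S - {i}) \<le> s" using Suc.prems(3) card_Diff1_le[of S i] by linarith
  qed
  with W show ?case by simp
qed

text \<open>The local uniform measure of total mass \<open>p ^ N\<close>: by \<open>W_superset\<close> it does not depend on which
  superset of \<open>cl X\<close> is used, which makes the measures of different \<open>X\<close> compatible.\<close>

definition \<mu> :: "nat set \<Rightarrow> ((nat \<Rightarrow> nat) \<Rightarrow> bool) \<Rightarrow> nat" where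
  "\<mu> X Q = W (cl X) Q"

lemma \<mu>_superset:
  assumes "X \<subseteq> Y" "finite Y" "2 * card Y \<le> s" "depends_on X Q"
  shows "\<mu> Y Q = \<mu> X Q"
proof -
  have X: "finite X" "2 * card X \<le> s"
    using assms card_mono[of Y X] finite_subset by auto
  show ?thesis
    unfolding \<mu>_def using W_superset[OF X assms(4) cl_mono[OF assms(1)]] sealed_cl[OF assms(2,3)]
    unfolding sealed_def by blast
qed

lemma \<mu>_total:
  assumes "finite X" "2 * card X \<le> s"
  shows "\<mu> X (\<lambda>_. True) = p ^ N"
proof -
  have "\<mu> X (\<lambda>_. True) = \<mu> {} (\<lambda>_. True)"
    by (rule \<mu>_superset) (use assms in \<open>auto simp: depends_on_def\<close>)
  also have "\<dots> = card assignments"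
    unfolding \<mu>_def cl_empty W_def Sol_def by simp
  also have "\<dots> = p ^ N" unfolding assignments_def by (simp add: card_PiE)
  finally show ?thesis .
qed

lemma \<mu>_sum:
  assumes "finite V"
  shows "(\<Sum>v\<in>V. \<mu> X (\<lambda>F. Q F \<and> h F = v)) = \<mu> X (\<lambda>F. Q F \<and> h F \<in> V)"
proof -
  let ?A = "{F \<in> Sol (cl X). Q F \<and> h F \<in> V}"
  have eq: "{F \<in> ?A. h F = v} = {F \<in> Sol (cl X). Q F \<and> h F = v}" if "v \<in> V" for v
    using that by blast
  have "(\<Sum>v\<in>V. card {F \<in> Sol (cl X). Q F \<and> h F = v}) = (\<Sum>v\<in>V. card {F \<in> ?A. h F = v})"
    by (rule sum.cong) (simp_all only: eq)
  also have "\<dots> = card ?A"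
    unfolding card_eq_sum by (rule sum.group) (use assms in \<open>auto intro: finite_Sol\<close>)
  finally have "(\<Sum>v\<in>V. card {F \<in> Sol (cl X). Q F \<and> h F = v}) = card ?A" .
  then show ?thesis unfolding \<mu>_def W_def by (simp flip: sum_distrib_left)
qed

lemma \<mu>_cong:
  assumes "\<And>F. F \<in> Sol (cl X) \<Longrightarrow> Q F = Q' F"
  shows "\<mu> X Q = \<mu> X Q'"
proof -
  have "{F \<in> Sol (cl X). Q F} = {F \<in> Sol (cl X). Q' F}" using assms by auto
  then show ?thesis unfolding \<mu>_def W_def by simp
qed

lemma \<mu>_nonzero_iff: "\<mu> X Q \<noteq> 0 \<longleftrightarrow> (\<exists>F\<in>Sol (cl X). Q F)"
  using finite_Sol[of "cl X" Q] p_pos unfolding \<mu>_def W_def by auto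

end

text \<open>The value of \<open>ext F\<close> on a set \<open>X\<close> of elements of the instance depends on \<open>F\<close> only through the
  variables \<open>loc X\<close>.\<close>

locale local_model = expanding_system +
  fixes ext :: "(nat \<Rightarrow> nat) \<Rightarrow> nat \<Rightarrow> nat" and loc :: "nat set \<Rightarrow> nat set" and V U :: "nat set"
  assumes finite_U: "finite U"
    and loc_finite: "finite X \<Longrightarrow> finite (loc X)"
    and loc_card: "finite X \<Longrightarrow> card (loc X) \<le> card X"
    and loc_mono: "X \<subseteq> Y \<Longrightarrow> loc X \<subseteq> loc Y"
    and ext_loc: "x \<in> X \<Longrightarrow> (\<And>y. y \<in> loc X \<Longrightarrow> F y = F' y) \<Longrightarrow> ext F x = ext F' x"
    and ext_range: "F \<in> assignments \<Longrightarrow> x \<in> V \<Longrightarrow> ext F x \<in> U"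
begin

text \<open>\<open>Z\<close> and \<open>C\<close> carry a conditioning event on the variables
  \<open>Z\<close>: the weights behind BLP, AIP and affine consistency use none, those needed for
  CLAP condition on the values of one tuple.\<close>

definition D :: "nat set \<Rightarrow> ((nat \<Rightarrow> nat) \<Rightarrow> bool) \<Rightarrow> nat set \<Rightarrow> (nat \<Rightarrow> nat) \<Rightarrow> nat" where
  "D Z C X f = \<mu> (loc X \<union> Z) (\<lambda>F. C F \<and> restrict (ext F) X = f)"

lemma depends_on_restrict:
  assumes "depends_on Z C"
  shows "depends_on (loc X \<union> Z) (\<lambda>F. C F \<and> restrict (ext F) X = f)"
  unfolding depends_on_def
proof (intro allI impI)
  fix F F' :: "nat \<Rightarrow> nat" assume eq: "\<forall>x\<in>loc X \<union> Z. F x = F' x"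
  have "restrict (ext F) X = restrict (ext F') X"
    by (rule restrict_ext) (use eq ext_loc[of _ X F F'] in blast)
  moreover have "C F = C F'" using assms eq unfolding depends_on_def by blast
  ultimately show "(C F \<and> restrict (ext F) X = f) = (C F' \<and> restrict (ext F') X = f)" by simp
qed

lemma small_loc_Un:
  assumes "finite X" "finite Z" "2 * (card X + card Z) \<le> s"
  shows "finite (loc X \<union> Z)" "2 * card (loc X \<union> Z) \<le> s"
proof -
  show "finite (loc X \<union> Z)" using assms loc_finite by simp
  have "card (loc X \<union> Z) \<le> card X + card Z"
    using card_Un_le[of "loc X" Z] loc_card[OF assms(1)] by linarith
  then have "2 * card (loc X \<union> Z) \<le> 2 * (card X + card Z)" by simp
  then show "2 * card (loc X \<union> Z) \<le> s" using assms(3) by (rule order_trans)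
qed

text \<open>Summing over the extensions of \<open>g\<close> yields the event for \<open>Y\<close>,
  still measured on the larger set; independence of the superset moves it to
  \<open>loc Y \<union> Z\<close>.\<close>

lemma D_marginal:
  assumes X: "X \<subseteq> V" "finite X" "Y \<subseteq> X" and Z: "finite Z" "depends_on Z C"
    and s: "2 * (card X + card Z) \<le> s" and g: "g \<in> Y \<rightarrow>\<^sub>E U"
  shows "(\<Sum>f\<in>{f \<in> X \<rightarrow>\<^sub>E U. restrict f Y = g}. D Z C X f) = D Z C Y g"
proof -
  let ?V = "{f \<in> X \<rightarrow>\<^sub>E U. restrict f Y = g}"
  have finV: "finite ?V" using finite_PiE[OF X(2), of "\<lambda>_. U"] finite_U by simp
  have "(\<Sum>f\<in>?V. D Z C X f) = \<mu> (loc X \<union> Z) (\<lambda>F. C F \<and> restrict (ext F) X \<in> ?V)"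
    unfolding D_def by (rule \<mu>_sum[OF finV])
  also have "\<dots> = \<mu> (loc X \<union> Z) (\<lambda>F. C F \<and> restrict (ext F) Y = g)"
  proof (rule \<mu>_cong)
    fix F assume "F \<in> Sol (cl (loc X \<union> Z))"
    then have "F \<in> assignments" unfolding Sol_def by blast
    then have "restrict (ext F) X \<in> X \<rightarrow>\<^sub>E U" using ext_range X(1) by auto
    moreover have "restrict (restrict (ext F) X) Y = restrict (ext F) Y"
      using X(3) by (simp add: Int_absorb1)
    ultimately show "(C F \<and> restrict (ext F) X \<in> ?V) = (C F \<and> restrict (ext F) Y = g)" by simp
  qed
  also have "\<dots> = D Z C Y g"
    unfolding D_def
  proof (rule \<mu>_superset)
    show "loc Y \<union> Z \<subseteq> loc X \<union> Z" using loc_mono[OF X(3)] by blast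
  qed (use small_loc_Un[OF X(2) Z(1) s] depends_on_restrict[OF Z(2)] in auto)
  finally show ?thesis .
qed

lemma loc_empty: "loc {} = {}"
  using loc_card[of "{}"] loc_finite[of "{}"] by simp

lemma D_total:
  assumes X: "X \<subseteq> V" "finite X" and Z: "finite Z" "depends_on Z C"
    and s: "2 * (card X + card Z) \<le> s"
  shows "(\<Sum>f\<in>X \<rightarrow>\<^sub>E U. D Z C X f) = \<mu> Z C"
proof -
  have "(\<Sum>f\<in>{f \<in> X \<rightarrow>\<^sub>E U. restrict f {} = (\<lambda>_. undefined)}. D Z C X f) = D Z C {} (\<lambda>_. undefined)"
    by (rule D_marginal) (use assms in auto)
  moreover have "restrict f {} = (\<lambda>_. undefined)" for f :: "nat \<Rightarrow> nat" by (simp add: restrict_def)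
  ultimately show ?thesis by (simp add: D_def loc_empty)
qed

lemma D_nonzero:
  assumes "D Z C X f \<noteq> 0"
  obtains F where "F \<in> Sol (cl (loc X \<union> Z))" "C F" "restrict (ext F) X = f"
  using assms unfolding D_def \<mu>_nonzero_iff by blast

text \<open>Conditioning creates no new support: a witness of the conditioned weight solves the
  closure of the larger set \<open>loc X \<union> Z\<close>, and the unconditional weight of the
  same event may be computed there as well.\<close>

lemma D_unconditional_nonzero:
  assumes nz: "D Z C X f \<noteq> 0" and "finite X" "finite Z" "2 * (card X + card Z) \<le> s"
  shows "D {} (\<lambda>_. True) X f \<noteq> 0"
proof -
  obtain F where F: "F \<in> Sol (cl (loc X \<union> Z))" "restrict (ext F) X = f"
    using nz by (rule D_nonzero)
  then have "\<mu> (loc X \<union> Z) (\<lambda>F. True \<and> restrict (ext F) X = f) \<noteq> 0"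
    unfolding \<mu>_nonzero_iff by blast
  moreover have "\<mu> (loc X \<union> Z) (\<lambda>F. True \<and> restrict (ext F) X = f)
      = \<mu> (loc X \<union> {}) (\<lambda>F. True \<and> restrict (ext F) X = f)"
    by (rule \<mu>_superset)
      (use small_loc_Un[OF assms(2-4)] depends_on_restrict[of "{}" "\<lambda>_. True"] in
        \<open>auto simp: depends_on_def\<close>)
  ultimately show ?thesis unfolding D_def by simp
qed

end

section \<open>Feasibility from consistent local distributions\<close>

lemma tuple_map_map:
  assumes "f \<in> extensional (set bs)"
  shows "tuple_map bs (map f bs) = f"
proof
  fix x
  show "tuple_map bs (map f bs) x = f x"
    using assms by (cases "x \<in> set bs") (auto simp: tuple_map_def map_of_zip_map extensional_def)
qed

lemma tuple_map_PiE:
  assumes "length bs = length as" "set as \<subseteq> U"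
  shows "tuple_map bs as \<in> set bs \<rightarrow>\<^sub>E U"
proof (rule PiE_I)
  fix x assume x: "x \<in> set bs"
  then obtain y where y: "map_of (zip bs as) x = Some y"
    using map_of_zip_is_Some[OF assms(1)] by blast
  then have "y \<in> set as" by (meson map_of_SomeD set_zip_rightD)
  then show "tuple_map bs as x \<in> U" using x y assms(2) by (auto simp: tuple_map_def)
qed (simp add: tuple_map_def)

lemma finite_rels: "fin_struct \<tau> A \<Longrightarrow> R < length \<tau> \<Longrightarrow> finite (rels A R)"
  unfolding fin_struct_def
  by (rule finite_subset[of _ "{t. set t \<subseteq> univ A \<and> length t = \<tau> ! R}"])
    (auto simp: finite_lists_length_eq)

text \<open>Weights may be negative: over \<open>int\<close> this is a signed family of local
  distributions, over \<open>rat\<close> with nonnegative weights a genuine one. \<open>K\<close>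
  may exceed the width of the algorithm, since whole tuples of the instance must be covered
  too.\<close>

definition pseudo_dist ::
  "nat \<Rightarrow> 'a set \<Rightarrow> 'b set \<Rightarrow> ('b set \<Rightarrow> ('b \<Rightarrow> 'a) \<Rightarrow> 'n::comm_ring_1) \<Rightarrow> bool" where
  "pseudo_dist K U V P \<longleftrightarrow> (\<forall>X. X \<subseteq> V \<and> finite X \<and> card X \<le> K \<longrightarrow>
     (\<Sum>f\<in>X \<rightarrow>\<^sub>E U. P X f) = 1 \<and>
     (\<forall>Y. Y \<subseteq> X \<longrightarrow> (\<forall>g\<in>Y \<rightarrow>\<^sub>E U. (\<Sum>f\<in>{f \<in> X \<rightarrow>\<^sub>E U. restrict f Y = g}. P X f) = P Y g)))"

definition lift_sol :: "('b set \<Rightarrow> ('b \<Rightarrow> 'a) \<Rightarrow> 'n) \<Rightarrow> ('a, 'b) lvar \<Rightarrow> 'n::comm_ring_1" where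
  "lift_sol P x = (case x of Lam X f \<Rightarrow> P X f
     | Mu R b a \<Rightarrow> if map (tuple_map b a) b = a then P (set b) (tuple_map b a) else 0)"

definition hom_supported :: "vocabulary \<Rightarrow> 'a rel_struct \<Rightarrow> 'b rel_struct \<Rightarrow>
    ('b set \<Rightarrow> ('b \<Rightarrow> 'a) \<Rightarrow> 'n::comm_ring_1) \<Rightarrow> bool" where
  "hom_supported \<tau> A B P \<longleftrightarrow> (\<forall>R<length \<tau>. \<forall>b\<in>rels B R. \<forall>f\<in>set b \<rightarrow>\<^sub>E univ A.
     P (set b) f \<noteq> 0 \<longrightarrow> map f b \<in> rels A R)"

text \<open>Both sides of (B3) are marginals of the one distribution on \<open>set b\<close>: tuples
  of the relation correspond to maps on \<open>set b\<close>, and maps that violate the relation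
  weigh nothing.\<close>

lemma L_system_lift_sol:
  assumes A: "fin_struct \<tau> A" and B: "fin_struct \<tau> B"
    and P: "pseudo_dist K (univ A) (univ B) P" and resp: "hom_supported \<tau> A B P"
    and k: "k \<le> K" and ar: "\<forall>R<length \<tau>. \<tau> ! R \<le> K"
  shows "L_system \<tau> k A B (lift_sol P)"
  unfolding L_system_def
proof (intro conjI ballI allI impI)
  fix X assume "X \<in> subsets_le k B"
  then show "(\<Sum>f\<in>X \<rightarrow>\<^sub>E univ A. lift_sol P (Lam X f)) = 1"
    using P k unfolding pseudo_dist_def subsets_le_def lift_sol_def by auto
next
  fix X Y g assume "X \<in> subsets_le k B" "Y \<subset> X" "g \<in> Y \<rightarrow>\<^sub>E univ A"
  then show "(\<Sum>f\<in>{f \<in> X \<rightarrow>\<^sub>E univ A. restrict f Y = g}. lift_sol P (Lam X f)) = lift_sol P (Lam Y g)"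
    using P k unfolding pseudo_dist_def subsets_le_def lift_sol_def by auto
next
  fix R b a' i
  assume R: "R < length \<tau>" and b: "b \<in> rels B R"
    and H: "length a' = k \<and> set a' \<subseteq> univ A \<and> length i = k \<and> set i \<subseteq> {..<\<tau> ! R}"
  define b' where "b' = map ((!) b) i"
  let ?U = "univ A" and ?X = "set b"
  have lb: "length b = \<tau> ! R" and Xsub: "?X \<subseteq> univ B"
    using B R b unfolding fin_struct_def by auto
  have cX: "card ?X \<le> K" using card_length[of b] lb ar R by fastforce
  have b'sub: "set b' \<subseteq> ?X" unfolding b'_def using H lb by auto
  have lb': "length b' = length a'" unfolding b'_def using H by simp
  have finU: "finite ?U" using A unfolding fin_struct_def by blast
  have finF: "finite (?X \<rightarrow>\<^sub>E ?U)" by (intro finite_PiE) (use finU in auto)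
  have lR: "length a = length b" "set a \<subseteq> ?U" if "a \<in> rels A R" for a
    using that A R lb unfolding fin_struct_def by auto
  have map_nth_map: "map ((!) (map f b)) i = map f b'" for f
    unfolding b'_def using H lb by auto
  let ?S1 = "{a \<in> rels A R. map ((!) a) i = a'}"
  let ?wd = "\<lambda>a. map (tuple_map b a) b = a"
  let ?S2 = "{f \<in> ?X \<rightarrow>\<^sub>E ?U. map f b' = a'}"
  have "(\<Sum>a\<in>?S1. lift_sol P (Mu R b a)) = (\<Sum>a\<in>{a \<in> ?S1. ?wd a}. P ?X (tuple_map b a))"
    unfolding lift_sol_def lvar.case
    by (rule sum.inter_filter[symmetric]) (simp add: finite_rels[OF A R])
  also have "\<dots> = (\<Sum>f\<in>{f \<in> ?S2. map f b \<in> rels A R}. P ?X f)"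
  proof (rule sum.reindex_bij_witness[of _ "\<lambda>f. map f b" "tuple_map b"])
    fix a assume "a \<in> {a \<in> ?S1. ?wd a}"
    then have a: "a \<in> rels A R" "map ((!) a) i = a'" "?wd a" by auto
    show "map (tuple_map b a) b = a" by (rule a(3))
    have "map (tuple_map b a) b' = map ((!) (map (tuple_map b a) b)) i" by (simp only: map_nth_map)
    also have "\<dots> = a'" using a(2,3) by simp
    finally show "tuple_map b a \<in> {f \<in> ?S2. map f b \<in> rels A R}"
      using a tuple_map_PiE[of b a ?U] lR[OF a(1)] by simp
  next
    fix f assume "f \<in> {f \<in> ?S2. map f b \<in> rels A R}"
    then have f: "f \<in> ?X \<rightarrow>\<^sub>E ?U" "map f b' = a'" "map f b \<in> rels A R" by auto
    have "f \<in> extensional ?X" using f(1) by (simp add: PiE_def)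
    then show tm: "tuple_map b (map f b) = f" by (rule tuple_map_map)
    show "map f b \<in> {a \<in> ?S1. ?wd a}" using f tm by (simp add: map_nth_map)
  qed simp
  also have "\<dots> = (\<Sum>f\<in>?S2. P ?X f)"
  proof (rule sum.mono_neutral_left)
    show "finite ?S2" using finF by simp
    show "\<forall>f\<in>?S2 - {f \<in> ?S2. map f b \<in> rels A R}. P ?X f = 0"
      using resp R b unfolding hom_supported_def by blast
  qed blast
  also have "\<dots> = (if map (tuple_map b' a') b' = a' then P (set b') (tuple_map b' a') else 0)"
  proof (cases "map (tuple_map b' a') b' = a'")
    case True
    have "?S2 = {f \<in> ?X \<rightarrow>\<^sub>E ?U. restrict f (set b') = tuple_map b' a'}"
    proof (intro Collect_cong conj_cong refl iffI)
      fix f assume "map f b' = a'"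
      then have "tuple_map b' a' = tuple_map b' (map (restrict f (set b')) b')" by (auto cong: map_cong)
      also have "\<dots> = restrict f (set b')" by (rule tuple_map_map) simp
      finally show "restrict f (set b') = tuple_map b' a'" by simp
    next
      fix f assume eq: "restrict f (set b') = tuple_map b' a'"
      have "map f b' = map (restrict f (set b')) b'" by simp
      then show "map f b' = a'" using True eq by simp
    qed
    moreover have "tuple_map b' a' \<in> set b' \<rightarrow>\<^sub>E ?U"
      using tuple_map_PiE[OF lb'] H by blast
    ultimately have "(\<Sum>f\<in>?S2. P ?X f) = P (set b') (tuple_map b' a')"
      using P Xsub cX b'sub unfolding pseudo_dist_def by auto
    then show ?thesis using True by simp
  next
    case False
    have "?S2 = {}"
    proof (rule equals0I)
      fix f assume "f \<in> ?S2"
      then have "map f b' = a'" by simp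
      moreover have "map (restrict f (set b')) b' = map f b'" by simp
      ultimately have f: "map (restrict f (set b')) b' = a'" by (rule trans[rotated])
      have "tuple_map b' (map (restrict f (set b')) b') = restrict f (set b')"
        by (rule tuple_map_map) simp
      then have "map (tuple_map b' a') b' = a'" using f by simp
      with False show False ..
    qed
    then have "(\<Sum>f\<in>?S2. P ?X f) = 0" by (simp only: sum.empty)
    then show ?thesis using False by (simp only: if_False)
  qed
  finally show "let b' = map ((!) b) i in
      (\<Sum>a\<in>{a \<in> rels A R. map ((!) a) i = a'}. lift_sol P (Mu R b a)) =
      (if map (tuple_map b' a') b' = a' then lift_sol P (Lam (set b') (tuple_map b' a')) else 0)"
    unfolding Let_def b'_def[symmetric] by (simp add: lift_sol_def)
qed

text \<open>Absolute continuity of \<open>P\<close> with respect to \<open>Q\<close>. The zero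
  constraints of BA and CLAP come down to this relation.\<close>

definition abs_cont ::
  "nat \<Rightarrow> 'a set \<Rightarrow> 'b set \<Rightarrow> ('b set \<Rightarrow> ('b \<Rightarrow> 'a) \<Rightarrow> 'n::zero) \<Rightarrow> ('b set \<Rightarrow> ('b \<Rightarrow> 'a) \<Rightarrow> 'm::zero) \<Rightarrow> bool"
  where "abs_cont K U V P Q \<longleftrightarrow>
    (\<forall>X f. X \<subseteq> V \<and> finite X \<and> card X \<le> K \<and> f \<in> X \<rightarrow>\<^sub>E U \<and> Q X f = 0 \<longrightarrow> P X f = 0)"

lemma hom_supported_abs_cont:
  assumes B: "fin_struct \<tau> B" and ar: "\<forall>R<length \<tau>. \<tau> ! R \<le> K"
    and "hom_supported \<tau> A B Q" "abs_cont K (univ A) (univ B) P Q"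
  shows "hom_supported \<tau> A B P"
  unfolding hom_supported_def
proof (intro allI impI ballI)
  fix R b f assume R: "R < length \<tau>" and b: "b \<in> rels B R" and f: "f \<in> set b \<rightarrow>\<^sub>E univ A" and nz: "P (set b) f \<noteq> 0"
  have "set b \<subseteq> univ B" "card (set b) \<le> K"
    using B R b ar card_length[of b] unfolding fin_struct_def by (blast, metis order_trans)
  then have "Q (set b) f \<noteq> 0" using assms(4) f nz unfolding abs_cont_def by blast
  then show "map f b \<in> rels A R" using assms(3) R b f unfolding hom_supported_def by blast
qed

section \<open>Relative interior points of the BLP polytope\<close>

lemma finite_L_vars:
  assumes A: "fin_struct \<tau> A" and B: "fin_struct \<tau> B"
  shows "finite (L_vars \<tau> k A B)"
proof -
  have fA: "finite (univ A)" and fB: "finite (univ B)" using A B unfolding fin_struct_def by auto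
  have "{Lam X f | X f. X \<in> subsets_le k B \<and> f \<in> X \<rightarrow>\<^sub>E univ A}
      = (\<Union>X\<in>subsets_le k B. Lam X ` (X \<rightarrow>\<^sub>E univ A))" by auto
  moreover have "finite (subsets_le k B)"
    by (rule finite_subset[of _ "Pow (univ B)"]) (auto simp: subsets_le_def fB)
  moreover have "finite (X \<rightarrow>\<^sub>E univ A)" if "X \<in> subsets_le k B" for X
    using that fA by (intro finite_PiE) (auto simp: subsets_le_def)
  ultimately have 1: "finite {Lam X f | X f. X \<in> subsets_le k B \<and> f \<in> X \<rightarrow>\<^sub>E univ A}" by simp
  have "{Mu R b a | R b a. R < length \<tau> \<and> b \<in> rels B R \<and> a \<in> rels A R}
      = (\<Union>R\<in>{..<length \<tau>}. (\<lambda>(b, a). Mu R b a) ` (rels B R \<times> rels A R))" by auto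
  then have 2: "finite {Mu R b a | R b a. R < length \<tau> \<and> b \<in> rels B R \<and> a \<in> rels A R}"
    using finite_rels[OF A] finite_rels[OF B] by simp
  show ?thesis unfolding L_vars_def using 1 2 by simp
qed

lemma L_system_Mu:
  assumes "L_system \<tau> k A B v" "R < length \<tau>" "b \<in> rels B R"
    "length a' = k \<and> set a' \<subseteq> univ A \<and> length i = k \<and> set i \<subseteq> {..<\<tau> ! R}"
  shows "(\<Sum>a\<in>{a \<in> rels A R. map ((!) a) i = a'}. v (Mu R b a)) =
    (if map (tuple_map (map ((!) b) i) a') (map ((!) b) i) = a'
     then v (Lam (set (map ((!) b) i)) (tuple_map (map ((!) b) i) a')) else 0)"
proof -
  have "\<forall>R<length \<tau>. \<forall>b\<in>rels B R. \<forall>a' i.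
        length a' = k \<and> set a' \<subseteq> univ A \<and> length i = k \<and> set i \<subseteq> {..<\<tau> ! R} \<longrightarrow>
        (let b' = map ((!) b) i in
          (\<Sum>a\<in>{a \<in> rels A R. map ((!) a) i = a'}. v (Mu R b a)) =
          (if map (tuple_map b' a') b' = a' then v (Lam (set b') (tuple_map b' a')) else 0))"
    using assms(1) unfolding L_system_def by (elim conjE) assumption
  from this[rule_format, OF assms(2-4)] show ?thesis unfolding Let_def .
qed

text \<open>The coefficients may be negative: this serves both the average that yields an interior
  point and the points of the affine hull around it.\<close>

lemma L_system_convex:
  fixes v :: "'x \<Rightarrow> ('a, 'b) lvar \<Rightarrow> rat"
  assumes "finite F" "sum u F = 1" "\<And>w. w \<in> F \<Longrightarrow> L_system \<tau> k A B (v w)"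
  shows "L_system \<tau> k A B (\<lambda>x. \<Sum>w\<in>F. u w * v w x)"
proof -
  have comm: "(\<Sum>y\<in>S. \<Sum>w\<in>F. u w * v w (h y)) = (\<Sum>w\<in>F. u w * (\<Sum>y\<in>S. v w (h y)))" for S h
    by (subst sum.swap) (simp add: sum_distrib_left)
  have sum_if: "(\<Sum>w\<in>F. u w * (if c then g w else 0)) = (if c then \<Sum>w\<in>F. u w * g w else 0)" for c g
    by simp
  show ?thesis
    unfolding L_system_def Let_def
  proof (intro conjI ballI allI impI)
    fix X assume X: "X \<in> subsets_le k B"
    have "(\<Sum>y\<in>X \<rightarrow>\<^sub>E univ A. \<Sum>w\<in>F. u w * v w (Lam X y))
        = (\<Sum>w\<in>F. u w * (\<Sum>y\<in>X \<rightarrow>\<^sub>E univ A. v w (Lam X y)))" by (rule comm)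
    also have "\<dots> = (\<Sum>w\<in>F. u w * 1)"
      using assms(3) X unfolding L_system_def by (intro sum.cong) auto
    finally show "(\<Sum>y\<in>X \<rightarrow>\<^sub>E univ A. \<Sum>w\<in>F. u w * v w (Lam X y)) = 1" using assms(2) by simp
  next
    fix X Y g assume *: "X \<in> subsets_le k B" "Y \<subset> X" "g \<in> Y \<rightarrow>\<^sub>E univ A"
    let ?S = "{f \<in> X \<rightarrow>\<^sub>E univ A. restrict f Y = g}"
    have "(\<Sum>y\<in>?S. \<Sum>w\<in>F. u w * v w (Lam X y)) = (\<Sum>w\<in>F. u w * (\<Sum>y\<in>?S. v w (Lam X y)))"
      by (rule comm)
    also have "\<dots> = (\<Sum>w\<in>F. u w * v w (Lam Y g))"
      using assms(3) * unfolding L_system_def by (intro sum.cong refl arg_cong2[of _ _ _ _ "(*)"]) blast+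
    finally show "(\<Sum>y\<in>?S. \<Sum>w\<in>F. u w * v w (Lam X y)) = (\<Sum>w\<in>F. u w * v w (Lam Y g))" .
  next
    fix R b a' i assume *: "R < length \<tau>" "b \<in> rels B R"
      "length a' = k \<and> set a' \<subseteq> univ A \<and> length i = k \<and> set i \<subseteq> {..<\<tau> ! R}"
    let ?b = "map ((!) b) i" and ?S = "{a \<in> rels A R. map ((!) a) i = a'}"
    have "(\<Sum>y\<in>?S. \<Sum>w\<in>F. u w * v w (Mu R b y)) = (\<Sum>w\<in>F. u w * (\<Sum>y\<in>?S. v w (Mu R b y)))"
      by (rule comm)
    also have "\<dots> = (\<Sum>w\<in>F. u w * (if map (tuple_map ?b a') ?b = a' then v w (Lam (set ?b) (tuple_map ?b a')) else 0))"
      by (intro sum.cong refl arg_cong2[of _ _ _ _ "(*)"] L_system_Mu[OF assms(3) *])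
    also have "\<dots> = (if map (tuple_map ?b a') ?b = a' then \<Sum>w\<in>F. u w * v w (Lam (set ?b) (tuple_map ?b a')) else 0)"
      by (rule sum_if)
    finally show "(\<Sum>y\<in>?S. \<Sum>w\<in>F. u w * v w (Mu R b y))
        = (if map (tuple_map ?b a') ?b = a' then \<Sum>w\<in>F. u w * v w (Lam (set ?b) (tuple_map ?b a')) else 0)" .
  qed
qed

lemma satisfies_convex:
  fixes v :: "'x \<Rightarrow> ('a, 'b) lvar \<Rightarrow> rat"
  assumes "finite F" "sum u F = 1" "\<And>w. w \<in> F \<Longrightarrow> satisfies (v w) C"
  shows "satisfies (\<lambda>x. \<Sum>w\<in>F. u w * v w x) C"
  unfolding satisfies_def
proof clarify
  fix x c assume "(x, c) \<in> C"
  then have "(\<Sum>w\<in>F. u w * v w x) = (\<Sum>w\<in>F. u w * of_int c)"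
    using assms(3) unfolding satisfies_def by (intro sum.cong) auto
  also have "\<dots> = of_int c" using assms(2) by (simp flip: sum_distrib_right)
  finally show "(\<Sum>w\<in>F. u w * v w x) = of_int c" .
qed

text \<open>A uniform average of solutions, one positive at each coordinate that is not identically
  zero, lies in the relative interior.\<close>

lemma relative_interior_BLP:
  assumes fin: "finite (L_vars \<tau> k A B)" and ne: "BLP_solutions \<tau> k C A B \<noteq> {}"
  shows "\<exists>\<Phi>\<in>relative_interior (L_vars \<tau> k A B) (BLP_solutions \<tau> k C A B).
    \<forall>x\<in>L_vars \<tau> k A B. \<Phi> x = 0 \<longrightarrow> (\<forall>v\<in>BLP_solutions \<tau> k C A B. v x = 0)"
proof -
  let ?P = "BLP_solutions \<tau> k C A B" and ?V = "L_vars \<tau> k A B"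
  obtain v0 where v0: "v0 \<in> ?P" using ne by blast
  have "\<exists>v. v \<in> ?P \<and> ((\<exists>v'\<in>?P. v' x \<noteq> 0) \<longrightarrow> v x \<noteq> 0)" for x
    using v0 by blast
  then obtain sel where sel: "\<And>x. sel x \<in> ?P \<and> ((\<exists>v'\<in>?P. v' x \<noteq> 0) \<longrightarrow> sel x x \<noteq> 0)"
    by metis
  have selP: "sel x \<in> ?P" for x using sel by blast
  have selnz: "sel x x \<noteq> 0" if "v \<in> ?P" "v x \<noteq> 0" for v x using sel that by blast
  \<comment> \<open>The index \<open>None\<close> makes the average nonempty without a case
    distinction.\<close>
  define I where "I = insert None (Some ` ?V)"
  define vv where "vv i = (case i of None \<Rightarrow> v0 | Some x \<Rightarrow> sel x)" for i
  have finI: "finite I" unfolding I_def using fin by simp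
  have vvP: "vv i \<in> ?P" for i
    unfolding vv_def using selP v0 by (cases i) simp_all
  define c where "c = (1 :: rat) / of_nat (card I)"
  have cardI: "card I > 0" unfolding I_def using fin by (simp add: card_gt_0_iff)
  then have c: "c > 0" and csum: "(\<Sum>i\<in>I. c) = 1" unfolding c_def by simp_all
  define \<Phi> where "\<Phi> x = (\<Sum>i\<in>I. c * vv i x)" for x
  have nn: "0 \<le> v x" if "v \<in> ?P" "x \<in> ?V" for v x using that unfolding BLP_solutions_def by blast
  have \<Phi>P: "\<Phi> \<in> ?P"
  proof -
    have "L_system \<tau> k A B (\<lambda>x. \<Sum>i\<in>I. c * vv i x)"
      by (rule L_system_convex[OF finI csum]) (use vvP in \<open>simp add: BLP_solutions_def\<close>)
    moreover have "satisfies (\<lambda>x. \<Sum>i\<in>I. c * vv i x) C"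
      by (rule satisfies_convex[OF finI csum]) (use vvP in \<open>simp add: BLP_solutions_def\<close>)
    moreover have "0 \<le> \<Phi> x" if "x \<in> ?V" for x
      unfolding \<Phi>_def using nn[OF vvP that] c by (intro sum_nonneg mult_nonneg_nonneg) auto
    ultimately show ?thesis unfolding BLP_solutions_def \<Phi>_def[abs_def, symmetric] by simp
  qed
  have zero: "v x = 0" if x: "x \<in> ?V" "\<Phi> x = 0" and v: "v \<in> ?P" for x v
  proof (rule ccontr)
    assume "v x \<noteq> 0"
    then have "sel x x \<noteq> 0" using selnz v by blast
    then have "0 < sel x x" using nn[OF selP x(1), of x] by simp
    moreover have "c * vv (Some x) x \<le> (\<Sum>i\<in>I. c * vv i x)"
      by (rule member_le_sum) (use finI x(1) nn[OF vvP x(1)] c in \<open>auto simp: I_def\<close>)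
    ultimately have "0 < \<Phi> x" unfolding \<Phi>_def using c
      by (simp add: vv_def) (metis less_le_trans mult_pos_pos)
    then show False using x(2) by simp
  qed
  \<comment> \<open>The least nonzero coordinate of \<open>\<Phi>\<close>: a nearer point of the
    affine hull stays positive there, and the other coordinates vanish on all solutions, hence on
    the affine hull. The element 1 guards against an empty minimum.\<close>
  define \<epsilon> where "\<epsilon> = Min (insert 1 (\<Phi> ` {x \<in> ?V. \<Phi> x \<noteq> 0}))"
  have fin\<epsilon>: "finite (insert 1 (\<Phi> ` {x \<in> ?V. \<Phi> x \<noteq> 0}))" using fin by simp
  have \<epsilon>: "\<epsilon> > 0"
    unfolding \<epsilon>_def using fin\<epsilon> nn[OF \<Phi>P] by (subst Min_gr_iff) (auto simp: less_le)
  have "\<Phi> \<in> relative_interior ?V ?P"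
    unfolding relative_interior_def
  proof (intro CollectI conjI \<Phi>P exI[of _ \<epsilon>] \<epsilon> ballI impI)
    fix w assume w: "w \<in> rat_affine_hull ?P" and close: "\<forall>x\<in>?V. \<bar>w x - \<Phi> x\<bar> < \<epsilon>"
    obtain F u where F: "finite F" "F \<subseteq> ?P" "sum u F = 1" and w': "w = (\<lambda>x. \<Sum>v\<in>F. u v * v x)"
      using w unfolding rat_affine_hull_def by blast
    have "L_system \<tau> k A B w" unfolding w'
      by (rule L_system_convex[OF F(1,3), of _ _ _ _ "\<lambda>v. v"]) (use F(2) in \<open>auto simp: BLP_solutions_def\<close>)
    moreover have "satisfies w C" unfolding w'
      by (rule satisfies_convex[OF F(1,3), of "\<lambda>v. v"]) (use F(2) in \<open>auto simp: BLP_solutions_def\<close>)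
    moreover have "0 \<le> w x" if x: "x \<in> ?V" for x
    proof (cases "\<Phi> x = 0")
      case True
      have "w x = (\<Sum>v\<in>F. u v * 0)" unfolding w' by (rule sum.cong) (use zero[OF x True] F(2) in auto)
      then show ?thesis by simp
    next
      case False
      then have "\<epsilon> \<le> \<Phi> x" unfolding \<epsilon>_def using fin\<epsilon> x by (intro Min_le) auto
      moreover have "\<bar>w x - \<Phi> x\<bar> < \<epsilon>" using close x by blast
      ultimately show ?thesis by linarith
    qed
    ultimately show "w \<in> ?P" unfolding BLP_solutions_def by simp
  qed
  then show ?thesis using zero by blast
qed

text \<open>An interior point has the fewest zeros among all solutions, so it is enough that the
  integer solution vanishes wherever one chosen rational solution does.\<close>

lemma BA_acceptsI:
  fixes w :: "('a, 'b) lvar \<Rightarrow> int"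
  assumes "fin_struct \<tau> A" "fin_struct \<tau> B" and v: "v \<in> BLP_solutions \<tau> k C A B"
    and w: "L_system \<tau> k A B w" "satisfies w C"
    and zero: "\<And>x. x \<in> L_vars \<tau> k A B \<Longrightarrow> v x = 0 \<Longrightarrow> w x = 0"
  shows "BA_accepts \<tau> k C A B"
proof -
  obtain \<Phi> where "\<Phi> \<in> relative_interior (L_vars \<tau> k A B) (BLP_solutions \<tau> k C A B)"
    "\<forall>x\<in>L_vars \<tau> k A B. \<Phi> x = 0 \<longrightarrow> (\<forall>v\<in>BLP_solutions \<tau> k C A B. v x = 0)"
    using relative_interior_BLP[OF finite_L_vars[OF assms(1,2)], of k C] v by blast
  then show ?thesis unfolding BA_accepts_def using v w zero by blast
qed

section \<open>Acceptance criteria for the algorithms\<close>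

lemma pseudo_dist_sum: 
  "pseudo_dist K U V P \<Longrightarrow> X \<subseteq> V \<Longrightarrow> finite X \<Longrightarrow> card X \<le> K \<Longrightarrow> (\<Sum>f\<in>X \<rightarrow>\<^sub>E U. P X f) = 1"
  unfolding pseudo_dist_def by blast

lemma pseudo_dist_marginal:
  "pseudo_dist K U V P \<Longrightarrow> X \<subseteq> V \<Longrightarrow> finite X \<Longrightarrow> card X \<le> K \<Longrightarrow> Y \<subseteq> X \<Longrightarrow> g \<in> Y \<rightarrow>\<^sub>E U \<Longrightarrow>
    (\<Sum>f\<in>{f \<in> X \<rightarrow>\<^sub>E U. restrict f Y = g}. P X f) = P Y g"
  unfolding pseudo_dist_def by blast

lemma set_tuple:
  assumes "fin_struct \<tau> B" "R < length \<tau>" "b \<in> rels B R" "\<forall>R<length \<tau>. \<tau> ! R \<le> K"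
  shows "set b \<subseteq> univ B" "finite (set b)" "card (set b) \<le> K" "length b = \<tau> ! R"
  using assms card_length[of b] unfolding fin_struct_def by (auto intro: order_trans)

text \<open>The supports of a nonnegative \<open>Q\<close> form a \<open>k\<close>-consistent
  family, which lies below the greatest one. As \<open>P\<close> vanishes off these supports,
  restricting its sums to the greatest family changes nothing.\<close>

lemma Z_affine_acceptsI:
  fixes P :: "'b set \<Rightarrow> ('b \<Rightarrow> 'a) \<Rightarrow> int" and Q :: "'b set \<Rightarrow> ('b \<Rightarrow> 'a) \<Rightarrow> rat"
  assumes A: "fin_struct \<tau> A" and B: "fin_struct \<tau> B"
    and Q: "pseudo_dist K (univ A) (univ B) Q" and nn: "\<And>X f. 0 \<le> Q X f"
    and resp: "hom_supported \<tau> A B Q"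
    and P: "pseudo_dist K (univ A) (univ B) P" and ac: "abs_cont K (univ A) (univ B) P Q"
    and k: "k \<le> K"
  shows "Z_affine_accepts \<tau> k A B"
proof -
  let ?U = "univ A"
  define \<kappa>0 where "\<kappa>0 X = {f \<in> X \<rightarrow>\<^sub>E ?U. Q X f \<noteq> 0}" for X
  have sm: "X \<subseteq> univ B" "finite X" "card X \<le> K" if "X \<in> subsets_le k B" for X
    using that k unfolding subsets_le_def by auto
  have finU: "finite ?U" using A unfolding fin_struct_def by blast
  have finF: "finite (X \<rightarrow>\<^sub>E ?U)" if "X \<in> subsets_le k B" for X
    using sm(2)[OF that] finU by (intro finite_PiE)
  have restr: "restrict f Y \<in> \<kappa>0 Y" if X: "X \<in> subsets_le k B" and Y: "Y \<subseteq> X" and f: "f \<in> \<kappa>0 X" for X Y f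
  proof -
    have f': "f \<in> X \<rightarrow>\<^sub>E ?U" "Q X f \<noteq> 0" using f unfolding \<kappa>0_def by auto
    have rY: "restrict f Y \<in> Y \<rightarrow>\<^sub>E ?U" using f'(1) Y by (auto simp: PiE_def Pi_def)
    \<comment> \<open>Nonnegativity excludes cancellation, so a map of positive weight has
      restrictions of positive weight.\<close>
    have "Q X f \<le> (\<Sum>f'\<in>{f' \<in> X \<rightarrow>\<^sub>E ?U. restrict f' Y = restrict f Y}. Q X f')"
      by (rule member_le_sum) (use f'(1) nn finF[OF X] in auto)
    also have "\<dots> = Q Y (restrict f Y)" by (rule pseudo_dist_marginal[OF Q sm[OF X] Y rY])
    finally have "Q Y (restrict f Y) \<noteq> 0" using f'(2) nn[of X f] by linarith
    then show ?thesis using rY unfolding \<kappa>0_def by simp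
  qed
  have cons: "k_consistent \<tau> k A B \<kappa>0"
    unfolding k_consistent_def
  proof (intro conjI ballI allI impI subsetI)
    fix X f assume X: "X \<in> subsets_le k B" and f: "f \<in> \<kappa>0 X"
    have "map f t \<in> rels A R" if R: "R < length \<tau>" and t: "t \<in> rels (induced B X) R" for R t
    proof -
      have t': "t \<in> rels B R" "set t \<subseteq> X" using t unfolding induced_def by auto
      have "restrict f (set t) \<in> \<kappa>0 (set t)" by (rule restr[OF X t'(2) f])
      then have "map (restrict f (set t)) t \<in> rels A R"
        using resp R t'(1) unfolding \<kappa>0_def hom_supported_def by blast
      moreover have "map (restrict f (set t)) t = map f t" by simp
      ultimately show ?thesis by simp
    qed
    then show "f \<in> homs \<tau> (induced B X) A"
      using f unfolding homs_def \<kappa>0_def induced_def by auto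
  next
    fix X Y f assume X: "X \<in> subsets_le k B" and Y: "Y \<subset> X" and f: "f \<in> \<kappa>0 Y"
    have f': "f \<in> Y \<rightarrow>\<^sub>E ?U" "Q Y f \<noteq> 0" using f unfolding \<kappa>0_def by auto
    have "(\<Sum>g\<in>{g \<in> X \<rightarrow>\<^sub>E ?U. restrict g Y = f}. Q X g) \<noteq> 0"
      using pseudo_dist_marginal[OF Q sm[OF X] _ f'(1)] Y f'(2) by auto
    then obtain g where "g \<in> {g \<in> X \<rightarrow>\<^sub>E ?U. restrict g Y = f}" "Q X g \<noteq> 0"
      by (meson sum.not_neutral_contains_not_neutral)
    then show "\<exists>g\<in>\<kappa>0 X. restrict g Y = f" unfolding \<kappa>0_def by blast
  next
    fix X Y g assume "X \<in> subsets_le k B" "Y \<subset> X" "g \<in> \<kappa>0 X"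
    then show "restrict g Y \<in> \<kappa>0 Y" using restr by blast
  qed
  define \<kappa> where "\<kappa> = kappa \<tau> k A B"
  have sub: "\<kappa>0 X \<subseteq> \<kappa> X" for X using kappa_greatest[OF cons] unfolding \<kappa>_def le_fun_def by blast
  have \<kappa>U: "\<kappa> X \<subseteq> X \<rightarrow>\<^sub>E ?U" if "X \<in> subsets_le k B" for X
    using k_consistent_kappa[of \<tau> k A B] that
    unfolding \<kappa>_def k_consistent_def homs_def induced_def by fastforce
  have P0: "P X f = 0" if "X \<in> subsets_le k B" "f \<in> X \<rightarrow>\<^sub>E ?U" "f \<notin> \<kappa> X" for X f
    using ac sm[OF that(1)] that sub[of X] unfolding abs_cont_def \<kappa>0_def by blast
  show ?thesis
    unfolding Z_affine_accepts_def Let_def \<kappa>_def[symmetric]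
  proof (intro exI[of _ P] conjI ballI allI impI)
    fix X assume X: "X \<in> subsets_le k B"
    have "(\<Sum>f\<in>\<kappa> X. P X f) = (\<Sum>f\<in>X \<rightarrow>\<^sub>E ?U. P X f)"
      by (rule sum.mono_neutral_left) (use finF[OF X] \<kappa>U[OF X] P0[OF X] in auto)
    then show "(\<Sum>f\<in>\<kappa> X. P X f) = 1" using pseudo_dist_sum[OF P sm[OF X]] by simp
  next
    fix X Y g assume X: "X \<in> subsets_le k B" and Y: "Y \<subset> X" and g: "g \<in> \<kappa> Y"
    have "Y \<in> subsets_le k B"
    proof -
      have "finite X" "card X \<le> k" "X \<subseteq> univ B" using X unfolding subsets_le_def by auto
      then show ?thesis using Y card_mono[of X Y] finite_subset[of Y X] unfolding subsets_le_def by auto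
    qed
    then have gU: "g \<in> Y \<rightarrow>\<^sub>E ?U" using \<kappa>U g by blast
    have "(\<Sum>f\<in>{f \<in> \<kappa> X. restrict f Y = g}. P X f) = (\<Sum>f\<in>{f \<in> X \<rightarrow>\<^sub>E ?U. restrict f Y = g}. P X f)"
    proof (rule sum.mono_neutral_left)
      show "finite {f \<in> X \<rightarrow>\<^sub>E ?U. restrict f Y = g}" using finF[OF X] by simp
      show "{f \<in> \<kappa> X. restrict f Y = g} \<subseteq> {f \<in> X \<rightarrow>\<^sub>E ?U. restrict f Y = g}" using \<kappa>U[OF X] by blast
      show "\<forall>f\<in>{f \<in> X \<rightarrow>\<^sub>E ?U. restrict f Y = g} - {f \<in> \<kappa> X. restrict f Y = g}. P X f = 0"
        using P0[OF X] by blast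
    qed
    also have "\<dots> = P Y g" by (rule pseudo_dist_marginal[OF P sm[OF X] _ gU]) (use Y in blast)
    finally show "(\<Sum>f\<in>{f \<in> \<kappa> X. restrict f Y = g}. P X f) = P Y g" .
  qed
qed

lemma abs_cont_lift_sol:
  assumes B: "fin_struct \<tau> B" and A: "fin_struct \<tau> A" and ac: "abs_cont K (univ A) (univ B) P Q"
    and k: "k \<le> K" and ar: "\<forall>R<length \<tau>. \<tau> ! R \<le> K"
    and x: "x \<in> L_vars \<tau> k A B" and 0: "lift_sol Q x = 0"
  shows "lift_sol P x = 0"
proof -
  have *: "P X f = 0" if "X \<subseteq> univ B" "finite X" "card X \<le> K" "f \<in> X \<rightarrow>\<^sub>E univ A" "Q X f = 0" for X f
    using ac that unfolding abs_cont_def by blast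
  consider X f where "x = Lam X f" "X \<in> subsets_le k B" "f \<in> X \<rightarrow>\<^sub>E univ A"
    | R b a where "x = Mu R b a" "R < length \<tau>" "b \<in> rels B R" "a \<in> rels A R"
    using x unfolding L_vars_def by blast
  then show ?thesis
  proof cases
    case (1 X f)
    then show ?thesis using * 0 k unfolding lift_sol_def subsets_le_def by auto
  next
    case (2 R b a)
    note b = set_tuple[OF B 2(2,3) ar]
    have "length b = length a" "set a \<subseteq> univ A" using A 2 b(4) unfolding fin_struct_def by auto
    then have "tuple_map b a \<in> set b \<rightarrow>\<^sub>E univ A" by (rule tuple_map_PiE)
    then show ?thesis using *[OF b(1-3)] 0 2(1) unfolding lift_sol_def by (auto split: if_splits)
  qed
qed

lemma lift_sol_nonneg: "(\<And>X f. (0::rat) \<le> Q X f) \<Longrightarrow> 0 \<le> lift_sol Q x"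
  unfolding lift_sol_def by (auto split: lvar.splits)

lemma BA_accepts_pseudo_dist:
  fixes P :: "'b set \<Rightarrow> ('b \<Rightarrow> 'a) \<Rightarrow> int" and Q :: "'b set \<Rightarrow> ('b \<Rightarrow> 'a) \<Rightarrow> rat"
  assumes A: "fin_struct \<tau> A" and B: "fin_struct \<tau> B"
    and Q: "pseudo_dist K (univ A) (univ B) Q" and nn: "\<And>X f. 0 \<le> Q X f"
    and resp: "hom_supported \<tau> A B Q"
    and P: "pseudo_dist K (univ A) (univ B) P" and ac: "abs_cont K (univ A) (univ B) P Q"
    and k: "k \<le> K" and ar: "\<forall>R<length \<tau>. \<tau> ! R \<le> K"
    and C: "satisfies (lift_sol Q) C" "satisfies (lift_sol P) C"
  shows "BA_accepts \<tau> k C A B"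
proof (rule BA_acceptsI[OF A B])
  show "lift_sol Q \<in> BLP_solutions \<tau> k C A B"
    using L_system_lift_sol[OF A B Q resp k ar] lift_sol_nonneg[of Q] nn C unfolding BLP_solutions_def by blast
  show "L_system \<tau> k A B (lift_sol P)"
    by (rule L_system_lift_sol[OF A B P hom_supported_abs_cont[OF B ar resp ac] k ar])
  show "satisfies (lift_sol P) C" by (rule C)
  show "lift_sol P x = 0" if "x \<in> L_vars \<tau> k A B" "lift_sol Q x = 0" for x
    by (rule abs_cont_lift_sol[OF B A ac k ar that])
qed

text \<open>No tuple of \<open>Supp\<close> is ever removed from a state that contains
  \<open>Supp\<close>, and every step shrinks the finite total size; so some run ends in a final
  state that still contains \<open>Supp\<close>.\<close>

lemma CLAP_final_exists:
  fixes A :: "'a rel_struct" and B :: "'b rel_struct"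
  assumes A: "fin_struct \<tau> A" and B: "fin_struct \<tau> B"
    and keep: "\<And>S R b a. \<lbrakk>\<And>R b. Supp R b \<subseteq> S R b; R < length \<tau>; b \<in> rels B R; a \<in> Supp R b\<rbrakk>
      \<Longrightarrow> BLP_solutions \<tau> 1 (CLAP_constraints \<tau> A B S R b a) A B \<noteq> {}"
    and Supp: "\<And>R b. Supp R b \<subseteq> rels A R"
  shows "\<exists>S. CLAP_final \<tau> A B S \<and> (\<forall>R b. Supp R b \<subseteq> S R b)"
proof -
  define \<Phi> where "\<Phi> S = (\<Sum>R<length \<tau>. \<Sum>b\<in>rels B R. card (S R b))" for S :: "nat \<Rightarrow> 'b list \<Rightarrow> 'a list set"
  have main: "\<exists>S'. (CLAP_step \<tau> A B)\<^sup>*\<^sup>* S S' \<and> (\<nexists>S''. CLAP_step \<tau> A B S' S'') \<and> (\<forall>R b. Supp R b \<subseteq> S' R b)"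
    if "\<And>R b. Supp R b \<subseteq> S R b" "\<And>R b. R < length \<tau> \<Longrightarrow> finite (S R b)" for S
    using that
  proof (induction "\<Phi> S" arbitrary: S rule: less_induct)
    case less
    show ?case
    proof (cases "\<exists>S'. CLAP_step \<tau> A B S S'")
      case False
      then show ?thesis using less.prems by blast
    next
      case True
      then obtain S' where step: "CLAP_step \<tau> A B S S'" by blast
      then obtain R b a where S': "S' = S(R := (S R)(b := S R b - {a}))"
        and R: "R < length \<tau>" and b: "b \<in> rels B R" and a: "a \<in> S R b"
        and inf: "BLP_solutions \<tau> 1 (CLAP_constraints \<tau> A B S R b a) A B = {}"
        by (auto elim: CLAP_step.cases)
      have "a \<notin> Supp R b" using keep[OF less.prems(1) R b] inf by blast
      then have supp: "Supp R' b' \<subseteq> S' R' b'" for R' b'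
        using less.prems(1) unfolding S' by auto
      have fin: "finite (S' R' b')" if "R' < length \<tau>" for R' b'
        using less.prems(2)[OF that] unfolding S' by auto
      have le: "card (S' R' b') \<le> card (S R' b')" if "R' < length \<tau>" for R' b'
        by (rule card_mono[OF less.prems(2)[OF that]]) (auto simp: S')
      have lt: "card (S' R b) < card (S R b)"
        by (rule psubset_card_mono[OF less.prems(2)[OF R]]) (use a in \<open>auto simp: S'\<close>)
      have "(\<Sum>b\<in>rels B R. card (S' R b)) < (\<Sum>b\<in>rels B R. card (S R b))"
        by (rule sum_strict_mono_ex1[OF finite_rels[OF B R]]) (use le[OF R] lt b in auto)
      then have "\<Phi> S' < \<Phi> S"
        unfolding \<Phi>_def by (intro sum_strict_mono_ex1) (use le R in \<open>auto intro!: sum_mono\<close>)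
      from less.hyps[OF this supp fin] step show ?thesis
        by (meson converse_rtranclp_into_rtranclp)
    qed
  qed
  show ?thesis
    unfolding CLAP_final_def using main[of "\<lambda>R b. rels A R"] Supp finite_rels[OF A] by blast
qed

lemma lift_sol_Mu_map:
  assumes "f \<in> set b \<rightarrow>\<^sub>E U"
  shows "lift_sol P (Mu R b (map f b)) = P (set b) f"
proof -
  have "tuple_map b (map f b) = f" by (rule tuple_map_map) (use assms in \<open>simp add: PiE_def\<close>)
  then show ?thesis unfolding lift_sol_def by simp
qed

text \<open>For each tuple in the support of \<open>Q\<close>, \<open>cond\<close> supplies a
  solution that fixes it and stays inside that support; so the propagation phase removes none of
  them. In the last phase \<open>Q\<close> and \<open>P\<close> themselves are the witnesses,
  because both already give weight 1 to \<open>a0\<close> at \<open>b0\<close>.\<close>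

lemma CLAP_acceptsI:
  fixes P :: "'b set \<Rightarrow> ('b \<Rightarrow> 'a) \<Rightarrow> int" and Q :: "'b set \<Rightarrow> ('b \<Rightarrow> 'a) \<Rightarrow> rat"
  assumes A: "fin_struct \<tau> A" and B: "fin_struct \<tau> B"
    and Q: "pseudo_dist K (univ A) (univ B) Q" and nn: "\<And>X f. 0 \<le> Q X f"
    and resp: "hom_supported \<tau> A B Q"
    and P: "pseudo_dist K (univ A) (univ B) P" and ac: "abs_cont K (univ A) (univ B) P Q"
    and K: "1 \<le> K" and ar: "\<forall>R<length \<tau>. \<tau> ! R \<le> K"
    and cond: "\<And>R b a. \<lbrakk>R < length \<tau>; b \<in> rels B R; a \<in> rels A R; lift_sol Q (Mu R b a) \<noteq> 0\<rbrakk> \<Longrightarrow>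
      \<exists>Q'. pseudo_dist K (univ A) (univ B) Q' \<and> (\<forall>X f. 0 \<le> Q' X f) \<and>
        abs_cont K (univ A) (univ B) Q' Q \<and> lift_sol Q' (Mu R b a) = (1::rat)"
    and R0: "R0 < length \<tau>" and b0: "b0 \<in> rels B R0" and a0: "a0 \<in> rels A R0"
    and fixed: "lift_sol Q (Mu R0 b0 a0) = 1" "lift_sol P (Mu R0 b0 a0) = 1"
  shows "CLAP \<tau> A B"
proof -
  define Supp where "Supp R b = {a \<in> rels A R. lift_sol Q (Mu R b a) \<noteq> 0}" for R b
  have keep: "BLP_solutions \<tau> 1 (CLAP_constraints \<tau> A B S R b a) A B \<noteq> {}"
    if S: "\<And>R b. Supp R b \<subseteq> S R b" and R: "R < length \<tau>" and b: "b \<in> rels B R" and a: "a \<in> Supp R b"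
    for S R b a
  proof -
    obtain Q' where Q': "pseudo_dist K (univ A) (univ B) Q'" "\<And>X f. 0 \<le> Q' X f"
      and ac': "abs_cont K (univ A) (univ B) Q' Q" and 1: "lift_sol Q' (Mu R b a) = (1::rat)"
      using cond[OF R b] a unfolding Supp_def by blast
    have "lift_sol Q' (Mu R' b' a') = 0"
      if "R' < length \<tau>" "b' \<in> rels B R'" "a' \<in> rels A R' - S R' b'" for R' b' a'
    proof (rule abs_cont_lift_sol[OF B A ac' K ar])
      show "Mu R' b' a' \<in> L_vars \<tau> 1 A B" using that unfolding L_vars_def by blast
      show "lift_sol Q (Mu R' b' a') = 0" using that S[of R' b'] unfolding Supp_def by blast
    qed
    then have "satisfies (lift_sol Q') (CLAP_constraints \<tau> A B S R b a)"
      using 1 unfolding satisfies_def CLAP_constraints_def by auto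
    then have "lift_sol Q' \<in> BLP_solutions \<tau> 1 (CLAP_constraints \<tau> A B S R b a) A B"
      using L_system_lift_sol[OF A B Q'(1) hom_supported_abs_cont[OF B ar resp ac'] K ar]
        lift_sol_nonneg[of Q'] Q'(2) unfolding BLP_solutions_def by blast
    then show ?thesis by blast
  qed
  obtain S where S: "CLAP_final \<tau> A B S" "\<And>R b. Supp R b \<subseteq> S R b"
    using CLAP_final_exists[OF A B, of Supp] keep unfolding Supp_def by blast
  have ne: "S R b \<noteq> {}" if R: "R < length \<tau>" and b: "b \<in> rels B R" for R b
  proof -
    note b' = set_tuple[OF B R b ar]
    have "(\<Sum>f\<in>set b \<rightarrow>\<^sub>E univ A. Q (set b) f) \<noteq> 0" using pseudo_dist_sum[OF Q b'(1-3)] by simp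
    then obtain f where f: "f \<in> set b \<rightarrow>\<^sub>E univ A" "Q (set b) f \<noteq> 0"
      by (meson sum.not_neutral_contains_not_neutral)
    then have "map f b \<in> rels A R" using resp R b unfolding hom_supported_def by blast
    then have "map f b \<in> Supp R b" unfolding Supp_def using lift_sol_Mu_map[OF f(1), of Q R] f(2) by auto
    then show ?thesis using S(2) by blast
  qed
  have a0S: "a0 \<in> S R0 b0" using S(2) a0 fixed(1) unfolding Supp_def by fastforce
  have 0: "lift_sol Q (Mu R' b' a') = 0" "lift_sol P (Mu R' b' a') = 0"
    if "R' < length \<tau>" "b' \<in> rels B R'" "a' \<in> rels A R' - S R' b'" for R' b' a'
  proof -
    show Q0: "lift_sol Q (Mu R' b' a') = 0" using that S(2)[of R' b'] unfolding Supp_def by blast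
    show "lift_sol P (Mu R' b' a') = 0"
      by (rule abs_cont_lift_sol[OF B A ac K ar _ Q0]) (use that in \<open>auto simp: L_vars_def\<close>)
  qed
  have "BA_accepts \<tau> 1 (CLAP_constraints \<tau> A B S R0 b0 a0) A B"
    by (rule BA_accepts_pseudo_dist[OF A B Q nn resp P ac K ar])
      (use 0 fixed in \<open>auto simp: satisfies_def CLAP_constraints_def\<close>)
  then show ?thesis unfolding CLAP_def using S(1) ne R0 b0 a0S by blast
qed

section \<open>The template\<close>

text \<open>The elements \<open>0, 1\<close> form the first group, \<open>3, 4, 5\<close> the second one, and \<open>2\<close>, \<open>6\<close> are the
  placeholders for an inactive left and right half.  Exactly one half is active and satisfies its
  linear equation.  The codes \<open>3 + i\<close> of the second group can be summed directly, because six of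
  them have the offset \<open>18\<close>.\<close>

definition tmpl_rel :: "nat list set" where
  "tmpl_rel = {l @ r | l r. length l = 6 \<and> length r = 6 \<and>
     (set l \<subseteq> {0, 1} \<and> sum_list l mod 2 = 1 \<and> set r \<subseteq> {6} \<or>
      set l \<subseteq> {2} \<and> set r \<subseteq> {3, 4, 5} \<and> sum_list r mod 3 = 1)}"

definition tmpl :: "nat rel_struct" where
  "tmpl = \<lparr>univ = {..<7}, rels = (\<lambda>_. tmpl_rel)\<rparr>"

lemma append_in_tmpl_rel:
  assumes "length l = 6" "length r = 6"
  shows "l @ r \<in> tmpl_rel \<longleftrightarrow> set l \<subseteq> {0, 1} \<and> sum_list l mod 2 = 1 \<and> set r \<subseteq> {6} \<or>
      set l \<subseteq> {2} \<and> set r \<subseteq> {3, 4, 5} \<and> sum_list r mod 3 = 1"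
proof
  assume "l @ r \<in> tmpl_rel"
  then obtain l' r' where *: "l @ r = l' @ r'" "length l' = 6" "length r' = 6"
    "set l' \<subseteq> {0, 1} \<and> sum_list l' mod 2 = 1 \<and> set r' \<subseteq> {6} \<or>
      set l' \<subseteq> {2} \<and> set r' \<subseteq> {3, 4, 5} \<and> sum_list r' mod 3 = 1"
    unfolding tmpl_rel_def by blast
  then have "l = l' \<and> r = r'" using assms by simp
  with *(4) show "set l \<subseteq> {0, 1} \<and> sum_list l mod 2 = 1 \<and> set r \<subseteq> {6} \<or>
      set l \<subseteq> {2} \<and> set r \<subseteq> {3, 4, 5} \<and> sum_list r mod 3 = 1" by simp
next
  assume "set l \<subseteq> {0, 1} \<and> sum_list l mod 2 = 1 \<and> set r \<subseteq> {6} \<or>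
      set l \<subseteq> {2} \<and> set r \<subseteq> {3, 4, 5} \<and> sum_list r mod 3 = 1"
  then show "l @ r \<in> tmpl_rel" unfolding tmpl_rel_def using assms by blast
qed

lemma tmpl_rel_cases:
  assumes "t \<in> tmpl_rel"
  obtains (1) l r where "t = l @ r" "length l = 6" "length r = 6" "set l \<subseteq> {0, 1}" "sum_list l mod 2 = 1" "set r \<subseteq> {6}"
  | (2) l r where "t = l @ r" "length l = 6" "length r = 6" "set l \<subseteq> {2}" "set r \<subseteq> {3, 4, 5}" "sum_list r mod 3 = 1"
proof -
  from assms obtain l r where t: "t = l @ r" "length l = 6" "length r = 6"
    and "set l \<subseteq> {0, 1} \<and> sum_list l mod 2 = 1 \<and> set r \<subseteq> {6} \<or>
      set l \<subseteq> {2} \<and> set r \<subseteq> {3, 4, 5} \<and> sum_list r mod 3 = 1"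
    unfolding tmpl_rel_def by (elim CollectE exE conjE) (rule that)
  from this(4) show ?thesis
    by (elim disjE conjE) (rule 1[OF t], assumption+, rule 2[OF t], assumption+)
qed

lemma fin_struct_tmpl: "fin_struct [12] tmpl"
proof -
  have "length t = 12 \<and> set t \<subseteq> {..<7}" if "t \<in> tmpl_rel" for t
    using that by (cases rule: tmpl_rel_cases) fastforce+
  then show ?thesis unfolding fin_struct_def tmpl_def by simp
qed

lemma template_tmpl: "template [12] tmpl"
  using fin_struct_tmpl unfolding template_def vocabulary_def by (auto simp: tmpl_def lessThan_empty_iff)

section \<open>A Maltsev polymorphism of the template\<close>

definition first_sort :: "nat \<Rightarrow> bool" where
  "first_sort x \<longleftrightarrow> x < 2 \<or> x = 6"

text \<open>The minority of the two sorts, and the affine operation of the group within a sort.\<close>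

definition minority :: "nat \<Rightarrow> nat \<Rightarrow> nat \<Rightarrow> nat" where
  "minority x y z =
     (if first_sort x = first_sort y \<and> first_sort y = first_sort z then
        if x < 2 \<and> y < 2 \<and> z < 2 then (x + y + z) mod 2
        else if {x, y, z} \<subseteq> {3, 4, 5} then 3 + (x + 2 * y + z) mod 3
        else if x = y then z else x
      else if first_sort x = first_sort y then z
      else if first_sort y = first_sort z then x else y)"

text \<open>Within a group the operation is \<open>x - y + z\<close>, with \<open>-1\<close> written
  as 1 modulo 2 and as 2 modulo 3; the offsets of the codes vanish modulo 3. The branch
  \<open>if x = y then z else x\<close> is Maltsev on any set and covers the placeholders and the
  triples that mix a placeholder with group elements.\<close>

lemma minority_Maltsev: "x < 7 \<Longrightarrow> y < 7 \<Longrightarrow> minority x x y = y \<and> minority y x x = y"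
proof -
  assume "x < 7" "y < 7"
  have eq: "x + x + y = y + 2 * x" "y + x + x = y + 2 * x" "x + 2 * x + y = y + 3 * x" "y + 2 * x + x = y + 3 * x"
    by simp_all
  have 1: "(x + x + y) mod 2 = y" "(y + x + x) mod 2 = y" if "y < 2"
    using that unfolding eq by simp_all
  define T where "T = {3, 4, 5 :: nat}"
  have 2: "3 + (x + 2 * x + y) mod 3 = y" "3 + (y + 2 * x + x) mod 3 = y" if "y \<in> T"
    using that unfolding eq mod_mult_self2 T_def by auto
  show ?thesis
    unfolding minority_def T_def[symmetric] insert_subset using 1 2 by simp
qed

lemma minority_range: "x < 7 \<Longrightarrow> y < 7 \<Longrightarrow> z < 7 \<Longrightarrow> minority x y z < 7"
  unfolding minority_def by auto

definition map3 :: "(nat \<Rightarrow> nat \<Rightarrow> nat \<Rightarrow> nat) \<Rightarrow> nat list \<Rightarrow> nat list \<Rightarrow> nat list \<Rightarrow> nat list" where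
  "map3 p s t u = map (\<lambda>i. p (s ! i) (t ! i) (u ! i)) [0..<length s]"

lemma map3_append:
  assumes "length s = length t" "length t = length u" 
  shows "map3 p (s @ s') (t @ t') (u @ u') = map3 p s t u @ map3 p s' t' u'"
proof (rule nth_equalityI)
  show "map3 p (s @ s') (t @ t') (u @ u') ! i = (map3 p s t u @ map3 p s' t' u') ! i"
    if "i < length (map3 p (s @ s') (t @ t') (u @ u'))" for i
    using that assms unfolding map3_def by (auto simp: nth_append)
qed (simp add: map3_def)

lemma first_sort_tmpl_rel:
  assumes "t \<in> tmpl_rel"
  shows "(\<forall>x\<in>set t. first_sort x) \<or> (\<forall>x\<in>set t. \<not> first_sort x)"
  using assms
proof (cases rule: tmpl_rel_cases)
  case (1 l r)
  then have "set t \<subseteq> {0, 1, 6}" by auto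
  then show ?thesis by (auto simp: first_sort_def)
next
  case (2 l r)
  then have "set t \<subseteq> {2, 3, 4, 5}" by auto
  then show ?thesis by (auto simp: first_sort_def)
qed

lemma map3_nth_sum_list:
  assumes "length s = n" "length t = n" "length u = n"
    and "\<And>i. i < n \<Longrightarrow> [p (s ! i) (t ! i) (u ! i) = s ! i + c * t ! i + u ! i] (mod q)"
  shows "[sum_list (map3 p s t u) = sum_list s + c * sum_list t + sum_list u] (mod q)"
proof -
  have "sum_list (map3 p s t u) = (\<Sum>i<n. p (s ! i) (t ! i) (u ! i))"
    using assms(1) by (simp add: map3_def interv_sum_list_conv_sum_set_nat atLeast0LessThan)
  moreover have "[(\<Sum>i<n. p (s ! i) (t ! i) (u ! i)) = (\<Sum>i<n. s ! i + c * t ! i + u ! i)] (mod q)"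
    by (rule cong_sum) (use assms(4) in auto)
  moreover have "(\<Sum>i<n. s ! i + c * t ! i + u ! i) = sum_list s + c * sum_list t + sum_list u"
    using assms(1-3) by (simp add: sum_list_sum_nth sum.distrib sum_distrib_left atLeast0LessThan)
  ultimately show ?thesis by simp
qed

lemma map3_const:
  assumes "set s \<subseteq> {x}" "set t \<subseteq> {x}" "set u \<subseteq> {x}" "length s = length t" "length t = length u" "p x x x = x"
  shows "set (map3 p s t u) \<subseteq> {x}"
proof
  fix y assume "y \<in> set (map3 p s t u)"
  then obtain i where i: "i < length s" "y = p (s ! i) (t ! i) (u ! i)" unfolding map3_def by auto
  then have "s ! i \<in> set s" "t ! i \<in> set t" "u ! i \<in> set u" using assms(4,5) by simp_all
  then have "s ! i = x" "t ! i = x" "u ! i = x" using assms(1-3) by blast+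
  then show "y \<in> {x}" using i assms(6) by simp
qed

text \<open>All entries of a tuple share one sort, so the same argument is in the minority at every
  position. If the sorts differ, the result is one of the three tuples; if they agree, all three
  have the same active half, and an affine combination with coefficients summing to 1 keeps the sum
  at 1.\<close>

lemma minority_tmpl_rel:
  assumes s: "s \<in> tmpl_rel" and t: "t \<in> tmpl_rel" and u: "u \<in> tmpl_rel"
  shows "map3 minority s t u \<in> tmpl_rel"
proof -
  have len: "length s = 12" "length t = 12" "length u = 12"
    using fin_struct_tmpl s t u unfolding fin_struct_def tmpl_def by auto
  have sort: "first_sort (v ! i) = first_sort (v ! 0)" if "v \<in> tmpl_rel" "i < 12" "length v = 12" for v i
  proof -
    have "v ! i \<in> set v" "v ! 0 \<in> set v" using that by auto
    with first_sort_tmpl_rel[OF that(1)] show ?thesis by blast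
  qed
  have nth: "map3 minority s t u ! i = minority (s ! i) (t ! i) (u ! i)" if "i < 12" for i
    using that len unfolding map3_def by simp
  have lenm: "length (map3 minority s t u) = 12" unfolding map3_def using len by simp
  consider "first_sort (s ! 0) = first_sort (t ! 0)" "first_sort (t ! 0) \<noteq> first_sort (u ! 0)"
    | "first_sort (s ! 0) \<noteq> first_sort (t ! 0)" "first_sort (t ! 0) = first_sort (u ! 0)"
    | "first_sort (s ! 0) \<noteq> first_sort (t ! 0)" "first_sort (t ! 0) \<noteq> first_sort (u ! 0)"
    | "first_sort (s ! 0) = first_sort (t ! 0)" "first_sort (t ! 0) = first_sort (u ! 0)" by blast
  then show ?thesis
  proof cases
    case 1
    have "map3 minority s t u ! i = u ! i" if "i < 12" for i
      using 1 sort[OF s that len(1)] sort[OF t that len(2)] sort[OF u that len(3)]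
      unfolding nth[OF that] minority_def by simp
    then have "map3 minority s t u = u" using lenm len by (intro nth_equalityI) simp_all
    then show ?thesis using u by simp
  next
    case 2
    have "map3 minority s t u ! i = s ! i" if "i < 12" for i
      using 2 sort[OF s that len(1)] sort[OF t that len(2)] sort[OF u that len(3)]
      unfolding nth[OF that] minority_def by simp
    then have "map3 minority s t u = s" using lenm len by (intro nth_equalityI) simp_all
    then show ?thesis using s by simp
  next
    case 3
    have "map3 minority s t u ! i = t ! i" if "i < 12" for i
      using 3 sort[OF s that len(1)] sort[OF t that len(2)] sort[OF u that len(3)]
      unfolding nth[OF that] minority_def by simp
    then have "map3 minority s t u = t" using lenm len by (intro nth_equalityI) simp_all
    then show ?thesis using t by simp
  next
    case 4
    \<comment> \<open>Position 0 belongs to the left half and never carries the placeholder 6, so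
      its value reveals which half is active.\<close>
    have lower: "first_sort (v ! 0) \<longleftrightarrow> v ! 0 < 2" if "v \<in> tmpl_rel" for v
    proof -
      have "v ! 0 \<noteq> 6"
        using that
      proof (cases rule: tmpl_rel_cases)
        case (1 l r)
        then have "v ! 0 = l ! 0" "l ! 0 \<in> set l" by (simp_all add: nth_append)
        moreover have "6 \<notin> set l" using 1(4) by auto
        ultimately show ?thesis by metis
      next
        case (2 l r)
        then have "v ! 0 = l ! 0" "l ! 0 \<in> set l" by (simp_all add: nth_append)
        moreover have "6 \<notin> set l" using 2(4) by auto
        ultimately show ?thesis by metis
      qed
      then show ?thesis unfolding first_sort_def by simp
    qed
    have low_l: "v ! 0 < 2" if "v = l @ r" "length l = 6" "set l \<subseteq> {0, 1}" for v l r :: "nat list"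
    proof -
      have "v ! 0 \<in> set l" using that by (simp add: nth_append)
      then show ?thesis using that by auto
    qed
    have high_l: "\<not> v ! 0 < 2" if "v = l @ r" "length l = 6" "set l \<subseteq> {2}" for v l r :: "nat list"
    proof -
      have "v ! 0 \<in> set l" using that by (simp add: nth_append)
      then show ?thesis using that by auto
    qed
    have all: "s ! 0 < 2 \<longleftrightarrow> t ! 0 < 2" "t ! 0 < 2 \<longleftrightarrow> u ! 0 < 2"
      using 4 lower s t u by blast+
    show ?thesis
    proof (cases "s ! 0 < 2")
      case True
      obtain ls rs where S: "s = ls @ rs" "length ls = 6" "length rs = 6" "set ls \<subseteq> {0, 1}" "sum_list ls mod 2 = 1" "set rs \<subseteq> {6}"
        using s by (cases rule: tmpl_rel_cases) (use True high_l in blast)+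
      obtain lt rt where T: "t = lt @ rt" "length lt = 6" "length rt = 6" "set lt \<subseteq> {0, 1}" "sum_list lt mod 2 = 1" "set rt \<subseteq> {6}"
        using t by (cases rule: tmpl_rel_cases) (use True all high_l in blast)+
      obtain lu ru where U: "u = lu @ ru" "length lu = 6" "length ru = 6" "set lu \<subseteq> {0, 1}" "sum_list lu mod 2 = 1" "set ru \<subseteq> {6}"
        using u by (cases rule: tmpl_rel_cases) (use True all high_l in blast)+
      have m: "minority (ls ! i) (lt ! i) (lu ! i) = (ls ! i + 1 * lt ! i + lu ! i) mod 2" if "i < 6" for i
      proof -
        have "ls ! i \<in> {0, 1}" "lt ! i \<in> {0, 1}" "lu ! i \<in> {0, 1}"
          using that S T U nth_mem by (metis subsetD)+
        then have "ls ! i < 2" "lt ! i < 2" "lu ! i < 2" by auto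
        then show ?thesis unfolding minority_def first_sort_def by simp
      qed
      have "[sum_list (map3 minority ls lt lu) = sum_list ls + 1 * sum_list lt + sum_list lu] (mod 2)"
        by (rule map3_nth_sum_list[OF S(2) T(2) U(2)]) (simp add: m cong_def)
      moreover have "[sum_list ls + 1 * sum_list lt + sum_list lu = 1 + 1 * 1 + 1] (mod 2)"
        by (intro cong_add cong_mult cong_refl) (use S T U in \<open>simp_all add: cong_def\<close>)
      ultimately have "[sum_list (map3 minority ls lt lu) = 1 + 1 * 1 + 1] (mod 2)" by (rule cong_trans)
      then have "sum_list (map3 minority ls lt lu) mod 2 = 1" by (simp add: cong_def)
      moreover have "set (map3 minority ls lt lu) \<subseteq> {0, 1}"
        unfolding map3_def using m S(2) by auto
      moreover have "set (map3 minority rs rt ru) \<subseteq> {6}"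
        by (rule map3_const) (use S T U in \<open>auto simp: minority_def\<close>)
      moreover have "map3 minority s t u = map3 minority ls lt lu @ map3 minority rs rt ru"
        unfolding S(1) T(1) U(1) by (rule map3_append) (use S T U in auto)
      ultimately show ?thesis using S(2,3) by (simp add: append_in_tmpl_rel map3_def)
    next
      case False
      obtain ls rs where S: "s = ls @ rs" "length ls = 6" "length rs = 6" "set ls \<subseteq> {2}" "set rs \<subseteq> {3, 4, 5}" "sum_list rs mod 3 = 1"
        using s by (cases rule: tmpl_rel_cases) (use False low_l in blast)+
      obtain lt rt where T: "t = lt @ rt" "length lt = 6" "length rt = 6" "set lt \<subseteq> {2}" "set rt \<subseteq> {3, 4, 5}" "sum_list rt mod 3 = 1"
        using t by (cases rule: tmpl_rel_cases) (use False all low_l in blast)+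
      obtain lu ru where U: "u = lu @ ru" "length lu = 6" "length ru = 6" "set lu \<subseteq> {2}" "set ru \<subseteq> {3, 4, 5}" "sum_list ru mod 3 = 1"
        using u by (cases rule: tmpl_rel_cases) (use False all low_l in blast)+
      have m: "minority (rs ! i) (rt ! i) (ru ! i) = 3 + (rs ! i + 2 * rt ! i + ru ! i) mod 3" if "i < 6" for i
      proof -
        have "rs ! i \<in> {3, 4, 5}" "rt ! i \<in> {3, 4, 5}" "ru ! i \<in> {3, 4, 5}"
          using that S T U nth_mem by (metis subsetD)+
        then have sub: "{rs ! i, rt ! i, ru ! i} \<subseteq> {3, 4, 5}" by blast
        have ns: "\<not> first_sort x \<and> \<not> x < 2" if "x \<in> {3, 4, 5}" for x
          using that unfolding first_sort_def by auto
        have "\<not> first_sort (rs ! i)" "\<not> rs ! i < 2" "\<not> first_sort (rt ! i)" "\<not> first_sort (ru ! i)"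
          using sub ns by blast+
        then show ?thesis unfolding minority_def using sub by (simp only: simp_thms if_True if_False)
      qed
      have "[sum_list (map3 minority rs rt ru) = sum_list rs + 2 * sum_list rt + sum_list ru] (mod 3)"
        by (rule map3_nth_sum_list[OF S(3) T(3) U(3)]) (simp add: m cong_def)
      moreover have "[sum_list rs + 2 * sum_list rt + sum_list ru = 1 + 2 * 1 + 1] (mod 3)"
        by (intro cong_add cong_mult cong_refl) (use S T U in \<open>simp_all add: cong_def\<close>)
      ultimately have "[sum_list (map3 minority rs rt ru) = 1 + 2 * 1 + 1] (mod 3)" by (rule cong_trans)
      then have "sum_list (map3 minority rs rt ru) mod 3 = 1" by (simp add: cong_def)
      moreover have "set (map3 minority rs rt ru) \<subseteq> {3, 4, 5}"
      proof -
        have "3 + k mod 3 \<in> {3, 4, 5}" for k :: nat by (simp, presburger)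
        then show ?thesis unfolding map3_def using m S(3) by auto
      qed
      moreover have "set (map3 minority ls lt lu) \<subseteq> {2}"
        by (rule map3_const) (use S T U in \<open>auto simp: minority_def\<close>)
      moreover have "map3 minority s t u = map3 minority ls lt lu @ map3 minority rs rt ru"
        unfolding S(1) T(1) U(1) by (rule map3_append) (use S T U in auto)
      ultimately show ?thesis using S(2,3) by (simp add: append_in_tmpl_rel map3_def)
    qed
  qed
qed

lemma has_Maltsev_tmpl: "has_Maltsev [12] tmpl"
  unfolding has_Maltsev_def ternary_polymorphism_def
proof (intro exI[of _ minority] conjI ballI allI impI)
  fix R s t u assume R: "R < length [12::nat]" and "s \<in> rels tmpl R" "t \<in> rels tmpl R" "u \<in> rels tmpl R"
  then have *: "s \<in> tmpl_rel" "t \<in> tmpl_rel" "u \<in> tmpl_rel" unfolding tmpl_def by auto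
  then have "length s = 12" using fin_struct_tmpl unfolding fin_struct_def tmpl_def by auto
  then show "map (\<lambda>i. minority (s ! i) (t ! i) (u ! i)) [0..<[12] ! R] \<in> rels tmpl R"
    using minority_tmpl_rel[OF *] R by (simp add: map3_def tmpl_def)
qed (use minority_Maltsev minority_range in \<open>auto simp: tmpl_def\<close>)

section \<open>The hard instance\<close>

lemma sum_list_upt: "sum_list (map f [0..<n]) = (\<Sum>j<n. f j)"
  by (simp add: interv_sum_list_conv_sum_set_nat atLeast0LessThan)

text \<open>\<open>N\<close> and \<open>N + 1\<close> play the constants 0 and 1, and the last entry
  \<open>N + a i\<close> selects the right-hand side \<open>1 - a i\<close>. The extra tuple keeps
  the two constants apart: a common value would give the sum \<open>6 * h N\<close>, which is 0 in
  both groups.\<close>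

definition eq_tuples :: "nat \<Rightarrow> nat \<Rightarrow> (nat \<Rightarrow> nat \<Rightarrow> nat) \<Rightarrow> (nat \<Rightarrow> nat) \<Rightarrow> nat list set" where
  "eq_tuples N m e a = insert [N + 1, N, N, N, N, N] {map (e i) [0..<5] @ [N + a i] | i. i < m}"

text \<open>Given the values of the variables and of the constant \<open>N\<close>, a solvable right-hand side is
  determined, so most of the \<open>2 ^ m\<close> right-hand sides are not solvable.\<close>

lemma unsolvable_rhs:
  assumes p: "p = 2 \<or> p = 3" and card: "p ^ (N + 1) < 2 ^ m" and e: "\<And>i j. i < m \<Longrightarrow> j < 5 \<Longrightarrow> e i j < N"
  shows "\<exists>a. (\<forall>i. a i \<le> (1::nat)) \<and>
    (\<nexists>h :: nat \<Rightarrow> nat. \<forall>l\<in>eq_tuples N m e a. sum_list (map h l) mod p = 1)"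
proof (rule ccontr)
  let ?A = "{..<m} \<rightarrow>\<^sub>E {..<2::nat}" and ?H = "{..<N + 1} \<rightarrow>\<^sub>E {..<p}"
  assume "\<not> ?thesis"
  then have ex: "\<exists>h :: nat \<Rightarrow> nat. \<forall>l\<in>eq_tuples N m e a. sum_list (map h l) mod p = 1"
    if "\<forall>i. a i \<le> (1::nat)" for a using that by blast
  \<comment> \<open>An element of \<open>?A\<close> is \<open>undefined\<close> outside
    \<open>{..<m}\<close>, whereas \<open>ex\<close> asks for values at most 1 everywhere.\<close>
  define tot where "tot a i = (if i < m then a i else 0)" for a :: "nat \<Rightarrow> nat" and i
  have "\<exists>h :: nat \<Rightarrow> nat. \<forall>l\<in>eq_tuples N m e (tot a). sum_list (map h l) mod p = 1" if "a \<in> ?A" for a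
    by (rule ex) (use that in \<open>fastforce simp: tot_def PiE_def Pi_def\<close>)
  then obtain H :: "(nat \<Rightarrow> nat) \<Rightarrow> nat \<Rightarrow> nat"
    where H: "\<And>a l. a \<in> ?A \<Longrightarrow> l \<in> eq_tuples N m e (tot a) \<Longrightarrow> sum_list (map (H a) l) mod p = 1" by metis
  \<comment> \<open>\<open>N + 1\<close> is left out: the extra tuple determines its value from that
    of \<open>N\<close>.\<close>
  define G where "G a = restrict (\<lambda>x. H a x mod p) {..<N + 1}" for a
  have "inj_on G ?A"
  proof (rule inj_onI)
    fix a a' assume a: "a \<in> ?A" and a': "a' \<in> ?A" and eq: "G a = G a'"
    have Heq: "[H a x = H a' x] (mod p)" if "x < N + 1" for x
      using fun_cong[OF eq, of x] that by (simp add: G_def cong_def)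
    have const: "[H c (N + 1) + 5 * H c N = 1] (mod p)" if "c \<in> ?A" for c
    proof -
      have "[N + 1, N, N, N, N, N] \<in> eq_tuples N m e (tot c)" unfolding eq_tuples_def by blast
      from H[OF that this] have "sum_list (map (H c) [N + 1, N, N, N, N, N]) mod p = 1" .
      moreover have "sum_list (map (H c) [N + 1, N, N, N, N, N]) = H c (N + 1) + 5 * H c N" by simp
      ultimately have "(H c (N + 1) + 5 * H c N) mod p = 1" by (simp only:)
      then show ?thesis using p unfolding cong_def by auto
    qed
    have eqn: "[(\<Sum>j<5. H c (e i j)) + H c (N + c i) = 1] (mod p)" if "c \<in> ?A" "i < m" for c i
    proof -
      have "map (e i) [0..<5] @ [N + tot c i] \<in> eq_tuples N m e (tot c)"
        using that unfolding eq_tuples_def by blast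
      from H[OF that(1) this] have "sum_list (map (H c) (map (e i) [0..<5] @ [N + tot c i])) mod p = 1" .
      moreover have "sum_list (map (H c) (map (e i) [0..<5] @ [N + tot c i]))
          = (\<Sum>j<5. H c (e i j)) + H c (N + c i)"
        unfolding map_append sum_list_append map_map sum_list_upt using that(2) by (simp add: tot_def)
      ultimately have "((\<Sum>j<5. H c (e i j)) + H c (N + c i)) mod p = 1" by (simp only:)
      then show ?thesis using p unfolding cong_def by auto
    qed
    have HN1: "[H a (N + 1) = H a' (N + 1)] (mod p)"
    proof -
      have "[5 * H a N = 5 * H a' N] (mod p)" by (intro cong_mult cong_refl Heq) simp
      moreover have "[H a (N + 1) + 5 * H a N = H a' (N + 1) + 5 * H a' N] (mod p)"
        using const[OF a] const[OF a'] cong_sym cong_trans by blast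
      ultimately have "[H a (N + 1) + 5 * H a N = H a' (N + 1) + 5 * H a N] (mod p)"
        by (meson cong_add cong_refl cong_sym cong_trans)
      then show ?thesis by (simp only: cong_add_rcancel_nat)
    qed
    have "a i = a' i" if i: "i < m" for i
    proof -
      have "[(\<Sum>j<5. H a (e i j)) = (\<Sum>j<5. H a' (e i j))] (mod p)"
        by (rule cong_sum) (use Heq e[OF i] in fastforce)
      moreover have "[(\<Sum>j<5. H a (e i j)) + H a (N + a i) = (\<Sum>j<5. H a' (e i j)) + H a' (N + a' i)] (mod p)"
        using eqn[OF a i] eqn[OF a' i] cong_sym cong_trans by blast
      ultimately have "[(\<Sum>j<5. H a (e i j)) + H a (N + a i) = (\<Sum>j<5. H a (e i j)) + H a' (N + a' i)] (mod p)"
        by (meson cong_add cong_refl cong_sym cong_trans)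
      then have c: "[H a (N + a i) = H a' (N + a' i)] (mod p)" by (simp only: cong_add_lcancel_nat)
      have "[H a' (N + a' i) = H a (N + a' i)] (mod p)"
      proof -
        have "a' i \<in> {..<2}" using a' i by blast
        then have "a' i = 0 \<or> a' i = 1" by auto
        then show ?thesis using Heq[of N] HN1 cong_sym by auto
      qed
      with c have c': "[H a (N + a i) = H a (N + a' i)] (mod p)" by (rule cong_trans)
      \<comment> \<open>Since the values of \<open>N\<close> and \<open>N + 1\<close> differ, the
        value of the last entry determines \<open>a i\<close>.\<close>
      have ne: "\<not> [H a N = H a (N + 1)] (mod p)"
      proof
        assume "[H a N = H a (N + 1)] (mod p)"
        then have "[H a N + 5 * H a N = 1] (mod p)"
          using const[OF a] by (meson cong_add cong_refl cong_trans)
        then have "[6 * H a N = 1] (mod p)" by simp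
        then show False using p unfolding cong_def by (elim disjE) (simp; presburger)+
      qed
      have "a i \<in> {..<2}" "a' i \<in> {..<2}" using a a' i by blast+
      then have "(a i = 0 \<or> a i = 1) \<and> (a' i = 0 \<or> a' i = 1)" by auto
      then show ?thesis using c' ne cong_sym by fastforce
    qed
    then show "a = a'" using a a' by (intro PiE_ext[OF a a']) auto
  qed
  moreover have "G ` ?A \<subseteq> ?H"
  proof (rule image_subsetI)
    fix a show "G a \<in> ?H" unfolding G_def restrict_PiE_iff using p by auto
  qed
  moreover have "finite ?H" by (intro finite_PiE) auto
  ultimately have "card ?A \<le> card ?H" by (meson card_inj_on_le)
  then show False using card by (simp add: card_PiE)
qed

section \<open>Normalised and conditioned local distributions\<close>

context local_model
begin

lemma pseudo_dist_D:
  assumes V: "finite V" and Z: "finite Z" "depends_on Z C" and s: "2 * (K + card Z) \<le> s"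
    and c: "c * of_nat (\<mu> Z C) = (1::'n::comm_ring_1)"
  shows "pseudo_dist K U V (\<lambda>X f. c * of_nat (D Z C X f))"
  unfolding pseudo_dist_def
proof (intro allI impI conjI ballI)
  fix X assume X: "X \<subseteq> V \<and> finite X \<and> card X \<le> K"
  then have "2 * (card X + card Z) \<le> 2 * (K + card Z)" by simp
  then have s': "2 * (card X + card Z) \<le> s" using s by (rule order_trans)
  have "(\<Sum>f\<in>X \<rightarrow>\<^sub>E U. D Z C X f) = \<mu> Z C" by (rule D_total) (use X Z s' in auto)
  then show "(\<Sum>f\<in>X \<rightarrow>\<^sub>E U. c * of_nat (D Z C X f)) = 1"
    using c by (simp flip: sum_distrib_left of_nat_sum)
  fix Y g assume Y: "Y \<subseteq> X" and g: "g \<in> Y \<rightarrow>\<^sub>E U"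
  have "(\<Sum>f\<in>{f \<in> X \<rightarrow>\<^sub>E U. restrict f Y = g}. D Z C X f) = D Z C Y g"
    by (rule D_marginal) (use X Y g Z s' in auto)
  then show "(\<Sum>f\<in>{f \<in> X \<rightarrow>\<^sub>E U. restrict f Y = g}. c * of_nat (D Z C X f)) = c * of_nat (D Z C Y g)"
    by (simp flip: sum_distrib_left of_nat_sum)
qed

abbreviation D0 :: "nat set \<Rightarrow> (nat \<Rightarrow> nat) \<Rightarrow> nat" where
  "D0 \<equiv> D {} (\<lambda>_. True)"

lemma depends_on_True: "depends_on X (\<lambda>_. True)"
  unfolding depends_on_def by simp

lemma \<mu>_empty: "\<mu> {} (\<lambda>_. True) = p ^ N"
  by (rule \<mu>_total) simp_all

text \<open>Conditions the uniform measure on \<open>Y\<close> receiving the values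
  \<open>f\<close>. The variables of \<open>Y\<close> then enter the closure of every queried set,
  hence the room for \<open>K + card Y\<close>.\<close>

lemma conditional_pseudo_dist:
  assumes V: "finite V" and Y: "finite Y" and s: "2 * (K + card Y) \<le> s" "card Y \<le> K"
    and nz: "D0 Y f \<noteq> 0"
  shows "\<exists>Q'. pseudo_dist K U V Q' \<and> (\<forall>X g. (0::rat) \<le> Q' X g) \<and> Q' Y f = 1 \<and>
    (\<forall>X g. finite X \<and> card X \<le> K \<and> Q' X g \<noteq> 0 \<longrightarrow> D0 X g \<noteq> 0)"
proof -
  let ?Z = "loc Y" and ?C = "\<lambda>F. True \<and> restrict (ext F) Y = f"
  have dep: "depends_on ?Z ?C" using depends_on_restrict[OF depends_on_True[of "{}"], of Y f] by simp
  have Z: "finite ?Z" "card ?Z \<le> card Y" using loc_finite[OF Y] loc_card[OF Y] by auto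
  then have "2 * (K + card ?Z) \<le> 2 * (K + card Y)" by simp
  then have s': "2 * (K + card ?Z) \<le> s" using s(1) by (rule order_trans)
  have m: "\<mu> ?Z ?C \<noteq> 0" using nz unfolding D_def by simp
  define c where "c = 1 / (of_nat (\<mu> ?Z ?C) :: rat)"
  have c: "c * of_nat (\<mu> ?Z ?C) = 1" unfolding c_def using m by simp
  show ?thesis
  proof (intro exI conjI allI impI)
    show "pseudo_dist K U V (\<lambda>X g. c * of_nat (D ?Z ?C X g))"
      by (rule pseudo_dist_D[OF V Z(1) dep s' c])
    show "0 \<le> c * of_nat (D ?Z ?C X g)" for X g unfolding c_def by simp
    have "D ?Z ?C Y f = \<mu> ?Z ?C" unfolding D_def by (simp add: conj_commute)
    then show "c * of_nat (D ?Z ?C Y f) = 1" using c by simp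
    fix X g assume X: "finite X \<and> card X \<le> K \<and> c * of_nat (D ?Z ?C X g) \<noteq> 0"
    then have "2 * (card X + card ?Z) \<le> 2 * (K + card ?Z)" by simp
    then have "2 * (card X + card ?Z) \<le> s" using s' by (rule order_trans)
    then show "D0 X g \<noteq> 0"
      using D_unconditional_nonzero[of ?Z ?C X g] X Z(1) by auto
  qed
qed

end

section \<open>The hard instance and its local solutions\<close>

definition ext1 :: "nat \<Rightarrow> (nat \<Rightarrow> nat) \<Rightarrow> nat \<Rightarrow> nat" where
  "ext1 N F x = (if x < N then F x else if x = N then 0 else if x = N + 1 then 1
     else if x < 2 * N + 4 then 6 else if x = 2 * N + 4 then 0 else if x = 2 * N + 5 then 1 else 6)"

text \<open>The isolated tuple keeps its first-sort values even here, where the right half is active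
  everywhere else; so the two kinds of local solutions agree on it.\<close>

definition ext2 :: "nat \<Rightarrow> (nat \<Rightarrow> nat) \<Rightarrow> nat \<Rightarrow> nat" where
  "ext2 N F x = (if x < N + 2 then 2 else if x < 2 * N + 2 then 3 + F (x - (N + 2))
     else if x = 2 * N + 2 then 3 else if x = 2 * N + 3 then 4
     else if x = 2 * N + 4 then 0 else if x = 2 * N + 5 then 1 else 6)"

definition loc1 :: "nat \<Rightarrow> nat set \<Rightarrow> nat set" where
  "loc1 N X = {y \<in> X. y < N}"

definition loc2 :: "nat \<Rightarrow> nat set \<Rightarrow> nat set" where
  "loc2 N X = {y. y < N \<and> y + (N + 2) \<in> X}"

text \<open>The right-hand side \<open>1 - a i\<close> of the five-variable equation, with
  \<open>p - 1\<close> for \<open>-1\<close>.\<close>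

definition rhs :: "nat \<Rightarrow> (nat \<Rightarrow> nat) \<Rightarrow> nat \<Rightarrow> nat" where
  "rhs p a i = 1 + (p - 1) * a i"

lemma local_model_ext1:
  assumes "expander N m s e" "0 < s"
  shows "local_model N m s e 2 (ext1 N) (loc1 N) {..<2 * N + 7} {..<7}"
proof -
  interpret expanding_system N m s e 2 "\<lambda>_. 0" by unfold_locales (use assms in auto)
  show ?thesis
  proof unfold_locales
    show "card (loc1 N X) \<le> card X" if "finite X" for X
      using that unfolding loc1_def by (intro card_mono) auto
    show "ext1 N F x = ext1 N F' x" if "x \<in> X" "\<And>y. y \<in> loc1 N X \<Longrightarrow> F y = F' y" for x X and F F' :: "nat \<Rightarrow> nat"
      using that unfolding ext1_def loc1_def by auto
    show "ext1 N F x \<in> {..<7}" if "F \<in> assignments" for F x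
    proof -
      have "F x < 2" if "x < N" using \<open>F \<in> assignments\<close> that unfolding assignments_def by auto
      then show ?thesis unfolding ext1_def by auto
    qed
  qed (auto simp: loc1_def)
qed

lemma local_model_ext2:
  assumes "expander N m s e" "0 < s"
  shows "local_model N m s e 3 (ext2 N) (loc2 N) {..<2 * N + 7} {..<7}"
proof -
  interpret expanding_system N m s e 3 "\<lambda>_. 0" by unfold_locales (use assms in auto)
  show ?thesis
  proof unfold_locales
    show "finite (loc2 N X)" for X
      by (rule finite_subset[of _ "{..<N}"]) (auto simp: loc2_def)
    show "card (loc2 N X) \<le> card X" if "finite X" for X
      by (rule card_inj_on_le[of "\<lambda>y. y + (N + 2)"]) (use that in \<open>auto simp: loc2_def inj_on_def\<close>)
    show "ext2 N F x = ext2 N F' x" if "x \<in> X" "\<And>y. y \<in> loc2 N X \<Longrightarrow> F y = F' y" for x X and F F' :: "nat \<Rightarrow> nat"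
    proof -
      have "F (x - (N + 2)) = F' (x - (N + 2))" if "\<not> x < N + 2" "x < 2 * N + 2"
      proof -
        have "x - (N + 2) + (N + 2) = x" "x - (N + 2) < N" using that by auto
        then have "x - (N + 2) \<in> loc2 N X"
          unfolding loc2_def mem_Collect_eq using \<open>x \<in> X\<close> by (simp only: simp_thms)
        then show ?thesis using \<open>\<And>y. y \<in> loc2 N X \<Longrightarrow> F y = F' y\<close> by blast
      qed
      then show ?thesis unfolding ext2_def by simp
    qed
    show "ext2 N F x \<in> {..<7}" if "F \<in> assignments" for F x
    proof -
      have "F (x - (N + 2)) < 3" if "\<not> x < N + 2" "x < 2 * N + 2"
      proof -
        have "x - (N + 2) \<in> {..<N}" using that by auto
        then show ?thesis using \<open>F \<in> assignments\<close> unfolding assignments_def by blast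
      qed
      then show ?thesis unfolding ext2_def by auto
    qed
  qed (auto simp: loc2_def)
qed

definition pad_tuple :: "nat \<Rightarrow> nat list" where
  "pad_tuple N = [2 * N + 5, 2 * N + 4, 2 * N + 4, 2 * N + 4, 2 * N + 4, 2 * N + 4] @ replicate 6 (2 * N + 6)"

text \<open>The left elements are \<open>{..<N + 2}\<close>, the right ones \<open>{N + 2..<2 * N + 4}\<close>.  The tuple
  \<open>pad_tuple\<close> is isolated from the others and allows CLAP to fix an assignment of one tuple without
  fixing the sort of the others.\<close>

definition hard_instance :: "nat \<Rightarrow> (nat \<Rightarrow> nat \<Rightarrow> nat) \<Rightarrow> (nat \<Rightarrow> nat) \<Rightarrow> (nat \<Rightarrow> nat) \<Rightarrow> nat rel_struct" where
  "hard_instance N e a1 a2 = \<lparr>univ = {..<2 * N + 7}, rels = (\<lambda>_. insert (pad_tuple N)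
     {l @ map (\<lambda>x. x + (N + 2)) r | l r. l \<in> eq_tuples N (2 * N) e a1 \<and> r \<in> eq_tuples N (2 * N) e a2})\<rparr>"

lemma eq_tuples_length: "l \<in> eq_tuples N m e a \<Longrightarrow> length l = 6"
  unfolding eq_tuples_def by auto

lemma eq_tuples_range:
  assumes "l \<in> eq_tuples N m e a" "\<And>i. a i \<le> 1" "\<And>i j. i < m \<Longrightarrow> j < 5 \<Longrightarrow> e i j < N"
  shows "set l \<subseteq> {..<N + 2}"
  using assms(1) unfolding eq_tuples_def
proof (elim insertE CollectE exE conjE)
  fix i assume i: "i < m" and l: "l = map (e i) [0..<5] @ [N + a i]"
  have "e i j < N + 2" if "j < 5" for j using assms(3)[OF i that] by simp
  moreover have "N + a i < N + 2" using assms(2)[of i] by simp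
  ultimately show ?thesis unfolding l by auto
qed auto

text \<open>If a left equation fails modulo 2, every tuple that contains it must have its right half
  active. It is paired with every right equation, so the whole right system would be solved modulo
  3.\<close>

lemma hard_instance_unsat:
  assumes 1: "\<nexists>h :: nat \<Rightarrow> nat. \<forall>l\<in>eq_tuples N (2 * N) e a1. sum_list (map h l) mod 2 = 1"
    and 2: "\<nexists>h :: nat \<Rightarrow> nat. \<forall>l\<in>eq_tuples N (2 * N) e a2. sum_list (map h l) mod 3 = 1"
  shows "hard_instance N e a1 a2 \<notin> CSP [12] tmpl"
proof
  let ?L = "eq_tuples N (2 * N) e a1" and ?R = "eq_tuples N (2 * N) e a2"
  let ?sh = "map (\<lambda>x. x + (N + 2))"
  assume "hard_instance N e a1 a2 \<in> CSP [12] tmpl"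
  then obtain h where "h \<in> homs [12] (hard_instance N e a1 a2) tmpl" unfolding CSP_def by blast
  then have hom: "map h t \<in> tmpl_rel" if "t \<in> rels (hard_instance N e a1 a2) 0" for t
    using that unfolding homs_def tmpl_def by auto
  have "l @ ?sh r \<in> rels (hard_instance N e a1 a2) 0" if "l \<in> ?L" "r \<in> ?R" for l r
    using that unfolding hard_instance_def rel_struct.simps by blast
  then have "map h (l @ ?sh r) \<in> tmpl_rel" if "l \<in> ?L" "r \<in> ?R" for l r
    using that hom by blast
  then have h: "sum_list (map h l) mod 2 = 1 \<or> sum_list (map h (?sh r)) mod 3 = 1 \<and> set (map h l) \<subseteq> {2}"
    if "l \<in> ?L" "r \<in> ?R" for l r
    using that append_in_tmpl_rel[of "map h l" "map h (?sh r)"] eq_tuples_length[OF that(1)] eq_tuples_length[OF that(2)]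
    by (simp only: map_append length_map) blast
  obtain l where l: "l \<in> ?L" "sum_list (map h l) mod 2 \<noteq> 1" using 1 by blast
  have "sum_list (map (\<lambda>x. h (x + (N + 2))) r) mod 3 = 1" if "r \<in> ?R" for r
    using h[OF l(1) that] l(2) by (simp add: comp_def)
  then show False using 2 by blast
qed

lemma pad_value: "[1, 0, 0, 0, 0, 0] @ replicate 6 6 \<in> tmpl_rel"
  by (subst append_in_tmpl_rel) simp_all

text \<open>Hypothesis \<open>sol\<close> asks only for equations whose variables are all entries of
  \<open>b\<close>; these are the ones that \<open>mem_cl\<close> puts into the closure.\<close>

lemma ext1_tuple:
  assumes e: "\<And>i j. i < 2 * N \<Longrightarrow> j < 5 \<Longrightarrow> e i j < N" and a1: "\<And>i. a1 i \<le> 1" and a2: "\<And>i. a2 i \<le> 1"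
    and F: "\<And>y. y < N \<Longrightarrow> F y < 2"
    and sol: "\<And>i. i < 2 * N \<Longrightarrow> (\<And>j. j < 5 \<Longrightarrow> e i j \<in> set b) \<Longrightarrow> [(\<Sum>j<5. F (e i j)) = rhs 2 a1 i] (mod 2)"
    and b: "b \<in> rels (hard_instance N e a1 a2) 0"
  shows "map (ext1 N F) b \<in> tmpl_rel"
proof (cases "b = pad_tuple N")
  case True
  have "map (ext1 N F) b = [1, 0, 0, 0, 0, 0] @ replicate 6 6"
    unfolding True pad_tuple_def by (simp add: ext1_def)
  then show ?thesis using pad_value by (simp only:)
next
  case False
  then obtain l r where lr: "b = l @ map (\<lambda>x. x + (N + 2)) r"
    "l \<in> eq_tuples N (2 * N) e a1" "r \<in> eq_tuples N (2 * N) e a2"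
    using b unfolding hard_instance_def by auto
  have "set r \<subseteq> {..<N + 2}" by (rule eq_tuples_range[OF lr(3)]) (use a2 e in auto)
  then have "ext1 N F (x + (N + 2)) = 6" if "x \<in> set r" for x
    using that by (auto simp: ext1_def)
  then have R: "set (map (ext1 N F) (map (\<lambda>x. x + (N + 2)) r)) \<subseteq> {6}" by auto
  have L: "set (map (ext1 N F) l) \<subseteq> {0, 1} \<and> sum_list (map (ext1 N F) l) mod 2 = 1"
    using lr(2) unfolding eq_tuples_def
  proof (elim insertE CollectE exE conjE)
    fix i assume i: "i < 2 * N" and l: "l = map (e i) [0..<5] @ [N + a1 i]"
    have ai: "ext1 N F (N + a1 i) = a1 i" using a1[of i] by (auto simp: ext1_def le_Suc_eq)
    have eF: "ext1 N F (e i j) = F (e i j)" if "j < 5" for j using e[OF i that] by (simp add: ext1_def)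
    have "sum_list (map (ext1 N F) l) = (\<Sum>j<5. F (e i j)) + a1 i"
      unfolding l map_append sum_list_append map_map sum_list_upt using eF ai by simp
    moreover have "[(\<Sum>j<5. F (e i j)) + a1 i = rhs 2 a1 i + a1 i] (mod 2)"
      by (intro cong_add cong_refl sol[OF i]) (auto simp: lr(1) l)
    moreover have "(rhs 2 a1 i + a1 i) mod 2 = 1" unfolding rhs_def by presburger
    ultimately have "sum_list (map (ext1 N F) l) mod 2 = 1" by (simp add: cong_def)
    moreover have "ext1 N F x \<in> {0, 1}" if x: "x \<in> set l" for x
    proof -
      from x consider j where "j < 5" "x = e i j" | "x = N + a1 i" unfolding l by auto
      then show ?thesis
      proof cases
        case (1 j)
        then show ?thesis using eF[of j] F[OF e[OF i 1(1)]] by auto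
      next
        case 2
        then show ?thesis using ai a1[of i] by auto
      qed
    qed
    then have "set (map (ext1 N F) l) \<subseteq> {0, 1}" unfolding set_map by (rule image_subsetI)
    ultimately show ?thesis by blast
  qed (simp add: ext1_def)
  show ?thesis
    unfolding lr(1) map_append
    by (subst append_in_tmpl_rel) (use L R eq_tuples_length[OF lr(2)] eq_tuples_length[OF lr(3)] in auto)
qed

lemma ext2_tuple:
  assumes e: "\<And>i j. i < 2 * N \<Longrightarrow> j < 5 \<Longrightarrow> e i j < N" and a1: "\<And>i. a1 i \<le> 1" and a2: "\<And>i. a2 i \<le> 1"
    and F: "\<And>y. y < N \<Longrightarrow> F y < 3"
    and sol: "\<And>i. i < 2 * N \<Longrightarrow> (\<And>j. j < 5 \<Longrightarrow> e i j + (N + 2) \<in> set b) \<Longrightarrow>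
      [(\<Sum>j<5. F (e i j)) = rhs 3 a2 i] (mod 3)"
    and b: "b \<in> rels (hard_instance N e a1 a2) 0"
  shows "map (ext2 N F) b \<in> tmpl_rel"
proof (cases "b = pad_tuple N")
  case True
  have "map (ext2 N F) b = [1, 0, 0, 0, 0, 0] @ replicate 6 6"
    unfolding True pad_tuple_def by (simp add: ext2_def)
  then show ?thesis using pad_value by (simp only:)
next
  case False
  let ?sh = "map (\<lambda>x. x + (N + 2))"
  obtain l r where lr: "b = l @ ?sh r"
    "l \<in> eq_tuples N (2 * N) e a1" "r \<in> eq_tuples N (2 * N) e a2"
    using b False unfolding hard_instance_def by auto
  have "set l \<subseteq> {..<N + 2}" by (rule eq_tuples_range[OF lr(2)]) (use a1 e in auto)
  then have "ext2 N F x = 2" if "x \<in> set l" for x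
    using that by (auto simp: ext2_def)
  then have L: "set (map (ext2 N F) l) \<subseteq> {2}" by auto
  have R: "set (map (ext2 N F) (?sh r)) \<subseteq> {3, 4, 5} \<and> sum_list (map (ext2 N F) (?sh r)) mod 3 = 1"
    using lr(3) unfolding eq_tuples_def
  proof (elim insertE CollectE exE conjE)
    fix i assume i: "i < 2 * N" and r: "r = map (e i) [0..<5] @ [N + a2 i]"
    have ai: "ext2 N F (N + a2 i + (N + 2)) = 3 + a2 i" using a2[of i] by (auto simp: ext2_def le_Suc_eq)
    have eF: "ext2 N F (e i j + (N + 2)) = 3 + F (e i j)" if "j < 5" for j
      using e[OF i that] by (simp add: ext2_def)
    have "sum_list (map (ext2 N F) (?sh r)) = (\<Sum>j<5. 3 + F (e i j)) + (3 + a2 i)"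
      unfolding r map_append sum_list_append map_map sum_list_upt using eF ai by simp
    also have "\<dots> = 3 * 6 + ((\<Sum>j<5. F (e i j)) + a2 i)" by (simp only: sum.distrib) simp
    finally have "sum_list (map (ext2 N F) (?sh r)) mod 3 = ((\<Sum>j<5. F (e i j)) + a2 i) mod 3"
      by (simp only: mod_mult_self4)
    moreover have "[(\<Sum>j<5. F (e i j)) + a2 i = rhs 3 a2 i + a2 i] (mod 3)"
      by (intro cong_add cong_refl sol[OF i]) (auto simp: lr(1) r)
    moreover have "(rhs 3 a2 i + a2 i) mod 3 = 1" unfolding rhs_def by presburger
    ultimately have "sum_list (map (ext2 N F) (?sh r)) mod 3 = 1" by (simp add: cong_def)
    moreover have "ext2 N F (x + (N + 2)) \<in> {3, 4, 5}" if x: "x \<in> set r" for x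
    proof -
      from x consider j where "j < 5" "x = e i j" | "x = N + a2 i" unfolding r by auto
      then show ?thesis
      proof cases
        case (1 j)
        then show ?thesis using eF[of j] F[OF e[OF i 1(1)]] by auto
      next
        case 2
        then show ?thesis using ai a2[of i] by auto
      qed
    qed
    then have "set (map (ext2 N F) (?sh r)) \<subseteq> {3, 4, 5}"
      unfolding set_map image_image by (rule image_subsetI)
    ultimately show ?thesis by blast
  qed (simp add: ext2_def)
  show ?thesis
    unfolding lr(1) map_append
    by (subst append_in_tmpl_rel) (use L R eq_tuples_length[OF lr(2)] eq_tuples_length[OF lr(3)] in auto)
qed

lemma fin_struct_hard_instance:
  assumes e: "\<And>i j. i < 2 * N \<Longrightarrow> j < 5 \<Longrightarrow> e i j < N" and a1: "\<And>i. a1 i \<le> 1" and a2: "\<And>i. a2 i \<le> 1"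
  shows "fin_struct [12] (hard_instance N e a1 a2)"
proof -
  have "length t = 12 \<and> set t \<subseteq> {..<2 * N + 7}" if t: "t \<in> rels (hard_instance N e a1 a2) 0" for t
  proof (cases "t = pad_tuple N")
    case False
    obtain l r where lr: "t = l @ map (\<lambda>x. x + (N + 2)) r"
      "l \<in> eq_tuples N (2 * N) e a1" "r \<in> eq_tuples N (2 * N) e a2"
      using t False unfolding hard_instance_def rel_struct.simps by blast
    have "set l \<subseteq> {..<N + 2}" by (rule eq_tuples_range[OF lr(2)]) (use a1 e in auto)
    have "set r \<subseteq> {..<N + 2}" by (rule eq_tuples_range[OF lr(3)]) (use a2 e in auto)
    have "x < 2 * N + 7" if "x \<in> set t" for x
    proof -
      from that consider "x \<in> set l" | y where "y \<in> set r" "x = y + (N + 2)" unfolding lr(1) by auto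
      then show ?thesis
      proof cases
        case 1
        then have "x \<in> {..<N + 2}" using \<open>set l \<subseteq> {..<N + 2}\<close> by blast
        then show ?thesis by simp
      next
        case (2 y)
        then have "y \<in> {..<N + 2}" using \<open>set r \<subseteq> {..<N + 2}\<close> by blast
        then show ?thesis using 2(2) by simp
      qed
    qed
    then have "set t \<subseteq> {..<2 * N + 7}" by auto
    moreover have "length t = 12"
      using eq_tuples_length[OF lr(2)] eq_tuples_length[OF lr(3)] lr(1) by simp
    ultimately show ?thesis by simp
  qed (auto simp: pad_tuple_def)
  then show ?thesis unfolding fin_struct_def by (simp add: hard_instance_def)
qed

section \<open>Acceptance of the hard instance\<close>

lemma pseudo_dist_combine:
  assumes tot: "\<And>X. X \<subseteq> V \<Longrightarrow> finite X \<Longrightarrow> card X \<le> K \<Longrightarrow> (\<Sum>f\<in>X \<rightarrow>\<^sub>E U. D1 X f) = t1 \<and> (\<Sum>f\<in>X \<rightarrow>\<^sub>E U. D2 X f) = t2"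
    and marg: "\<And>X Y g. X \<subseteq> V \<Longrightarrow> finite X \<Longrightarrow> card X \<le> K \<Longrightarrow> Y \<subseteq> X \<Longrightarrow> g \<in> Y \<rightarrow>\<^sub>E U \<Longrightarrow>
      (\<Sum>f\<in>{f \<in> X \<rightarrow>\<^sub>E U. restrict f Y = g}. D1 X f) = D1 Y g \<and>
      (\<Sum>f\<in>{f \<in> X \<rightarrow>\<^sub>E U. restrict f Y = g}. D2 X f) = D2 Y g"
    and ab: "a * of_nat t1 + b * of_nat t2 = (1::'n::comm_ring_1)"
  shows "pseudo_dist K U V (\<lambda>X f. a * of_nat (D1 X f) + b * of_nat (D2 X f))"
  unfolding pseudo_dist_def
proof (intro allI impI conjI ballI)
  have lin: "(\<Sum>f\<in>S. a * of_nat (D1 X f) + b * of_nat (D2 X f))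
      = a * of_nat (\<Sum>f\<in>S. D1 X f) + b * of_nat (\<Sum>f\<in>S. D2 X f)" for S X
    by (simp add: sum.distrib sum_distrib_left)
  fix X assume X: "X \<subseteq> V \<and> finite X \<and> card X \<le> K"
  show "(\<Sum>f\<in>X \<rightarrow>\<^sub>E U. a * of_nat (D1 X f) + b * of_nat (D2 X f)) = 1"
    unfolding lin using tot[of X] X ab by simp
  fix Y g assume "Y \<subseteq> X" "g \<in> Y \<rightarrow>\<^sub>E U"
  then show "(\<Sum>f\<in>{f \<in> X \<rightarrow>\<^sub>E U. restrict f Y = g}. a * of_nat (D1 X f) + b * of_nat (D2 X f))
      = a * of_nat (D1 Y g) + b * of_nat (D2 Y g)"
    unfolding lin using marg[of X Y g] X by simp
qed

lemma lift_sol_determined: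
  assumes P: "pseudo_dist K U V P" and b: "set b \<subseteq> V" "card (set b) \<le> K" and fin: "finite U"
    and f: "f \<in> set b \<rightarrow>\<^sub>E U" and only: "\<And>g. g \<in> set b \<rightarrow>\<^sub>E U \<Longrightarrow> g \<noteq> f \<Longrightarrow> P (set b) g = 0"
  shows "lift_sol P (Mu R b (map f b)) = 1"
proof -
  have "finite (set b \<rightarrow>\<^sub>E U)" by (intro finite_PiE) (use fin in auto)
  then have "(\<Sum>g\<in>set b \<rightarrow>\<^sub>E U. P (set b) g) = (\<Sum>g\<in>{f}. P (set b) g)"
    by (intro sum.mono_neutral_right) (use f only in auto)
  then show ?thesis using pseudo_dist_sum[OF P b(1) _ b(2)] lift_sol_Mu_map[OF f, of P R] by simp
qed

text \<open>In \<open>2 * (K + 12) \<le> s\<close>, \<open>K\<close> accounts for the queried set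
  and 12 for the tuple on which CLAP conditions; \<open>12 \<le> K\<close> makes every tuple itself
  a queried set.\<close>

lemma hard_instance_accepted:
  assumes ex: "expander N (2 * N) s e" and a1: "\<And>i. a1 i \<le> 1" and a2: "\<And>i. a2 i \<le> 1"
    and K: "12 \<le> K" "2 * (K + 12) \<le> s" and k: "k \<le> K"
  defines "B \<equiv> hard_instance N e a1 a2"
  shows "Z_affine_accepts [12] k tmpl B" "BA_accepts [12] k {} tmpl B" "CLAP [12] tmpl B"
proof -
  have s: "0 < s" using K by simp
  have e: "e i j < N" if "i < 2 * N" "j < 5" for i j using ex that unfolding expander_def by blast
  define V where "V = {..<2 * N + 7}"
  have uB: "univ B = V" unfolding B_def hard_instance_def V_def by simp
  have uA: "univ tmpl = {..<7}" and rA: "rels tmpl R = tmpl_rel" for R unfolding tmpl_def by simp_all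
  interpret L: local_model N "2 * N" s e 2 "rhs 2 a1" "ext1 N" "loc1 N" V "{..<7}"
    unfolding V_def by (rule local_model_ext1[OF ex s])
  interpret R: local_model N "2 * N" s e 3 "rhs 3 a2" "ext2 N" "loc2 N" V "{..<7}"
    unfolding V_def by (rule local_model_ext2[OF ex s])
  have A: "fin_struct [12] tmpl" by (rule fin_struct_tmpl)
  have B: "fin_struct [12] B" unfolding B_def by (rule fin_struct_hard_instance[OF e a1 a2])
  have ar: "\<forall>R<length [12]. [12] ! R \<le> K" using K by simp
  have finV: "finite V" unfolding V_def by simp
  have small: "2 * (card X + card ({}::nat set)) \<le> s" if "card X \<le> K" for X :: "nat set"
    using that K by simp
  have tot: "(\<Sum>f\<in>X \<rightarrow>\<^sub>E {..<7}. L.D0 X f) = 2 ^ N \<and> (\<Sum>f\<in>X \<rightarrow>\<^sub>E {..<7}. R.D0 X f) = 3 ^ N"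
    if "X \<subseteq> V" "finite X" "card X \<le> K" for X
    using L.D_total[OF that(1,2) _ L.depends_on_True small[OF that(3)]] L.\<mu>_empty
      R.D_total[OF that(1,2) _ R.depends_on_True small[OF that(3)]] R.\<mu>_empty by simp
  have marg: "(\<Sum>f\<in>{f \<in> X \<rightarrow>\<^sub>E {..<7}. restrict f Y = g}. L.D0 X f) = L.D0 Y g \<and>
      (\<Sum>f\<in>{f \<in> X \<rightarrow>\<^sub>E {..<7}. restrict f Y = g}. R.D0 X f) = R.D0 Y g"
    if "X \<subseteq> V" "finite X" "card X \<le> K" "Y \<subseteq> X" "g \<in> Y \<rightarrow>\<^sub>E {..<7}" for X Y g
    using L.D_marginal[OF that(1,2,4) _ L.depends_on_True small[OF that(3)] that(5)]
      R.D_marginal[OF that(1,2,4) _ R.depends_on_True small[OF that(3)] that(5)] by simp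
  \<comment> \<open>The even mixture of the two normalised measures: its support is the union of
    both, so the signed Bezout combination \<open>P\<close> vanishes wherever \<open>Q\<close>
    does.\<close>
  define Q where "Q X f = 1 / (2 * 2 ^ N) * of_nat (L.D0 X f) + 1 / (2 * 3 ^ N) * (of_nat (R.D0 X f) :: rat)" for X f
  have "coprime (2 ^ N) (3 ^ N :: int)" by simp
  then obtain \<alpha> \<beta> where \<alpha>\<beta>: "\<alpha> * 2 ^ N + \<beta> * 3 ^ N = (1 :: int)"
    using bezout_int[of "2 ^ N" "3 ^ N"] by auto
  define P where "P X f = \<alpha> * of_nat (L.D0 X f) + \<beta> * (of_nat (R.D0 X f) :: int)" for X f
  have P: "pseudo_dist K (univ tmpl) (univ B) P"
    unfolding P_def uA uB by (rule pseudo_dist_combine[OF tot marg]) (use \<alpha>\<beta> in simp_all)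
  have Q: "pseudo_dist K (univ tmpl) (univ B) Q"
    unfolding Q_def uA uB by (rule pseudo_dist_combine[OF tot marg]) simp_all
  have nn: "0 \<le> Q X f" for X f unfolding Q_def by simp
  have Qnz: "Q X f \<noteq> 0 \<longleftrightarrow> L.D0 X f \<noteq> 0 \<or> R.D0 X f \<noteq> 0" for X f
  proof -
    have "Q X f = 0 \<longleftrightarrow> 1 / (2 * 2 ^ N) * (of_nat (L.D0 X f) :: rat) = 0 \<and> 1 / (2 * 3 ^ N) * (of_nat (R.D0 X f) :: rat) = 0"
      unfolding Q_def by (rule add_nonneg_eq_0_iff) simp_all
    then show ?thesis by simp
  qed
  have ac: "abs_cont K (univ tmpl) (univ B) P Q"
    unfolding abs_cont_def P_def using Qnz by fastforce
  have L_sol: "map f b \<in> tmpl_rel" if "b \<in> rels B 0" "L.D0 (set b) f \<noteq> 0" for f b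
  proof -
    from that(2) obtain F where F: "F \<in> L.Sol (L.cl (loc1 N (set b) \<union> {}))" "restrict (ext1 N F) (set b) = f"
      by (rule L.D_nonzero)
    have "map (ext1 N F) b \<in> tmpl_rel"
    proof (rule ext1_tuple[OF e a1 a2])
      show "F y < 2" if "y < N" for y
        using F(1) that unfolding L.Sol_def L.assignments_def by auto
      show "[(\<Sum>j<5. F (e i j)) = rhs 2 a1 i] (mod 2)"
        if "i < 2 * N" "\<And>j. j < 5 \<Longrightarrow> e i j \<in> set b" for i
      proof -
        have "i \<in> L.cl (loc1 N (set b) \<union> {})"
          by (rule L.mem_cl[OF that(1)]) (use that e in \<open>simp add: loc1_def\<close>)
        then show ?thesis using F(1) unfolding L.Sol_def by blast
      qed
    qed (use that(1) in \<open>simp_all add: B_def\<close>)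
    moreover have "map (ext1 N F) b = map f b" using F(2) by auto
    ultimately show ?thesis by simp
  qed
  have R_sol: "map f b \<in> tmpl_rel" if "b \<in> rels B 0" "R.D0 (set b) f \<noteq> 0" for f b
  proof -
    from that(2) obtain F where F: "F \<in> R.Sol (R.cl (loc2 N (set b) \<union> {}))" "restrict (ext2 N F) (set b) = f"
      by (rule R.D_nonzero)
    have "map (ext2 N F) b \<in> tmpl_rel"
    proof (rule ext2_tuple[OF e a1 a2])
      show "F y < 3" if "y < N" for y
        using F(1) that unfolding R.Sol_def R.assignments_def by auto
      show "[(\<Sum>j<5. F (e i j)) = rhs 3 a2 i] (mod 3)"
        if "i < 2 * N" "\<And>j. j < 5 \<Longrightarrow> e i j + (N + 2) \<in> set b" for i
      proof -
        have "i \<in> R.cl (loc2 N (set b) \<union> {})"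
          by (rule R.mem_cl[OF that(1)]) (use that e in \<open>simp add: loc2_def\<close>)
        then show ?thesis using F(1) unfolding R.Sol_def by blast
      qed
    qed (use that(1) in \<open>simp_all add: B_def\<close>)
    moreover have "map (ext2 N F) b = map f b" using F(2) by auto
    ultimately show ?thesis by simp
  qed
  have resp: "hom_supported [12] tmpl B Q"
    unfolding hom_supported_def rA using Qnz L_sol R_sol by simp
  show "Z_affine_accepts [12] k tmpl B" by (rule Z_affine_acceptsI[OF A B Q nn resp P ac k])
  show "BA_accepts [12] k {} tmpl B"
    by (rule BA_accepts_pseudo_dist[OF A B Q nn resp P ac k ar]) (simp_all add: satisfies_def)
  \<comment> \<open>All local solutions of both kinds induce the single map \<open>f0\<close> on the
    isolated tuple, so \<open>Q\<close> and \<open>P\<close> put their whole mass 1 there and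
    already satisfy the constraint that fixes its value.\<close>
  let ?t = "pad_tuple N"
  define f0 where "f0 = restrict (ext1 N (\<lambda>_. 0)) (set ?t)"
  have tB: "?t \<in> rels B 0" unfolding B_def hard_instance_def by simp
  have pad1: "restrict (ext1 N F) (set ?t) = f0" for F
    unfolding f0_def by (rule restrict_ext) (auto simp: pad_tuple_def ext1_def)
  have pad2: "restrict (ext2 N F) (set ?t) = f0" for F
    unfolding f0_def by (rule restrict_ext) (auto simp: pad_tuple_def ext1_def ext2_def)
  have f0: "f0 \<in> set ?t \<rightarrow>\<^sub>E univ tmpl"
    unfolding f0_def uA by (auto simp: ext1_def)
  have "map f0 ?t = [1, 0, 0, 0, 0, 0] @ replicate 6 6"
    unfolding f0_def by (simp add: pad_tuple_def ext1_def)
  then have a0: "map f0 ?t \<in> rels tmpl 0" unfolding rA using pad_value by (simp only:)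
  have only: "L.D0 (set ?t) g = 0 \<and> R.D0 (set ?t) g = 0" if "g \<noteq> f0" for g
    using L.D_nonzero[of "{}" "\<lambda>_. True" "set ?t" g] R.D_nonzero[of "{}" "\<lambda>_. True" "set ?t" g] that pad1 pad2
    by metis
  have Rl: "0 < length [12::nat]" by simp
  note t = set_tuple[OF B Rl tB ar]
  have finA: "finite (univ tmpl)" unfolding uA by simp
  show "CLAP [12] tmpl B"
  proof (rule CLAP_acceptsI[OF A B Q nn resp P ac _ ar _ Rl tB a0])
    show "1 \<le> K" using K by simp
    show "lift_sol Q (Mu 0 ?t (map f0 ?t)) = 1"
      by (rule lift_sol_determined[OF Q t(1,3) finA f0]) (use only in \<open>simp add: Q_def\<close>)
    show "lift_sol P (Mu 0 ?t (map f0 ?t)) = 1"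
      by (rule lift_sol_determined[OF P t(1,3) finA f0]) (use only in \<open>simp add: P_def\<close>)
    fix R b a assume R: "R < length [12::nat]" and b: "b \<in> rels B R" and a: "a \<in> rels tmpl R"
      and nz: "lift_sol Q (Mu R b a) \<noteq> 0"
    note b' = set_tuple[OF B R b ar]
    define f where "f = tuple_map b a"
    have wd: "map f b = a" and Qf: "Q (set b) f \<noteq> 0"
      using nz unfolding lift_sol_def f_def by (simp_all split: if_splits)
    have "length b = length a" "set a \<subseteq> univ tmpl" using A R a b'(4) unfolding fin_struct_def by auto
    then have f: "f \<in> set b \<rightarrow>\<^sub>E univ tmpl" unfolding f_def by (rule tuple_map_PiE)
    have "length b = 12" using b'(4) R by simp
    then have "card (set b) \<le> 12" using card_length[of b] by simp
    then have sb: "2 * (K + card (set b)) \<le> s" using K(2) by simp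
    have fs: "f \<in> set b \<rightarrow>\<^sub>E {..<7}" using f unfolding uA .
    have lift: "lift_sol Q' (Mu R b a) = 1" if "Q' (set b) f = 1" for Q' :: "nat set \<Rightarrow> (nat \<Rightarrow> nat) \<Rightarrow> rat"
      using lift_sol_Mu_map[OF f, of Q' R] wd that by simp
    from Qf consider "L.D0 (set b) f \<noteq> 0" | "R.D0 (set b) f \<noteq> 0" using Qnz by blast
    then show "\<exists>Q'. pseudo_dist K (univ tmpl) (univ B) Q' \<and> (\<forall>X f. 0 \<le> Q' X f) \<and>
        abs_cont K (univ tmpl) (univ B) Q' Q \<and> lift_sol Q' (Mu R b a) = (1::rat)"
    proof cases
      case 1
      obtain Q' where Q': "pseudo_dist K {..<7} V Q'" "\<forall>X g. (0::rat) \<le> Q' X g" "Q' (set b) f = 1"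
        "\<forall>X g. finite X \<and> card X \<le> K \<and> Q' X g \<noteq> 0 \<longrightarrow> L.D0 X g \<noteq> 0"
        using L.conditional_pseudo_dist[OF finV b'(2) sb b'(3) 1] by blast
      have "Q' X g = 0" if "finite X" "card X \<le> K" "Q X g = 0" for X g
        using Q'(4) that Qnz[of X g] by blast
      then have "abs_cont K {..<7} V Q' Q" unfolding abs_cont_def by blast
      then show ?thesis unfolding uA uB using lift[of Q', OF Q'(3)] Q'(1,2) by blast
    next
      case 2
      obtain Q' where Q': "pseudo_dist K {..<7} V Q'" "\<forall>X g. (0::rat) \<le> Q' X g" "Q' (set b) f = 1"
        "\<forall>X g. finite X \<and> card X \<le> K \<and> Q' X g \<noteq> 0 \<longrightarrow> R.D0 X g \<noteq> 0"
        using R.conditional_pseudo_dist[OF finV b'(2) sb b'(3) 2] by blast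
      have "Q' X g = 0" if "finite X" "card X \<le> K" "Q X g = 0" for X g
        using Q'(4) that Qnz[of X g] by blast
      then have "abs_cont K {..<7} V Q' Q" unfolding abs_cont_def by blast
      then show ?thesis unfolding uA uB using lift[of Q', OF Q'(3)] Q'(1,2) by blast
    qed
  qed
qed

lemma hard_instance_exists:
  assumes N: "5832 \<le> N" and K: "2 * (max k 12 + 12) \<le> N div 5832"
  shows "\<exists>B :: nat rel_struct. fin_struct [12] B \<and> card (univ B) = 2 * N + 7 \<and> B \<notin> CSP [12] tmpl \<and>
    Z_affine_accepts [12] k tmpl B \<and> BA_accepts [12] k {} tmpl B \<and> CLAP [12] tmpl B"
proof -
  obtain e where ex: "expander N (2 * N) (N div 5832) e"
    using expander_exists[of N "N div 5832"] N by auto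
  have e: "e i j < N" if "i < 2 * N" "j < 5" for i j using ex that unfolding expander_def by blast
  \<comment> \<open>Two equations per variable give \<open>4 ^ N\<close> right-hand sides, enough to
    beat base 3.\<close>
  have big: "3 ^ (N + 1) < (2::nat) ^ (2 * N)"
  proof -
    have "3 ^ (n + 1) < (4::nat) ^ n" if "4 \<le> n" for n using that by (induction n rule: dec_induct) auto
    then show ?thesis using N by (simp add: power_mult)
  qed
  have "(2::nat) ^ (N + 1) \<le> 3 ^ (N + 1)" by (rule power_mono) simp_all
  then have big2: "2 ^ (N + 1) < (2::nat) ^ (2 * N)" using big by linarith
  obtain a1 where a1: "\<forall>i. a1 i \<le> (1::nat)"
    "\<nexists>h :: nat \<Rightarrow> nat. \<forall>l\<in>eq_tuples N (2 * N) e a1. sum_list (map h l) mod 2 = 1"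
    using unsolvable_rhs[OF _ big2, of e] e by blast
  obtain a2 where a2: "\<forall>i. a2 i \<le> (1::nat)"
    "\<nexists>h :: nat \<Rightarrow> nat. \<forall>l\<in>eq_tuples N (2 * N) e a2. sum_list (map h l) mod 3 = 1"
    using unsolvable_rhs[OF _ big, of e] e by blast
  let ?B = "hard_instance N e a1 a2"
  have "fin_struct [12] ?B" by (rule fin_struct_hard_instance) (use e a1 a2 in auto)
  moreover have "card (univ ?B) = 2 * N + 7" unfolding hard_instance_def by simp
  moreover have "?B \<notin> CSP [12] tmpl" by (rule hard_instance_unsat[OF a1(2) a2(2)])
  moreover have "Z_affine_accepts [12] k tmpl ?B \<and> BA_accepts [12] k {} tmpl ?B \<and> CLAP [12] tmpl ?B"
    using hard_instance_accepted[OF ex, of a1 a2 "max k 12" k] a1(1) a2(1) K by simp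
  ultimately show ?thesis by blast
qed

lemma tmpl_not_solved:
  shows "sublinear_width k \<Longrightarrow> \<not> solves_CSP (Z_affine_consistency k :: (nat, nat) csp_algorithm) [12] tmpl"
    and "sublinear_width k \<Longrightarrow> \<not> solves_CSP (BA k :: (nat, nat) csp_algorithm) [12] tmpl"
    and "\<not> solves_CSP (CLAP :: (nat, nat) csp_algorithm) [12] tmpl"
proof -
  have ex: "\<exists>N. 5832 \<le> N \<and> 2 * (max (k (2 * N + 7)) 12 + 12) \<le> N div 5832" if "sublinear_width k" for k
  proof -
    have "(\<lambda>n. real (k n)) \<in> o(\<lambda>n. real n)" using that unfolding sublinear_width_def by blast
    then have "eventually (\<lambda>n. norm (real (k n)) \<le> 1 / 100000 * norm (real n)) at_top"
      by (rule landau_o.smallD) simp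
    then obtain n0 where n0: "\<And>n. n \<ge> n0 \<Longrightarrow> real (k n) \<le> 1 / 100000 * real n"
      unfolding eventually_at_top_linorder by auto
    \<comment> \<open>A multiple of 5832, so that the division is exact; the summand 1000 absorbs
      the additive constants, and \<open>n0\<close> brings the instance size into the asymptotic
      range.\<close>
    define N where "N = 5832 * (1000 + n0)"
    have "real (k (2 * N + 7)) \<le> 1 / 100000 * real (2 * N + 7)"
      by (rule n0) (simp add: N_def)
    then have "100000 * k (2 * N + 7) \<le> 2 * N + 7" by (simp add: field_simps)
    moreover have "N div 5832 = 1000 + n0" unfolding N_def by simp
    ultimately have "2 * (max (k (2 * N + 7)) 12 + 12) \<le> N div 5832"
      unfolding N_def max_def by auto
    then show ?thesis using N_def by (intro exI[of _ N]) auto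
  qed
  show "\<not> solves_CSP (Z_affine_consistency k :: (nat, nat) csp_algorithm) [12] tmpl" if k: "sublinear_width k"
  proof -
    obtain N where "5832 \<le> N" "2 * (max (k (2 * N + 7)) 12 + 12) \<le> N div 5832" using ex[OF k] by blast
    from hard_instance_exists[OF this] obtain B :: "nat rel_struct"
      where "fin_struct [12] B" "card (univ B) = 2 * N + 7" "B \<notin> CSP [12] tmpl"
        "Z_affine_accepts [12] (k (2 * N + 7)) tmpl B" by blast
    then show ?thesis unfolding solves_CSP_def Z_affine_consistency_def by metis
  qed
  show "\<not> solves_CSP (BA k :: (nat, nat) csp_algorithm) [12] tmpl" if k: "sublinear_width k"
  proof -
    obtain N where "5832 \<le> N" "2 * (max (k (2 * N + 7)) 12 + 12) \<le> N div 5832" using ex[OF k] by blast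
    from hard_instance_exists[OF this] obtain B :: "nat rel_struct"
      where "fin_struct [12] B" "card (univ B) = 2 * N + 7" "B \<notin> CSP [12] tmpl"
        "BA_accepts [12] (k (2 * N + 7)) {} tmpl B" by blast
    then show ?thesis unfolding solves_CSP_def BA_def by metis
  qed
  show "\<not> solves_CSP (CLAP :: (nat, nat) csp_algorithm) [12] tmpl"
  proof -
    have "2 * (max 1 12 + 12) \<le> (5832 * 1000 :: nat) div 5832" by simp
    from hard_instance_exists[OF _ this] obtain B :: "nat rel_struct"
      where "fin_struct [12] B" "B \<notin> CSP [12] tmpl" "CLAP [12] tmpl B" by auto
    then show ?thesis unfolding solves_CSP_def by metis
  qed
qed

lemma sublinear_width_1: "sublinear_width (\<lambda>_. 1)"
proof -
  have "(\<lambda>n::nat. 1 :: real) \<in> o(\<lambda>n. real n)"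
    by (rule smalloI_tendsto) (auto intro: lim_1_over_n simp: eventually_at_top_linorder intro!: exI[of _ 1])
  then show ?thesis unfolding sublinear_width_def by simp
qed

section \<open>While programs on three tapes\<close>

text \<open>Tests and actions see only the registers and the three scanned symbols (input, work and
  matrix tape). Over finite types, the rest of the program together with the registers is therefore
  a finite control state.\<close>

datatype ('r, 'i, 'w, 'm) prog =
    Skip
  | Act "'r \<Rightarrow> 'i \<Rightarrow> 'w \<Rightarrow> 'm \<Rightarrow> 'r \<times> ('i \<times> int) \<times> ('w \<times> int) \<times> ('m \<times> int)"
  | Seq "('r, 'i, 'w, 'm) prog" "('r, 'i, 'w, 'm) prog"
  | Cond "'r \<Rightarrow> 'i \<Rightarrow> 'w \<Rightarrow> 'm \<Rightarrow> bool" "('r, 'i, 'w, 'm) prog" "('r, 'i, 'w, 'm) prog"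
  | While "'r \<Rightarrow> 'i \<Rightarrow> 'w \<Rightarrow> 'm \<Rightarrow> bool" "('r, 'i, 'w, 'm) prog"

type_synonym ('r, 'i, 'w, 'm) store =
  "'r \<times> (int \<times> (int \<Rightarrow> 'i)) \<times> (int \<times> (int \<Rightarrow> 'w)) \<times> (int \<times> (int \<Rightarrow> 'm))"

text \<open>Every step, including pure control, is one machine step; control steps write back the
  scanned symbols and leave the heads in place.\<close>

primrec delta :: "('r, 'i, 'w, 'm) prog \<Rightarrow> 'r \<Rightarrow> 'i \<Rightarrow> 'w \<Rightarrow> 'm \<Rightarrow>
    ('r, 'i, 'w, 'm) prog \<times> ('r \<times> ('i \<times> int) \<times> ('w \<times> int) \<times> ('m \<times> int))" where
  "delta Skip r i w m = (Skip, (r, (i, 0), (w, 0), (m, 0)))"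
| "delta (Act f) r i w m = (Skip, f r i w m)"
| "delta (Seq p q) r i w m = (if p = Skip then (q, (r, (i, 0), (w, 0), (m, 0)))
     else (Seq (fst (delta p r i w m)) q, snd (delta p r i w m)))"
| "delta (Cond b p q) r i w m = (if b r i w m then p else q, (r, (i, 0), (w, 0), (m, 0)))"
| "delta (While b p) r i w m = (if b r i w m then Seq p (While b p) else Skip, (r, (i, 0), (w, 0), (m, 0)))"

text \<open>\<open>sgn\<close> turns any displacement into a legal head movement, so that programs
  carry no well-formedness condition.\<close>

fun tape_act :: "'x \<times> int \<Rightarrow> int \<times> (int \<Rightarrow> 'x) \<Rightarrow> int \<times> (int \<Rightarrow> 'x)" where
  "tape_act (x, d) (h, c) = (h + sgn d, c(h := x))"

fun store_act :: "'r \<times> ('i \<times> int) \<times> ('w \<times> int) \<times> ('m \<times> int) \<Rightarrow>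
    ('r, 'i, 'w, 'm) store \<Rightarrow> ('r, 'i, 'w, 'm) store" where
  "store_act (r', ai, aw, am) (r, ti, tw, tm) = (r', tape_act ai ti, tape_act aw tw, tape_act am tm)"

fun scan :: "int \<times> (int \<Rightarrow> 'x) \<Rightarrow> 'x" where
  "scan (h, c) = c h"

fun pstep :: "('r, 'i, 'w, 'm) prog \<times> ('r, 'i, 'w, 'm) store \<Rightarrow> ('r, 'i, 'w, 'm) prog \<times> ('r, 'i, 'w, 'm) store" where
  "pstep (p, (r, ti, tw, tm)) = (fst (delta p r (scan ti) (scan tw) (scan tm)),
     store_act (snd (delta p r (scan ti) (scan tw) (scan tm))) (r, ti, tw, tm))"

definition runs :: "('r, 'i, 'w, 'm) prog \<Rightarrow> nat \<Rightarrow> ('r, 'i, 'w, 'm) store \<Rightarrow> ('r, 'i, 'w, 'm) store \<Rightarrow> bool" where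
  "runs p T s s' \<longleftrightarrow> (\<exists>t\<le>T. (pstep ^^ t) (p, s) = (Skip, s'))"

lemma tape_act_scan: "tape_act (scan t, 0) t = t"
  by (cases t) simp

lemma pstep_Skip: "pstep (Skip, s) = (Skip, s)"
  by (cases s) (simp add: tape_act_scan)

lemma pstep_Seq: "p \<noteq> Skip \<Longrightarrow> pstep (Seq p q, s) = (Seq (fst (pstep (p, s))) q, snd (pstep (p, s)))"
  by (cases s) simp

lemma pstep_Seq_Skip: "pstep (Seq Skip q, s) = (q, s)"
  by (cases s) (simp add: tape_act_scan)

lemma funpow_pstep_Skip: "(pstep ^^ t) (Skip, s) = (Skip, s)"
  by (induction t) (simp_all add: pstep_Skip)

lemma runs_mono: "runs p T s s' \<Longrightarrow> T \<le> T' \<Longrightarrow> runs p T' s s'"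
  unfolding runs_def by (meson order_trans)

text \<open>\<open>Skip\<close> idles, so \<open>t\<close> may overshoot the halting time of
  \<open>p\<close>; inside \<open>Seq\<close> the count has to stop exactly there.\<close>

lemma funpow_pstep_Seq:
  "(pstep ^^ t) (p, s) = (Skip, s') \<Longrightarrow> \<exists>t'\<le>t. (pstep ^^ t') (Seq p q, s) = (Seq Skip q, s')"
proof (induction t arbitrary: p s)
  case 0
  then show ?case by simp
next
  case (Suc t)
  show ?case
  proof (cases "p = Skip")
    case True
    then have "s' = s" using Suc.prems funpow_pstep_Skip[of "Suc t" s] by simp
    then show ?thesis using True by (intro exI[of _ 0]) simp
  next
    case False
    obtain p1 s1 where 1: "pstep (p, s) = (p1, s1)" by (cases "pstep (p, s)")
    then have "(pstep ^^ t) (p1, s1) = (Skip, s')" using Suc.prems by (simp add: funpow_swap1)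
    from Suc.IH[OF this] obtain t' where t': "t' \<le> t" "(pstep ^^ t') (Seq p1 q, s1) = (Seq Skip q, s')"
      by blast
    have "(pstep ^^ Suc t') (Seq p q, s) = (Seq Skip q, s')"
      using t'(2) pstep_Seq[OF False, of q s] 1 by (simp add: funpow_swap1)
    then show ?thesis using t'(1) by (intro exI[of _ "Suc t'"]) simp
  qed
qed

lemma runs_Skip: "runs Skip 0 s s"
  unfolding runs_def by simp

lemma runs_Act:
  "runs (Act f) 1 (r, ti, tw, tm) (store_act (f r (scan ti) (scan tw) (scan tm)) (r, ti, tw, tm))"
  unfolding runs_def by (intro exI[of _ 1]) simp

lemma runs_Seq:
  assumes "runs p T1 s s1" "runs q T2 s1 s2"
  shows "runs (Seq p q) (T1 + T2 + 1) s s2"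
proof -
  obtain t1 where t1: "t1 \<le> T1" "(pstep ^^ t1) (p, s) = (Skip, s1)" using assms(1) unfolding runs_def by blast
  obtain t2 where t2: "t2 \<le> T2" "(pstep ^^ t2) (q, s1) = (Skip, s2)" using assms(2) unfolding runs_def by blast
  obtain t' where t': "t' \<le> t1" "(pstep ^^ t') (Seq p q, s) = (Seq Skip q, s1)"
    using funpow_pstep_Seq[OF t1(2)] by blast
  have "(pstep ^^ (t2 + Suc t')) (Seq p q, s) = (pstep ^^ t2) (pstep ((pstep ^^ t') (Seq p q, s)))"
    by (simp only: funpow_add comp_apply funpow.simps(2))
  then have "(pstep ^^ (t2 + Suc t')) (Seq p q, s) = (Skip, s2)"
    using t'(2) t2(2) by (simp only: pstep_Seq_Skip)
  then show ?thesis unfolding runs_def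
    by (intro exI[of _ "t2 + Suc t'"]) (use t' t1 t2 in simp)
qed

lemma runs_step:
  assumes "pstep (p, s) = (p1, s1)" "runs p1 T s1 s'"
  shows "runs p (T + 1) s s'"
proof -
  obtain t where t: "t \<le> T" "(pstep ^^ t) (p1, s1) = (Skip, s')" using assms(2) unfolding runs_def by blast
  have "(pstep ^^ Suc t) (p, s) = (Skip, s')" using t(2) assms(1) by (simp add: funpow_swap1)
  then show ?thesis unfolding runs_def using t(1) by (intro exI[of _ "Suc t"]) simp
qed

lemma runs_Cond:
  assumes "b r (scan ti) (scan tw) (scan tm) \<Longrightarrow> runs p T (r, ti, tw, tm) s'"
    and "\<not> b r (scan ti) (scan tw) (scan tm) \<Longrightarrow> runs q T (r, ti, tw, tm) s'"
  shows "runs (Cond b p q) (T + 1) (r, ti, tw, tm) s'"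
  by (rule runs_step[of _ _ "if b r (scan ti) (scan tw) (scan tm) then p else q" "(r, ti, tw, tm)"])
    (use assms in \<open>auto simp: tape_act_scan\<close>)

lemma runs_While_False:
  assumes "\<not> b r (scan ti) (scan tw) (scan tm)"
  shows "runs (While b p) 1 (r, ti, tw, tm) (r, ti, tw, tm)"
  using runs_step[of "While b p" "(r, ti, tw, tm)" Skip "(r, ti, tw, tm)" 0 "(r, ti, tw, tm)"] assms
  by (simp add: tape_act_scan runs_Skip)

lemma runs_While_True:
  assumes "b r (scan ti) (scan tw) (scan tm)" "runs p T1 (r, ti, tw, tm) s1" "runs (While b p) T2 s1 s2"
  shows "runs (While b p) (T1 + T2 + 2) (r, ti, tw, tm) s2"
  using runs_step[of "While b p" "(r, ti, tw, tm)" "Seq p (While b p)" "(r, ti, tw, tm)" "T1 + T2 + 1" s2]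
    runs_Seq[OF assms(2,3)] assms(1)
  by (simp add: tape_act_scan)

section \<open>Compilation to Turing machines\<close>

primrec reach :: "('r, 'i, 'w, 'm) prog \<Rightarrow> ('r, 'i, 'w, 'm) prog set" where
  "reach Skip = {Skip}"
| "reach (Act f) = {Act f, Skip}"
| "reach (Seq p q) = (\<lambda>p'. Seq p' q) ` reach p \<union> reach q"
| "reach (Cond b p q) = insert (Cond b p q) (reach p \<union> reach q)"
| "reach (While b p) = {While b p, Skip} \<union> (\<lambda>p'. Seq p' (While b p)) ` reach p"

lemma self_reach: "p \<in> reach p"
  by (induction p) auto

lemma finite_reach: "finite (reach p)"
  by (induction p) auto

lemma delta_reach: "p' \<in> reach p \<Longrightarrow> fst (delta p' r i w m) \<in> reach p"
proof (induction p arbitrary: p')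
  case (Seq p q)
  then show ?case using self_reach[of q] by (auto split: if_splits)
next
  case (While b p)
  then show ?case using self_reach[of p] by (auto split: if_splits)
next
  case (Cond b p q)
  then show ?case using self_reach[of p] self_reach[of q] by (auto split: if_splits)
qed auto

datatype isym = IB | I0 | I1 | IS

instance isym :: finite
proof
  have "(UNIV :: isym set) \<subseteq> {IB, I0, I1, IS}" using isym.exhaust by auto
  then show "finite (UNIV :: isym set)" by (rule finite_subset) simp
qed

primrec enc_isym :: "isym \<Rightarrow> nat" where
  "enc_isym IB = 0"
| "enc_isym I0 = 1"
| "enc_isym I1 = 2"
| "enc_isym IS = 3"

lemma inj_enc_isym: "inj enc_isym"
proof (rule injI)
  show "x = y" if "enc_isym x = enc_isym y" for x y
    using that by (cases x; cases y) simp_all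
qed

definition input_tape :: "bool list \<Rightarrow> int \<Rightarrow> isym" where
  "input_tape w p = (if 0 \<le> p \<and> p < int (length w) then (if w ! nat p then I1 else I0) else IB)"

text \<open>An arbitrary numbering is adjusted by exchanging two codes; the blank of each tape must
  get code 0.\<close>

lemma ex_enc:
  fixes x0 :: "'x::finite"
  shows "\<exists>f :: 'x \<Rightarrow> nat. inj f \<and> f x0 = 0 \<and> (\<forall>x. f x < card (UNIV :: 'x set))"
proof -
  obtain h :: "'x \<Rightarrow> nat" where h: "bij_betw h UNIV {0..<card (UNIV :: 'x set)}"
    using ex_bij_betw_finite_nat[of "UNIV :: 'x set"] by auto
  have inj: "h x = h y \<Longrightarrow> x = y" for x y using h by (auto simp: bij_betw_def inj_on_def)
  have lt: "h x < card (UNIV :: 'x set)" for x using h by (auto simp: bij_betw_def)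
  define f where "f x = (if x = x0 then 0 else if h x = 0 then h x0 else h x)" for x
  have "inj f"
  proof (rule injI)
    fix x y assume "f x = f y"
    then show "x = y" using inj[of x y] inj[of x x0] inj[of y x0] unfolding f_def
      by (simp split: if_splits)
  qed
  moreover have "f x < card (UNIV :: 'x set)" for x
    unfolding f_def using lt[of x] lt[of x0] by (simp add: card_gt_0_iff)
  moreover have "f x0 = 0" unfolding f_def by simp
  ultimately show ?thesis by blast
qed

text \<open>Control states are pairs of a residual program and a register value, numbered from 3
  because 0, 1 and 2 are the initial, accepting and rejecting states. One step enters the simulation
  and one leaves it, hence \<open>T + 2\<close>; a halted machine idles, so every later time gives
  the same answer.\<close>

theorem tm_of_prog:
  fixes P :: "('r::finite, isym, 'w::finite, 'm::finite) prog" and r0 :: 'r and bw :: 'w and bm :: 'm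
    and acc :: "'r \<Rightarrow> bool"
  shows "\<exists>M. wf_tm M \<and> (\<forall>w T s'. runs P T (r0, (0, input_tape w), (0, \<lambda>_. bw), (0, \<lambda>_. bm)) s' \<longrightarrow>
    (\<forall>t\<ge>T + 2. tm_state_after M t w = (if acc (fst s') then 1 else 2)))"
proof -
  obtain ew :: "'w \<Rightarrow> nat" where ew: "inj ew" "ew bw = 0" "\<And>x. ew x < card (UNIV :: 'w set)" using ex_enc by blast
  obtain em :: "'m \<Rightarrow> nat" where em: "inj em" "em bm = 0" "\<And>x. em x < card (UNIV :: 'm set)" using ex_enc by blast
  let ?S = "reach P \<times> (UNIV :: 'r set)"
  have finS: "finite ?S" by (intro finite_cartesian_product finite_reach finite_UNIV)
  obtain h where h: "bij_betw h ?S {0..<card ?S}" using ex_bij_betw_finite_nat[OF finS] by blast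
  define est where "est x = 3 + h x" for x
  have inj: "inj_on est ?S" using h unfolding est_def bij_betw_def inj_on_def by auto
  define ns where "ns = 3 + card ?S"
  have est: "3 \<le> est x" "est x < ns" if "x \<in> ?S" for x
    using h that unfolding est_def ns_def bij_betw_def by auto
  define nsym where "nsym = 4 + card (UNIV :: 'w set) + card (UNIV :: 'm set)"
  define idle where "idle ss = map (\<lambda>s. (s, 0 :: int)) ss" for ss :: "nat list"
  define tr where "tr q ss =
    (if q = 0 then (est (P, r0), idle ss)
     else if q \<in> est ` ?S then
       (case inv_into ?S est q of (p, r) \<Rightarrow>
          if p = Skip then (if acc r then 1 else 2, idle ss)
          else (case delta p r (inv enc_isym (ss ! 0)) (inv ew (ss ! 1)) (inv em (ss ! 2)) of
            (p', (r', (i', di), (w', dw), (m', dm))) \<Rightarrow>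
              (est (p', r'), [(enc_isym i', sgn di), (ew w', sgn dw), (em m', sgn dm)])))
     else (q, idle ss))" for q ss
  define M where "M = \<lparr>num_tapes = 3, num_states = ns, num_symbols = nsym, transition = tr\<rparr>"
  have ei: "enc_isym x < nsym" for x by (cases x) (simp_all add: nsym_def)
  have ew': "ew x < nsym" and em': "em y < nsym" for x y
    using ew(3)[of x] em(3)[of y] unfolding nsym_def by linarith+
  have PS: "(P, r0) \<in> ?S" using self_reach by simp
  have sgn_dir: "sgn d \<in> {-1, 0, 1 :: int}" for d by (simp add: sgn_if)
  have wf: "wf_tm M"
    unfolding wf_tm_def
  proof (intro conjI allI impI)
    show "1 \<le> num_tapes M" "3 \<le> num_states M" "3 \<le> num_symbols M"
      unfolding M_def ns_def nsym_def by simp_all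
    fix q ss assume q: "q < num_states M" and ss: "length ss = num_tapes M \<and> set ss \<subseteq> {..<num_symbols M}"
    have q': "q < ns" and ss': "length ss = 3" "set ss \<subseteq> {..<nsym}" using q ss unfolding M_def by simp_all
    have idle: "length (idle ss) = 3" "set (idle ss) \<subseteq> {..<nsym} \<times> {-1, 0, 1}"
      using ss' unfolding idle_def by auto
    have "fst (tr q ss) < ns \<and> length (snd (tr q ss)) = 3 \<and> set (snd (tr q ss)) \<subseteq> {..<nsym} \<times> {-1, 0, 1}"
    proof (cases "q = 0")
      case True
      then show ?thesis unfolding tr_def using est[OF PS] idle by simp
    next
      case q0: False
      show ?thesis
      proof (cases "q \<in> est ` ?S")
        case False
        then show ?thesis unfolding tr_def using q0 q' idle by simp
      next
        case True
        obtain p r where pr: "inv_into ?S est q = (p, r)" by fastforce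
        have pS: "p \<in> reach P" using inv_into_into[OF True] pr by auto
        obtain p' r' i' di w' dw m' dm where d: "delta p r (inv enc_isym (ss ! 0)) (inv ew (ss ! 1)) (inv em (ss ! 2))
          = (p', (r', (i', di), (w', dw), (m', dm)))" by (metis prod.exhaust)
        have "p' \<in> reach P" using delta_reach[OF pS] d by (metis fst_conv)
        then have "est (p', r') < ns" using est(2) by simp
        moreover have "(1::nat) < ns" "2 < ns" unfolding ns_def by simp_all
        ultimately show ?thesis
          unfolding tr_def using q0 True pr d idle ei ew' em' sgn_dir by simp
      qed
    qed
    then show "case transition M q ss of (q', acts) \<Rightarrow> q' < num_states M \<and> length acts = num_tapes M \<and>
           set acts \<subseteq> {..<num_symbols M} \<times> {-1, 0, 1}"
      unfolding M_def by (simp add: case_prod_beta)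
  qed
  define conf :: "('r, isym, 'w, 'm) prog \<Rightarrow> ('r, isym, 'w, 'm) store \<Rightarrow> tm_config" where
    "conf p s = (case s of (r, (hi, ci), (hw, cw), (hm, cm)) \<Rightarrow>
      (est (p, r), [(hi, \<lambda>x. enc_isym (ci x)), (hw, \<lambda>x. ew (cw x)), (hm, \<lambda>x. em (cm x))]))" for p s
  have fin12: "q \<notin> {1, 2}" if "q = est (p, r)" "p \<in> reach P" for q p r
    using est(1)[of "(p, r)"] that by auto
  have inv_est: "inv_into ?S est (est (p, r)) = (p, r)" if "p \<in> reach P" for p r
    by (rule inv_into_f_f[OF inj]) (use that in simp)
  have estS: "est (p, r) \<in> est ` ?S" if "p \<in> reach P" for p r using that by simp
  have est0: "est (p, r) \<noteq> 0" if "p \<in> reach P" for p r using est(1)[of "(p, r)"] that by auto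
  have inv_ei: "inv enc_isym (enc_isym x) = x" and inv_ew: "inv ew (ew y) = y" and inv_em: "inv em (em z) = z" for x y z
    using inj_enc_isym ew(1) em(1) by simp_all
  have step: "tm_step M (conf p s) = conf (fst (pstep (p, s))) (snd (pstep (p, s)))"
    if p: "p \<in> reach P" "p \<noteq> Skip" for p s
  proof -
    obtain r hi ci hw cw hm cm where s: "s = (r, (hi, ci), (hw, cw), (hm, cm))" by (metis prod.exhaust)
    obtain p' r' i' di w' dw m' dm where d: "delta p r (ci hi) (cw hw) (cm hm)
        = (p', (r', (i', di), (w', dw), (m', dm)))" by (metis prod.exhaust)
    have "tr (est (p, r)) [enc_isym (ci hi), ew (cw hw), em (cm hm)]
        = (est (p', r'), [(enc_isym i', sgn di), (ew w', sgn dw), (em m', sgn dm)])"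
      unfolding tr_def using p est0[OF p(1), of r] estS[OF p(1), of r] inv_est[OF p(1), of r] d
      by (simp add: inv_ei inv_ew inv_em)
    then show ?thesis
      unfolding tm_step_def conf_def s using fin12[OF refl p(1), of r] d
      by (simp add: M_def fun_upd_def if_distrib cong: if_cong)
  qed
  have sim: "\<exists>t'\<le>t. (tm_step M ^^ t') (conf p s) = conf Skip s' \<and> Skip \<in> reach P"
    if "(pstep ^^ t) (p, s) = (Skip, s')" "p \<in> reach P" for t p s s'
    using that
  proof (induction t arbitrary: p s)
    case 0
    then show ?case by simp
  next
    case (Suc t)
    show ?case
    proof (cases "p = Skip")
      case True
      then have "s' = s" using Suc.prems funpow_pstep_Skip[of "Suc t" s] by simp
      then show ?thesis using True Suc.prems by (intro exI[of _ 0]) simp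
    next
      case False
      obtain p1 s1 where 1: "pstep (p, s) = (p1, s1)" by (cases "pstep (p, s)")
      then have t: "(pstep ^^ t) (p1, s1) = (Skip, s')" using Suc.prems by (simp add: funpow_swap1)
      have "p1 \<in> reach P" using 1 delta_reach[OF Suc.prems(2)] by (cases s) auto
      from Suc.IH[OF t this] obtain t' where t': "t' \<le> t" "(tm_step M ^^ t') (conf p1 s1) = conf Skip s'" "Skip \<in> reach P"
        by blast
      have "(tm_step M ^^ Suc t') (conf p s) = conf Skip s'"
        using t'(2) step[OF Suc.prems(2) False, of s] 1 by (simp add: funpow_swap1)
      then show ?thesis using t' by (intro exI[of _ "Suc t'"]) simp
    qed
  qed
  have halt: "(tm_step M ^^ t) (q, tps) = (q, tps)" if "q \<in> {1, 2}" for t q tps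
    using that by (induction t) (auto simp: tm_step_def)
  have "tm_state_after M t w = (if acc (fst s') then 1 else 2)"
    if run: "runs P T (r0, (0, input_tape w), (0, \<lambda>_. bw), (0, \<lambda>_. bm)) s'" and t: "T + 2 \<le> t" for w T s' t
  proof -
    let ?s0 = "(r0, (0 :: int, input_tape w), (0 :: int, \<lambda>_ :: int. bw), (0 :: int, \<lambda>_ :: int. bm))"
    obtain t1 where t1: "t1 \<le> T" "(pstep ^^ t1) (P, ?s0) = (Skip, s')" using run unfolding runs_def by blast
    obtain t2 where t2: "t2 \<le> t1" "(tm_step M ^^ t2) (conf P ?s0) = conf Skip s'" "Skip \<in> reach P"
      using sim[OF t1(2) self_reach] by blast
    have "(\<lambda>x. enc_isym (input_tape w x))
        = (\<lambda>p. if 0 \<le> p \<and> p < int (length w) then (if w ! nat p then 2 else 1) else 0)"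
      unfolding input_tape_def by auto
    then have init: "tm_init M w = (0, [(0, \<lambda>x. enc_isym (input_tape w x)), (0, \<lambda>_. 0), (0, \<lambda>_. 0)])"
      unfolding tm_init_def M_def by (simp add: numeral_2_eq_2)
    have "tr 0 ss = (est (P, r0), idle ss)" for ss unfolding tr_def by simp
    then have s0: "tm_step M (tm_init M w) = conf P ?s0"
      unfolding init tm_step_def conf_def by (simp add: M_def idle_def ew(2) em(2) fun_eq_iff)
    obtain r tps where r: "conf Skip s' = (est (Skip, r), tps)" "r = fst s'"
      unfolding conf_def by (cases s') auto
    have tr: "fst (tr (est (Skip, r)) ss) = (if acc r then 1 else 2)" for ss
      unfolding tr_def using est0[OF t2(3), of r] estS[OF t2(3), of r] inv_est[OF t2(3), of r] by simp
    obtain tps' where fin: "tm_step M (conf Skip s') = (if acc r then 1 else 2, tps')"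
    proof -
      have "fst (tm_step M (conf Skip s')) = (if acc r then 1 else 2)"
        unfolding r(1) tm_step_def using fin12[OF refl t2(3), of r] tr
        by (simp add: M_def case_prod_beta)
      then show ?thesis using that by (metis prod.collapse)
    qed
    have "t = (t - (t2 + 2)) + (1 + (t2 + 1))" using t t1 t2 by simp
    then have "(tm_step M ^^ t) (tm_init M w)
        = (tm_step M ^^ (t - (t2 + 2))) ((tm_step M ^^ 1) ((tm_step M ^^ (t2 + 1)) (tm_init M w)))"
      by (metis comp_apply funpow_add)
    also have "(tm_step M ^^ (t2 + 1)) (tm_init M w) = conf Skip s'"
      using t2(2) s0 by (simp add: funpow_swap1)
    also have "(tm_step M ^^ 1) (conf Skip s') = (if acc r then 1 else 2, tps')" using fin by simp
    also have "(tm_step M ^^ (t - (t2 + 2))) \<dots> = (if acc r then 1 else 2, tps')"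
      by (rule halt) simp
    finally show ?thesis unfolding tm_state_after_def r(2) by simp
  qed
  then show ?thesis using wf by blast
qed

section \<open>Gaussian elimination modulo 2 and 3\<close>

definition satisfies_eq :: "int \<Rightarrow> nat \<Rightarrow> (nat \<Rightarrow> int) \<Rightarrow> (nat \<Rightarrow> int) \<Rightarrow> bool" where
  "satisfies_eq p D v y \<longleftrightarrow> [(\<Sum>j<D. v j * y j) = v D] (mod p)"

text \<open>Every nonzero element is its own inverse modulo 2 and modulo 3, so \<open>w i\<close> stands for its inverse.\<close>

definition row_elim :: "int \<Rightarrow> nat \<Rightarrow> (nat \<Rightarrow> int) \<Rightarrow> (nat \<Rightarrow> int) \<Rightarrow> (nat \<Rightarrow> int) \<times> (nat \<Rightarrow> int)" where
  "row_elim p i v w =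
     (if v i = 0 then (v, w)
      else if w i = 0 then (\<lambda>j. if i \<le> j then 0 else v j, \<lambda>j. if i \<le> j then v j else w j)
      else (\<lambda>j. if i \<le> j then (v j - v i * w i * w j) mod p else v j, w))"

text \<open>Row \<open>A i\<close> is reserved for the pivot column \<open>i\<close>, and a zero row
  is a free slot. This avoids any search for pivots and any permutation of rows.\<close>

primrec insert_eq :: "int \<Rightarrow> nat \<Rightarrow> (nat \<Rightarrow> int) \<Rightarrow> (nat \<Rightarrow> nat \<Rightarrow> int) \<Rightarrow> (nat \<Rightarrow> int) \<times> (nat \<Rightarrow> nat \<Rightarrow> int)" where
  "insert_eq p 0 v A = (v, A)"
| "insert_eq p (Suc i) v A =
     (case insert_eq p i v A of (v', A') \<Rightarrow> case row_elim p i v' (A' i) of (v'', w) \<Rightarrow> (v'', A'(i := w)))"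

definition echelon :: "int \<Rightarrow> nat \<Rightarrow> (nat \<Rightarrow> nat \<Rightarrow> int) \<Rightarrow> bool" where
  "echelon p D A \<longleftrightarrow> (\<forall>i<D. (\<forall>j\<le>D. 0 \<le> A i j \<and> A i j < p) \<and> (\<forall>j<i. A i j = 0) \<and>
     (A i i = 0 \<longrightarrow> (\<forall>j\<le>D. A i j = 0)))"

lemma square_mod:
  assumes "p = 2 \<or> p = (3::int)" "0 < a" "a < p"
  shows "[a * a = 1] (mod p)"
proof -
  have "a = 1 \<or> (p = 3 \<and> a = 2)" using assms by auto
  then show ?thesis by (auto simp: cong_def)
qed

lemma satisfies_eq_zero: "(\<And>j. j \<le> D \<Longrightarrow> v j = 0) \<Longrightarrow> satisfies_eq p D v y"
  unfolding satisfies_eq_def by simp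

lemma satisfies_eq_sub:
  assumes w: "satisfies_eq p D w y" and v': "\<And>j. j \<le> D \<Longrightarrow> [v' j = v j - c * w j] (mod p)"
  shows "satisfies_eq p D v' y \<longleftrightarrow> satisfies_eq p D v y"
proof -
  have "[(\<Sum>j<D. v' j * y j) = (\<Sum>j<D. (v j - c * w j) * y j)] (mod p)"
    by (intro cong_sum cong_mult cong_refl v') simp
  also have "(\<Sum>j<D. (v j - c * w j) * y j) = (\<Sum>j<D. v j * y j) - c * (\<Sum>j<D. w j * y j)"
    by (simp add: left_diff_distrib sum_subtractf sum_distrib_left mult.assoc)
  also have "[\<dots> = (\<Sum>j<D. v j * y j) - c * w D] (mod p)"
    using w unfolding satisfies_eq_def by (intro cong_diff cong_mult cong_refl)
  finally have 1: "[(\<Sum>j<D. v' j * y j) = (\<Sum>j<D. v j * y j) - c * w D] (mod p)" .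
  have 2: "[v' D = v D - c * w D] (mod p)" by (rule v') simp
  have "satisfies_eq p D v' y \<longleftrightarrow> [(\<Sum>j<D. v j * y j) - c * w D = v D - c * w D] (mod p)"
    unfolding satisfies_eq_def using 1 2 by (simp only: cong_def)
  also have "\<dots> \<longleftrightarrow> satisfies_eq p D v y"
    unfolding satisfies_eq_def by (simp add: cong_iff_dvd_diff)
  finally show ?thesis .
qed

lemma row_elim_correct:
  assumes p: "p = 2 \<or> p = (3::int)" and i: "i < D"
    and v_range: "\<forall>j\<le>D. 0 \<le> v j \<and> v j < p" and v_zero: "\<forall>j<i. v j = 0"
    and w_row: "(\<forall>j\<le>D. 0 \<le> w j \<and> w j < p) \<and> (\<forall>j<i. w j = 0) \<and> (w i = 0 \<longrightarrow> (\<forall>j\<le>D. w j = 0))"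
    and re: "row_elim p i v w = (v', w')"
  shows "(\<forall>j\<le>D. 0 \<le> v' j \<and> v' j < p) \<and> (\<forall>j<Suc i. v' j = 0) \<and>
    (\<forall>j\<le>D. 0 \<le> w' j \<and> w' j < p) \<and> (\<forall>j<i. w' j = 0) \<and> (w' i = 0 \<longrightarrow> (\<forall>j\<le>D. w' j = 0)) \<and>
    (satisfies_eq p D v' y \<and> satisfies_eq p D w' y \<longleftrightarrow> satisfies_eq p D v y \<and> satisfies_eq p D w y)"
proof -
  have v: "\<And>j. j \<le> D \<Longrightarrow> 0 \<le> v j \<and> v j < p" "\<And>j. j < i \<Longrightarrow> v j = 0"
    using v_range v_zero by blast+
  have w: "\<And>j. j \<le> D \<Longrightarrow> 0 \<le> w j \<and> w j < p" "\<And>j. j < i \<Longrightarrow> w j = 0"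
      "w i = 0 \<Longrightarrow> \<forall>j\<le>D. w j = 0"
    using w_row by blast+
  have pos: "0 < p" using p by auto
  consider "v i = 0" | "v i \<noteq> 0" "w i = 0" | "v i \<noteq> 0" "w i \<noteq> 0" by blast
  then show ?thesis
  proof cases
    case 1
    then have "v' = v" "w' = w" using re unfolding row_elim_def by auto
    then show ?thesis using v w 1 by (auto simp: less_Suc_eq)
  next
    case 2
    have e: "v' = (\<lambda>j. if i \<le> j then 0 else v j)" "w' = (\<lambda>j. if i \<le> j then v j else w j)"
      using re 2 unfolding row_elim_def by auto
    have v0: "v' j = 0" for j unfolding e using v(2) by simp
    have w': "w' j = v j" for j unfolding e using v(2)[of j] w(2)[of j] by simp
    have w0: "w j = 0" if "j \<le> D" for j using w(3)[OF 2(2)] that by blast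
    have "satisfies_eq p D v' y" "satisfies_eq p D w y" by (rule satisfies_eq_zero; simp add: v0 w0)+
    moreover have "satisfies_eq p D w' y = satisfies_eq p D v y" unfolding satisfies_eq_def w' ..
    ultimately show ?thesis using v w' v0 2(1) pos by auto
  next
    case 3
    have e: "v' = (\<lambda>j. if i \<le> j then (v j - v i * w i * w j) mod p else v j)" "w' = w"
      using re 3 unfolding row_elim_def by auto
    have "[v' j = v j - (v i * w i) * w j] (mod p)" if "j \<le> D" for j
      unfolding e using v(2)[of j] w(2)[of j] by (simp add: cong_def)
    then have "satisfies_eq p D v' y \<longleftrightarrow> satisfies_eq p D v y" if "satisfies_eq p D w y"
      using satisfies_eq_sub[OF that] by blast
    moreover have "v' i = 0"
    proof -
      have "[w i * w i = 1] (mod p)"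
        using square_mod[OF p, of "w i"] w(1)[of i] 3(2) i by simp
      then have "[v i - v i * (w i * w i) = v i - v i * 1] (mod p)"
        by (intro cong_diff cong_mult cong_refl)
      then show ?thesis unfolding e by (simp add: cong_def mult.assoc)
    qed
    moreover have "0 \<le> v' j \<and> v' j < p" if "j \<le> D" for j unfolding e using v(1)[OF that] pos by simp
    moreover have "v' j = 0" if "j < i" for j unfolding e using that v(2) by simp
    ultimately show ?thesis using w e(2) by (auto simp: less_Suc_eq)
  qed
qed

lemma insert_eq_correct:
  assumes p: "p = 2 \<or> p = (3::int)" and A: "echelon p D A"
    and v: "\<And>j. j \<le> D \<Longrightarrow> 0 \<le> v j \<and> v j < p"
    and "i \<le> D" "insert_eq p i v A = (v', A')"
  shows "echelon p D A' \<and> (\<forall>j\<le>D. 0 \<le> v' j \<and> v' j < p) \<and> (\<forall>j<i. v' j = 0) \<and>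
    (\<forall>y. satisfies_eq p D v' y \<and> (\<forall>k<D. satisfies_eq p D (A' k) y) \<longleftrightarrow>
      satisfies_eq p D v y \<and> (\<forall>k<D. satisfies_eq p D (A k) y))"
  using assms(4,5)
proof (induction i arbitrary: v' A')
  case 0
  then show ?case using A v by simp
next
  case (Suc i)
  obtain v1 A1 where 1: "insert_eq p i v A = (v1, A1)" by fastforce
  obtain w where w: "row_elim p i v1 (A1 i) = (v', w)" "A' = A1(i := w)"
    using Suc.prems(2) 1 by (auto split: prod.splits)
  have IH: "echelon p D A1" "\<And>j. j \<le> D \<Longrightarrow> 0 \<le> v1 j \<and> v1 j < p" "\<And>j. j < i \<Longrightarrow> v1 j = 0"
    "\<And>y. satisfies_eq p D v1 y \<and> (\<forall>k<D. satisfies_eq p D (A1 k) y) \<longleftrightarrow>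
      satisfies_eq p D v y \<and> (\<forall>k<D. satisfies_eq p D (A k) y)"
    using Suc.IH[OF _ 1] Suc.prems(1) by auto
  have iD: "i < D" using Suc.prems(1) by simp
  have ech: "(\<forall>j\<le>D. 0 \<le> A1 i j \<and> A1 i j < p) \<and> (\<forall>j<i. A1 i j = 0) \<and> (A1 i i = 0 \<longrightarrow> (\<forall>j\<le>D. A1 i j = 0))"
    using IH(1) iD unfolding echelon_def by blast
  have re: "(\<forall>j\<le>D. 0 \<le> v' j \<and> v' j < p) \<and> (\<forall>j<Suc i. v' j = 0) \<and>
    (\<forall>j\<le>D. 0 \<le> w j \<and> w j < p) \<and> (\<forall>j<i. w j = 0) \<and> (w i = 0 \<longrightarrow> (\<forall>j\<le>D. w j = 0)) \<and>
    (satisfies_eq p D v' y \<and> satisfies_eq p D w y \<longleftrightarrow> satisfies_eq p D v1 y \<and> satisfies_eq p D (A1 i) y)" for y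
    using row_elim_correct[OF p iD _ _ ech w(1)] IH(2,3) by blast
  have ech': "echelon p D A'"
    unfolding echelon_def
  proof (intro allI impI)
    fix k assume k: "k < D"
    show "(\<forall>j\<le>D. 0 \<le> A' k j \<and> A' k j < p) \<and> (\<forall>j<k. A' k j = 0) \<and> (A' k k = 0 \<longrightarrow> (\<forall>j\<le>D. A' k j = 0))"
    proof (cases "k = i")
      case True
      then have "A' k = w" unfolding w(2) by simp
      then show ?thesis using re True by blast
    next
      case False
      then have "A' k = A1 k" unfolding w(2) by simp
      moreover have "(\<forall>j\<le>D. 0 \<le> A1 k j \<and> A1 k j < p) \<and> (\<forall>j<k. A1 k j = 0) \<and>
          (A1 k k = 0 \<longrightarrow> (\<forall>j\<le>D. A1 k j = 0))"
        using IH(1) k unfolding echelon_def by blast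
      ultimately show ?thesis by (simp only:)
    qed
  qed
  have eqv: "(satisfies_eq p D v' y \<and> (\<forall>k<D. satisfies_eq p D (A' k) y)) \<longleftrightarrow>
      (satisfies_eq p D v1 y \<and> (\<forall>k<D. satisfies_eq p D (A1 k) y))" for y
  proof -
    have split: "(\<forall>k<D. P k) \<longleftrightarrow> P i \<and> (\<forall>k<D. k \<noteq> i \<longrightarrow> P k)" for P :: "nat \<Rightarrow> bool"
      using iD by blast
    define R where "R \<longleftrightarrow> (\<forall>k<D. k \<noteq> i \<longrightarrow> satisfies_eq p D (A1 k) y)"
    have "(\<forall>k<D. satisfies_eq p D (A' k) y) \<longleftrightarrow> satisfies_eq p D w y \<and> R"
    proof -
      have "(\<forall>k<D. k \<noteq> i \<longrightarrow> satisfies_eq p D (A' k) y) \<longleftrightarrow> R" unfolding R_def w(2) by simp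
      moreover have "A' i = w" unfolding w(2) by simp
      ultimately show ?thesis using split[of "\<lambda>k. satisfies_eq p D (A' k) y"] by (simp only:)
    qed
    moreover have "(\<forall>k<D. satisfies_eq p D (A1 k) y) \<longleftrightarrow> satisfies_eq p D (A1 i) y \<and> R"
      unfolding R_def by (rule split)
    moreover have "satisfies_eq p D v' y \<and> satisfies_eq p D w y \<longleftrightarrow> satisfies_eq p D v1 y \<and> satisfies_eq p D (A1 i) y"
      using re[of y] by (elim conjE)
    ultimately show ?thesis by blast
  qed
  show ?case
  proof (intro conjI allI impI)
    show "echelon p D A'" by (rule ech')
    show "0 \<le> v' j" "v' j < p" if "j \<le> D" for j using re that by blast+
    show "v' j = 0" if "j < Suc i" for j using re that by blast
    show "satisfies_eq p D v' y \<and> (\<forall>k<D. satisfies_eq p D (A' k) y) \<longleftrightarrow>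
      satisfies_eq p D v y \<and> (\<forall>k<D. satisfies_eq p D (A k) y)" for y
      using eqv[of y] IH(4)[of y] by (rule trans)
  qed
qed

text \<open>Back substitution from the last row upwards: rows below \<open>k\<close> have no entry
  in column \<open>k\<close>, so the choice of \<open>y k\<close> leaves them intact. A row without
  pivot is entirely zero, including its right-hand side, so nothing can fail.\<close>

lemma echelon_solvable:
  assumes p: "p = 2 \<or> p = (3::int)" and A: "echelon p D A"
  shows "\<exists>y. \<forall>i<D. satisfies_eq p D (A i) y"
proof -
  have "\<exists>y. \<forall>i<D. D - d \<le> i \<longrightarrow> satisfies_eq p D (A i) y" if "d \<le> D" for d
    using that
  proof (induction d)
    case (Suc d)
    then obtain y where y: "\<forall>i<D. D - d \<le> i \<longrightarrow> satisfies_eq p D (A i) y" by auto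
    define k where "k = D - Suc d"
    have k: "k < D" "D - d = Suc k" using Suc.prems unfolding k_def by auto
    \<comment> \<open>Solves row \<open>k\<close> for \<open>y k\<close>; the pivot is its own
      inverse.\<close>
    define c where "c = A k k * (A k D - (\<Sum>j\<in>{..<D} - {k}. A k j * y j))"
    have sum_k: "(\<Sum>j<D. A k j * (y(k := c)) j) = A k k * c + (\<Sum>j\<in>{..<D} - {k}. A k j * y j)"
      using k(1) by (subst sum.remove[of _ k]) (auto intro!: sum.cong)
    have "satisfies_eq p D (A k) (y(k := c))"
    proof (cases "A k k = 0")
      case True
      then show ?thesis using A k(1) unfolding echelon_def by (intro satisfies_eq_zero) auto
    next
      case False
      have "[A k k * A k k = 1] (mod p)"
        using A k(1) False unfolding echelon_def by (intro square_mod[OF p]) (auto simp: less_le)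
      then have "[A k k * A k k * (A k D - (\<Sum>j\<in>{..<D} - {k}. A k j * y j))
          = 1 * (A k D - (\<Sum>j\<in>{..<D} - {k}. A k j * y j))] (mod p)"
        by (intro cong_mult cong_refl)
      then have "[A k k * c + (\<Sum>j\<in>{..<D} - {k}. A k j * y j)
          = 1 * (A k D - (\<Sum>j\<in>{..<D} - {k}. A k j * y j)) + (\<Sum>j\<in>{..<D} - {k}. A k j * y j)] (mod p)"
        unfolding c_def mult.assoc by (intro cong_add cong_refl)
      then show ?thesis unfolding satisfies_eq_def sum_k by simp
    qed
    moreover have "satisfies_eq p D (A i) (y(k := c))" if "i < D" "Suc k \<le> i" for i
    proof -
      have "A i k = 0" using A that unfolding echelon_def by auto
      then have "(\<Sum>j<D. A i j * (y(k := c)) j) = (\<Sum>j<D. A i j * y j)"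
        by (intro sum.cong) auto
      then show ?thesis using y that k(2) unfolding satisfies_eq_def by simp
    qed
    ultimately have "\<forall>i<D. D - Suc d \<le> i \<longrightarrow> satisfies_eq p D (A i) (y(k := c))"
      unfolding k_def[symmetric] by (metis Suc_leI le_neq_implies_less)
    then show ?case by blast
  qed simp
  from this[of D] show ?thesis by simp
qed

lemma satisfies_eq_const:
  assumes "\<And>j. j < D \<Longrightarrow> v j = 0" "0 \<le> v D" "v D < p"
  shows "satisfies_eq p D v y \<longleftrightarrow> v D = 0"
  unfolding satisfies_eq_def using assms by (auto simp: cong_def)

primrec insert_eqs :: "int \<Rightarrow> nat \<Rightarrow> (nat \<Rightarrow> int) list \<Rightarrow> bool \<times> (nat \<Rightarrow> nat \<Rightarrow> int) \<Rightarrow> bool \<times> (nat \<Rightarrow> nat \<Rightarrow> int)" where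
  "insert_eqs p D [] s = s"
| "insert_eqs p D (v # vs) s = insert_eqs p D vs
     (case insert_eq p D v (snd s) of (v', A') \<Rightarrow> (fst s \<or> v' D \<noteq> 0, A'))"

lemma insert_eqs_append: "insert_eqs p D (vs @ ws) s = insert_eqs p D ws (insert_eqs p D vs s)"
  by (induction vs arbitrary: s) simp_all

lemma insert_eqs_correct:
  assumes p: "p = 2 \<or> p = (3::int)" and A: "echelon p D A"
    and v: "\<And>v j. v \<in> set vs \<Longrightarrow> j \<le> D \<Longrightarrow> 0 \<le> v j \<and> v j < p"
    and res: "insert_eqs p D vs (bad, A) = (bad', A')"
  shows "echelon p D A' \<and> (\<forall>y. \<not> bad' \<and> (\<forall>k<D. satisfies_eq p D (A' k) y) \<longleftrightarrow>
      \<not> bad \<and> (\<forall>v\<in>set vs. satisfies_eq p D v y) \<and> (\<forall>k<D. satisfies_eq p D (A k) y))"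
  using A v res
proof (induction vs arbitrary: bad A)
  case Nil
  then show ?case by simp
next
  case (Cons v vs)
  obtain v1 A1 where 1: "insert_eq p D v A = (v1, A1)" by fastforce
  have vb: "\<And>j. j \<le> D \<Longrightarrow> 0 \<le> v j \<and> v j < p" using Cons.prems(2) by simp
  have c: "echelon p D A1" "\<And>j. j \<le> D \<Longrightarrow> 0 \<le> v1 j \<and> v1 j < p" "\<And>j. j < D \<Longrightarrow> v1 j = 0"
    "\<And>y. satisfies_eq p D v1 y \<and> (\<forall>k<D. satisfies_eq p D (A1 k) y) \<longleftrightarrow>
      satisfies_eq p D v y \<and> (\<forall>k<D. satisfies_eq p D (A k) y)"
    using insert_eq_correct[OF p Cons.prems(1) vb le_refl 1] by auto
  have "satisfies_eq p D v1 y \<longleftrightarrow> v1 D = 0" for y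
    by (rule satisfies_eq_const) (use c(2,3) in auto)
  moreover have "insert_eqs p D vs (bad \<or> v1 D \<noteq> 0, A1) = (bad', A')"
    using Cons.prems(3) 1 by simp
  moreover have "\<And>w j. w \<in> set vs \<Longrightarrow> j \<le> D \<Longrightarrow> 0 \<le> w j \<and> w j < p" using Cons.prems(2) by simp
  ultimately have "echelon p D A'" and "(\<not> bad' \<and> (\<forall>k<D. satisfies_eq p D (A' k) y)) \<longleftrightarrow>
      (\<not> bad \<and> satisfies_eq p D v1 y \<and> (\<forall>v\<in>set vs. satisfies_eq p D v y) \<and> (\<forall>k<D. satisfies_eq p D (A1 k) y))" for y
    using Cons.IH[OF c(1)] by auto
  then show ?case using c(4) unfolding list.set ball_simps by blast
qed

theorem insert_eqs_solvable:
  assumes p: "p = 2 \<or> p = (3::int)"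
    and v: "\<And>v j. v \<in> set vs \<Longrightarrow> j \<le> D \<Longrightarrow> 0 \<le> v j \<and> v j < p"
  shows "fst (insert_eqs p D vs (False, \<lambda>_ _. 0)) \<longleftrightarrow> (\<nexists>y. \<forall>v\<in>set vs. satisfies_eq p D v y)"
proof -
  have E: "echelon p D (\<lambda>_ _. 0)" using p unfolding echelon_def by auto
  obtain bad' A' where r: "insert_eqs p D vs (False, \<lambda>_ _. 0) = (bad', A')" by fastforce
  have "echelon p D A' \<and> (\<forall>y. \<not> bad' \<and> (\<forall>k<D. satisfies_eq p D (A' k) y) \<longleftrightarrow>
      \<not> False \<and> (\<forall>v\<in>set vs. satisfies_eq p D v y) \<and> (\<forall>k<D. satisfies_eq p D (\<lambda>_. 0) y))"
    by (rule insert_eqs_correct[OF p E _ r]) (fact v)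
  moreover have "satisfies_eq p D (\<lambda>_. 0) y" for y by (rule satisfies_eq_zero) simp
  ultimately have "echelon p D A'"
    and eq: "\<And>y. \<not> bad' \<and> (\<forall>k<D. satisfies_eq p D (A' k) y) \<longleftrightarrow> (\<forall>v\<in>set vs. satisfies_eq p D v y)"
    by simp_all
  then obtain y where "\<forall>k<D. satisfies_eq p D (A' k) y" using echelon_solvable[OF p] by blast
  then have "bad' \<longleftrightarrow> (\<nexists>y. \<forall>v\<in>set vs. satisfies_eq p D v y)" using eq by blast
  then show ?thesis by (simp add: r)
qed

section \<open>Homomorphisms as solutions of homogenised systems\<close>

text \<open>The column of \<open>x\<^sub>b\<close> is \<open>2 * b\<close>, that of \<open>s\<^sub>b\<close> is \<open>2 * b + 1\<close>, and the right-hand side has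
  column \<open>2 * n\<close>.  A coefficient depends on a tuple only through the set of positions at which the
  element of the column occurs.  Mode 0 says that left positions and right positions have no element
  in common.  In modes 1 and 2, \<open>s\<^sub>b\<close> homogenises the linear equation of the left and of the right
  positions respectively; all entries of a tuple have the same \<open>s\<^sub>b\<close>.\<close>

definition modulus :: "nat \<Rightarrow> int" where
  "modulus md = (if md = 2 then 3 else 2)"

definition coef :: "nat \<Rightarrow> nat \<Rightarrow> bool \<Rightarrow> nat set \<Rightarrow> int" where
  "coef md q s ps =
    (if md = 0 then (if s then 0 else of_bool (q \<in> ps))
     else if q = 0 then
       (if s then - of_bool (0 \<in> ps)
        else int (card (ps \<inter> (if md = 1 then {..<6} else {6..<12}))))
     else if s then of_bool (q \<in> ps) - of_bool (0 \<in> ps) else 0)"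

definition rhs_coef :: "nat \<Rightarrow> nat \<Rightarrow> int" where
  "rhs_coef md q = of_bool (md = 0 \<and> 6 \<le> q)"

definition positions :: "(nat \<Rightarrow> nat) \<Rightarrow> nat \<Rightarrow> nat set" where
  "positions t b = {j. j < 12 \<and> t j = b}"

definition eqn :: "nat \<Rightarrow> nat \<Rightarrow> nat \<Rightarrow> (nat \<Rightarrow> nat) \<Rightarrow> nat \<Rightarrow> int" where
  "eqn n md q t j = (if j = 2 * n then rhs_coef md q mod modulus md
     else coef md q (odd j) (positions t (j div 2)) mod modulus md)"

definition init_eqn :: "nat \<Rightarrow> nat \<Rightarrow> nat \<Rightarrow> int" where
  "init_eqn n c j = of_bool (j = 2 * c + 1 \<or> j = 2 * n)"

definition solvable :: "nat \<Rightarrow> (nat \<Rightarrow> nat) set \<Rightarrow> nat \<Rightarrow> nat \<Rightarrow> bool" where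
  "solvable n \<T> md c \<longleftrightarrow> (\<exists>y. satisfies_eq (modulus md) (2 * n) (init_eqn n c) y \<and>
     (\<forall>t\<in>\<T>. \<forall>q<12. satisfies_eq (modulus md) (2 * n) (eqn n md q t) y))"

lemma sum_pairs: "(\<Sum>j<2 * n. f j) = (\<Sum>b<n. f (2 * b) + f (2 * b + 1))" for f :: "nat \<Rightarrow> int"
  by (induction n) (simp_all add: algebra_simps)

lemma satisfies_eq_pairs:
  assumes "\<forall>b<n. [v (2 * b) = f b] (mod p)" "\<forall>b<n. [v (2 * b + 1) = g b] (mod p)"
    "[v (2 * n) = r] (mod p)"
  shows "satisfies_eq p (2 * n) v y \<longleftrightarrow> [(\<Sum>b<n. f b * y (2 * b)) + (\<Sum>b<n. g b * y (2 * b + 1)) = r] (mod p)"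
proof -
  have "[(\<Sum>b<n. v (2 * b) * y (2 * b) + v (2 * b + 1) * y (2 * b + 1))
      = (\<Sum>b<n. f b * y (2 * b) + g b * y (2 * b + 1))] (mod p)"
    by (intro cong_sum cong_add cong_mult cong_refl assms(1,2)[rule_format]) simp_all
  then have "[(\<Sum>j<2 * n. v j * y j) = (\<Sum>b<n. f b * y (2 * b)) + (\<Sum>b<n. g b * y (2 * b + 1))] (mod p)"
    unfolding sum_pairs sum.distrib .
  then show ?thesis unfolding satisfies_eq_def using assms(3) by (simp only: cong_def)
qed

lemma sum_positions:
  assumes "finite J" "\<And>j. j \<in> J \<Longrightarrow> j < 12 \<and> t j < n"
  shows "(\<Sum>b<n. int (card (positions t b \<inter> J)) * y b) = (\<Sum>j\<in>J. y (t j))"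
proof -
  have "(\<Sum>j\<in>J. y (t j)) = (\<Sum>b<n. \<Sum>j\<in>{j \<in> J. t j = b}. y (t j))"
    by (rule sum.group[symmetric]) (use assms in auto)
  also have "\<dots> = (\<Sum>b<n. int (card (positions t b \<inter> J)) * y b)"
  proof (rule sum.cong[OF refl])
    fix b
    have "positions t b \<inter> J = {j \<in> J. t j = b}" using assms(2) unfolding positions_def by auto
    then show "(\<Sum>j\<in>{j \<in> J. t j = b}. y (t j)) = int (card (positions t b \<inter> J)) * y b" by simp
  qed
  finally show ?thesis by simp
qed

lemma sum_position:
  assumes "q < 12" "t q < n"
  shows "(\<Sum>b<n. of_bool (q \<in> positions t b) * y b) = (y (t q) :: int)"
proof -
  have "(\<Sum>b<n. of_bool (q \<in> positions t b) * y b) = (\<Sum>b<n. if b = t q then y b else 0)"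
    by (rule sum.cong) (use assms in \<open>auto simp: positions_def\<close>)
  then show ?thesis using assms by simp
qed

definition side :: "nat \<Rightarrow> nat set" where
  "side md = (if md = 1 then {..<6} else {6..<12})"

lemma eqn_iff:
  assumes t: "\<forall>j<12. t j < n" and q: "q < 12"
  shows "satisfies_eq (modulus md) (2 * n) (eqn n md q t) y \<longleftrightarrow>
    (if md = 0 then [y (2 * t q) = of_bool (6 \<le> q)] (mod 2)
     else if q = 0 then [(\<Sum>j\<in>side md. y (2 * t j)) = y (2 * t 0 + 1)] (mod modulus md)
     else [y (2 * t q + 1) = y (2 * t 0 + 1)] (mod modulus md))"
proof -
  have X: "\<forall>b<n. [eqn n md q t (2 * b) = coef md q False (positions t b)] (mod modulus md)"
    by (simp add: eqn_def cong_def)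
  have S: "\<forall>b<n. [eqn n md q t (2 * b + 1) = coef md q True (positions t b)] (mod modulus md)"
  proof (intro allI impI)
    fix b assume "b < n"
    have "2 * b + 1 \<noteq> 2 * n" by presburger
    then show "[eqn n md q t (2 * b + 1) = coef md q True (positions t b)] (mod modulus md)"
      by (simp add: eqn_def cong_def)
  qed
  have R: "[eqn n md q t (2 * n) = rhs_coef md q] (mod modulus md)" by (simp add: eqn_def cong_def)
  have t0: "t 0 < n" "t q < n" using t q by simp_all
  note iff = satisfies_eq_pairs[OF X S R, of y]
  consider "md = 0" | "md \<noteq> 0" "q = 0" | "md \<noteq> 0" "q \<noteq> 0" by blast
  then show ?thesis
  proof cases
    case 1
    have "(\<Sum>b<n. coef md q False (positions t b) * y (2 * b)) = y (2 * t q)"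
      using sum_position[where t = t and y = "\<lambda>b. y (2 * b)", OF q t0(2)] 1 by (simp add: coef_def)
    moreover have "(\<Sum>b<n. coef md q True (positions t b) * y (2 * b + 1)) = 0"
      using 1 by (simp add: coef_def)
    ultimately show ?thesis unfolding iff using 1 by (simp add: modulus_def rhs_coef_def)
  next
    case 2
    have "(\<Sum>b<n. coef md q False (positions t b) * y (2 * b)) = (\<Sum>j\<in>side md. y (2 * t j))"
      using sum_positions[of "side md" t n "\<lambda>b. y (2 * b)"] 2 t by (auto simp: coef_def side_def)
    moreover have "(\<Sum>b<n. coef md q True (positions t b) * y (2 * b + 1)) = - y (2 * t 0 + 1)"
      using sum_position[where q = 0 and t = t and y = "\<lambda>b. y (2 * b + 1)", OF _ t0(1)] 2
      by (simp add: coef_def sum_negf)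
    ultimately show ?thesis unfolding iff using 2 by (simp add: rhs_coef_def cong_iff_dvd_diff)
  next
    case 3
    have "(\<Sum>b<n. coef md q True (positions t b) * y (2 * b + 1)) = y (2 * t q + 1) - y (2 * t 0 + 1)"
      using sum_position[where q = 0 and t = t and y = "\<lambda>b. y (2 * b + 1)", OF _ t0(1)] sum_position[where t = t and y = "\<lambda>b. y (2 * b + 1)", OF q t0(2)] 3
      by (simp add: coef_def left_diff_distrib sum_subtractf)
    moreover have "(\<Sum>b<n. coef md q False (positions t b) * y (2 * b)) = 0"
      using 3 by (simp add: coef_def)
    ultimately show ?thesis unfolding iff using 3 by (simp add: rhs_coef_def cong_iff_dvd_diff)
  qed
qed

lemma init_eqn_iff:
  assumes "c < n"
  shows "satisfies_eq p (2 * n) (init_eqn n c) y \<longleftrightarrow> [y (2 * c + 1) = 1] (mod p)"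
proof -
  have X: "\<forall>b<n. [init_eqn n c (2 * b) = 0] (mod p)"
  proof (intro allI impI)
    fix b assume "b < n"
    moreover have "2 * b \<noteq> 2 * c + 1" by presburger
    ultimately show "[init_eqn n c (2 * b) = 0] (mod p)" by (simp add: init_eqn_def)
  qed
  have S: "\<forall>b<n. [init_eqn n c (2 * b + 1) = of_bool (b = c)] (mod p)"
  proof (intro allI impI)
    fix b
    have "2 * b + 1 \<noteq> 2 * n" by presburger
    then show "[init_eqn n c (2 * b + 1) = of_bool (b = c)] (mod p)" by (simp add: init_eqn_def)
  qed
  have R: "[init_eqn n c (2 * n) = 1] (mod p)" by (simp add: init_eqn_def)
  have "(\<Sum>b<n. of_bool (b = c) * y (2 * b + 1)) = (\<Sum>b<n. if b = c then y (2 * b + 1) else 0)"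
    by (rule sum.cong) auto
  also have "\<dots> = y (2 * c + 1)" using assms by simp
  finally have "(\<Sum>b<n. of_bool (b = c) * y (2 * b + 1)) = y (2 * c + 1)" .
  then show ?thesis
    unfolding satisfies_eq_pairs[OF X S R, of y] by (simp only: mult_zero_left sum.neutral_const add_0)
qed

section \<open>Homomorphisms versus solvability\<close>

definition tmpl_tuple :: "(nat \<Rightarrow> nat) \<Rightarrow> bool" where
  "tmpl_tuple f \<longleftrightarrow> map f [0..<12] \<in> tmpl_rel"

lemma tmpl_tuple_iff:
  "tmpl_tuple f \<longleftrightarrow>
    (\<forall>j<6. f j \<in> {0, 1}) \<and> (\<Sum>j<6. f j) mod 2 = 1 \<and> (\<forall>j\<in>{6..<12}. f j = 6) \<or>
    (\<forall>j<6. f j = 2) \<and> (\<forall>j\<in>{6..<12}. f j \<in> {3, 4, 5}) \<and> (\<Sum>j\<in>{6..<12}. f j) mod 3 = 1"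
proof -
  have "[0..<12] = [0..<6] @ [6..<12::nat]"
    using upt_add_eq_append[of 0 6 6] by (simp only: numeral_plus_numeral arith_simps zero_le)
  then have split: "map f [0..<12] = map f [0..<6] @ map f [6..<12]" by (simp only: map_append)
  have s1: "sum_list (map f [0..<6]) = (\<Sum>j<6. f j)"
    by (rule sum_list_upt)
  have s2: "sum_list (map f [6..<12]) = (\<Sum>j\<in>{6..<12}. f j)"
    by (simp only: interv_sum_list_conv_sum_set_nat set_upt)
  have l: "length (map f [0..<6]) = 6" "length (map f [6..<12]) = 6" by simp_all
  have set1: "set (map f [0..<6]) = f ` {..<6}" and set2: "set (map f [6..<12]) = f ` {6..<12}"
    by (simp_all only: set_map set_upt atLeast0LessThan)
  show ?thesis
    unfolding tmpl_tuple_def split append_in_tmpl_rel[OF l] s1 s2 set1 set2 image_subset_iff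
    by (simp only: singleton_iff lessThan_iff Ball_def)
qed

text \<open>A homomorphism solves the system of \<open>c\<close> with \<open>s = 1\<close> on the
  sort of \<open>h c\<close> and zeros on the other sort, where the homogeneous equations hold
  trivially. Conversely, the solutions for different elements must be glued: within a component, one
  representative decides which half is active and supplies the values.\<close>

theorem hom_iff_solvable:
  assumes T: "\<And>t. t \<in> \<T> \<Longrightarrow> \<forall>j<12. t j < n"
  shows "(\<exists>h. (\<forall>b<n. h b < (7::nat)) \<and> (\<forall>t\<in>\<T>. tmpl_tuple (h \<circ> t))) \<longleftrightarrow>
    (\<forall>c<n. solvable n \<T> 0 c \<and> (solvable n \<T> 1 c \<or> solvable n \<T> 2 c))"
proof
  assume "\<exists>h. (\<forall>b<n. h b < (7::nat)) \<and> (\<forall>t\<in>\<T>. tmpl_tuple (h \<circ> t))"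
  then obtain h where hom: "\<And>t. t \<in> \<T> \<Longrightarrow> tmpl_tuple (h \<circ> t)" by blast
  define fs where "fs b = first_sort (h b)" for b
  have cases: "((\<forall>j<6. h (t j) \<in> {0, 1}) \<and> (\<Sum>j<6. h (t j)) mod 2 = 1 \<and> (\<forall>j\<in>{6..<12}. h (t j) = 6)) \<or>
    ((\<forall>j<6. h (t j) = 2) \<and> (\<forall>j\<in>{6..<12}. h (t j) \<in> {3, 4, 5}) \<and> (\<Sum>j\<in>{6..<12}. h (t j)) mod 3 = 1)"
    if "t \<in> \<T>" for t using hom[OF that] unfolding tmpl_tuple_iff comp_def .
  have sort: "(\<forall>j<12. fs (t j)) \<or> (\<forall>j<12. \<not> fs (t j))" if "t \<in> \<T>" for t
  proof -
    have j: "j < 6 \<or> j \<in> {6..<12}" if "j < 12" for j :: nat using that by auto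
    from cases[OF that] show ?thesis
    proof
      assume a: "(\<forall>j<6. h (t j) \<in> {0, 1}) \<and> (\<Sum>j<6. h (t j)) mod 2 = 1 \<and> (\<forall>j\<in>{6..<12}. h (t j) = 6)"
      have "fs (t j)" if "j < 12" for j using j[OF that] a unfolding fs_def first_sort_def by auto
      then show ?thesis by blast
    next
      assume a: "(\<forall>j<6. h (t j) = 2) \<and> (\<forall>j\<in>{6..<12}. h (t j) \<in> {3, 4, 5}) \<and> (\<Sum>j\<in>{6..<12}. h (t j)) mod 3 = 1"
      have "\<not> fs (t j)" if "j < 12" for j
        using j[OF that]
      proof
        assume "j < 6"
        then have "h (t j) = 2" using a by blast
        then show ?thesis unfolding fs_def first_sort_def by simp
      next
        assume "j \<in> {6..<12}"
        then have "h (t j) \<in> {3, 4, 5}" using a by blast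
        then show ?thesis unfolding fs_def first_sort_def by auto
      qed
      then show ?thesis by blast
    qed
  qed
  show "\<forall>c<n. solvable n \<T> 0 c \<and> (solvable n \<T> 1 c \<or> solvable n \<T> 2 c)"
  proof (intro allI impI conjI)
    fix c assume c: "c < n"
    \<comment> \<open>Mode 0 does not constrain the \<open>s\<close> columns, so the constant 1
      meets the initial equation of every \<open>c\<close>.\<close>
    define y0 where "y0 j = (if odd j then 1 else of_bool (h (j div 2) \<in> {3, 4, 5, 6}) :: int)" for j
    have "satisfies_eq (modulus 0) (2 * n) (eqn n 0 q t) y0" if t: "t \<in> \<T>" and q: "q < 12" for t q
    proof -
      have "of_bool (h (t q) \<in> {3, 4, 5, 6}) = (of_bool (6 \<le> q) :: int)"
      proof (cases "q < 6")
        case True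
        then show ?thesis using cases[OF t] by auto
      next
        case False
        then have "q \<in> {6..<12}" using q by simp
        then show ?thesis using cases[OF t] by auto
      qed
      then have "y0 (2 * t q) = of_bool (6 \<le> q)" unfolding y0_def by simp
      then show ?thesis unfolding eqn_iff[OF T[OF t] q] by simp
    qed
    moreover have "satisfies_eq (modulus 0) (2 * n) (init_eqn n c) y0"
      unfolding init_eqn_iff[OF c] y0_def by simp
    ultimately show "solvable n \<T> 0 c" unfolding solvable_def by blast
    show "solvable n \<T> 1 c \<or> solvable n \<T> 2 c"
    proof (cases "fs c")
      case True
      define y where "y j = (if odd j then of_bool (fs (j div 2))
        else if h (j div 2) \<in> {0, 1} then int (h (j div 2)) else 0 :: int)" for j
      have "satisfies_eq (modulus 1) (2 * n) (eqn n 1 q t) y" if t: "t \<in> \<T>" and q: "q < 12" for t q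
      proof -
        have s: "fs (t q) = fs (t 0)" using sort[OF t] q by auto
        have "[(\<Sum>j\<in>side 1. y (2 * t j)) = y (2 * t 0 + 1)] (mod 2)"
          using cases[OF t]
        proof
          assume a: "(\<forall>j<6. h (t j) \<in> {0, 1}) \<and> (\<Sum>j<6. h (t j)) mod 2 = 1 \<and> (\<forall>j\<in>{6..<12}. h (t j) = 6)"
          then have "(\<Sum>j\<in>side 1. y (2 * t j)) = (\<Sum>j<6. int (h (t j)))"
            unfolding side_def y_def by (intro sum.cong) auto
          moreover have "fs (t 0)"
          proof -
            have "h (t 0) \<in> {0, 1}" using a by (meson zero_less_numeral)
            then show ?thesis unfolding fs_def first_sort_def by auto
          qed
          moreover have "(\<Sum>j<6. int (h (t j))) mod 2 = 1"
            using a by (metis of_nat_1 of_nat_mod of_nat_numeral of_nat_sum)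
          ultimately show ?thesis unfolding cong_def y_def by simp
        next
          assume a: "(\<forall>j<6. h (t j) = 2) \<and> (\<forall>j\<in>{6..<12}. h (t j) \<in> {3, 4, 5}) \<and> (\<Sum>j\<in>{6..<12}. h (t j)) mod 3 = 1"
          then have "(\<Sum>j\<in>side 1. y (2 * t j)) = 0"
            unfolding side_def y_def by (intro sum.neutral) auto
          moreover have "\<not> fs (t 0)" using a unfolding fs_def first_sort_def by auto
          ultimately show ?thesis unfolding cong_def y_def by simp
        qed
        moreover have "y (2 * t q + 1) = y (2 * t 0 + 1)" unfolding y_def using s by simp
        ultimately show ?thesis unfolding eqn_iff[OF T[OF t] q] by (simp add: modulus_def)
      qed
      moreover have "satisfies_eq (modulus 1) (2 * n) (init_eqn n c) y"
        unfolding init_eqn_iff[OF c] y_def using True by simp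
      ultimately show ?thesis unfolding solvable_def by blast
    next
      case False
      define y where "y j = (if odd j then of_bool (\<not> fs (j div 2))
        else if h (j div 2) \<in> {3, 4, 5} then int (h (j div 2)) else 0 :: int)" for j
      have "satisfies_eq (modulus 2) (2 * n) (eqn n 2 q t) y" if t: "t \<in> \<T>" and q: "q < 12" for t q
      proof -
        have s: "fs (t q) = fs (t 0)" using sort[OF t] q by auto
        have "[(\<Sum>j\<in>side 2. y (2 * t j)) = y (2 * t 0 + 1)] (mod 3)"
          using cases[OF t]
        proof
          assume a: "(\<forall>j<6. h (t j) \<in> {0, 1}) \<and> (\<Sum>j<6. h (t j)) mod 2 = 1 \<and> (\<forall>j\<in>{6..<12}. h (t j) = 6)"
          then have "(\<Sum>j\<in>side 2. y (2 * t j)) = 0"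
            unfolding side_def y_def by (intro sum.neutral) auto
          moreover have "fs (t 0)"
          proof -
            have "h (t 0) \<in> {0, 1}" using a by (meson zero_less_numeral)
            then show ?thesis unfolding fs_def first_sort_def by auto
          qed
          ultimately show ?thesis unfolding cong_def y_def by simp
        next
          assume a: "(\<forall>j<6. h (t j) = 2) \<and> (\<forall>j\<in>{6..<12}. h (t j) \<in> {3, 4, 5}) \<and> (\<Sum>j\<in>{6..<12}. h (t j)) mod 3 = 1"
          then have "(\<Sum>j\<in>side 2. y (2 * t j)) = (\<Sum>j\<in>{6..<12}. int (h (t j)))"
            unfolding side_def y_def by (intro sum.cong) auto
          moreover have "\<not> fs (t 0)" using a unfolding fs_def first_sort_def by auto
          moreover have "(\<Sum>j\<in>{6..<12}. int (h (t j))) mod 3 = 1"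
            using a by (metis of_nat_1 of_nat_mod of_nat_numeral of_nat_sum)
          ultimately show ?thesis unfolding cong_def y_def by simp
        qed
        moreover have "y (2 * t q + 1) = y (2 * t 0 + 1)" unfolding y_def using s by simp
        ultimately show ?thesis unfolding eqn_iff[OF T[OF t] q] by (simp add: modulus_def)
      qed
      moreover have "satisfies_eq (modulus 2) (2 * n) (init_eqn n c) y"
        unfolding init_eqn_iff[OF c] y_def using False by simp
      ultimately show ?thesis unfolding solvable_def by blast
    qed
  qed
next
  assume sol: "\<forall>c<n. solvable n \<T> 0 c \<and> (solvable n \<T> 1 c \<or> solvable n \<T> 2 c)"
  \<comment> \<open>A linear substitute for connectedness: the \<open>s\<close> values of
    \<open>b\<close> and \<open>c\<close> agree in every solution. It holds along tuples, and it
    suffices to carry \<open>s = 1\<close> from a representative over to \<open>c\<close>.\<close>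
  define tied where "tied b c \<longleftrightarrow> b < n \<and> (\<forall>md\<in>{1, 2}. \<forall>y.
      (\<forall>t\<in>\<T>. \<forall>q<12. satisfies_eq (modulus md) (2 * n) (eqn n md q t) y) \<longrightarrow>
      [y (2 * b + 1) = y (2 * c + 1)] (mod modulus md))" for b c
  define rep where "rep c = (SOME b. tied b c)" for c
  have tied_refl: "tied c c" if "c < n" for c using that unfolding tied_def by simp
  have tied_rep: "tied (rep c) c" if "c < n" for c
    unfolding rep_def by (rule someI[of "\<lambda>b. tied b c"]) (rule tied_refl[OF that])
  have tied_tuple: "tied b (t q) \<longleftrightarrow> tied b (t 0)" if t: "t \<in> \<T>" and q: "q < 12" for b t q
  proof (cases "q = 0")
    case False
    have "[y (2 * t q + 1) = y (2 * t 0 + 1)] (mod modulus md)"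
      if "md \<in> {1, 2}" "\<forall>t\<in>\<T>. \<forall>q<12. satisfies_eq (modulus md) (2 * n) (eqn n md q t) y" for md y
    proof -
      have "satisfies_eq (modulus md) (2 * n) (eqn n md q t) y" using that(2) t q by blast
      then show ?thesis using eqn_iff[OF T[OF t] q, of md y] that(1) False by auto
    qed
    then show ?thesis unfolding tied_def by (meson cong_sym cong_trans)
  qed simp
  \<comment> \<open>All entries of a tuple are tied to the same elements, so the choice operator
    picks the same representative for them.\<close>
  have rep_tuple: "rep (t q) = rep (t 0)" if "t \<in> \<T>" "q < 12" for t q
    unfolding rep_def using tied_tuple[OF that] by simp
  define kind where "kind c = (if solvable n \<T> 1 (rep c) then 1 else 2 :: nat)" for c
  have rep_n: "rep c < n" if "c < n" for c using tied_rep[OF that] unfolding tied_def by blast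
  have "solvable n \<T> (if solvable n \<T> 1 b then 1 else 2) b" if "b < n" for b
    using sol that by auto
  then have "\<forall>b. \<exists>y. b < n \<longrightarrow>
      satisfies_eq (modulus (if solvable n \<T> 1 b then 1 else 2)) (2 * n) (init_eqn n b) y \<and>
      (\<forall>t\<in>\<T>. \<forall>q<12. satisfies_eq (modulus (if solvable n \<T> 1 b then 1 else 2)) (2 * n)
         (eqn n (if solvable n \<T> 1 b then 1 else 2) q t) y)"
    unfolding solvable_def[of _ _ "if _ then _ else _"] by blast
  from choice[OF this] obtain y where y: "\<forall>b. b < n \<longrightarrow>
      satisfies_eq (modulus (if solvable n \<T> 1 b then 1 else 2)) (2 * n) (init_eqn n b) (y b) \<and>
      (\<forall>t\<in>\<T>. \<forall>q<12. satisfies_eq (modulus (if solvable n \<T> 1 b then 1 else 2)) (2 * n)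
         (eqn n (if solvable n \<T> 1 b then 1 else 2) q t) (y b))" by blast
  have y0: "satisfies_eq (modulus (kind c)) (2 * n) (init_eqn n (rep c)) (y (rep c)) \<and>
     (\<forall>t\<in>\<T>. \<forall>q<12. satisfies_eq (modulus (kind c)) (2 * n) (eqn n (kind c) q t) (y (rep c)))"
    if "c < n" for c
    unfolding kind_def using y rep_n[OF that] by blast
  define z where "z c = y (rep c)" for c
  have kind: "kind c \<in> {1, 2}" for c unfolding kind_def by simp
  have s1: "[z c (2 * c + 1) = 1] (mod modulus (kind c))" if c: "c < n" for c
  proof -
    have "[z c (2 * rep c + 1) = 1] (mod modulus (kind c))"
      using y0[OF c] init_eqn_iff[OF rep_n[OF c]] unfolding z_def by blast
    moreover have "[z c (2 * rep c + 1) = z c (2 * c + 1)] (mod modulus (kind c))"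
      using tied_rep[OF c] y0[OF c] kind[of c] unfolding tied_def z_def by blast
    ultimately show ?thesis using cong_sym cong_trans by blast
  qed
  define isL where "isL b \<longleftrightarrow> (\<exists>t\<in>\<T>. \<exists>j<6. t j = b)" for b
  \<comment> \<open>Here mode 0 is used: an element in a left and a right position would have to be
    both 0 and 1 modulo 2.\<close>
  have notL: "\<not> isL (t j)" if t: "t \<in> \<T>" and j: "j \<in> {6..<12}" for t j
  proof
    assume "isL (t j)"
    then obtain t' j' where t': "t' \<in> \<T>" "j' < 6" "t' j' = t j" unfolding isL_def by blast
    have "t 0 < n" using T[OF t] by simp
    then obtain w where w: "\<forall>t\<in>\<T>. \<forall>q<12. satisfies_eq (modulus 0) (2 * n) (eqn n 0 q t) w"
      using sol unfolding solvable_def by blast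
    have j12: "j < 12" "j' < 12" using j t'(2) by simp_all
    have "satisfies_eq (modulus 0) (2 * n) (eqn n 0 j t) w" "satisfies_eq (modulus 0) (2 * n) (eqn n 0 j' t') w"
      using w t t'(1) j12 by blast+
    then have "[w (2 * t j) = of_bool (6 \<le> j)] (mod 2)" "[w (2 * t' j') = of_bool (6 \<le> j')] (mod 2)"
      using eqn_iff[OF T[OF t] j12(1), of 0 w] eqn_iff[OF T[OF t'(1)] j12(2), of 0 w] by simp_all
    then show False using t' j by (simp add: cong_def)
  qed
  define h where "h b = (if kind b = 1 then if isL b then nat (z b (2 * b) mod 2) else 6
      else if isL b then 2 else 3 + nat (z b (2 * b) mod 3))" for b
  have h7: "h b < 7" for b
  proof -
    have "z b (2 * b) mod 2 < 2" "z b (2 * b) mod 3 < 3" by simp_all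
    then have "nat (z b (2 * b) mod 2) < 2" "nat (z b (2 * b) mod 3) < 3" by linarith+
    then show ?thesis unfolding h_def by simp
  qed
  have "tmpl_tuple (h \<circ> t)" if t: "t \<in> \<T>" for t
  proof -
    define c where "c = t 0"
    have c: "c < n" unfolding c_def using T[OF t] by simp
    have same: "kind (t q) = kind c" "z (t q) = z c" if "q < 12" for q
      unfolding kind_def z_def c_def using rep_tuple[OF t that] by simp_all
    have L: "isL (t j)" if "j < 6" for j unfolding isL_def using t that by blast
    have zero: "(0::nat) < 12" by simp
    have "satisfies_eq (modulus (kind c)) (2 * n) (eqn n (kind c) 0 t) (z c)"
      using y0[OF c] t unfolding z_def by simp
    then have "[(\<Sum>j\<in>side (kind c). z c (2 * t j)) = z c (2 * c + 1)] (mod modulus (kind c))"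
      using eqn_iff[OF T[OF t] zero, of "kind c" "z c"] kind[of c] unfolding c_def by auto
    then have sum: "[(\<Sum>j\<in>side (kind c). z c (2 * t j)) = 1] (mod modulus (kind c))"
      using s1[OF c] by (rule cong_trans)
    show ?thesis
    proof (cases "kind c = 1")
      case True
      have hL: "int (h (t j)) = z c (2 * t j) mod 2" if "j < 6" for j
        unfolding h_def using same[of j] L[OF that] True that by simp
      have h01: "h (t j) \<in> {0, 1}" if "j < 6" for j
        using hL[OF that] by auto
      have hR: "h (t j) = 6" if "j \<in> {6..<12}" for j
        unfolding h_def using same[of j] notL[OF t that] True that by simp
      have "[int (\<Sum>j<6. h (t j)) = (\<Sum>j<6. z c (2 * t j))] (mod 2)"
        unfolding of_nat_sum by (rule cong_sum) (use hL in \<open>simp add: cong_def\<close>)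
      also have "[(\<Sum>j<6. z c (2 * t j)) = 1] (mod 2)"
        using sum True by (simp add: side_def modulus_def)
      finally have "(\<Sum>j<6. h (t j)) mod 2 = 1"
        unfolding cong_def by (metis of_nat_1 of_nat_eq_iff of_nat_mod of_nat_numeral one_mod_two_eq_one)
      then show ?thesis unfolding tmpl_tuple_iff comp_def using h01 hR by blast
    next
      case False
      then have t2: "kind c = 2" using kind[of c] by simp
      have hR: "int (h (t j)) = 3 + z c (2 * t j) mod 3" if "j \<in> {6..<12}" for j
        unfolding h_def using same[of j] notL[OF t that] t2 that by simp
      have h345: "h (t j) \<in> {3, 4, 5}" if "j \<in> {6..<12}" for j
      proof -
        have "0 \<le> z c (2 * t j) mod 3" "z c (2 * t j) mod 3 < 3" by simp_all
        then have "3 \<le> h (t j)" "h (t j) < 6" using hR[OF that] by linarith+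
        then show ?thesis by auto
      qed
      have hL: "h (t j) = 2" if "j < 6" for j
        unfolding h_def using same[of j] L[OF that] t2 that by simp
      have "[int (\<Sum>j\<in>{6..<12}. h (t j)) = (\<Sum>j\<in>{6..<12}. z c (2 * t j))] (mod 3)"
        unfolding of_nat_sum by (rule cong_sum) (use hR in \<open>simp add: cong_def\<close>)
      also have "[(\<Sum>j\<in>{6..<12}. z c (2 * t j)) = 1] (mod 3)"
        using sum t2 by (simp add: side_def modulus_def)
      finally have "int (\<Sum>j\<in>{6..<12}. h (t j)) mod 3 = 1" unfolding cong_def by simp
      then have "int ((\<Sum>j\<in>{6..<12}. h (t j)) mod 3) = int 1" unfolding zmod_int by simp
      then have "(\<Sum>j\<in>{6..<12}. h (t j)) mod 3 = 1" by (simp only: of_nat_eq_iff)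
      then show ?thesis unfolding tmpl_tuple_iff comp_def using h345 hL by blast
    qed
  qed
  with h7 show "\<exists>h. (\<forall>b<n. h b < (7::nat)) \<and> (\<forall>t\<in>\<T>. tmpl_tuple (h \<circ> t))" by blast
qed

section \<open>Gaussian elimination on tapes\<close>

datatype tri = Z0 | Z1 | Z2

primrec tri_int :: "tri \<Rightarrow> int" where
  "tri_int Z0 = 0" | "tri_int Z1 = 1" | "tri_int Z2 = 2"

definition int_tri :: "int \<Rightarrow> tri" where
  "int_tri x = (if x = 0 then Z0 else if x = 1 then Z1 else Z2)"

lemma tri_int_int_tri: "0 \<le> x \<Longrightarrow> x < 3 \<Longrightarrow> tri_int (int_tri x) = x"
  unfolding int_tri_def by auto

lemma int_tri_eq_Z0: "0 \<le> x \<Longrightarrow> x < 3 \<Longrightarrow> int_tri x = Z0 \<longleftrightarrow> x = 0"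
  unfolding int_tri_def by auto

instance tri :: finite
proof
  have "(UNIV :: tri set) \<subseteq> {Z0, Z1, Z2}" using tri.exhaust by auto
  then show "finite (UNIV :: tri set)" by (rule finite_subset) simp
qed

text \<open>Tuple positions as a finite type, so that a set of positions fits into a tape cell or a
  register.\<close>

typedef ix = "{..<12::nat}" morphisms ix_nat nat_ix
  by (rule exI[of _ 0]) simp

instance ix :: finite
proof
  have "(UNIV :: ix set) \<subseteq> nat_ix ` {..<12}"
    using nat_ix_cases by blast
  then show "finite (UNIV :: ix set)" by (rule finite_subset) simp
qed

datatype cell_kind = KX | KS | KR

instance cell_kind :: finite
proof
  have "(UNIV :: cell_kind set) \<subseteq> {KX, KS, KR}" using cell_kind.exhaust by auto
  then show "finite (UNIV :: cell_kind set)" by (rule finite_subset) simp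
qed

text \<open>One cell per column. Indices are never stored as numbers: the current tuple, pivot
  column and element are marks on the cells, which a sweep can shift with bounded memory.
  \<open>w_val\<close> holds the equation being inserted.\<close>

record wcell =
  w_kind :: cell_kind
  w_marks :: "ix set"
  w_piv :: bool
  w_cur :: bool
  w_val :: tri

instance wcell_ext :: (finite) finite
proof
  have "(UNIV :: 'a wcell_ext set) \<subseteq> range (\<lambda>(k, m, p, c, v, x). wcell_ext k m p c v x)"
  proof
    fix y :: "'a wcell_ext"
    show "y \<in> range (\<lambda>(k, m, p, c, v, x). wcell_ext k m p c v x)"
      by (cases y rule: wcell.cases_scheme) (auto intro: range_eqI[of _ _ "(_, _, _, _, _, _)"])
  qed
  then show "finite (UNIV :: 'a wcell_ext set)" by (rule finite_subset) simp
qed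

record reg =
  r_mode :: tri
  r_eq :: ix
  r_bad :: bool
  r_ok0 :: bool
  r_ok1 :: bool
  r_fail :: bool
  r_done :: bool
  r_f :: tri
  r_g :: tri
  r_b1 :: bool
  r_b2 :: bool
  r_m1 :: "ix set"
  r_m2 :: "ix set"
  r_inc :: "ix set"
  r_more :: bool

instance reg_ext :: (finite) finite
proof
  have "(UNIV :: 'a reg_ext set) \<subseteq> range (\<lambda>(a, b, c, d, e, f, g, h, i, j, k, l, m, n, p, x).
      reg_ext a b c d e f g h i j k l m n p x)"
  proof
    fix y :: "'a reg_ext"
    show "y \<in> range (\<lambda>(a, b, c, d, e, f, g, h, i, j, k, l, m, n, p, x). reg_ext a b c d e f g h i j k l m n p x)"
      by (cases y rule: reg.cases_scheme)
        (auto intro: range_eqI[of _ _ "(_, _, _, _, _, _, _, _, _, _, _, _, _, _, _, _)"])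
  qed
  then show "finite (UNIV :: 'a reg_ext set)" by (rule finite_subset) simp
qed

type_synonym mprog = "(reg, isym, wcell option, tri \<times> bool) prog"
type_synonym mstore = "(reg, isym, wcell option, tri \<times> bool) store"

section \<open>Sweeps over the work and matrix tapes\<close>

definition keep :: "reg \<Rightarrow> tri \<times> bool \<times> bool \<times> bool \<times> bool \<times> bool" where
  "keep r = (r_mode r, r_bad r, r_ok0 r, r_ok1 r, r_fail r, r_done r)"

definition on_reg :: "(reg \<Rightarrow> reg) \<Rightarrow> mprog" where
  "on_reg f = Act (\<lambda>r i w m. (f r, (i, 0), (w, 0), (m, 0)))"

definition move :: "int \<Rightarrow> int \<Rightarrow> int \<Rightarrow> mprog" where
  "move di dw dm = Act (\<lambda>r i w m. (r, (i, di), (w, dw), (m, dm)))"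

definition rewind_W :: mprog where
  "rewind_W = Seq (move 0 (-1) 0) (Seq (While (\<lambda>r i w m. w \<noteq> None) (move 0 (-1) 0)) (move 0 1 0))"

definition rewind_M :: mprog where
  "rewind_M = Seq (move 0 0 (-1)) (Seq (While (\<lambda>r i w m. \<not> snd m) (move 0 0 (-1))) (move 0 0 1))"

definition rewind_I :: mprog where
  "rewind_I = Seq (While (\<lambda>r i w m. i \<noteq> IS) (move (-1) 0 0)) (move 1 0 0)"

definition sweep_W :: "(reg \<Rightarrow> wcell \<Rightarrow> reg \<times> wcell) \<Rightarrow> mprog" where
  "sweep_W u = Seq (While (\<lambda>r i w m. w \<noteq> None)
     (Act (\<lambda>r i w m. (fst (u r (the w)), (i, 0), (Some (snd (u r (the w))), 1), (m, 0))))) rewind_W"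

definition sweep_M :: "(reg \<Rightarrow> wcell \<Rightarrow> tri \<Rightarrow> reg \<times> wcell \<times> tri) \<Rightarrow> mprog" where
  "sweep_M u = Seq (While (\<lambda>r i w m. w \<noteq> None)
     (Act (\<lambda>r i w m. (fst (u r (the w) (fst m)), (i, 0), (Some (fst (snd (u r (the w) (fst m)))), 1),
        ((snd (snd (u r (the w) (fst m))), snd m), 1))))) rewind_W"

definition wtape :: "nat \<Rightarrow> (nat \<Rightarrow> wcell) \<Rightarrow> int \<Rightarrow> wcell option" where
  "wtape D ws x = (if 0 \<le> x \<and> x \<le> int D then Some (ws (nat x)) else None)"

lemma wtape_cong: "(\<And>j. j \<le> D \<Longrightarrow> ws j = ws' j) \<Longrightarrow> wtape D ws = wtape D ws'"
  unfolding wtape_def by (auto simp: fun_eq_iff)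

lemma wtape_upd: "j \<le> D \<Longrightarrow> (wtape D ws)(int j := Some x) = wtape D (ws(j := x))"
  unfolding wtape_def by (auto simp: fun_eq_iff)

lemma runs_on_reg: "runs (on_reg f) 1 (r, ti, tw, tm) (f r, ti, tw, tm)"
  using runs_Act[of "\<lambda>r i w m. (f r, (i, 0), (w, 0), (m, 0))" r ti tw tm]
  unfolding on_reg_def by (simp add: tape_act_scan)

lemma runs_move:
  assumes "di \<in> {-1, 0, 1}" "dw \<in> {-1, 0, 1}" "dm \<in> {-1, 0, 1}"
  shows "runs (move di dw dm) 1 (r, (hi, ci), (hw, cw), (hm, cm))
    (r, (hi + di, ci), (hw + dw, cw), (hm + dm, cm))"
proof -
  have "sgn di = di" "sgn dw = dw" "sgn dm = dm" using assms by auto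
  then show ?thesis
    using runs_Act[of "\<lambda>r i w m. (r, (i, di), (w, dw), (m, dm))" r "(hi, ci)" "(hw, cw)" "(hm, cm)"]
    unfolding move_def by simp
qed

lemma runs_scan_W:
  assumes "\<And>x. x \<le> int d \<Longrightarrow> 0 \<le> x \<Longrightarrow> cw (hw - x) \<noteq> None" "cw (hw - int d - 1) = None"
  shows "runs (While (\<lambda>r i w m. w \<noteq> None) (move 0 (-1) 0)) (3 * d + 4) (r, ti, (hw, cw), tm)
    (r, ti, (hw - int d - 1, cw), tm)"
  using assms
proof (induction d arbitrary: hw)
  case 0
  obtain hi ci hm cm where t: "ti = (hi, ci)" "tm = (hm, cm)" by (cases ti; cases tm) auto
  have "runs (move 0 (-1) 0) 1 (r, ti, (hw, cw), tm) (r, ti, (hw - 1, cw), tm)"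
    unfolding t using runs_move[of 0 "-1" 0 r hi ci hw cw hm cm] by simp
  moreover have "runs (While (\<lambda>r i w m. w \<noteq> None) (move 0 (-1) 0)) 1 (r, ti, (hw - 1, cw), tm) (r, ti, (hw - 1, cw), tm)"
    by (rule runs_While_False) (use 0 in simp)
  ultimately have "runs (While (\<lambda>r i w m. w \<noteq> None) (move 0 (-1) 0)) (1 + 1 + 2) (r, ti, (hw, cw), tm) (r, ti, (hw - 1, cw), tm)"
    by (intro runs_While_True) (use 0(1)[of 0] in simp_all)
  then show ?case by (simp add: eval_nat_numeral)
next
  case (Suc d)
  obtain hi ci hm cm where t: "ti = (hi, ci)" "tm = (hm, cm)" by (cases ti; cases tm) auto
  have "runs (move 0 (-1) 0) 1 (r, ti, (hw, cw), tm) (r, ti, (hw - 1, cw), tm)"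
    unfolding t using runs_move[of 0 "-1" 0 r hi ci hw cw hm cm] by simp
  moreover have "runs (While (\<lambda>r i w m. w \<noteq> None) (move 0 (-1) 0)) (3 * d + 4) (r, ti, (hw - 1, cw), tm)
      (r, ti, (hw - 1 - int d - 1, cw), tm)"
  proof (rule Suc.IH)
    show "cw (hw - 1 - x) \<noteq> None" if "x \<le> int d" "0 \<le> x" for x
      using Suc.prems(1)[of "x + 1"] that by (simp add: algebra_simps)
    show "cw (hw - 1 - int d - 1) = None" using Suc.prems(2) by (simp add: algebra_simps)
  qed
  ultimately have "runs (While (\<lambda>r i w m. w \<noteq> None) (move 0 (-1) 0)) (1 + (3 * d + 4) + 2) (r, ti, (hw, cw), tm)
      (r, ti, (hw - 1 - int d - 1, cw), tm)"
    by (intro runs_While_True) (use Suc.prems(1)[of 0] in simp_all)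
  then show ?case by (simp add: algebra_simps)
qed

lemma runs_rewind_W: "runs rewind_W (3 * D + 8) (r, ti, (int D + 1, wtape D ws), tm) (r, ti, (0, wtape D ws), tm)"
proof -
  obtain hi ci hm cm where t: "ti = (hi, ci)" "tm = (hm, cm)" by (cases ti; cases tm) auto
  have 1: "runs (move 0 (-1) 0) 1 (r, ti, (int D + 1, wtape D ws), tm) (r, ti, (int D, wtape D ws), tm)"
    unfolding t using runs_move[of 0 "-1" 0 r hi ci "int D + 1" "wtape D ws" hm cm] by simp
  have "runs (While (\<lambda>r i w m. w \<noteq> None) (move 0 (-1) 0)) (3 * D + 4) (r, ti, (int D, wtape D ws), tm)
      (r, ti, (int D - int D - 1, wtape D ws), tm)"
    by (rule runs_scan_W) (auto simp: wtape_def)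
  then have 2: "runs (While (\<lambda>r i w m. w \<noteq> None) (move 0 (-1) 0)) (3 * D + 4) (r, ti, (int D, wtape D ws), tm)
      (r, ti, (-1, wtape D ws), tm)" by simp
  have 3: "runs (move 0 1 0) 1 (r, ti, (-1, wtape D ws), tm) (r, ti, (0, wtape D ws), tm)"
    unfolding t using runs_move[of 0 1 0 r hi ci "-1" "wtape D ws" hm cm] by simp
  show ?thesis unfolding rewind_W_def
    by (rule runs_mono[OF runs_Seq[OF 1 runs_Seq[OF 2 3]]]) simp
qed

text \<open>Reduces a sweep to a check of single cells: \<open>\<rho> j\<close> gives the registers
  when the head reaches column \<open>j\<close>. The loop invariant is a tape whose first
  \<open>j\<close> cells are already the new ones.\<close>

lemma runs_sweep_W:
  assumes u: "\<And>j. j \<le> D \<Longrightarrow> u (\<rho> j) (ws j) = (\<rho> (Suc j), ws' j)"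
  shows "runs (sweep_W u) (6 * D + 20) (\<rho> 0, ti, (0, wtape D ws), tm) (\<rho> (Suc D), ti, (0, wtape D ws'), tm)"
proof -
  let ?wh = "\<lambda>j x. if x < j then ws' x else ws x"
  let ?A = "Act (\<lambda>r i w m. (fst (u r (the w)), (i, 0 :: int), (Some (snd (u r (the w))), 1 :: int), (m, 0 :: int))) :: mprog"
  let ?b = "\<lambda>(r::reg) (i::isym) w (m :: tri \<times> bool). w \<noteq> (None :: wcell option)"
  let ?s = "\<lambda>j. (\<rho> j, ti, (int j, wtape D (?wh j)), tm)"
  have "runs (While ?b ?A) (3 * d + 1) (?s j) (?s (Suc D))" if "d + j = Suc D" for d j
    using that
  proof (induction d arbitrary: j)
    case 0
    have "runs (While ?b ?A) 1 (?s j) (?s j)" by (rule runs_While_False) (use 0 in \<open>simp add: wtape_def\<close>)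
    then show ?case using 0 by simp
  next
    case (Suc d)
    have j: "j \<le> D" using Suc.prems by simp
    have "runs ?A 1 (?s j) (?s (Suc j))"
    proof -
      have sc: "scan (int j, wtape D (?wh j)) = Some (ws j)" using j by (simp add: wtape_def)
      have eq: "(?wh j)(j := ws' j) = ?wh (Suc j)" by (auto simp: fun_eq_iff less_Suc_eq)
      show ?thesis
        using runs_Act[of "\<lambda>r i w m. (fst (u r (the w)), (i, 0 :: int), (Some (snd (u r (the w))), 1 :: int), (m, 0 :: int))"
            "\<rho> j" ti "(int j, wtape D (?wh j))" tm]
        unfolding sc option.sel u[OF j] fst_conv snd_conv store_act.simps tape_act_scan tape_act.simps
          wtape_upd[OF j] eq by (simp add: add.commute)
    qed
    moreover have "runs (While ?b ?A) (3 * d + 1) (?s (Suc j)) (?s (Suc D))" by (rule Suc.IH) (use Suc.prems in simp)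
    ultimately have "runs (While ?b ?A) (1 + (3 * d + 1) + 2) (?s j) (?s (Suc D))"
      by (intro runs_While_True) (use j in \<open>simp_all add: wtape_def\<close>)
    then show ?case by (simp add: eval_nat_numeral)
  qed
  from this[of "Suc D" 0] have 1: "runs (While ?b ?A) (3 * Suc D + 1) (\<rho> 0, ti, (0, wtape D ws), tm) (?s (Suc D))"
    by simp
  have "wtape D (?wh (Suc D)) = wtape D ws'" by (rule wtape_cong) simp
  then have "?s (Suc D) = (\<rho> (Suc D), ti, (int D + 1, wtape D ws'), tm)" by simp
  with 1 have 1: "runs (While ?b ?A) (3 * Suc D + 1) (\<rho> 0, ti, (0, wtape D ws), tm)
    (\<rho> (Suc D), ti, (int D + 1, wtape D ws'), tm)" by (simp only:)
  show ?thesis unfolding sweep_W_def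
    by (rule runs_mono[OF runs_Seq[OF 1 runs_rewind_W]]) simp
qed

text \<open>The matrix head runs along one row in step with the work head and is left at the start
  of the next row; only the work head is rewound.\<close>

lemma runs_sweep_M:
  assumes u: "\<And>j. j \<le> D \<Longrightarrow> u (\<rho> j) (ws j) (fst (mt (mh + int j))) = (\<rho> (Suc j), ws' j, ms j)"
    and mt': "\<And>x. mt' x = (if mh \<le> x \<and> x \<le> mh + int D then (ms (nat (x - mh)), snd (mt x)) else mt x)"
  shows "runs (sweep_M u) (6 * D + 20) (\<rho> 0, ti, (0, wtape D ws), (mh, mt))
    (\<rho> (Suc D), ti, (0, wtape D ws'), (mh + int D + 1, mt'))"
proof -
  let ?wh = "\<lambda>j x. if x < j then ws' x else ws x"
  let ?mt = "\<lambda>j x. if mh \<le> x \<and> x < mh + int j then (ms (nat (x - mh)), snd (mt x)) else mt x"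
  let ?f = "\<lambda>r i w m. (fst (u r (the w) (fst m)), (i, 0 :: int), (Some (fst (snd (u r (the w) (fst m)))), 1 :: int),
        ((snd (snd (u r (the w) (fst m))), snd m), 1 :: int))"
  let ?A = "Act ?f :: mprog"
  let ?b = "\<lambda>(r::reg) (i::isym) w (m :: tri \<times> bool). w \<noteq> (None :: wcell option)"
  let ?s = "\<lambda>j. (\<rho> j, ti, (int j, wtape D (?wh j)), (mh + int j, ?mt j))"
  have "runs (While ?b ?A) (3 * d + 1) (?s j) (?s (Suc D))" if "d + j = Suc D" for d j
    using that
  proof (induction d arbitrary: j)
    case 0
    have "runs (While ?b ?A) 1 (?s j) (?s j)" by (rule runs_While_False) (use 0 in \<open>simp add: wtape_def\<close>)
    then show ?case using 0 by simp
  next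
    case (Suc d)
    have j: "j \<le> D" using Suc.prems by simp
    have "runs ?A 1 (?s j) (?s (Suc j))"
    proof -
      have sc: "scan (int j, wtape D (?wh j)) = Some (ws j)" using j by (simp add: wtape_def)
      have sm: "scan (mh + int j, ?mt j) = mt (mh + int j)" by simp
      have eq: "(?wh j)(j := ws' j) = ?wh (Suc j)" by (auto simp: fun_eq_iff less_Suc_eq)
      have eqm: "(?mt j)(mh + int j := (ms j, snd (mt (mh + int j)))) = ?mt (Suc j)" by (auto simp: fun_eq_iff)
      show ?thesis
        using runs_Act[of ?f "\<rho> j" ti "(int j, wtape D (?wh j))" "(mh + int j, ?mt j)"]
        unfolding sc sm option.sel u[OF j] fst_conv snd_conv store_act.simps tape_act_scan tape_act.simps
          wtape_upd[OF j] eq eqm by (simp add: add.commute add.left_commute)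
    qed
    moreover have "runs (While ?b ?A) (3 * d + 1) (?s (Suc j)) (?s (Suc D))" by (rule Suc.IH) (use Suc.prems in simp)
    ultimately have "runs (While ?b ?A) (1 + (3 * d + 1) + 2) (?s j) (?s (Suc D))"
      by (intro runs_While_True) (use j in \<open>simp_all add: wtape_def\<close>)
    then show ?case by (simp add: eval_nat_numeral)
  qed
  from this[of "Suc D" 0] have 1: "runs (While ?b ?A) (3 * Suc D + 1) (\<rho> 0, ti, (0, wtape D ws), (mh, ?mt 0)) (?s (Suc D))"
    by simp
  have "wtape D (?wh (Suc D)) = wtape D ws'" by (rule wtape_cong) simp
  moreover have "?mt (Suc D) = mt'" unfolding fun_eq_iff mt' by auto
  ultimately have eq: "?s (Suc D) = (\<rho> (Suc D), ti, (int D + 1, wtape D ws'), (mh + int D + 1, mt'))" by simp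
  have "?mt 0 = mt" by (auto simp: fun_eq_iff)
  with 1 eq have 1: "runs (While ?b ?A) (3 * Suc D + 1) (\<rho> 0, ti, (0, wtape D ws), (mh, mt))
    (\<rho> (Suc D), ti, (int D + 1, wtape D ws'), (mh + int D + 1, mt'))" by (simp only:)
  show ?thesis unfolding sweep_M_def
    by (rule runs_mono[OF runs_Seq[OF 1 runs_rewind_W]]) simp
qed

text \<open>\<open>D\<close> rows of \<open>D + 1\<close> entries, stored consecutively; the flag at
  position \<open>-1\<close> is the stop mark for rewinding.\<close>

definition mtape :: "nat \<Rightarrow> (nat \<Rightarrow> nat \<Rightarrow> int) \<Rightarrow> int \<Rightarrow> tri \<times> bool" where
  "mtape D A x = (if 0 \<le> x \<and> x < int (D * Suc D) then (int_tri (A (nat x div Suc D) (nat x mod Suc D)), False)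
     else (Z0, x = -1))"

lemma runs_rewind_M:
  "runs rewind_M (3 * (D * Suc D) + 8) (r, ti, tw, (int (D * Suc D), mtape D A)) (r, ti, tw, (0, mtape D A))"
proof -
  obtain hi ci hw cw where t: "ti = (hi, ci)" "tw = (hw, cw)" by (cases ti; cases tw) auto
  have mv: "runs (move 0 0 (-1)) 1 (r, ti, tw, (h, mtape D A)) (r, ti, tw, (h - 1, mtape D A))" for h
    unfolding t using runs_move[of 0 0 "-1" r hi ci hw cw h "mtape D A"] by simp
  have lp: "runs (While (\<lambda>r i w m. \<not> snd m) (move 0 0 (-1))) (3 * d + 1) (r, ti, tw, (int d - 1, mtape D A))
      (r, ti, tw, (-1, mtape D A))" for d
  proof (induction d)
    case 0
    have "runs (While (\<lambda>r i w m. \<not> snd m) (move 0 0 (-1))) 1 (r, ti, tw, (-1, mtape D A)) (r, ti, tw, (-1, mtape D A))"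
      by (rule runs_While_False) (simp add: mtape_def)
    then show ?case by simp
  next
    case (Suc d)
    have "runs (While (\<lambda>r i w m. \<not> snd m) (move 0 0 (-1))) (1 + (3 * d + 1) + 2) (r, ti, tw, (int (Suc d) - 1, mtape D A))
        (r, ti, tw, (-1, mtape D A))"
    proof (rule runs_While_True)
      show "\<not> snd (scan (int (Suc d) - 1, mtape D A))" by (simp add: mtape_def)
      show "runs (move 0 0 (-1)) 1 (r, ti, tw, (int (Suc d) - 1, mtape D A)) (r, ti, tw, (int d - 1, mtape D A))"
        using mv[of "int (Suc d) - 1"] by simp
    qed (rule Suc.IH)
    then show ?case by (simp add: eval_nat_numeral)
  qed
  have 3: "runs (move 0 0 1) 1 (r, ti, tw, (-1, mtape D A)) (r, ti, tw, (0, mtape D A))"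
    unfolding t using runs_move[of 0 0 1 r hi ci hw cw "-1" "mtape D A"] by simp
  show ?thesis unfolding rewind_M_def
    by (rule runs_mono[OF runs_Seq[OF mv runs_Seq[OF lp 3]]]) simp
qed

definition cell_kind_of :: "nat \<Rightarrow> nat \<Rightarrow> cell_kind" where
  "cell_kind_of D j = (if j = D then KR else if even j then KX else KS)"

definition cells :: "nat \<Rightarrow> (nat \<Rightarrow> ix set) \<Rightarrow> (nat \<Rightarrow> bool) \<Rightarrow> (nat \<Rightarrow> bool) \<Rightarrow> (nat \<Rightarrow> int) \<Rightarrow> nat \<Rightarrow> wcell" where
  "cells D mk pv c v j =
     \<lparr>w_kind = cell_kind_of D j, w_marks = mk j, w_piv = pv j, w_cur = c j, w_val = int_tri (v j)\<rparr>"

definition in_range :: "(nat \<Rightarrow> int) \<Rightarrow> bool" where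
  "in_range v \<longleftrightarrow> (\<forall>j. 0 \<le> v j \<and> v j < 3)"

definition mode_nat :: "tri \<Rightarrow> nat" where
  "mode_nat t = nat (tri_int t)"

section \<open>Row operations steered by a pivot mark\<close>

lemma runs_sweep_W_split:
  assumes "\<And>j. j < D \<Longrightarrow> u (\<rho> j) (ws j) = (\<rho> (Suc j), ws' j)" "u (\<rho> D) (ws D) = (\<rho> (Suc D), ws' D)"
  shows "runs (sweep_W u) (6 * D + 20) (\<rho> 0, ti, (0, wtape D ws), tm) (\<rho> (Suc D), ti, (0, wtape D ws'), tm)"
proof (rule runs_sweep_W)
  fix j assume "j \<le> D"
  then show "u (\<rho> j) (ws j) = (\<rho> (Suc j), ws' j)" using assms by (cases "j = D") simp_all
qed

text \<open>One bit of memory shifts the mark by one column. Between loops the mark rests on column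
  \<open>D\<close>; \<open>shift_piv True\<close> lets it fall off and starts it anew at column 0,
  and \<open>r_more\<close> turns false once it is back on \<open>D\<close>. Clearing
  \<open>r_f\<close> and \<open>r_g\<close> prepares the next row.\<close>

definition shift_piv :: "bool \<Rightarrow> mprog" where
  "shift_piv x = Seq (on_reg (\<lambda>r. r\<lparr>r_b1 := x, r_f := Z0, r_g := Z0\<rparr>))
     (sweep_W (\<lambda>r wc. (if w_kind wc = KR then r\<lparr>r_b1 := w_piv wc, r_more := \<not> r_b1 r\<rparr> else r\<lparr>r_b1 := w_piv wc\<rparr>,
        wc\<lparr>w_piv := r_b1 r\<rparr>)))"

lemma runs_shift_piv:
  "\<exists>r'. runs (shift_piv x) (6 * D + 22) (r, ti, (0, wtape D (cells D mk pv c v)), tm)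
      (r', ti, (0, wtape D (cells D mk (\<lambda>j. if j = 0 then x else pv (j - 1)) c v)), tm) \<and>
    keep r' = keep r \<and> r_f r' = Z0 \<and> r_g r' = Z0 \<and> r_more r' = (\<not> (if D = 0 then x else pv (D - 1)))"
proof -
  let ?pv = "\<lambda>j. if j = 0 then x else pv (j - 1)"
  define r0 where "r0 = r\<lparr>r_b1 := x, r_f := Z0, r_g := Z0\<rparr>"
  define \<rho> where "\<rho> j = (if j \<le> D then r0\<lparr>r_b1 := ?pv j\<rparr> else r0\<lparr>r_b1 := pv D, r_more := \<not> ?pv D\<rparr>)" for j
  have \<rho>0: "\<rho> 0 = r0" unfolding \<rho>_def r0_def by simp
  have 1: "runs (on_reg (\<lambda>r. r\<lparr>r_b1 := x, r_f := Z0, r_g := Z0\<rparr>)) 1 (r, ti, (0, wtape D (cells D mk pv c v)), tm)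
      (\<rho> 0, ti, (0, wtape D (cells D mk pv c v)), tm)"
    unfolding \<rho>0 r0_def by (rule runs_on_reg)
  have 2: "runs (sweep_W (\<lambda>r wc. (if w_kind wc = KR then r\<lparr>r_b1 := w_piv wc, r_more := \<not> r_b1 r\<rparr> else r\<lparr>r_b1 := w_piv wc\<rparr>,
        wc\<lparr>w_piv := r_b1 r\<rparr>))) (6 * D + 20) (\<rho> 0, ti, (0, wtape D (cells D mk pv c v)), tm)
      (\<rho> (Suc D), ti, (0, wtape D (cells D mk ?pv c v)), tm)"
    by (rule runs_sweep_W_split) (auto simp: \<rho>_def cells_def cell_kind_of_def)
  have "runs (shift_piv x) (6 * D + 22) (r, ti, (0, wtape D (cells D mk pv c v)), tm)
      (\<rho> (Suc D), ti, (0, wtape D (cells D mk ?pv c v)), tm)"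
    unfolding shift_piv_def by (rule runs_mono[OF runs_Seq[OF 1 2]]) simp
  moreover have "keep (\<rho> (Suc D)) = keep r \<and> r_f (\<rho> (Suc D)) = Z0 \<and> r_g (\<rho> (Suc D)) = Z0 \<and>
      r_more (\<rho> (Suc D)) = (\<not> (if D = 0 then x else pv (D - 1)))"
    unfolding \<rho>_def r0_def keep_def by simp
  ultimately show ?thesis by blast
qed

definition row_loop :: "(reg \<Rightarrow> wcell \<Rightarrow> tri \<Rightarrow> reg \<times> wcell \<times> tri) \<Rightarrow> mprog" where
  "row_loop u = Seq (shift_piv True)
     (Seq (While (\<lambda>r i w m. r_more r) (Seq (sweep_M u) (shift_piv False))) rewind_M)"

primrec rows :: "(nat \<Rightarrow> (nat \<Rightarrow> int) \<Rightarrow> (nat \<Rightarrow> int) \<Rightarrow> (nat \<Rightarrow> int) \<times> (nat \<Rightarrow> int)) \<Rightarrow> nat \<Rightarrow>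
    (nat \<Rightarrow> int) \<Rightarrow> (nat \<Rightarrow> nat \<Rightarrow> int) \<Rightarrow> (nat \<Rightarrow> int) \<times> (nat \<Rightarrow> nat \<Rightarrow> int)" where
  "rows G 0 v A = (v, A)"
| "rows G (Suc i) v A =
     (case rows G i v A of (v', A') \<Rightarrow> case G i v' (A' i) of (v'', w) \<Rightarrow> (v'', A'(i := w)))"

lemma insert_eq_rows: "insert_eq p i v A = rows (row_elim p) i v A"
  by (induction i) (simp_all split: prod.splits)

text \<open>The contract under which a sweep with \<open>u\<close>, with the pivot mark on column
  \<open>i\<close>, performs \<open>G\<close> on the current equation and row
  \<open>i\<close>.\<close>

definition row_op :: "nat \<Rightarrow> tri \<Rightarrow> (reg \<Rightarrow> wcell \<Rightarrow> tri \<Rightarrow> reg \<times> wcell \<times> tri) \<Rightarrow>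
    (nat \<Rightarrow> (nat \<Rightarrow> int) \<Rightarrow> (nat \<Rightarrow> int) \<Rightarrow> (nat \<Rightarrow> int) \<times> (nat \<Rightarrow> int)) \<Rightarrow> bool" where
  "row_op D md u G \<longleftrightarrow> (\<forall>r v w i mk c. i < D \<and> r_f r = Z0 \<and> r_g r = Z0 \<and> r_mode r = md \<and> in_range v \<and> in_range w \<longrightarrow>
     in_range (fst (G i v w)) \<and> in_range (snd (G i v w)) \<and>
     (\<exists>\<rho>. \<rho> 0 = r \<and> keep (\<rho> (Suc D)) = keep r \<and>
       (\<forall>j\<le>D. u (\<rho> j) (cells D mk (\<lambda>j. j = i) c v j) (int_tri (w j)) =
          (\<rho> (Suc j), cells D mk (\<lambda>j. j = i) c (fst (G i v w)) j, int_tri (snd (G i v w) j)))))"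

lemma rows_in_range:
  assumes "row_op D md u G" "in_range v" "\<forall>i. in_range (A i)" "i \<le> D"
  shows "in_range (fst (rows G i v A)) \<and> (\<forall>k. in_range (snd (rows G i v A) k))"
  using assms(4)
proof (induction i)
  case 0
  then show ?case using assms by simp
next
  case (Suc i)
  obtain v' A' where 1: "rows G i v A = (v', A')" by fastforce
  obtain v'' w where 2: "G i v' (A' i) = (v'', w)" by fastforce
  have IH: "in_range v'" "\<And>k. in_range (A' k)" using Suc 1 by auto
  define r :: reg where "r = (undefined :: reg)\<lparr>r_f := Z0, r_g := Z0, r_mode := md\<rparr>"
  have "r_f r = Z0" "r_g r = Z0" "r_mode r = md" unfolding r_def by simp_all
  then have "in_range v'' \<and> in_range w"
    using assms(1) IH(1) IH(2)[of i] Suc.prems 2 unfolding row_op_def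
    by (metis Suc_le_lessD fst_conv snd_conv)
  then show ?case using 1 2 IH by simp
qed

lemma div_Suc_eq_iff: "y div Suc D = i \<longleftrightarrow> i * Suc D \<le> y \<and> y < i * Suc D + Suc D"
proof
  assume "y div Suc D = i"
  then show "i * Suc D \<le> y \<and> y < i * Suc D + Suc D"
    using div_times_less_eq_dividend[of y "Suc D"] dividend_less_times_div[of "Suc D" y] by (simp add: mult.commute)
next
  assume "i * Suc D \<le> y \<and> y < i * Suc D + Suc D"
  then show "y div Suc D = i" by (intro div_nat_eqI) (simp_all add: mult.commute)
qed

lemma mtape_row:
  assumes "i < D" "j \<le> D"
  shows "fst (mtape D A (int (i * Suc D) + int j)) = int_tri (A i j)"
proof -
  have "i * Suc D + j < Suc i * Suc D" using assms(2) by simp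
  also have "\<dots> \<le> D * Suc D" using assms(1) by (intro mult_le_mono1) simp
  finally have lt: "i * Suc D + j < D * Suc D" .
  have "(i * Suc D + j) div Suc D = i" using assms(2) unfolding div_Suc_eq_iff by simp
  moreover have "(i * Suc D + j) mod Suc D = j" unfolding mod_mult_self3 using assms(2) by simp
  moreover have "int (i * Suc D) + int j = int (i * Suc D + j)" by (simp only: of_nat_add)
  ultimately show ?thesis unfolding mtape_def using lt by (simp only: nat_int of_nat_0_le_iff of_nat_less_iff simp_thms if_True fst_conv)
qed

lemma mtape_upd:
  assumes "i < D"
  shows "mtape D (A(i := w)) x = (if int (i * Suc D) \<le> x \<and> x \<le> int (i * Suc D) + int D
    then (int_tri (w (nat (x - int (i * Suc D)))), snd (mtape D A x)) else mtape D A x)"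
proof (cases "0 \<le> x \<and> x < int (D * Suc D)")
  case True
  then obtain y where y: "x = int y" by (metis nonneg_int_cases)
  have yl: "y < D * Suc D" using True unfolding y of_nat_less_iff by blast
  have iff: "int (i * Suc D) \<le> x \<and> x \<le> int (i * Suc D) + int D \<longleftrightarrow> y div Suc D = i"
    unfolding y div_Suc_eq_iff by linarith
  have md: "y mod Suc D = nat (x - int (i * Suc D))" if "y div Suc D = i"
  proof -
    have "y = i * Suc D + y mod Suc D" using div_mult_mod_eq[of y "Suc D"] that by simp
    then have "x - int (i * Suc D) = int (y mod Suc D)" unfolding y by linarith
    then show ?thesis by simp
  qed
  show ?thesis unfolding iff using True md by (simp add: mtape_def y)
next
  case False
  have "Suc i * Suc D \<le> D * Suc D" using assms by (intro mult_le_mono1) simp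
  then have "i * Suc D + D < D * Suc D" by simp
  then have "\<not> (int (i * Suc D) \<le> x \<and> x \<le> int (i * Suc D) + int D)" using False by linarith
  then show ?thesis using False unfolding mtape_def by (simp only: if_False)
qed

lemma runs_row_loop:
  assumes op: "row_op D (r_mode r) u G" and v: "in_range v" and A: "\<forall>i. in_range (A i)"
  shows "\<exists>r'. runs (row_loop u) (100 * (D + 1) ^ 2)
      (r, ti, (0, wtape D (cells D mk (\<lambda>j. j = D) c v)), (0, mtape D A))
      (r', ti, (0, wtape D (cells D mk (\<lambda>j. j = D) c (fst (rows G D v A)))), (0, mtape D (snd (rows G D v A)))) \<and>
    keep r' = keep r"
proof -
  let ?v = "\<lambda>i. fst (rows G i v A)" and ?A = "\<lambda>i. snd (rows G i v A)"
  let ?st = "\<lambda>r' i. (r', ti, (0, wtape D (cells D mk (\<lambda>j. j = i) c (?v i))), (int (i * Suc D), mtape D (?A i)))"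
  let ?L = "While (\<lambda>r i w m. r_more r) (Seq (sweep_M u) (shift_piv False)) :: mprog"
  have "\<exists>r'. runs ?L (d * (12 * D + 45) + 1) (?st r1 i) (?st r' D) \<and> keep r' = keep r"
    if "d + i = D" "keep r1 = keep r" "r_f r1 = Z0" "r_g r1 = Z0" "r_more r1 = (i < D)" for d i r1
    using that
  proof (induction d arbitrary: i r1)
    case 0
    have "runs ?L 1 (?st r1 i) (?st r1 i)" by (rule runs_While_False) (use 0 in simp)
    then show ?case using 0 by auto
  next
    case (Suc d)
    have i: "i < D" using Suc.prems by simp
    have rng: "in_range (?v i)" "in_range (?A i i)"
      using rows_in_range[OF op v A, of i] i by auto
    have "r_mode r1 = r_mode r" using Suc.prems(2) unfolding keep_def by simp
    then obtain \<rho> where \<rho>: "\<rho> 0 = r1" "keep (\<rho> (Suc D)) = keep r1"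
      "\<forall>j\<le>D. u (\<rho> j) (cells D mk (\<lambda>j. j = i) c (?v i) j) (int_tri (?A i i j)) =
          (\<rho> (Suc j), cells D mk (\<lambda>j. j = i) c (fst (G i (?v i) (?A i i))) j, int_tri (snd (G i (?v i) (?A i i)) j))"
      using op i rng Suc.prems(3,4) unfolding row_op_def by blast
    have Gv: "fst (G i (?v i) (?A i i)) = ?v (Suc i)" and GA: "(?A i)(i := snd (G i (?v i) (?A i i))) = ?A (Suc i)"
      by (simp_all add: case_prod_beta)
    have 1: "runs (sweep_M u) (6 * D + 20) (?st r1 i)
        (\<rho> (Suc D), ti, (0, wtape D (cells D mk (\<lambda>j. j = i) c (?v (Suc i)))),
          (int (i * Suc D) + int D + 1, mtape D (?A (Suc i))))"
      unfolding \<rho>(1)[symmetric]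
    proof (rule runs_sweep_M[where ms = "\<lambda>j. int_tri (snd (G i (?v i) (?A i i)) j)"])
      show "u (\<rho> j) (cells D mk (\<lambda>j. j = i) c (?v i) j) (fst (mtape D (?A i) (int (i * Suc D) + int j))) =
          (\<rho> (Suc j), cells D mk (\<lambda>j. j = i) c (?v (Suc i)) j, int_tri (snd (G i (?v i) (?A i i)) j))"
        if "j \<le> D" for j
        unfolding mtape_row[OF i that] Gv[symmetric] using \<rho>(3) that by blast
      show "mtape D (?A (Suc i)) x = (if int (i * Suc D) \<le> x \<and> x \<le> int (i * Suc D) + int D
          then (int_tri (snd (G i (?v i) (?A i i)) (nat (x - int (i * Suc D)))), snd (mtape D (?A i) x))
          else mtape D (?A i) x)" for x
        unfolding GA[symmetric] by (rule mtape_upd[OF i])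
    qed
    have h: "int (i * Suc D) + int D + 1 = int (Suc i * Suc D)" by simp
    obtain r2 where r2: "runs (shift_piv False) (6 * D + 22)
        (\<rho> (Suc D), ti, (0, wtape D (cells D mk (\<lambda>j. j = i) c (?v (Suc i)))), (int (Suc i * Suc D), mtape D (?A (Suc i))))
        (r2, ti, (0, wtape D (cells D mk (\<lambda>j. if j = 0 then False else j - 1 = i) c (?v (Suc i)))),
          (int (Suc i * Suc D), mtape D (?A (Suc i))))"
      "keep r2 = keep (\<rho> (Suc D))" "r_f r2 = Z0" "r_g r2 = Z0" "r_more r2 = (\<not> (if D = 0 then False else D - 1 = i))"
      using runs_shift_piv[of False D "\<rho> (Suc D)" ti mk "\<lambda>j. j = i" c "?v (Suc i)"
          "(int (Suc i * Suc D), mtape D (?A (Suc i)))"] by blast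
    have pv: "(\<lambda>j. if j = 0 then False else j - 1 = i) = (\<lambda>j. j = Suc i)" by (auto simp: fun_eq_iff)
    have it: "runs (Seq (sweep_M u) (shift_piv False)) (12 * D + 43) (?st r1 i) (?st r2 (Suc i))"
      by (rule runs_mono[OF runs_Seq[OF 1[unfolded h] r2(1)[unfolded pv]]]) simp
    have "r_more r2 = (Suc i < D)" using r2(5) i by auto
    then obtain r' where r': "runs ?L (d * (12 * D + 45) + 1) (?st r2 (Suc i)) (?st r' D)" "keep r' = keep r"
      using Suc.IH[of "Suc i" r2] Suc.prems r2 \<rho>(2) by auto
    have "runs ?L ((12 * D + 43) + (d * (12 * D + 45) + 1) + 2) (?st r1 i) (?st r' D)"
      by (rule runs_While_True[OF _ it r'(1)]) (use Suc.prems(5) i in simp)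
    then have "runs ?L (Suc d * (12 * D + 45) + 1) (?st r1 i) (?st r' D)"
      by (rule runs_mono) simp
    then show ?case using r'(2) by blast
  qed
  note loop = this
  obtain r1 where r1: "runs (shift_piv True) (6 * D + 22)
      (r, ti, (0, wtape D (cells D mk (\<lambda>j. j = D) c v)), (0, mtape D A))
      (r1, ti, (0, wtape D (cells D mk (\<lambda>j. if j = 0 then True else j - 1 = D) c v)), (0, mtape D A))"
    "keep r1 = keep r" "r_f r1 = Z0" "r_g r1 = Z0" "r_more r1 = (\<not> (if D = 0 then True else D - 1 = D))"
    using runs_shift_piv[of True D r ti mk "\<lambda>j. j = D" c v "(0, mtape D A)"] by blast
  have "wtape D (cells D mk (\<lambda>j. if j = 0 then True else j - 1 = D) c v) = wtape D (cells D mk (\<lambda>j. j = 0) c v)"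
    by (rule wtape_cong) (auto simp: cells_def)
  then have 1: "runs (shift_piv True) (6 * D + 22)
      (r, ti, (0, wtape D (cells D mk (\<lambda>j. j = D) c v)), (0, mtape D A)) (?st r1 0)"
    using r1(1) by simp
  have "r_more r1 = (0 < D)" using r1(5) by auto
  then obtain r' where r': "runs ?L (D * (12 * D + 45) + 1) (?st r1 0) (?st r' D)" "keep r' = keep r"
    using loop[of D 0 r1] r1 by auto
  have "runs (row_loop u) ((6 * D + 22) + ((D * (12 * D + 45) + 1) + (3 * (D * Suc D) + 8) + 1) + 1)
      (r, ti, (0, wtape D (cells D mk (\<lambda>j. j = D) c v)), (0, mtape D A))
      (r', ti, (0, wtape D (cells D mk (\<lambda>j. j = D) c (?v D))), (0, mtape D (?A D)))"
    unfolding row_loop_def by (rule runs_Seq[OF 1 runs_Seq[OF r'(1) runs_rewind_M]])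
  then have "runs (row_loop u) (100 * (D + 1) ^ 2)
      (r, ti, (0, wtape D (cells D mk (\<lambda>j. j = D) c v)), (0, mtape D A))
      (r', ti, (0, wtape D (cells D mk (\<lambda>j. j = D) c (?v D))), (0, mtape D (?A D)))"
    by (rule runs_mono) (simp add: power2_eq_square algebra_simps)
  then show ?thesis using r'(2) by blast
qed

definition clear_cell :: "reg \<Rightarrow> wcell \<Rightarrow> tri \<Rightarrow> reg \<times> wcell \<times> tri" where
  "clear_cell r wc m = (r, wc, Z0)"

text \<open>\<open>r_f\<close> and \<open>r_g\<close> record the entries \<open>v i\<close> and
  \<open>w i\<close> met at the pivot. Before that \<open>r_f\<close> is \<open>Z0\<close> and cells
  stay untouched, which realises the tests \<open>i \<le> j\<close> in
  \<open>row_elim\<close>.\<close>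

definition insert_cell :: "reg \<Rightarrow> wcell \<Rightarrow> tri \<Rightarrow> reg \<times> wcell \<times> tri" where
  "insert_cell r wc m =
    (let r' = (if w_piv wc then r\<lparr>r_f := w_val wc, r_g := m\<rparr> else r) in
     if r_f r' = Z0 then (r', wc, m)
     else if r_g r' = Z0 then (r', wc\<lparr>w_val := Z0\<rparr>, w_val wc)
     else (r', wc\<lparr>w_val := int_tri ((tri_int (w_val wc) - tri_int (r_f r') * tri_int (r_g r') * tri_int m)
        mod modulus (mode_nat (r_mode r')))\<rparr>, m))"

lemma row_op_clear: "row_op D md clear_cell (\<lambda>i v w. (v, \<lambda>_. 0))"
proof -
  have "in_range (\<lambda>_. 0)" unfolding in_range_def by simp
  moreover have "int_tri 0 = Z0" unfolding int_tri_def by simp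
  ultimately show ?thesis
    unfolding row_op_def clear_cell_def
  proof (intro allI impI conjI)
    fix r :: reg and v w :: "nat \<Rightarrow> int" and i mk c
    show "\<exists>\<rho>. \<rho> 0 = r \<and> keep (\<rho> (Suc D)) = keep r \<and>
       (\<forall>j\<le>D. (\<rho> j, cells D mk (\<lambda>j. j = i) c v j, Z0) =
          (\<rho> (Suc j), cells D mk (\<lambda>j. j = i) c (fst (v, \<lambda>_. 0)) j, int_tri (snd (v, \<lambda>_. 0) j)))"
      by (rule exI[of _ "\<lambda>_. r"]) (simp add: int_tri_def)
  qed auto
qed

lemma modulus_bounds: "0 \<le> x mod modulus md" "x mod modulus md < 3"
proof -
  have "modulus md = 2 \<or> modulus md = 3" unfolding modulus_def by simp
  then show "0 \<le> x mod modulus md" "x mod modulus md < 3"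
    using pos_mod_bound[of "modulus md" x] by auto
qed

lemma row_elim_in_range:
  assumes "in_range v" "in_range w"
  shows "in_range (fst (row_elim (modulus md) i v w))" "in_range (snd (row_elim (modulus md) i v w))"
  using assms modulus_bounds unfolding row_elim_def in_range_def by auto

lemma row_op_insert: "row_op D md insert_cell (row_elim (modulus (mode_nat md)))"
  unfolding row_op_def
proof (intro allI impI conjI)
  fix r :: reg and v w :: "nat \<Rightarrow> int" and i mk c
  assume a: "i < D \<and> r_f r = Z0 \<and> r_g r = Z0 \<and> r_mode r = md \<and> in_range v \<and> in_range w"
  let ?p = "modulus (mode_nat md)"
  show "in_range (fst (row_elim ?p i v w))" "in_range (snd (row_elim ?p i v w))"
    by (intro row_elim_in_range; use a in blast)+
  define \<rho> where "\<rho> j = (if j \<le> i then r else r\<lparr>r_f := int_tri (v i), r_g := int_tri (w i)\<rparr>)" for j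
  have z: "int_tri (v j) = Z0 \<longleftrightarrow> v j = 0" "int_tri (w j) = Z0 \<longleftrightarrow> w j = 0"
    "tri_int (int_tri (v j)) = v j" "tri_int (int_tri (w j)) = w j" for j
    using a int_tri_eq_Z0 tri_int_int_tri unfolding in_range_def by simp_all
  have z0: "int_tri 0 = Z0" unfolding int_tri_def by simp
  have "insert_cell (\<rho> j) (cells D mk (\<lambda>j. j = i) c v j) (int_tri (w j)) =
          (\<rho> (Suc j), cells D mk (\<lambda>j. j = i) c (fst (row_elim ?p i v w)) j, int_tri (snd (row_elim ?p i v w) j))" for j
  proof (cases "j < i")
    case True
    then show ?thesis
      using a by (simp add: insert_cell_def \<rho>_def cells_def row_elim_def)
  next
    case False
    then have ij: "i \<le> j" by simp
    have piv: "(if w_piv (cells D mk (\<lambda>j. j = i) c v j) then (\<rho> j)\<lparr>r_f := w_val (cells D mk (\<lambda>j. j = i) c v j), r_g := int_tri (w j)\<rparr>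
        else \<rho> j) = r\<lparr>r_f := int_tri (v i), r_g := int_tri (w i)\<rparr>"
      using ij by (simp add: cells_def \<rho>_def)
    show ?thesis
      unfolding insert_cell_def Let_def piv
      using ij a by (simp add: z z0 \<rho>_def cells_def row_elim_def)
  qed
  moreover have "\<rho> 0 = r" "keep (\<rho> (Suc D)) = keep r" unfolding \<rho>_def keep_def by simp_all
  ultimately show "\<exists>\<rho>. \<rho> 0 = r \<and> keep (\<rho> (Suc D)) = keep r \<and>
     (\<forall>j\<le>D. insert_cell (\<rho> j) (cells D mk (\<lambda>j. j = i) c v j) (int_tri (w j)) =
          (\<rho> (Suc j), cells D mk (\<lambda>j. j = i) c (fst (row_elim ?p i v w)) j, int_tri (snd (row_elim ?p i v w) j)))"
    by blast
qed

definition insert_prog :: mprog where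
  "insert_prog = Seq (row_loop insert_cell)
     (sweep_W (\<lambda>r wc. (if w_kind wc = KR \<and> w_val wc \<noteq> Z0 then r\<lparr>r_bad := True\<rparr> else r, wc)))"

lemma runs_insert:
  assumes v: "in_range v" and A: "\<forall>i. in_range (A i)"
    and res: "insert_eq (modulus (mode_nat (r_mode r))) D v A = (v', A')"
  shows "\<exists>r'. runs insert_prog (200 * (D + 1) ^ 2)
      (r, ti, (0, wtape D (cells D mk (\<lambda>j. j = D) c v)), (0, mtape D A))
      (r', ti, (0, wtape D (cells D mk (\<lambda>j. j = D) c v')), (0, mtape D A')) \<and>
    keep r' = keep (r\<lparr>r_bad := r_bad r \<or> v' D \<noteq> 0\<rparr>) \<and> in_range v' \<and> (\<forall>i. in_range (A' i))"
proof -
  have rng: "in_range v'" "\<And>i. in_range (A' i)"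
    using rows_in_range[OF row_op_insert[of D "r_mode r"] v A le_refl] res unfolding insert_eq_rows by auto
  obtain r1 where 1: "runs (row_loop insert_cell) (100 * (D + 1) ^ 2)
      (r, ti, (0, wtape D (cells D mk (\<lambda>j. j = D) c v)), (0, mtape D A))
      (r1, ti, (0, wtape D (cells D mk (\<lambda>j. j = D) c v')), (0, mtape D A'))" "keep r1 = keep r"
    using runs_row_loop[where G = "row_elim (modulus (mode_nat (r_mode r)))" and r = r and u = insert_cell and D = D and v = v
        and A = A and ti = ti and mk = mk and c = c, OF row_op_insert v A]
    unfolding insert_eq_rows[symmetric] res fst_conv snd_conv by blast
  define \<rho> where "\<rho> j = (if j \<le> D then r1 else r1\<lparr>r_bad := r_bad r1 \<or> v' D \<noteq> 0\<rparr>)" for j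
  have z: "int_tri (v' j) = Z0 \<longleftrightarrow> v' j = 0" for j
    using rng(1) int_tri_eq_Z0 unfolding in_range_def by simp
  have "runs (sweep_W (\<lambda>r wc. (if w_kind wc = KR \<and> w_val wc \<noteq> Z0 then r\<lparr>r_bad := True\<rparr> else r, wc))) (6 * D + 20)
      (\<rho> 0, ti, (0, wtape D (cells D mk (\<lambda>j. j = D) c v')), (0, mtape D A'))
      (\<rho> (Suc D), ti, (0, wtape D (cells D mk (\<lambda>j. j = D) c v')), (0, mtape D A'))"
    by (rule runs_sweep_W_split) (auto simp: \<rho>_def cells_def cell_kind_of_def z)
  then have 2: "runs (sweep_W (\<lambda>r wc. (if w_kind wc = KR \<and> w_val wc \<noteq> Z0 then r\<lparr>r_bad := True\<rparr> else r, wc))) (6 * D + 20)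
      (r1, ti, (0, wtape D (cells D mk (\<lambda>j. j = D) c v')), (0, mtape D A'))
      (\<rho> (Suc D), ti, (0, wtape D (cells D mk (\<lambda>j. j = D) c v')), (0, mtape D A'))"
    by (simp add: \<rho>_def)
  have "runs insert_prog (200 * (D + 1) ^ 2)
      (r, ti, (0, wtape D (cells D mk (\<lambda>j. j = D) c v)), (0, mtape D A))
      (\<rho> (Suc D), ti, (0, wtape D (cells D mk (\<lambda>j. j = D) c v')), (0, mtape D A'))"
    unfolding insert_prog_def
    by (rule runs_mono[OF runs_Seq[OF 1(1) 2]]) (simp add: power2_eq_square algebra_simps)
  moreover have "keep (\<rho> (Suc D)) = keep (r\<lparr>r_bad := r_bad r \<or> v' D \<noteq> 0\<rparr>)"
    using 1(2) unfolding \<rho>_def keep_def by simp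
  ultimately show ?thesis using rng by blast
qed

section \<open>Generating the equations of an instance\<close>

text \<open>The transposed representation of a tuple: both columns of an element carry the positions
  at which it occurs, so each cell can compute its own coefficient.\<close>

definition tuple_marks :: "nat \<Rightarrow> (nat \<Rightarrow> nat) \<Rightarrow> nat \<Rightarrow> ix set" where
  "tuple_marks D t j = (if j = D then {} else {x. t (ix_nat x) = j div 2})"

lemma ix_nat_less: "ix_nat x < 12"
  using ix_nat[of x] by simp

lemma positions_tuple_marks: "j \<noteq> D \<Longrightarrow> ix_nat ` tuple_marks D t j = positions t (j div 2)"
proof -
  assume j: "j \<noteq> D"
  show ?thesis
  proof (intro set_eqI iffI)
    fix i assume "i \<in> ix_nat ` tuple_marks D t j"
    then show "i \<in> positions t (j div 2)" using j ix_nat_less unfolding tuple_marks_def positions_def by auto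
  next
    fix i assume "i \<in> positions t (j div 2)"
    then have "i < 12" "t i = j div 2" unfolding positions_def by auto
    then have "ix_nat (nat_ix i) = i" by (intro nat_ix_inverse) simp
    then show "i \<in> ix_nat ` tuple_marks D t j"
      using j \<open>t i = j div 2\<close> unfolding tuple_marks_def by (intro image_eqI[of _ _ "nat_ix i"]) auto
  qed
qed

definition eqn_cell :: "reg \<Rightarrow> wcell \<Rightarrow> reg \<times> wcell" where
  "eqn_cell r wc = (r, wc\<lparr>w_val := int_tri ((if w_kind wc = KR then rhs_coef (mode_nat (r_mode r)) (ix_nat (r_eq r))
     else coef (mode_nat (r_mode r)) (ix_nat (r_eq r)) (w_kind wc = KS) (ix_nat ` w_marks wc))
       mod modulus (mode_nat (r_mode r)))\<rparr>)"

lemma runs_eqn_cell: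
  "runs (sweep_W eqn_cell) (6 * (2 * n) + 20)
    (r, ti, (0, wtape (2 * n) (cells (2 * n) (tuple_marks (2 * n) t) pv c v)), tm)
    (r, ti, (0, wtape (2 * n) (cells (2 * n) (tuple_marks (2 * n) t) pv c
       (eqn n (mode_nat (r_mode r)) (ix_nat (r_eq r)) t))), tm)"
  by (rule runs_sweep_W[where \<rho> = "\<lambda>_. r"])
    (simp add: eqn_cell_def cells_def cell_kind_of_def eqn_def positions_tuple_marks)

lemma in_range_eqn: "in_range (eqn n md q t)"
  unfolding in_range_def eqn_def using modulus_bounds by simp

primrec eqs_prog :: "ix list \<Rightarrow> mprog" where
  "eqs_prog [] = Skip"
| "eqs_prog (x # xs) = Seq (on_reg (\<lambda>r. r\<lparr>r_eq := x\<rparr>)) (Seq (sweep_W eqn_cell) (Seq insert_prog (eqs_prog xs)))"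

lemma runs_eqs_prog:
  assumes "in_range v" "\<forall>i. in_range (A i)"
    and "insert_eqs (modulus (mode_nat (r_mode r))) (2 * n)
      (map (\<lambda>x. eqn n (mode_nat (r_mode r)) (ix_nat x) t) xs) (r_bad r, A) = (bad', A')"
  shows "\<exists>r' v'. runs (eqs_prog xs) (length xs * (300 * (2 * n + 1) ^ 2))
      (r, ti, (0, wtape (2 * n) (cells (2 * n) (tuple_marks (2 * n) t) (\<lambda>j. j = 2 * n) c v)), (0, mtape (2 * n) A))
      (r', ti, (0, wtape (2 * n) (cells (2 * n) (tuple_marks (2 * n) t) (\<lambda>j. j = 2 * n) c v')), (0, mtape (2 * n) A')) \<and>
    keep r' = keep (r\<lparr>r_bad := bad'\<rparr>) \<and> in_range v' \<and> (\<forall>i. in_range (A' i))"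
  using assms
proof (induction xs arbitrary: r v A)
  case Nil
  from Nil.prems(3) have "bad' = r_bad r" "A' = A" by simp_all
  then show ?case
    using Nil.prems(1,2) by (intro exI[of _ r] exI[of _ v]) (simp add: keep_def runs_Skip del: split_paired_All)
next
  case (Cons x xs)
  let ?D = "2 * n"
  let ?st = "\<lambda>r v A. (r, ti, (0 :: int, wtape ?D (cells ?D (tuple_marks ?D t) (\<lambda>j. j = ?D) c v)), (0 :: int, mtape ?D A))"
  let ?md = "mode_nat (r_mode r)"
  define r1 where "r1 = r\<lparr>r_eq := x\<rparr>"
  have m1: "r_mode r1 = r_mode r" "r_eq r1 = x" "r_bad r1 = r_bad r" unfolding r1_def by simp_all
  have 1: "runs (on_reg (\<lambda>r. r\<lparr>r_eq := x\<rparr>)) 1 (?st r v A) (?st r1 v A)"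
    unfolding r1_def by (rule runs_on_reg)
  let ?e = "eqn n ?md (ix_nat x) t"
  have 2: "runs (sweep_W eqn_cell) (6 * ?D + 20) (?st r1 v A) (?st r1 ?e A)"
    using runs_eqn_cell[of n r1 ti t "\<lambda>j. j = ?D" c v "(0, mtape ?D A)"] unfolding m1 .
  obtain v2 A2 where ins: "insert_eq (modulus ?md) ?D ?e A = (v2, A2)" by fastforce
  then have ins1: "insert_eq (modulus (mode_nat (r_mode r1))) ?D ?e A = (v2, A2)" unfolding m1 .
  obtain r2 where r2: "runs insert_prog (200 * (?D + 1) ^ 2) (?st r1 ?e A) (?st r2 v2 A2)"
    "keep r2 = keep (r1\<lparr>r_bad := r_bad r1 \<or> v2 ?D \<noteq> 0\<rparr>)" "in_range v2" "\<forall>i. in_range (A2 i)"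
    using runs_insert[OF in_range_eqn Cons.prems(2) ins1] by blast
  have m2: "r_mode r2 = r_mode r" "r_bad r2 = (r_bad r \<or> v2 ?D \<noteq> 0)"
    using r2(2) m1 unfolding keep_def by simp_all
  have "insert_eqs (modulus (mode_nat (r_mode r2))) ?D
      (map (\<lambda>x. eqn n (mode_nat (r_mode r2)) (ix_nat x) t) xs) (r_bad r2, A2) = (bad', A')"
    using Cons.prems(3) ins unfolding m2 by simp
  from Cons.IH[OF r2(3,4) this] obtain r' v' where
    r': "runs (eqs_prog xs) (length xs * (300 * (?D + 1) ^ 2)) (?st r2 v2 A2) (?st r' v' A')"
    "keep r' = keep (r2\<lparr>r_bad := bad'\<rparr>)" "in_range v'" "\<forall>i. in_range (A' i)" by blast
  have "runs (eqs_prog (x # xs)) (length (x # xs) * (300 * (?D + 1) ^ 2)) (?st r v A) (?st r' v' A')"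
    unfolding eqs_prog.simps
    by (rule runs_mono[OF runs_Seq[OF 1 runs_Seq[OF 2 runs_Seq[OF r2(1) r'(1)]]]])
      (simp add: power2_eq_square algebra_simps)
  moreover have "keep r' = keep (r\<lparr>r_bad := bad'\<rparr>)"
    using r'(2) r2(2) unfolding keep_def r1_def by simp
  ultimately show ?case using r'(3,4) by blast
qed

section \<open>Running through all tuples\<close>

definition next_tuple :: "nat \<Rightarrow> (nat \<Rightarrow> nat) \<Rightarrow> nat \<Rightarrow> nat" where
  "next_tuple n t i = (if \<forall>i'\<le>i. t i' = n - 1 then 0 else if \<forall>i'<i. t i' = n - 1 then t i + 1 else t i)"

definition last_cell :: "reg \<Rightarrow> wcell \<Rightarrow> reg \<times> wcell" where
  "last_cell r wc = (if w_kind wc = KR then r else r\<lparr>r_m1 := w_marks wc\<rparr>, wc)"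

text \<open>Incrementing an entry moves its mark to the next element, two columns to the right, so
  \<open>r_m1\<close> and \<open>r_m2\<close> remember the marks of the last two columns. They start
  with the positions that wrap from \<open>n - 1\<close> to 0, whose marks thus reappear in the
  first two columns.\<close>

definition shift_cell :: "reg \<Rightarrow> wcell \<Rightarrow> reg \<times> wcell" where
  "shift_cell r wc = (if w_kind wc = KR then (r, wc) else
     (r\<lparr>r_m2 := r_m1 r, r_m1 := w_marks wc\<rparr>,
      wc\<lparr>w_marks := {x. if x \<in> r_inc r then x \<in> r_m2 r else x \<in> w_marks wc}\<rparr>))"

definition next_prog :: mprog where
  "next_prog = Seq (sweep_W last_cell) (Seq (on_reg (\<lambda>r.
     r\<lparr>r_inc := {x. \<forall>y. ix_nat y < ix_nat x \<longrightarrow> y \<in> r_m1 r},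
       r_m1 := {x. \<forall>y. ix_nat y \<le> ix_nat x \<longrightarrow> y \<in> r_m1 r},
       r_m2 := {x. \<forall>y. ix_nat y \<le> ix_nat x \<longrightarrow> y \<in> r_m1 r}\<rparr>)) (sweep_W shift_cell))"

lemma ix_all_iff: "(\<forall>y. P (ix_nat y)) \<longleftrightarrow> (\<forall>i<12. P i)"
proof
  assume a: "\<forall>y. P (ix_nat y)"
  show "\<forall>i<12. P i"
  proof (intro allI impI)
    fix i :: nat assume "i < 12"
    then have "ix_nat (nat_ix i) = i" by (intro nat_ix_inverse) simp
    then show "P i" using a by metis
  qed
qed (use ix_nat_less in blast)

lemma runs_next_prog:
  assumes n: "0 < n" and t: "\<forall>i<12. t i < n"
  shows "\<exists>r'. runs next_prog (30 * (2 * n + 1)) 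
    (r, ti, (0, wtape (2 * n) (cells (2 * n) (tuple_marks (2 * n) t) pv c v)), tm)
    (r', ti, (0, wtape (2 * n) (cells (2 * n) (tuple_marks (2 * n) (next_tuple n t)) pv c v)), tm) \<and> keep r' = keep r"
proof -
  let ?D = "2 * n"
  let ?mk = "tuple_marks ?D t"
  define \<rho>1 where "\<rho>1 j = (if j = 0 then r else if j \<le> ?D then r\<lparr>r_m1 := ?mk (j - 1)\<rparr> else r\<lparr>r_m1 := ?mk (?D - 1)\<rparr>)" for j
  have "runs (sweep_W last_cell) (6 * ?D + 20) (\<rho>1 0, ti, (0, wtape ?D (cells ?D ?mk pv c v)), tm)
      (\<rho>1 (Suc ?D), ti, (0, wtape ?D (cells ?D ?mk pv c v)), tm)"
    by (rule runs_sweep_W_split) (use n in \<open>auto simp: \<rho>1_def last_cell_def cells_def cell_kind_of_def\<close>)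
  moreover have "\<rho>1 0 = r" "\<rho>1 (Suc ?D) = r\<lparr>r_m1 := ?mk (?D - 1)\<rparr>" unfolding \<rho>1_def by simp_all
  ultimately have 1: "runs (sweep_W last_cell) (6 * ?D + 20) (r, ti, (0, wtape ?D (cells ?D ?mk pv c v)), tm)
      (r\<lparr>r_m1 := ?mk (?D - 1)\<rparr>, ti, (0, wtape ?D (cells ?D ?mk pv c v)), tm)" by simp
  have last: "y \<in> ?mk (?D - 1) \<longleftrightarrow> t (ix_nat y) = n - 1" for y
  proof -
    have "(2 * n - 1) div 2 = n - 1" using n by linarith
    then show ?thesis unfolding tuple_marks_def using n by simp
  qed
  \<comment> \<open>A carry reaches a position when all earlier entries are \<open>n - 1\<close>;
    the position wraps (\<open>wr\<close>) when its own entry is \<open>n - 1\<close> as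
    well.\<close>
  define inc where "inc = {x. \<forall>i'<ix_nat x. t i' = n - 1}"
  define wr where "wr = {x. \<forall>i'\<le>ix_nat x. t i' = n - 1}"
  have inc: "{x. \<forall>y. ix_nat y < ix_nat x \<longrightarrow> y \<in> ?mk (?D - 1)} = inc"
  proof -
    have "(\<forall>y. ix_nat y < ix_nat x \<longrightarrow> t (ix_nat y) = n - 1) \<longleftrightarrow> (\<forall>i'<ix_nat x. t i' = n - 1)" for x
      using ix_all_iff[of "\<lambda>i. i < ix_nat x \<longrightarrow> t i = n - 1"] ix_nat_less[of x] by auto
    then show ?thesis unfolding inc_def last by simp
  qed
  have wr: "{x. \<forall>y. ix_nat y \<le> ix_nat x \<longrightarrow> y \<in> ?mk (?D - 1)} = wr"
  proof -
    have "(\<forall>y. ix_nat y \<le> ix_nat x \<longrightarrow> t (ix_nat y) = n - 1) \<longleftrightarrow> (\<forall>i'\<le>ix_nat x. t i' = n - 1)" for x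
      using ix_all_iff[of "\<lambda>i. i \<le> ix_nat x \<longrightarrow> t i = n - 1"] ix_nat_less[of x] by auto
    then show ?thesis unfolding wr_def last by simp
  qed
  define r2 where "r2 = r\<lparr>r_m1 := wr, r_inc := inc, r_m2 := wr\<rparr>"
  let ?f = "\<lambda>r. r\<lparr>r_inc := {x. \<forall>y. ix_nat y < ix_nat x \<longrightarrow> y \<in> r_m1 r},
       r_m1 := {x. \<forall>y. ix_nat y \<le> ix_nat x \<longrightarrow> y \<in> r_m1 r},
       r_m2 := {x. \<forall>y. ix_nat y \<le> ix_nat x \<longrightarrow> y \<in> r_m1 r}\<rparr> :: reg"
  have "?f (r\<lparr>r_m1 := ?mk (?D - 1)\<rparr>) = r2"
    unfolding r2_def inc[symmetric] wr[symmetric] by simp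
  then have 2: "runs (on_reg ?f) 1 (r\<lparr>r_m1 := ?mk (?D - 1)\<rparr>, ti, (0, wtape ?D (cells ?D ?mk pv c v)), tm)
      (r2, ti, (0, wtape ?D (cells ?D ?mk pv c v)), tm)"
    using runs_on_reg[of ?f "r\<lparr>r_m1 := ?mk (?D - 1)\<rparr>" ti "(0, wtape ?D (cells ?D ?mk pv c v))" tm] by simp
  let ?mk' = "tuple_marks ?D (next_tuple n t)"
  define \<rho>2 where "\<rho>2 j = (let k = min j ?D in r2\<lparr>r_m1 := if k = 0 then wr else ?mk (k - 1), r_m2 := if k < 2 then wr else ?mk (k - 2)\<rparr>)" for j
  have new: "{x. if x \<in> inc then x \<in> (if j < 2 then wr else ?mk (j - 2)) else x \<in> ?mk j} = ?mk' j" if j: "j < ?D" for j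
  proof (rule set_eqI)
    fix x
    have jn: "j div 2 < n" using j by simp
    have mj: "x \<in> ?mk j \<longleftrightarrow> t (ix_nat x) = j div 2" using j unfolding tuple_marks_def by simp
    have mj2: "x \<in> ?mk (j - 2) \<longleftrightarrow> t (ix_nat x) + 1 = j div 2" if "\<not> j < 2"
    proof -
      have "(j - 2) div 2 + 1 = j div 2" using that by simp
      then show ?thesis using j unfolding tuple_marks_def by auto
    qed
    have mj': "x \<in> ?mk' j \<longleftrightarrow> next_tuple n t (ix_nat x) = j div 2" using j unfolding tuple_marks_def by simp
    consider "x \<notin> inc" | "x \<in> inc" "x \<notin> wr" | "x \<in> wr" by blast
    then show "x \<in> {x. if x \<in> inc then x \<in> (if j < 2 then wr else ?mk (j - 2)) else x \<in> ?mk j} \<longleftrightarrow> x \<in> ?mk' j"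
    proof cases
      case 1
      then have "next_tuple n t (ix_nat x) = t (ix_nat x)" unfolding next_tuple_def inc_def by auto
      then show ?thesis using 1 mj mj' by simp
    next
      case 2
      then have nx: "next_tuple n t (ix_nat x) = t (ix_nat x) + 1" unfolding next_tuple_def inc_def wr_def by auto
      show ?thesis
      proof (cases "j < 2")
        case True
        then have "j div 2 = 0" by simp
        then show ?thesis using 2 mj' nx True by simp
      next
        case False
        then show ?thesis using 2 mj2 mj' nx by simp
      qed
    next
      case 3
      then have inc: "x \<in> inc" unfolding inc_def wr_def by auto
      have tx: "t (ix_nat x) = n - 1" using 3 unfolding wr_def by simp
      have nx: "next_tuple n t (ix_nat x) = 0" using 3 unfolding next_tuple_def wr_def by auto
      show ?thesis
      proof (cases "j < 2")
        case True
        then have "j div 2 = 0" by simp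
        then show ?thesis using 3 inc mj' nx True by simp
      next
        case False
        then have "j div 2 \<noteq> 0" by simp
        then show ?thesis using False inc mj2 mj' nx tx jn n by simp
      qed
    qed
  qed
  have "runs (sweep_W shift_cell) (6 * ?D + 20) (\<rho>2 0, ti, (0, wtape ?D (cells ?D ?mk pv c v)), tm)
      (\<rho>2 (Suc ?D), ti, (0, wtape ?D (cells ?D ?mk' pv c v)), tm)"
  proof (rule runs_sweep_W_split)
    fix j assume j: "j < ?D"
    have k: "w_kind (cells ?D ?mk pv c v j) \<noteq> KR" using j by (simp add: cells_def cell_kind_of_def)
    have mj: "w_marks (cells ?D ?mk pv c v j) = ?mk j" by (simp add: cells_def)
    have regs: "r_inc (\<rho>2 j) = inc" "r_m2 (\<rho>2 j) = (if j < 2 then wr else ?mk (j - 2))"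
      "r_m1 (\<rho>2 j) = (if j = 0 then wr else ?mk (j - 1))"
      using j unfolding \<rho>2_def r2_def Let_def by simp_all
    have "(\<rho>2 j)\<lparr>r_m2 := if j = 0 then wr else ?mk (j - 1), r_m1 := ?mk j\<rparr> = \<rho>2 (Suc j)"
      using j unfolding \<rho>2_def Let_def r2_def by (simp add: min_def)
    moreover have "(cells ?D ?mk pv c v j)\<lparr>w_marks := ?mk' j\<rparr> = cells ?D ?mk' pv c v j"
      by (simp add: cells_def)
    ultimately show "shift_cell (\<rho>2 j) (cells ?D ?mk pv c v j) = (\<rho>2 (Suc j), cells ?D ?mk' pv c v j)"
      unfolding shift_cell_def regs mj new[OF j] using k by (simp only: if_False)
  next
    show "shift_cell (\<rho>2 ?D) (cells ?D ?mk pv c v ?D) = (\<rho>2 (Suc ?D), cells ?D ?mk' pv c v ?D)"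
      by (simp add: shift_cell_def cells_def cell_kind_of_def \<rho>2_def tuple_marks_def)
  qed
  moreover have "\<rho>2 0 = r2" unfolding \<rho>2_def r2_def by simp
  ultimately have 3: "runs (sweep_W shift_cell) (6 * ?D + 20) (r2, ti, (0, wtape ?D (cells ?D ?mk pv c v)), tm)
      (\<rho>2 (Suc ?D), ti, (0, wtape ?D (cells ?D ?mk' pv c v)), tm)" by simp
  have "keep (\<rho>2 (Suc ?D)) = keep r" unfolding \<rho>2_def r2_def keep_def Let_def by simp
  moreover have "runs next_prog (30 * (?D + 1)) (r, ti, (0, wtape ?D (cells ?D ?mk pv c v)), tm)
      (\<rho>2 (Suc ?D), ti, (0, wtape ?D (cells ?D ?mk' pv c v)), tm)"
    unfolding next_prog_def by (rule runs_mono[OF runs_Seq[OF 1 runs_Seq[OF 2 3]]]) (use n in simp)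
  ultimately show ?thesis by blast
qed

definition reset_cell :: "reg \<Rightarrow> wcell \<Rightarrow> reg \<times> wcell" where
  "reset_cell r wc = (if w_kind wc = KR then (r, wc\<lparr>w_marks := {}\<rparr>) else
     (r\<lparr>r_m2 := r_m1 r, r_m1 := {}\<rparr>, wc\<lparr>w_marks := r_m2 r\<rparr>))"

definition reset_prog :: mprog where
  "reset_prog = Seq (on_reg (\<lambda>r. r\<lparr>r_m1 := UNIV, r_m2 := UNIV\<rparr>)) (sweep_W reset_cell)"

lemma runs_reset_prog:
  "\<exists>r'. runs reset_prog (6 * (2 * n) + 22) 
    (r, ti, (0, wtape (2 * n) (cells (2 * n) mk pv c v)), tm)
    (r', ti, (0, wtape (2 * n) (cells (2 * n) (tuple_marks (2 * n) (\<lambda>_. 0)) pv c v)), tm) \<and> keep r' = keep r"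
proof -
  let ?D = "2 * n"
  define r0 where "r0 = r\<lparr>r_m1 := UNIV, r_m2 := UNIV\<rparr>"
  have 1: "runs (on_reg (\<lambda>r. r\<lparr>r_m1 := UNIV, r_m2 := UNIV\<rparr>)) 1 (r, ti, (0, wtape ?D (cells ?D mk pv c v)), tm)
      (r0, ti, (0, wtape ?D (cells ?D mk pv c v)), tm)"
    unfolding r0_def by (rule runs_on_reg)
  define \<rho> where "\<rho> j = (let k = min j ?D in r0\<lparr>r_m1 := if k = 0 then UNIV else {}, r_m2 := if k < 2 then UNIV else {}\<rparr>)" for j
  have "runs (sweep_W reset_cell) (6 * ?D + 20) (\<rho> 0, ti, (0, wtape ?D (cells ?D mk pv c v)), tm)
      (\<rho> (Suc ?D), ti, (0, wtape ?D (cells ?D (tuple_marks ?D (\<lambda>_. 0)) pv c v)), tm)"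
  proof (rule runs_sweep_W_split)
    fix j assume j: "j < ?D"
    have "tuple_marks ?D (\<lambda>_. 0) j = (if j < 2 then UNIV else {})"
    proof -
      have "j div 2 = 0 \<longleftrightarrow> j < 2" by auto
      then show ?thesis using j unfolding tuple_marks_def by auto
    qed
    then show "reset_cell (\<rho> j) (cells ?D mk pv c v j) = (\<rho> (Suc j), cells ?D (tuple_marks ?D (\<lambda>_. 0)) pv c v j)"
      using j by (simp add: reset_cell_def cells_def cell_kind_of_def \<rho>_def min_def)
  qed (simp add: reset_cell_def cells_def cell_kind_of_def \<rho>_def tuple_marks_def)
  moreover have "\<rho> 0 = r0" unfolding \<rho>_def r0_def by simp
  ultimately have 2: "runs (sweep_W reset_cell) (6 * ?D + 20) (r0, ti, (0, wtape ?D (cells ?D mk pv c v)), tm)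
      (\<rho> (Suc ?D), ti, (0, wtape ?D (cells ?D (tuple_marks ?D (\<lambda>_. 0)) pv c v)), tm)" by simp
  have "keep (\<rho> (Suc ?D)) = keep r" unfolding \<rho>_def r0_def keep_def Let_def by simp
  moreover have "runs reset_prog (6 * ?D + 22) (r, ti, (0, wtape ?D (cells ?D mk pv c v)), tm)
      (\<rho> (Suc ?D), ti, (0, wtape ?D (cells ?D (tuple_marks ?D (\<lambda>_. 0)) pv c v)), tm)"
    unfolding reset_prog_def by (rule runs_mono[OF runs_Seq[OF 1 2]]) simp
  ultimately show ?thesis by blast
qed

text \<open>The mark of the current element occupies both of its columns and moves by two.
  \<open>r_done\<close> becomes true when the mark leaves the last element; on an empty universe the
  initial \<open>cur_prog True\<close> sets it at once, so that the main loop does not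
  start.\<close>

definition cur_cell :: "reg \<Rightarrow> wcell \<Rightarrow> reg \<times> wcell" where
  "cur_cell r wc = (if w_kind wc = KR then (r\<lparr>r_done := r_b2 r\<rparr>, wc\<lparr>w_cur := False\<rparr>) else
     (r\<lparr>r_b2 := r_b1 r, r_b1 := w_cur wc\<rparr>, wc\<lparr>w_cur := r_b2 r\<rparr>))"

definition cur_prog :: "bool \<Rightarrow> mprog" where
  "cur_prog x = Seq (on_reg (\<lambda>r. r\<lparr>r_b1 := x, r_b2 := x\<rparr>)) (sweep_W cur_cell)"

lemma runs_cur_prog:
  "\<exists>r'. runs (cur_prog x) (6 * D + 22) 
    (r, ti, (0, wtape D (cells D mk pv c v)), tm)
    (r', ti, (0, wtape D (cells D mk pv (\<lambda>j. j \<noteq> D \<and> (if j < 2 then x else c (j - 2))) v)), tm) \<and>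
    keep r' = keep (r\<lparr>r_done := (if D < 2 then x else c (D - 2))\<rparr>)"
proof -
  define r0 where "r0 = r\<lparr>r_b1 := x, r_b2 := x\<rparr>"
  let ?c = "\<lambda>j. j \<noteq> D \<and> (if j < 2 then x else c (j - 2))"
  have 1: "runs (on_reg (\<lambda>r. r\<lparr>r_b1 := x, r_b2 := x\<rparr>)) 1 (r, ti, (0, wtape D (cells D mk pv c v)), tm)
      (r0, ti, (0, wtape D (cells D mk pv c v)), tm)"
    unfolding r0_def by (rule runs_on_reg)
  define \<rho>' where "\<rho>' k = r0\<lparr>r_b1 := if k = 0 then x else c (k - 1), r_b2 := if k < 2 then x else c (k - 2)\<rparr>" for k
  define \<rho> where "\<rho> j = (if j \<le> D then \<rho>' j else (\<rho>' D)\<lparr>r_done := (if D < 2 then x else c (D - 2))\<rparr>)" for j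
  have "runs (sweep_W cur_cell) (6 * D + 20) (\<rho> 0, ti, (0, wtape D (cells D mk pv c v)), tm)
      (\<rho> (Suc D), ti, (0, wtape D (cells D mk pv ?c v)), tm)"
  proof (rule runs_sweep_W_split)
    fix j assume j: "j < D"
    then show "cur_cell (\<rho> j) (cells D mk pv c v j) = (\<rho> (Suc j), cells D mk pv ?c v j)"
      by (simp add: cur_cell_def cells_def cell_kind_of_def \<rho>_def \<rho>'_def)
  qed (simp add: cur_cell_def cells_def cell_kind_of_def \<rho>_def \<rho>'_def)
  moreover have "\<rho> 0 = r0" unfolding \<rho>_def \<rho>'_def r0_def by simp
  ultimately have 2: "runs (sweep_W cur_cell) (6 * D + 20) (r0, ti, (0, wtape D (cells D mk pv c v)), tm)
      (\<rho> (Suc D), ti, (0, wtape D (cells D mk pv ?c v)), tm)" by simp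
  have "keep (\<rho> (Suc D)) = keep (r\<lparr>r_done := (if D < 2 then x else c (D - 2))\<rparr>)"
    unfolding \<rho>_def \<rho>'_def r0_def keep_def by simp
  moreover have "runs (cur_prog x) (6 * D + 22) (r, ti, (0, wtape D (cells D mk pv c v)), tm)
      (\<rho> (Suc D), ti, (0, wtape D (cells D mk pv ?c v)), tm)"
    unfolding cur_prog_def by (rule runs_mono[OF runs_Seq[OF 1 2]]) simp
  ultimately show ?thesis by blast
qed

definition start_cell :: "reg \<Rightarrow> wcell \<Rightarrow> reg \<times> wcell" where
  "start_cell r wc = (r, wc\<lparr>w_val := if w_kind wc = KR \<or> w_kind wc = KS \<and> w_cur wc then Z1 else Z0\<rparr>)"

lemma runs_start_cell:
  assumes c: "\<And>j. j < 2 * n \<Longrightarrow> cu j \<longleftrightarrow> j div 2 = c"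
  shows "runs (sweep_W start_cell) (6 * (2 * n) + 20)
    (r, ti, (0, wtape (2 * n) (cells (2 * n) mk pv cu v)), tm)
    (r, ti, (0, wtape (2 * n) (cells (2 * n) mk pv cu (init_eqn n c))), tm)"
proof (rule runs_sweep_W_split[where \<rho> = "\<lambda>_. r"])
  fix j assume j: "j < 2 * n"
  have "init_eqn n c j = of_bool (odd j \<and> cu j)"
  proof -
    have "j = 2 * c + 1 \<longleftrightarrow> odd j \<and> j div 2 = c" by presburger
    then show ?thesis unfolding init_eqn_def using j c[OF j] by simp
  qed
  then show "start_cell r (cells (2 * n) mk pv cu v j) = (r, cells (2 * n) mk pv cu (init_eqn n c) j)"
    using j by (auto simp: start_cell_def cells_def cell_kind_of_def int_tri_def)
qed (simp add: start_cell_def cells_def cell_kind_of_def init_eqn_def int_tri_def)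

lemma in_range_init_eqn: "in_range (init_eqn n c)"
  unfolding in_range_def init_eqn_def by simp

section \<open>The order of the tuples in the encoding\<close>

lemma concat_nth_uniform:
  assumes "\<forall>ys\<in>set xss. length ys = n" "0 < n" "m < n * length xss"
  shows "concat xss ! m = xss ! (m div n) ! (m mod n)"
  using assms(1,3)
proof (induction xss arbitrary: m)
  case (Cons ys xss)
  show ?case
  proof (cases "m < n")
    case True
    then show ?thesis using Cons.prems by (simp add: nth_append)
  next
    case False
    then obtain k where k: "m = n + k" using le_Suc_ex[of n m] by auto
    have "concat xss ! k = xss ! (k div n) ! (k mod n)"
      by (rule Cons.IH) (use Cons.prems k in auto)
    then show ?thesis using Cons.prems assms(2) k by (simp add: nth_append)
  qed
qed simp

definition digit :: "nat \<Rightarrow> nat \<Rightarrow> nat \<Rightarrow> nat" where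
  "digit n m i = (m div n ^ i) mod n"

text \<open>\<open>List.n_lists\<close> varies the first entry fastest, so the tuple at index
  \<open>m\<close> is given by the base-\<open>n\<close> digits of \<open>m\<close>, least
  significant first.\<close>

lemma n_lists_nth:
  assumes "length xs = n" "m < n ^ k"
  shows "List.n_lists k xs ! m = map (\<lambda>i. xs ! digit n m i) [0..<k]"
  using assms(2)
proof (induction k arbitrary: m)
  case 0
  then show ?case by simp
next
  case (Suc k)
  have n: "0 < n" using Suc.prems by (cases "n = 0") simp_all
  have len: "length (List.n_lists k xs) = n ^ k" using assms(1) by (simp add: length_n_lists)
  have m': "m div n < n ^ k" using Suc.prems by (simp add: less_mult_imp_div_less mult.commute)
  have "List.n_lists (Suc k) xs ! m
      = map (\<lambda>ys. map (\<lambda>y. y # ys) xs) (List.n_lists k xs) ! (m div n) ! (m mod n)"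
    unfolding List.n_lists.simps by (rule concat_nth_uniform) (use assms(1) n Suc.prems len in auto)
  also have "\<dots> = xs ! (m mod n) # map (\<lambda>i. xs ! digit n (m div n) i) [0..<k]"
    using m' len n assms(1) Suc.IH[OF m'] by simp
  also have "\<dots> = map (\<lambda>i. xs ! digit n m i) (0 # map Suc [0..<k])"
    by (simp add: digit_def div_mult2_eq)
  also have "0 # map Suc [0..<k] = [0..<Suc k]" by (simp add: map_Suc_upt upt_conv_Cons)
  finally show ?case .
qed

text \<open>Adding 1 is the odometer step: by \<open>q\<close>, a carry gets past the first
  \<open>i\<close> digits iff they are all \<open>n - 1\<close>.\<close>

lemma digit_Suc:
  assumes n: "0 < n"
  shows "digit n (Suc m) = next_tuple n (digit n m)"
proof
  have q: "Suc m div n ^ i = m div n ^ i + of_bool (\<forall>i'<i. digit n m i' = n - 1)" for i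
  proof (induction i)
    case (Suc i)
    let ?c = "\<forall>i'<i. digit n m i' = n - 1"
    have iff: "(\<forall>i'<Suc i. digit n m i' = n - 1) \<longleftrightarrow> ?c \<and> digit n m i = n - 1" by (auto simp: less_Suc_eq)
    have dv: "a div n ^ Suc i = a div n ^ i div n" for a
      by (simp only: power_Suc2 div_mult2_eq)
    have "Suc m div n ^ Suc i = (m div n ^ i + of_bool ?c) div n"
      unfolding dv Suc.IH ..
    moreover have "(a + 1) div n = a div n + of_bool (a mod n = n - 1)" for a
    proof -
      have "(a + 1) div n = (if Suc (a mod n) = n then Suc (a div n) else a div n)"
        using div_Suc[of a n] by (simp add: mod_Suc)
      moreover have "Suc (a mod n) = n \<longleftrightarrow> a mod n = n - 1" using n by auto
      ultimately show ?thesis by simp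
    qed
    moreover have "digit n m i = (m div n ^ i) mod n" by (rule digit_def)
    ultimately show ?case unfolding iff dv by auto
  qed simp
  fix i
  let ?c = "\<forall>i'<i. digit n m i' = n - 1"
  have iff: "(\<forall>i'\<le>i. digit n m i' = n - 1) \<longleftrightarrow> ?c \<and> digit n m i = n - 1" by (auto simp: le_less)
  define C where "C \<longleftrightarrow> ?c"
  have "digit n (Suc m) i = (m div n ^ i + of_bool C) mod n" unfolding digit_def q C_def ..
  also have "\<dots> = (if C \<and> digit n m i = n - 1 then 0 else if C then digit n m i + 1 else digit n m i)"
  proof (cases C)
    case True
    have "(m div n ^ i + 1) mod n = (if Suc (digit n m i) = n then 0 else Suc (digit n m i))"
      unfolding digit_def using mod_Suc[of "m div n ^ i" n] by simp
    moreover have "Suc (digit n m i) = n \<longleftrightarrow> digit n m i = n - 1" using n by auto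
    ultimately show ?thesis using True by simp
  next
    case False
    then show ?thesis unfolding digit_def by simp
  qed
  finally show "digit n (Suc m) i = next_tuple n (digit n m) i" unfolding next_tuple_def iff C_def .
qed

definition all_ix :: "ix list" where
  "all_ix = map nat_ix [0..<12]"

lemma map_ix_nat_all_ix: "map ix_nat all_ix = [0..<12]"
  unfolding all_ix_def map_map by (rule map_idI) (simp add: nat_ix_inverse)

section \<open>Solving the system of one element in one mode\<close>

definition tuple_body :: mprog where
  "tuple_body = Seq (Cond (\<lambda>r i w m. i = I1) (eqs_prog all_ix) Skip) (Seq next_prog (move 1 0 0))"

definition tuple_loop :: mprog where
  "tuple_loop = While (\<lambda>r i w m. i \<noteq> IB) tuple_body"

definition sys_prog :: "tri \<Rightarrow> mprog" where
  "sys_prog md = Seq (on_reg (\<lambda>r. r\<lparr>r_mode := md, r_bad := False\<rparr>)) (Seq (row_loop clear_cell)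
     (Seq (sweep_W start_cell) (Seq insert_prog (Seq reset_prog (Seq rewind_I tuple_loop)))))"

definition vecs :: "nat \<Rightarrow> (nat \<Rightarrow> bool) \<Rightarrow> nat \<Rightarrow> nat \<Rightarrow> nat \<Rightarrow> (nat \<Rightarrow> int) list" where
  "vecs n sel md c k = init_eqn n c #
     concat (map (\<lambda>m. if sel m then map (\<lambda>q. eqn n md q (digit n m)) [0..<12] else []) [0..<k])"

lemma vecs_Suc: "vecs n sel md c (Suc k) =
    vecs n sel md c k @ (if sel k then map (\<lambda>q. eqn n md q (digit n k)) [0..<12] else [])"
  unfolding vecs_def by simp

lemma mtape_cong: "(\<And>i. i < D \<Longrightarrow> A i = A' i) \<Longrightarrow> mtape D A = mtape D A'"
proof
  fix x assume a: "\<And>i. i < D \<Longrightarrow> A i = A' i"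
  show "mtape D A x = mtape D A' x"
  proof (cases "0 \<le> x \<and> x < int (D * Suc D)")
    case True
    then have "nat x < D * Suc D" by (metis nat_less_iff)
    then have "nat x div Suc D < D" by (rule less_mult_imp_div_less)
    then show ?thesis using a unfolding mtape_def by simp
  next
    case False
    then show ?thesis unfolding mtape_def by (simp only: if_False)
  qed
qed

lemma rows_clear: "k < i \<Longrightarrow> snd (rows (\<lambda>i v w. (v, \<lambda>_. 0)) i v A) k = (\<lambda>_. 0)"
  and rows_clear_fst: "fst (rows (\<lambda>i v w. (v, \<lambda>_. 0)) i v A) = v"
  by (induction i) (auto simp: case_prod_beta less_Suc_eq)

definition tuples :: "nat \<Rightarrow> nat \<Rightarrow> (nat \<Rightarrow> bool) \<Rightarrow> (nat \<Rightarrow> nat) set" where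
  "tuples n K sel = digit n ` {m. m < K \<and> sel m}"

definition sys_time :: "nat \<Rightarrow> nat \<Rightarrow> nat" where
  "sys_time n K = 4000 * (K + 1) * (2 * n + 1) ^ 2"

context
  fixes n K :: nat and sel :: "nat \<Rightarrow> bool" and inp :: "int \<Rightarrow> isym"
  assumes K: "K = n ^ 12"
    and inp_sep: "inp (int n) = IS" and inp_other: "\<forall>x. x \<noteq> int n \<longrightarrow> inp x \<noteq> IS"
    and inp_tuple: "\<forall>m<K. inp (int (n + 1 + m)) = (if sel m then I1 else I0)"
    and inp_end: "inp (int (n + 1 + K)) = IB"
begin

abbreviation (input) st :: "reg \<Rightarrow> int \<Rightarrow> (nat \<Rightarrow> ix set) \<Rightarrow> (nat \<Rightarrow> bool) \<Rightarrow> (nat \<Rightarrow> int) \<Rightarrow> (nat \<Rightarrow> nat \<Rightarrow> int) \<Rightarrow> mstore" where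
  "st r ip mk cu v A \<equiv> (r, (ip, inp), (0, wtape (2 * n) (cells (2 * n) mk (\<lambda>j. j = 2 * n) cu v)), (0, mtape (2 * n) A))"

text \<open>Invariant: after \<open>m\<close> tuple bits the matrix is the echelon form of the
  initial equation and those of the first \<open>m\<close> tuples, and \<open>r_bad\<close> records
  whether a contradiction has appeared. The constant 3700 covers twelve insertions at cost 300 and
  the step to the next tuple.\<close>

lemma runs_tuple_loop:
  assumes "d + m = K" "in_range v" "\<forall>i. in_range (A i)"
    "insert_eqs (modulus (mode_nat (r_mode r))) (2 * n) (vecs n sel (mode_nat (r_mode r)) c m) (False, \<lambda>_ _. 0) = (r_bad r, A)"
  shows "\<exists>r' v' A' mk'. runs tuple_loop (d * (3700 * (2 * n + 1) ^ 2) + 1)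
      (st r (int (n + 1 + m)) (tuple_marks (2 * n) (digit n m)) cu v A) (st r' (int (n + 1 + K)) mk' cu v' A') \<and>
    keep r' = keep (r\<lparr>r_bad := fst (insert_eqs (modulus (mode_nat (r_mode r))) (2 * n)
      (vecs n sel (mode_nat (r_mode r)) c K) (False, \<lambda>_ _. 0))\<rparr>) \<and> in_range v' \<and> (\<forall>i. in_range (A' i))"
  using assms
proof (induction d arbitrary: m r v A)
  case 0
  let ?s = "st r (int (n + 1 + m)) (tuple_marks (2 * n) (digit n m)) cu v A"
  have m: "m = K" using 0 by simp
  have "runs tuple_loop 1 ?s ?s"
    unfolding tuple_loop_def by (rule runs_While_False) (use m inp_end in simp)
  moreover have "keep r = keep (r\<lparr>r_bad := fst (insert_eqs (modulus (mode_nat (r_mode r))) (2 * n)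
      (vecs n sel (mode_nat (r_mode r)) c K) (False, \<lambda>_ _. 0))\<rparr>)"
    using 0(4) unfolding m keep_def by simp
  ultimately show ?case using 0(2,3) m by auto
next
  case (Suc d)
  let ?D = "2 * n" and ?md = "mode_nat (r_mode r)"
  let ?t = "digit n m"
  let ?mk = "tuple_marks ?D ?t"
  have m: "m < K" using Suc.prems(1) by simp
  then have n: "0 < n" unfolding K by (cases "n = 0") simp_all
  have t: "\<forall>i<12. ?t i < n" unfolding digit_def using n by simp
  have sc: "scan (int (n + 1 + m), inp) = (if sel m then I1 else I0)" using inp_tuple[rule_format, OF m] by simp
  obtain bad1 A1 where res: "insert_eqs (modulus ?md) ?D (vecs n sel ?md c (Suc m)) (False, \<lambda>_ _. 0) = (bad1, A1)"
    by fastforce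
  have "\<exists>r1 v1. runs (Cond (\<lambda>r i w m. i = I1) (eqs_prog all_ix) Skip) (12 * (300 * (?D + 1) ^ 2) + 1)
      (st r (int (n + 1 + m)) ?mk cu v A) (st r1 (int (n + 1 + m)) ?mk cu v1 A1) \<and>
      keep r1 = keep (r\<lparr>r_bad := bad1\<rparr>) \<and> in_range v1 \<and> (\<forall>i. in_range (A1 i))"
  proof (cases "sel m")
    case True
    have "map (\<lambda>x. eqn n ?md (ix_nat x) ?t) all_ix = map (\<lambda>q. eqn n ?md q ?t) (map ix_nat all_ix)" by simp
    then have "map (\<lambda>x. eqn n ?md (ix_nat x) ?t) all_ix = map (\<lambda>q. eqn n ?md q ?t) [0..<12]"
      unfolding map_ix_nat_all_ix .
    then have "insert_eqs (modulus ?md) ?D (map (\<lambda>x. eqn n ?md (ix_nat x) ?t) all_ix) (r_bad r, A) = (bad1, A1)"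
      using res Suc.prems(4) True unfolding vecs_Suc insert_eqs_append by (simp only: if_True)
    from runs_eqs_prog[OF Suc.prems(2,3) this] obtain r1 v1 where
      r1: "runs (eqs_prog all_ix) (length all_ix * (300 * (?D + 1) ^ 2))
        (st r (int (n + 1 + m)) ?mk cu v A) (st r1 (int (n + 1 + m)) ?mk cu v1 A1)"
        "keep r1 = keep (r\<lparr>r_bad := bad1\<rparr>)" "in_range v1" "\<forall>i. in_range (A1 i)" by blast
    have len: "length all_ix = 12" unfolding all_ix_def by simp
    have "runs (Cond (\<lambda>r i w m. i = I1) (eqs_prog all_ix) Skip) (12 * (300 * (?D + 1) ^ 2) + 1)
      (st r (int (n + 1 + m)) ?mk cu v A) (st r1 (int (n + 1 + m)) ?mk cu v1 A1)"
      by (rule runs_Cond) (use r1(1) sc True in \<open>simp_all only: len if_True simp_thms\<close>)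
    then show ?thesis using r1 by blast
  next
    case False
    then have e: "bad1 = r_bad r" "A1 = A" using res Suc.prems(4) unfolding vecs_Suc by simp_all
    have "runs Skip (12 * (300 * (?D + 1) ^ 2)) (st r (int (n + 1 + m)) ?mk cu v A) (st r (int (n + 1 + m)) ?mk cu v A)"
      by (rule runs_mono[OF runs_Skip]) simp
    then have "runs (Cond (\<lambda>r i w m. i = I1) (eqs_prog all_ix) Skip) (12 * (300 * (?D + 1) ^ 2) + 1)
      (st r (int (n + 1 + m)) ?mk cu v A) (st r (int (n + 1 + m)) ?mk cu v A1)"
      unfolding e by (intro runs_Cond) (use sc False in \<open>simp_all only: if_False isym.distinct simp_thms\<close>)
    moreover have "keep r = keep (r\<lparr>r_bad := bad1\<rparr>)" unfolding e keep_def by simp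
    ultimately show ?thesis using Suc.prems(2,3) e by blast
  qed
  then obtain r1 v1 where r1: "runs (Cond (\<lambda>r i w m. i = I1) (eqs_prog all_ix) Skip) (12 * (300 * (?D + 1) ^ 2) + 1)
      (st r (int (n + 1 + m)) ?mk cu v A) (st r1 (int (n + 1 + m)) ?mk cu v1 A1)"
    "keep r1 = keep (r\<lparr>r_bad := bad1\<rparr>)" "in_range v1" "\<forall>i. in_range (A1 i)" by blast
  let ?mk' = "tuple_marks ?D (digit n (Suc m))"
  obtain r2 where r2: "runs next_prog (30 * (?D + 1)) (st r1 (int (n + 1 + m)) ?mk cu v1 A1)
      (st r2 (int (n + 1 + m)) ?mk' cu v1 A1)" "keep r2 = keep r1"
    using runs_next_prog[OF n t, of r1 "(int (n + 1 + m), inp)" "\<lambda>j. j = ?D" cu v1 "(0, mtape ?D A1)"]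
    unfolding digit_Suc[OF n, of m] by blast
  have h: "int (n + 1 + m) + 1 = int (n + 1 + Suc m)" by simp
  have mv: "runs (move 1 0 0) 1 (st r2 (int (n + 1 + m)) ?mk' cu v1 A1) (st r2 (int (n + 1 + Suc m)) ?mk' cu v1 A1)"
    using runs_move[of 1 0 0 r2 "int (n + 1 + m)" inp 0 _ 0] unfolding h by simp
  have body: "runs tuple_body ((12 * (300 * (?D + 1) ^ 2) + 1) + ((30 * (?D + 1)) + 1 + 1) + 1)
      (st r (int (n + 1 + m)) ?mk cu v A) (st r2 (int (n + 1 + Suc m)) ?mk' cu v1 A1)"
    unfolding tuple_body_def by (rule runs_Seq[OF r1(1) runs_Seq[OF r2(1) mv]])
  have k2: "r_mode r2 = r_mode r" "r_bad r2 = bad1" using r2(2) r1(2) unfolding keep_def by simp_all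
  have "insert_eqs (modulus (mode_nat (r_mode r2))) ?D (vecs n sel (mode_nat (r_mode r2)) c (Suc m)) (False, \<lambda>_ _. 0) = (r_bad r2, A1)"
    unfolding k2 by (rule res)
  from Suc.IH[OF _ r1(3,4) this] Suc.prems(1) obtain r' v' A' mk' where
    r': "runs tuple_loop (d * (3700 * (?D + 1) ^ 2) + 1)
      (st r2 (int (n + 1 + Suc m)) ?mk' cu v1 A1) (st r' (int (n + 1 + K)) mk' cu v' A')"
    "keep r' = keep (r2\<lparr>r_bad := fst (insert_eqs (modulus ?md) ?D (vecs n sel ?md c K) (False, \<lambda>_ _. 0))\<rparr>)"
    "in_range v'" "\<forall>i. in_range (A' i)" unfolding k2 by auto
  have "runs tuple_loop (((12 * (300 * (?D + 1) ^ 2) + 1) + ((30 * (?D + 1)) + 1 + 1) + 1) + (d * (3700 * (?D + 1) ^ 2) + 1) + 2)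
      (st r (int (n + 1 + m)) ?mk cu v A) (st r' (int (n + 1 + K)) mk' cu v' A')"
    unfolding tuple_loop_def
    by (rule runs_While_True[OF _ body r'(1)[unfolded tuple_loop_def]]) (simp only: sc split: if_split, simp)
  then have "runs tuple_loop (Suc d * (3700 * (?D + 1) ^ 2) + 1)
      (st r (int (n + 1 + m)) ?mk cu v A) (st r' (int (n + 1 + K)) mk' cu v' A')"
    by (rule runs_mono) (simp add: power2_eq_square algebra_simps)
  moreover have "keep r' = keep (r\<lparr>r_bad := fst (insert_eqs (modulus ?md) ?D (vecs n sel ?md c K) (False, \<lambda>_ _. 0))\<rparr>)"
    using r'(2) r2(2) r1(2) unfolding keep_def by simp
  ultimately show ?case using r'(3,4) by blast
qed

lemma runs_rewind_I:
  "runs rewind_I (3 * d + 3) (r, (int (n + d), inp), tw, tm) (r, (int (n + 1), inp), tw, tm)"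
proof -
  obtain hw cw hm cm where t: "tw = (hw, cw)" "tm = (hm, cm)" by (cases tw; cases tm) auto
  have lp: "runs (While (\<lambda>r i w m. i \<noteq> IS) (move (-1) 0 0)) (3 * d + 1) (r, (int (n + d), inp), tw, tm) (r, (int n, inp), tw, tm)" for d
  proof (induction d)
    case 0
    have "runs (While (\<lambda>r i w m. i \<noteq> IS) (move (-1) 0 0)) 1 (r, (int n, inp), tw, tm) (r, (int n, inp), tw, tm)"
      by (rule runs_While_False) (simp add: inp_sep)
    then show ?case by simp
  next
    case (Suc d)
    have "runs (While (\<lambda>r i w m. i \<noteq> IS) (move (-1) 0 0)) (1 + (3 * d + 1) + 2) (r, (int (n + Suc d), inp), tw, tm) (r, (int n, inp), tw, tm)"
    proof (rule runs_While_True[OF _ _ Suc.IH])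
      show "scan (int (n + Suc d), inp) \<noteq> IS" using inp_other by simp
      show "runs (move (-1) 0 0) 1 (r, (int (n + Suc d), inp), tw, tm) (r, (int (n + d), inp), tw, tm)"
        unfolding t using runs_move[of "-1" 0 0 r "int (n + Suc d)" inp hw cw hm cm] by simp
    qed
    then show ?case by (rule runs_mono) simp
  qed
  have "runs (move 1 0 0) 1 (r, (int n, inp), tw, tm) (r, (int (n + 1), inp), tw, tm)"
    unfolding t using runs_move[of 1 0 0 r "int n" inp hw cw hm cm] by (simp add: add.commute)
  from runs_Seq[OF lp this] show ?thesis unfolding rewind_I_def by (rule runs_mono) simp
qed

lemma insert_vecs_solvable:
  "fst (insert_eqs (modulus md) (2 * n) (vecs n sel md c K) (False, \<lambda>_ _. 0)) \<longleftrightarrow> \<not> solvable n (tuples n K sel) md c"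
proof -
  have p: "modulus md = 2 \<or> modulus md = 3" unfolding modulus_def by simp
  have rng: "0 \<le> v j \<and> v j < modulus md" if "v \<in> set (vecs n sel md c K)" for v j
  proof -
    have pos: "0 < modulus md" "1 < modulus md" using p by auto
    have "0 \<le> init_eqn n c j \<and> init_eqn n c j < modulus md" unfolding init_eqn_def using pos by simp
    moreover have "0 \<le> eqn n md q t j \<and> eqn n md q t j < modulus md" for q t
      unfolding eqn_def using pos by simp
    ultimately show ?thesis using that unfolding vecs_def by (auto split: if_splits)
  qed
  have "set (vecs n sel md c K) = insert (init_eqn n c) (\<Union>t\<in>tuples n K sel. (\<lambda>q. eqn n md q t) ` {..<12})"
    unfolding vecs_def tuples_def by (auto simp: atLeast0LessThan split: if_splits)
  then have "(\<forall>v\<in>set (vecs n sel md c K). satisfies_eq (modulus md) (2 * n) v y) \<longleftrightarrow>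
      satisfies_eq (modulus md) (2 * n) (init_eqn n c) y \<and>
      (\<forall>t\<in>tuples n K sel. \<forall>q<12. satisfies_eq (modulus md) (2 * n) (eqn n md q t) y)" for y
    by auto
  then have "(\<exists>y. \<forall>v\<in>set (vecs n sel md c K). satisfies_eq (modulus md) (2 * n) v y) \<longleftrightarrow> solvable n (tuples n K sel) md c"
    unfolding solvable_def by (simp only:)
  then show ?thesis using insert_eqs_solvable[OF p, of "vecs n sel md c K" "2 * n"] rng by blast
qed

text \<open>\<open>d\<close> is the distance of the input head from the separator: 1 on the first
  call and \<open>K + 1\<close> on all later ones. Its bound keeps the rewinding within
  \<open>sys_time\<close>.\<close>

lemma runs_sys_prog:
  assumes v: "in_range v" and A: "\<forall>i. in_range (A i)" and cu: "\<forall>j<2 * n. cu j \<longleftrightarrow> j div 2 = c"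
    and d: "d \<le> K + 1"
  shows "\<exists>r' v' A' mk'. runs (sys_prog md) (sys_time n K) (st r (int (n + d)) mk cu v A) (st r' (int (n + (K + 1))) mk' cu v' A') \<and>
    keep r' = keep (r\<lparr>r_mode := md, r_bad := \<not> solvable n (tuples n K sel) (mode_nat md) c\<rparr>) \<and> in_range v' \<and> (\<forall>i. in_range (A' i))"
proof -
  let ?D = "2 * n" and ?md = "mode_nat md"
  define r1 where "r1 = r\<lparr>r_mode := md, r_bad := False\<rparr>"
  have 1: "runs (on_reg (\<lambda>r. r\<lparr>r_mode := md, r_bad := False\<rparr>)) 1 (st r (int (n + d)) mk cu v A) (st r1 (int (n + d)) mk cu v A)"
    unfolding r1_def by (rule runs_on_reg)
  obtain r2 where 2: "runs (row_loop clear_cell) (100 * (?D + 1) ^ 2) (st r1 (int (n + d)) mk cu v A)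
      (r2, (int (n + d), inp), (0, wtape ?D (cells ?D mk (\<lambda>j. j = ?D) cu (fst (rows (\<lambda>i v w. (v, \<lambda>_. 0)) ?D v A)))),
        (0, mtape ?D (snd (rows (\<lambda>i v w. (v, \<lambda>_. 0)) ?D v A))))" "keep r2 = keep r1"
    using runs_row_loop[OF row_op_clear v A] by blast
  have "mtape ?D (snd (rows (\<lambda>i v w. (v, \<lambda>_. 0)) ?D v A)) = mtape ?D (\<lambda>_ _. 0)"
    by (rule mtape_cong) (rule rows_clear)
  with 2(1) have 2: "runs (row_loop clear_cell) (100 * (?D + 1) ^ 2) (st r1 (int (n + d)) mk cu v A)
      (st r2 (int (n + d)) mk cu v (\<lambda>_ _. 0))" "keep r2 = keep r1"
    using \<open>keep r2 = keep r1\<close> by (simp_all only: rows_clear_fst)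
  have 3: "runs (sweep_W start_cell) (6 * ?D + 20) (st r2 (int (n + d)) mk cu v (\<lambda>_ _. 0))
      (st r2 (int (n + d)) mk cu (init_eqn n c) (\<lambda>_ _. 0))"
    by (rule runs_start_cell) (use cu in blast)
  have zr: "\<forall>i::nat. in_range ((\<lambda>_ _. 0) i)" unfolding in_range_def by simp
  have m2: "r_mode r2 = md" "r_bad r2 = False" using 2(2) unfolding r1_def keep_def by simp_all
  obtain v3 A3 where ins: "insert_eq (modulus (mode_nat (r_mode r2))) ?D (init_eqn n c) (\<lambda>_ _. 0) = (v3, A3)" by fastforce
  obtain r3 where 4: "runs insert_prog (200 * (?D + 1) ^ 2) (st r2 (int (n + d)) mk cu (init_eqn n c) (\<lambda>_ _. 0))
      (st r3 (int (n + d)) mk cu v3 A3)"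
    "keep r3 = keep (r2\<lparr>r_bad := r_bad r2 \<or> v3 ?D \<noteq> 0\<rparr>)" "in_range v3" "\<forall>i. in_range (A3 i)"
    using runs_insert[OF in_range_init_eqn zr ins] by blast
  obtain r4 where 5: "runs reset_prog (6 * ?D + 22) (st r3 (int (n + d)) mk cu v3 A3)
      (st r4 (int (n + d)) (tuple_marks ?D (\<lambda>_. 0)) cu v3 A3)" "keep r4 = keep r3"
    using runs_reset_prog by blast
  have "digit n 0 = (\<lambda>_. 0)" unfolding digit_def by (simp add: fun_eq_iff)
  then have 5: "runs reset_prog (6 * ?D + 22) (st r3 (int (n + d)) mk cu v3 A3)
      (st r4 (int (n + d)) (tuple_marks ?D (digit n 0)) cu v3 A3)" "keep r4 = keep r3"
    using 5 by simp_all
  have 6: "runs rewind_I (3 * d + 3) (st r4 (int (n + d)) (tuple_marks ?D (digit n 0)) cu v3 A3)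
      (st r4 (int (n + 1 + 0)) (tuple_marks ?D (digit n 0)) cu v3 A3)"
    using runs_rewind_I[of d r4] by simp
  have m4: "r_mode r4 = md" "r_bad r4 = (v3 ?D \<noteq> 0)" using 5(2) 4(2) m2 unfolding keep_def by simp_all
  have "insert_eqs (modulus (mode_nat (r_mode r4))) ?D (vecs n sel (mode_nat (r_mode r4)) c 0) (False, \<lambda>_ _. 0) = (r_bad r4, A3)"
    unfolding m4 vecs_def using ins unfolding m2 by simp
  from runs_tuple_loop[OF _ 4(3,4) this, of K cu] obtain r' v' A' mk' where
    7: "runs tuple_loop (K * (3700 * (?D + 1) ^ 2) + 1)
      (st r4 (int (n + 1 + 0)) (tuple_marks ?D (digit n 0)) cu v3 A3) (st r' (int (n + 1 + K)) mk' cu v' A')"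
    "keep r' = keep (r4\<lparr>r_bad := fst (insert_eqs (modulus ?md) ?D (vecs n sel ?md c K) (False, \<lambda>_ _. 0))\<rparr>)"
    "in_range v'" "\<forall>i. in_range (A' i)" unfolding m4 by auto
  have "runs (sys_prog md) (sys_time n K) (st r (int (n + d)) mk cu v A) (st r' (int (n + 1 + K)) mk' cu v' A')"
    unfolding sys_prog_def
  proof (rule runs_mono[OF runs_Seq[OF 1 runs_Seq[OF 2(1) runs_Seq[OF 3 runs_Seq[OF 4(1) runs_Seq[OF 5(1) runs_Seq[OF 6 7(1)]]]]]]])
    define Y where "Y = (?D + 1) ^ 2"
    have Y: "?D + 1 \<le> Y" unfolding Y_def by (simp add: power2_eq_square)
    then have "K \<le> K * Y" by simp
    moreover have "sys_time n K = 4000 * (K * Y) + 4000 * Y" unfolding sys_time_def Y_def[symmetric] by (simp add: algebra_simps)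
    moreover have "K * (3700 * Y) = 3700 * (K * Y)" by simp
    ultimately show "1 + (100 * (?D + 1)\<^sup>2 + (6 * ?D + 20 + (200 * (?D + 1)\<^sup>2 + (6 * ?D + 22 +
        (3 * d + 3 + (K * (3700 * (?D + 1)\<^sup>2) + 1) + 1) + 1) + 1) + 1) + 1) + 1 \<le> sys_time n K"
      unfolding Y_def[symmetric] using Y d by linarith
  qed
  moreover have "keep r' = keep (r\<lparr>r_mode := md, r_bad := \<not> solvable n (tuples n K sel) ?md c\<rparr>)"
    using 7(2) 5(2) 4(2) 2(2) insert_vecs_solvable[of ?md c] unfolding keep_def r1_def by simp
  moreover have "int (n + 1 + K) = int (n + (K + 1))" by simp
  ultimately show ?thesis using 7(3,4) by metis
qed

end

section \<open>Tractability of the template\<close>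

definition main_body :: mprog where
  "main_body = Seq (sys_prog Z0) (Seq (on_reg (\<lambda>r. r\<lparr>r_ok0 := \<not> r_bad r\<rparr>))
     (Seq (sys_prog Z1) (Seq (on_reg (\<lambda>r. r\<lparr>r_ok1 := \<not> r_bad r\<rparr>))
     (Seq (sys_prog Z2) (Seq (on_reg (\<lambda>r. r\<lparr>r_fail := r_fail r \<or> \<not> (r_ok0 r \<and> (r_ok1 r \<or> \<not> r_bad r))\<rparr>))
     (cur_prog False))))))"

definition main_loop :: mprog where
  "main_loop = While (\<lambda>r i w m. \<not> r_done r) main_body"

definition blank_cell :: "cell_kind \<Rightarrow> wcell" where
  "blank_cell k = \<lparr>w_kind = k, w_marks = {}, w_piv = (k = KR), w_cur = False, w_val = Z0\<rparr>"

text \<open>Each unary 0 of the input yields the two columns of an element. The separator bit is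
  overwritten by \<open>IS\<close>: relation bits may also be \<open>I1\<close>, so the separator
  could not be recognised when the head returns from the right.\<close>

definition init_prog :: mprog where
  "init_prog = Seq (move 0 0 (-1)) (Seq (Act (\<lambda>r i w m. (r, (i, 0), (w, 0), ((Z0, True), 1))))
     (Seq (While (\<lambda>r i w m. i = I0)
        (Seq (Act (\<lambda>r i w m. (r, (i, 0), (Some (blank_cell KX), 1), (m, 0))))
          (Act (\<lambda>r i w m. (r, (i, 1), (Some (blank_cell KS), 1), (m, 0))))))
     (Seq (Act (\<lambda>r i w m. (r, (IS, 1), (Some (blank_cell KR), 1), (m, 0)))) rewind_W)))"

definition main_prog :: mprog where
  "main_prog = Seq init_prog (Seq (cur_prog True) main_loop)"

definition blank_cells :: "nat \<Rightarrow> nat \<Rightarrow> wcell" where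
  "blank_cells D = cells D (\<lambda>_. {}) (\<lambda>j. j = D) (\<lambda>_. False) (\<lambda>_. 0)"

definition partial_tape :: "nat \<Rightarrow> nat \<Rightarrow> int \<Rightarrow> wcell option" where
  "partial_tape D k x = (if 0 \<le> x \<and> x < int k then Some (blank_cells D (nat x)) else None)"

lemma partial_tape_upd: "(partial_tape D k)(int k := Some (blank_cells D k)) = partial_tape D (Suc k)"
  unfolding partial_tape_def by (auto simp: fun_eq_iff)

lemma blank_cells_eq: "blank_cells D j = blank_cell (cell_kind_of D j)"
  unfolding blank_cells_def cells_def blank_cell_def int_tri_def cell_kind_of_def by auto

lemma runs_init_prog:
  assumes i0: "\<And>x. x < n \<Longrightarrow> inp0 (int x) = I0" and i1: "inp0 (int n) = I1"
  shows "runs init_prog (20 * (n + 2)) (r, (0, inp0), (0, \<lambda>_. None), (0, \<lambda>_. (Z0, False)))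
    (r, (int (n + 1), inp0(int n := IS)), (0, wtape (2 * n) (blank_cells (2 * n))), (0, mtape (2 * n) (\<lambda>_ _. 0)))"
proof -
  let ?D = "2 * n"
  let ?m = "mtape ?D (\<lambda>_ _. 0)"
  have 1: "runs (move 0 0 (-1)) 1 (r, (0, inp0), (0, \<lambda>_. None), (0, \<lambda>_. (Z0, False)))
      (r, (0, inp0), (0, \<lambda>_. None), (-1, \<lambda>_. (Z0, False)))"
    using runs_move[of 0 0 "-1" r 0 inp0 0 "\<lambda>_. None" 0 "\<lambda>_. (Z0, False)"] by simp
  have m: "(\<lambda>_. (Z0, False))(-1 := (Z0, True)) = ?m"
    unfolding mtape_def int_tri_def by (auto simp: fun_eq_iff)
  have w0: "(\<lambda>_. None) = partial_tape ?D 0" unfolding partial_tape_def by (auto simp: fun_eq_iff)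
  have 2: "runs (Act (\<lambda>r i w m. (r, (i, 0), (w, 0), ((Z0, True), 1)))) 1
      (r, (0, inp0), (0, \<lambda>_. None), (-1, \<lambda>_. (Z0, False))) (r, (0, inp0), (0, partial_tape ?D 0), (0, ?m))"
    using runs_Act[of "\<lambda>r i w m. (r, (i, 0), (w, 0), ((Z0, True), 1))" r "(0, inp0)" "(0, \<lambda>_. None)" "(-1, \<lambda>_. (Z0, False))"]
    by (simp add: m w0[symmetric] fun_upd_idem)
  let ?b = "Seq (Act (\<lambda>r i w m. (r, (i, 0), (Some (blank_cell KX), 1), (m, 0))))
          (Act (\<lambda>r i w m. (r, (i, 1), (Some (blank_cell KS), 1), (m, 0)))) :: mprog"
  let ?s = "\<lambda>k. (r, (int k, inp0), (int (2 * k), partial_tape ?D (2 * k)), (0 :: int, ?m))"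
  have lp: "runs (While (\<lambda>r i w m. i = I0) ?b) (5 * d + 1) (?s k) (?s n)" if "d + k = n" for d k
    using that
  proof (induction d arbitrary: k)
    case 0
    have "runs (While (\<lambda>r i w m. i = I0) ?b) 1 (?s k) (?s k)"
      by (rule runs_While_False) (use 0 i1 in simp)
    then show ?case using 0 by simp
  next
    case (Suc d)
    then have k: "k < n" by simp
    have odd: "Suc (2 * k) \<noteq> 2 * n" by presburger
    have X: "blank_cells ?D (2 * k) = blank_cell KX" "blank_cells ?D (Suc (2 * k)) = blank_cell KS"
      unfolding blank_cells_eq cell_kind_of_def using k odd by simp_all
    have a: "runs (Act (\<lambda>r i w m. (r, (i, 0), (Some (blank_cell KX), 1), (m, 0)))) 1 (?s k)
        (r, (int k, inp0), (int (Suc (2 * k)), partial_tape ?D (Suc (2 * k))), (0, ?m))"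
      using runs_Act[of "\<lambda>r i w m. (r, (i, 0), (Some (blank_cell KX), 1), (m, 0))" r "(int k, inp0)"
          "(int (2 * k), partial_tape ?D (2 * k))" "(0, ?m)"]
      unfolding X(1)[symmetric] store_act.simps tape_act.simps partial_tape_upd scan.simps
      by (simp add: fun_upd_idem add.commute)
    have b: "runs (Act (\<lambda>r i w m. (r, (i, 1), (Some (blank_cell KS), 1), (m, 0)))) 1
        (r, (int k, inp0), (int (Suc (2 * k)), partial_tape ?D (Suc (2 * k))), (0, ?m)) (?s (Suc k))"
      using runs_Act[of "\<lambda>r i w m. (r, (i, 1), (Some (blank_cell KS), 1), (m, 0))" r "(int k, inp0)"
          "(int (Suc (2 * k)), partial_tape ?D (Suc (2 * k)))" "(0, ?m)"]
      unfolding X(2)[symmetric] store_act.simps tape_act.simps partial_tape_upd scan.simps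
      by (simp add: fun_upd_idem add.commute)
    have "runs (While (\<lambda>r i w m. i = I0) ?b) ((1 + 1 + 1) + (5 * d + 1) + 2) (?s k) (?s n)"
    proof (rule runs_While_True[OF _ runs_Seq[OF a b]])
      show "scan (int k, inp0) = I0" using i0[OF k] by simp
      show "runs (While (\<lambda>r i w m. i = I0) ?b) (5 * d + 1) (?s (Suc k)) (?s n)" by (rule Suc.IH) (use Suc.prems in simp)
    qed
    then show ?case by (rule runs_mono) simp
  qed
  have KRc: "blank_cells ?D ?D = blank_cell KR" unfolding blank_cells_eq cell_kind_of_def by simp
  have wt: "partial_tape ?D (Suc ?D) = wtape ?D (blank_cells ?D)"
    unfolding partial_tape_def wtape_def by (auto simp: fun_eq_iff)
  have 4: "runs (Act (\<lambda>r i w m. (r, (IS, 1), (Some (blank_cell KR), 1), (m, 0)))) 1 (?s n)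
      (r, (int (n + 1), inp0(int n := IS)), (int ?D + 1, wtape ?D (blank_cells ?D)), (0, ?m))"
    using runs_Act[of "\<lambda>r i w m. (r, (IS, 1), (Some (blank_cell KR), 1), (m, 0))" r "(int n, inp0)"
        "(int ?D, partial_tape ?D ?D)" "(0, ?m)"]
    unfolding KRc[symmetric] store_act.simps tape_act.simps partial_tape_upd scan.simps wt
    by (simp add: fun_upd_idem add.commute)
  have lp0: "runs (While (\<lambda>r i w m. i = I0) ?b) (5 * n + 1) (r, (0, inp0), (0, partial_tape ?D 0), (0, ?m)) (?s n)"
    using lp[of n 0] by simp
  show ?thesis unfolding init_prog_def
    by (rule runs_mono[OF runs_Seq[OF 1 runs_Seq[OF 2 runs_Seq[OF lp0 runs_Seq[OF 4 runs_rewind_W]]]]]) simp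
qed

definition elem_ok :: "nat \<Rightarrow> nat \<Rightarrow> (nat \<Rightarrow> bool) \<Rightarrow> nat \<Rightarrow> bool" where
  "elem_ok n K sel c \<longleftrightarrow> solvable n (tuples n K sel) 0 c \<and> (solvable n (tuples n K sel) 1 c \<or> solvable n (tuples n K sel) 2 c)"

context
  fixes n K :: nat and sel :: "nat \<Rightarrow> bool" and inp :: "int \<Rightarrow> isym"
  assumes K: "K = n ^ 12"
    and inp_sep: "inp (int n) = IS" and inp_other: "\<forall>x. x \<noteq> int n \<longrightarrow> inp x \<noteq> IS"
    and inp_tuple: "\<forall>m<K. inp (int (n + 1 + m)) = (if sel m then I1 else I0)"
    and inp_end: "inp (int (n + 1 + K)) = IB"
begin

abbreviation (input) st' :: "reg \<Rightarrow> int \<Rightarrow> (nat \<Rightarrow> ix set) \<Rightarrow> (nat \<Rightarrow> bool) \<Rightarrow> (nat \<Rightarrow> int) \<Rightarrow> (nat \<Rightarrow> nat \<Rightarrow> int) \<Rightarrow> mstore" where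
  "st' r ip mk cu v A \<equiv> (r, (ip, inp), (0, wtape (2 * n) (cells (2 * n) mk (\<lambda>j. j = 2 * n) cu v)), (0, mtape (2 * n) A))"

lemma mode_nat_simps: "mode_nat Z0 = 0" "mode_nat Z1 = 1" "mode_nat Z2 = 2"
  unfolding mode_nat_def by simp_all

lemmas runs_sys = runs_sys_prog[OF K inp_sep inp_other inp_tuple inp_end]

lemma runs_main_body:
  assumes v: "in_range v" and A: "\<forall>i. in_range (A i)" and cu: "\<forall>j<2 * n. cu j \<longleftrightarrow> j div 2 = c"
    and c: "c < n" and d: "d \<le> K + 1"
  shows "\<exists>r' v' A' mk' cu'. runs main_body (20000 * (K + 1) * (2 * n + 1) ^ 2)
      (st' r (int (n + d)) mk cu v A) (st' r' (int (n + (K + 1))) mk' cu' v' A') \<and>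
    r_fail r' = (r_fail r \<or> \<not> elem_ok n K sel c) \<and> r_done r' = (Suc c = n) \<and> in_range v' \<and> (\<forall>i. in_range (A' i)) \<and>
    (\<forall>j<2 * n. cu' j \<longleftrightarrow> j div 2 = Suc c)"
proof -
  let ?T = "tuples n K sel" and ?e = "int (n + (K + 1))"
  obtain r1 v1 A1 mk1 where 1: "runs (sys_prog Z0) (sys_time n K) (st' r (int (n + d)) mk cu v A) (st' r1 ?e mk1 cu v1 A1)"
    "keep r1 = keep (r\<lparr>r_mode := Z0, r_bad := \<not> solvable n ?T (mode_nat Z0) c\<rparr>)" "in_range v1" "\<forall>i. in_range (A1 i)"
    using runs_sys[OF v A cu d, where md = Z0 and mk = mk and r = r] by blast
  define r1' where "r1' = r1\<lparr>r_ok0 := \<not> r_bad r1\<rparr>"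
  have 2: "runs (on_reg (\<lambda>r. r\<lparr>r_ok0 := \<not> r_bad r\<rparr>)) 1 (st' r1 ?e mk1 cu v1 A1) (st' r1' ?e mk1 cu v1 A1)"
    unfolding r1'_def by (rule runs_on_reg)
  obtain r2 v2 A2 mk2 where 3: "runs (sys_prog Z1) (sys_time n K) (st' r1' ?e mk1 cu v1 A1) (st' r2 ?e mk2 cu v2 A2)"
    "keep r2 = keep (r1'\<lparr>r_mode := Z1, r_bad := \<not> solvable n ?T (mode_nat Z1) c\<rparr>)" "in_range v2" "\<forall>i. in_range (A2 i)"
    using runs_sys[OF 1(3,4) cu le_refl, where md = Z1 and mk = mk1 and r = r1'] by blast
  define r2' where "r2' = r2\<lparr>r_ok1 := \<not> r_bad r2\<rparr>"
  have 4: "runs (on_reg (\<lambda>r. r\<lparr>r_ok1 := \<not> r_bad r\<rparr>)) 1 (st' r2 ?e mk2 cu v2 A2) (st' r2' ?e mk2 cu v2 A2)"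
    unfolding r2'_def by (rule runs_on_reg)
  obtain r3 v3 A3 mk3 where 5: "runs (sys_prog Z2) (sys_time n K) (st' r2' ?e mk2 cu v2 A2) (st' r3 ?e mk3 cu v3 A3)"
    "keep r3 = keep (r2'\<lparr>r_mode := Z2, r_bad := \<not> solvable n ?T (mode_nat Z2) c\<rparr>)" "in_range v3" "\<forall>i. in_range (A3 i)"
    using runs_sys[OF 3(3,4) cu le_refl, where md = Z2 and mk = mk2 and r = r2'] by blast
  define r3' where "r3' = r3\<lparr>r_fail := r_fail r3 \<or> \<not> (r_ok0 r3 \<and> (r_ok1 r3 \<or> \<not> r_bad r3))\<rparr>"
  have 6: "runs (on_reg (\<lambda>r. r\<lparr>r_fail := r_fail r \<or> \<not> (r_ok0 r \<and> (r_ok1 r \<or> \<not> r_bad r))\<rparr>)) 1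
      (st' r3 ?e mk3 cu v3 A3) (st' r3' ?e mk3 cu v3 A3)"
    unfolding r3'_def by (rule runs_on_reg)
  let ?cu = "\<lambda>j. j \<noteq> 2 * n \<and> (if j < 2 then False else cu (j - 2))"
  obtain r4 where 7: "runs (cur_prog False) (6 * (2 * n) + 22) (st' r3' ?e mk3 cu v3 A3) (st' r4 ?e mk3 ?cu v3 A3)"
    "keep r4 = keep (r3'\<lparr>r_done := (if 2 * n < 2 then False else cu (2 * n - 2))\<rparr>)"
    using runs_cur_prog by blast
  have run: "runs main_body (20000 * (K + 1) * (2 * n + 1) ^ 2) (st' r (int (n + d)) mk cu v A) (st' r4 ?e mk3 ?cu v3 A3)"
    unfolding main_body_def
  proof (rule runs_mono[OF runs_Seq[OF 1(1) runs_Seq[OF 2 runs_Seq[OF 3(1) runs_Seq[OF 4 runs_Seq[OF 5(1) runs_Seq[OF 6 7(1)]]]]]]])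
    define Z where "Z = (K + 1) * (2 * n + 1) ^ 2"
    have "2 * n + 1 \<le> Z" unfolding Z_def power2_eq_square by simp
    moreover have "sys_time n K = 4000 * Z" unfolding sys_time_def Z_def by (simp only: mult.assoc)
    moreover have "20000 * (K + 1) * (2 * n + 1)\<^sup>2 = 20000 * Z" unfolding Z_def by (simp only: mult.assoc)
    ultimately show "sys_time n K + (1 + (sys_time n K + (1 + (sys_time n K + (1 + (6 * (2 * n) + 22) + 1) + 1) + 1) + 1) + 1) + 1
        \<le> 20000 * (K + 1) * (2 * n + 1)\<^sup>2"
      by linarith
  qed
  have k1: "r_bad r1 = (\<not> solvable n ?T 0 c)" "r_fail r1 = r_fail r"
    using 1(2) unfolding keep_def mode_nat_simps by simp_all
  have k2: "r_bad r2 = (\<not> solvable n ?T 1 c)" "r_ok0 r2 = solvable n ?T 0 c" "r_fail r2 = r_fail r"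
    using 3(2) k1 unfolding keep_def mode_nat_simps r1'_def by simp_all
  have k3: "r_bad r3 = (\<not> solvable n ?T 2 c)" "r_ok0 r3 = solvable n ?T 0 c" "r_ok1 r3 = solvable n ?T 1 c" "r_fail r3 = r_fail r"
    using 5(2) k2 unfolding keep_def mode_nat_simps r2'_def by simp_all
  have "r_fail r4 = (r_fail r \<or> \<not> elem_ok n K sel c)"
    using 7(2) k3 unfolding keep_def r3'_def elem_ok_def by simp
  moreover have "r_done r4 = (Suc c = n)"
  proof -
    have "(2 * n - 2) div 2 = n - 1" by simp
    moreover have "2 * n - 2 < 2 * n" using c by simp
    ultimately have "cu (2 * n - 2) \<longleftrightarrow> n - 1 = c" using cu by metis
    moreover have "r_done r4 = cu (2 * n - 2)" using 7(2) c unfolding keep_def by simp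
    ultimately show ?thesis using c by auto
  qed
  moreover have "\<forall>j<2 * n. ?cu j \<longleftrightarrow> j div 2 = Suc c"
  proof (intro allI impI)
    fix j assume j: "j < 2 * n"
    show "?cu j \<longleftrightarrow> j div 2 = Suc c"
    proof (cases "j < 2")
      case True
      then have "j div 2 = 0" by simp
      then show ?thesis using True by simp
    next
      case False
      then have "j div 2 = Suc ((j - 2) div 2)" by simp
      moreover have "cu (j - 2) \<longleftrightarrow> (j - 2) div 2 = c" using cu j by (metis less_imp_diff_less)
      ultimately show ?thesis using False j by simp
    qed
  qed
  ultimately show ?thesis using run 5(3,4) by blast
qed

lemma runs_main_loop:
  assumes "k + c = n" "in_range v" "\<forall>i. in_range (A i)" "\<forall>j<2 * n. cu j \<longleftrightarrow> j div 2 = c"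
    "d \<le> K + 1" "r_done r = (c = n)"
  shows "\<exists>s'. runs main_loop (k * (20000 * (K + 1) * (2 * n + 1) ^ 2 + 2) + 1) (st' r (int (n + d)) mk cu v A) s' \<and>
    r_fail (fst s') = (r_fail r \<or> (\<exists>c'. c \<le> c' \<and> c' < n \<and> \<not> elem_ok n K sel c'))"
  using assms
proof (induction k arbitrary: c r v A cu d mk)
  case 0
  let ?s = "st' r (int (n + d)) mk cu v A"
  have "runs main_loop 1 ?s ?s" unfolding main_loop_def by (rule runs_While_False) (use 0 in simp)
  moreover have "r_fail (fst ?s) = (r_fail r \<or> (\<exists>c'. c \<le> c' \<and> c' < n \<and> \<not> elem_ok n K sel c'))" using 0(1) by auto
  ultimately show ?case by (intro exI[of _ ?s] conjI) (simp_all only: mult_0 add_0)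
next
  case (Suc k)
  have c: "c < n" using Suc.prems(1) by simp
  obtain r1 v1 A1 mk1 cu1 where 1: "runs main_body (20000 * (K + 1) * (2 * n + 1) ^ 2)
      (st' r (int (n + d)) mk cu v A) (st' r1 (int (n + (K + 1))) mk1 cu1 v1 A1)"
    "r_fail r1 = (r_fail r \<or> \<not> elem_ok n K sel c)" "r_done r1 = (Suc c = n)" "in_range v1" "\<forall>i. in_range (A1 i)"
    "\<forall>j<2 * n. cu1 j \<longleftrightarrow> j div 2 = Suc c"
    using runs_main_body[OF Suc.prems(2,3,4) c Suc.prems(5), where mk = mk and r = r] by blast
  have e: "k + Suc c = n" using Suc.prems(1) by simp
  from Suc.IH[OF e 1(4,5,6) le_refl 1(3), of mk1] obtain s' where
    2: "runs main_loop (k * (20000 * (K + 1) * (2 * n + 1) ^ 2 + 2) + 1) (st' r1 (int (n + (K + 1))) mk1 cu1 v1 A1) s'"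
    "r_fail (fst s') = (r_fail r1 \<or> (\<exists>c'. Suc c \<le> c' \<and> c' < n \<and> \<not> elem_ok n K sel c'))" by blast
  have "runs main_loop (20000 * (K + 1) * (2 * n + 1) ^ 2 + (k * (20000 * (K + 1) * (2 * n + 1) ^ 2 + 2) + 1) + 2)
      (st' r (int (n + d)) mk cu v A) s'"
    unfolding main_loop_def
    by (rule runs_While_True[OF _ 1(1) 2(1)[unfolded main_loop_def]]) (use Suc.prems(6) c in simp)
  then have "runs main_loop (Suc k * (20000 * (K + 1) * (2 * n + 1) ^ 2 + 2) + 1) (st' r (int (n + d)) mk cu v A) s'"
    by (rule runs_mono) simp
  moreover have "(\<exists>c'. c \<le> c' \<and> c' < n \<and> \<not> elem_ok n K sel c') \<longleftrightarrow> \<not> elem_ok n K sel c \<or> (\<exists>c'. Suc c \<le> c' \<and> c' < n \<and> \<not> elem_ok n K sel c')"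
    using c by (metis Suc_le_eq le_eq_less_or_eq)
  ultimately show ?case using 1(2) 2(2) by blast
qed

end

lemma encode_tmpl:
  assumes B: "fin_struct [12] B"
  defines "us \<equiv> sorted_list_of_set (univ B)" and "n \<equiv> card (univ B)"
  defines "sel \<equiv> \<lambda>m. map (\<lambda>i. us ! digit n m i) [0..<12] \<in> rels B 0"
  shows "encode [12] B = replicate n False @ [True] @ map sel [0..<n ^ 12]"
proof -
  have len: "length us = n" unfolding us_def n_def by simp
  have "map (\<lambda>t. t \<in> rels B 0) (List.n_lists 12 us) = map sel [0..<n ^ 12]"
  proof (rule nth_equalityI)
    show l: "length (map (\<lambda>t. t \<in> rels B 0) (List.n_lists 12 us)) = length (map sel [0..<n ^ 12])"
      by (simp add: length_n_lists len)
    fix m assume "m < length (map (\<lambda>t. t \<in> rels B 0) (List.n_lists 12 us))"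
    then have m: "m < n ^ 12" using l by simp
    then show "map (\<lambda>t. t \<in> rels B 0) (List.n_lists 12 us) ! m = map sel [0..<n ^ 12] ! m"
      unfolding sel_def using n_lists_nth[OF len m] by (simp add: length_n_lists len)
  qed
  then show ?thesis unfolding encode_def us_def[symmetric] n_def[symmetric] by simp
qed

text \<open>Renames the universe to \<open>{..<n}\<close> along its sorted enumeration, the order
  used by \<open>encode\<close>.\<close>

lemma CSP_tmpl_iff:
  assumes B: "fin_struct [12] B"
  defines "us \<equiv> sorted_list_of_set (univ B)" and "n \<equiv> card (univ B)"
  defines "sel \<equiv> \<lambda>m. map (\<lambda>i. us ! digit n m i) [0..<12] \<in> rels B 0"
  shows "B \<in> CSP [12] tmpl \<longleftrightarrow> (\<exists>h. (\<forall>b<n. h b < 7) \<and> (\<forall>t\<in>tuples n (n ^ 12) sel. tmpl_tuple (h \<circ> t)))"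
proof -
  have fin: "finite (univ B)" using B unfolding fin_struct_def by blast
  have us: "length us = n" "set us = univ B" "distinct us" unfolding us_def n_def using fin by simp_all
  have tup: "t \<in> rels B 0 \<Longrightarrow> length t = 12 \<and> set t \<subseteq> univ B" for t using B unfolding fin_struct_def by simp
  have dig: "digit n m i < n" if "m < n ^ 12" for m i
  proof -
    have "0 < n" using that by (cases "n = 0") simp_all
    then show ?thesis unfolding digit_def by simp
  qed
  have ex: "\<exists>m<n ^ 12. map (\<lambda>i. us ! digit n m i) [0..<12] = t" if "t \<in> rels B 0" for t
  proof -
    have "t \<in> set (List.n_lists 12 us)" using tup[OF that] us by (simp add: set_n_lists)
    then obtain m where m: "m < length (List.n_lists 12 us)" "List.n_lists 12 us ! m = t"
      by (metis in_set_conv_nth)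
    then have "m < n ^ 12" by (simp add: length_n_lists us)
    then show ?thesis using n_lists_nth[OF us(1), of m 12] m(2) by auto
  qed
  show ?thesis
  proof
    assume "B \<in> CSP [12] tmpl"
    then obtain f where f: "f \<in> homs [12] B tmpl" unfolding CSP_def by blast
    have fu: "f \<in> univ B \<rightarrow>\<^sub>E {..<7}" and fr: "\<And>t. t \<in> rels B 0 \<Longrightarrow> map f t \<in> tmpl_rel"
      using f unfolding homs_def tmpl_def by auto
    have "tmpl_tuple ((\<lambda>b. f (us ! b)) \<circ> t)" if t: "t \<in> tuples n (n ^ 12) sel" for t
    proof -
      obtain m where m: "m < n ^ 12" "sel m" "t = digit n m" using t unfolding tuples_def by blast
      have "map f (map (\<lambda>i. us ! digit n m i) [0..<12]) \<in> tmpl_rel" using fr m(2) unfolding sel_def by blast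
      then show ?thesis unfolding tmpl_tuple_def m(3) by (simp only: map_map comp_def)
    qed
    moreover have "f (us ! b) < 7" if "b < n" for b
    proof -
      have "us ! b \<in> univ B" using us that nth_mem by metis
      then show ?thesis using fu by auto
    qed
    ultimately show "\<exists>h. (\<forall>b<n. h b < 7) \<and> (\<forall>t\<in>tuples n (n ^ 12) sel. tmpl_tuple (h \<circ> t))"
      by (intro exI[of _ "\<lambda>b. f (us ! b)"]) simp
  next
    assume "\<exists>h. (\<forall>b<n. h b < 7) \<and> (\<forall>t\<in>tuples n (n ^ 12) sel. tmpl_tuple (h \<circ> t))"
    then obtain h where h: "\<And>b. b < n \<Longrightarrow> h b < (7::nat)" "\<And>t. t \<in> tuples n (n ^ 12) sel \<Longrightarrow> tmpl_tuple (h \<circ> t)" by blast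
    define idx where "idx x = (THE b. b < n \<and> us ! b = x)" for x
    have idx: "idx (us ! b) = b" if "b < n" for b
      unfolding idx_def using that us(1,3) by (intro the_equality) (auto simp: nth_eq_iff_index_eq)
    define f where "f = restrict (\<lambda>x. h (idx x)) (univ B)"
    have fus: "f (us ! b) = h b" if "b < n" for b
    proof -
      have "us ! b \<in> univ B" using us that nth_mem by metis
      then show ?thesis unfolding f_def using idx[OF that] by simp
    qed
    have "f \<in> univ B \<rightarrow>\<^sub>E {..<7}"
    proof (rule PiE_I)
      fix x assume "x \<in> univ B"
      then obtain b where "b < n" "us ! b = x" using us by (metis in_set_conv_nth)
      then show "f x \<in> {..<7}" using fus h(1) by auto
    qed (simp add: f_def)
    moreover have "map f t \<in> tmpl_rel" if t: "t \<in> rels B 0" for t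
    proof -
      obtain m where m: "m < n ^ 12" "map (\<lambda>i. us ! digit n m i) [0..<12] = t" using ex[OF t] by blast
      then have "digit n m \<in> tuples n (n ^ 12) sel" unfolding tuples_def sel_def using t by auto
      then have "map (h \<circ> digit n m) [0..<12] \<in> tmpl_rel" using h(2) unfolding tmpl_tuple_def by blast
      moreover have "map f t = map (h \<circ> digit n m) [0..<12]"
        unfolding m(2)[symmetric] map_map comp_def using fus dig[OF m(1)] by (simp only:)
      ultimately show ?thesis by simp
    qed
    ultimately have "f \<in> homs [12] B tmpl" unfolding homs_def tmpl_def by simp
    then show "B \<in> CSP [12] tmpl" unfolding CSP_def using B by blast
  qed
qed

lemma tractable_tmpl: "tractable_CSP [12] tmpl"
proof -
  \<comment> \<open>All registers but \<open>r_fail\<close> are written before they are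
    read.\<close>
  define r0 :: reg where "r0 = undefined\<lparr>r_fail := False\<rparr>"
  obtain M where wf: "wf_tm M" and M: "\<And>w T s' t. runs main_prog T (r0, (0, input_tape w), (0, \<lambda>_. None), (0, \<lambda>_. (Z0, False))) s' \<Longrightarrow>
      T + 2 \<le> t \<Longrightarrow> tm_state_after M t w = (if \<not> r_fail (fst s') then 1 else 2)"
    using tm_of_prog[of main_prog r0 None "(Z0, False)" "\<lambda>r. \<not> r_fail r"] by blast
  \<comment> \<open>The time is of order \<open>n * (K + 1) * (2 * n + 1) ^ 2\<close>. The input has
    one bit for each of the \<open>K = n ^ 12\<close> tuples, so every factor is linear in its
    length \<open>n + 1 + K\<close>.\<close>
  define p :: "nat poly" where "p = [:100000:] * [:1, 1:] ^ 4"
  have p: "poly p L = 100000 * (L + 1) ^ 4" for L unfolding p_def by (simp add: poly_power)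
  have "tm_state_after M (poly p (length (encode [12] B))) (encode [12] B) = (if B \<in> CSP [12] tmpl then 1 else 2)"
    if B: "fin_struct [12] B" for B
  proof -
    define us where "us = sorted_list_of_set (univ B)"
    define n where "n = card (univ B)"
    define sel where "sel m \<longleftrightarrow> map (\<lambda>i. us ! digit n m i) [0..<12] \<in> rels B 0" for m
    define K where "K = n ^ 12"
    define w where "w = encode [12] B"
    have w: "w = replicate n False @ [True] @ map sel [0..<K]"
      unfolding w_def K_def sel_def[abs_def] us_def n_def by (rule encode_tmpl[OF B])
    have lw: "length w = n + 1 + K" unfolding w by simp
    define inp where "inp = (input_tape w)(int n := IS)"
    have inw: "input_tape w (int x) = (if x < length w then if w ! x then I1 else I0 else IB)" for x
      unfolding input_tape_def by simp
    have i0: "input_tape w (int x) = I0" if "x < n" for x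
      unfolding inw using that lw by (simp add: w nth_append)
    have i1: "input_tape w (int n) = I1" unfolding inw using lw by (simp add: w nth_append)
    have inp': "inp (int x) = input_tape w (int x)" if "x \<noteq> n" for x using that unfolding inp_def by simp
    have it: "\<forall>m<K. inp (int (n + 1 + m)) = (if sel m then I1 else I0)"
    proof (intro allI impI)
      fix m assume m: "m < K"
      have "w ! (n + 1 + m) = sel m" using m by (simp add: w nth_append)
      moreover have "n + 1 + m < length w" using m lw by simp
      moreover have "n + 1 + m \<noteq> n" by simp
      ultimately show "inp (int (n + 1 + m)) = (if sel m then I1 else I0)" using inp'[of "n + 1 + m"] inw[of "n + 1 + m"] by presburger
    qed
    have ie: "inp (int (n + 1 + K)) = IB"
    proof -
      have "n + 1 + K \<noteq> n" "\<not> n + 1 + K < length w" using lw by simp_all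
      then show ?thesis using inp'[of "n + 1 + K"] inw[of "n + 1 + K"] by presburger
    qed
    have io: "\<forall>x. x \<noteq> int n \<longrightarrow> inp x \<noteq> IS" unfolding inp_def input_tape_def by simp
    have sep: "inp (int n) = IS" unfolding inp_def by simp
    let ?D = "2 * n"
    have 1: "runs init_prog (20 * (n + 2)) (r0, (0, input_tape w), (0, \<lambda>_. None), (0, \<lambda>_. (Z0, False)))
      (r0, (int (n + 1), inp), (0, wtape ?D (blank_cells ?D)), (0, mtape ?D (\<lambda>_ _. 0)))"
      unfolding inp_def by (rule runs_init_prog[where n = n]) (use i0 i1 in simp_all)
    let ?cu = "\<lambda>j. j \<noteq> ?D \<and> (if j < 2 then True else False)"
    obtain r1 where 2: "runs (cur_prog True) (6 * ?D + 22)
        (r0, (int (n + 1), inp), (0, wtape ?D (blank_cells ?D)), (0, mtape ?D (\<lambda>_ _. 0)))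
        (r1, (int (n + 1), inp), (0, wtape ?D (cells ?D (\<lambda>_. {}) (\<lambda>j. j = ?D) ?cu (\<lambda>_. 0))), (0, mtape ?D (\<lambda>_ _. 0)))"
      "keep r1 = keep (r0\<lparr>r_done := (if ?D < 2 then True else False)\<rparr>)"
      using runs_cur_prog[where x = True and D = ?D and r = r0 and c = "\<lambda>_. False" and mk = "\<lambda>_. {}" and pv = "\<lambda>j. j = ?D" and v = "\<lambda>_. 0"]
      unfolding blank_cells_def by blast
    have r1: "r_done r1 = (0 = n)" "r_fail r1 = False" using 2(2) unfolding keep_def r0_def by auto
    have cu: "\<forall>j<?D. ?cu j \<longleftrightarrow> j div 2 = 0" by auto
    have zr: "in_range (\<lambda>_. 0)" unfolding in_range_def by simp
    have zA: "\<forall>i::nat. in_range ((\<lambda>_ _. 0) i)" using zr by simp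
    have le: "1 \<le> K + 1" by simp
    have "\<exists>s'. runs main_loop (n * (20000 * (K + 1) * (2 * n + 1) ^ 2 + 2) + 1)
        (r1, (int (n + 1), inp), (0, wtape ?D (cells ?D (\<lambda>_. {}) (\<lambda>j. j = ?D) ?cu (\<lambda>_. 0))), (0, mtape ?D (\<lambda>_ _. 0))) s' \<and>
      r_fail (fst s') = (r_fail r1 \<or> (\<exists>c'. 0 \<le> c' \<and> c' < n \<and> \<not> elem_ok n K sel c'))"
      by (rule runs_main_loop[OF K_def sep io it ie add_0_right zr zA cu le r1(1)])
    then obtain s' where 3: "runs main_loop (n * (20000 * (K + 1) * (2 * n + 1) ^ 2 + 2) + 1)
        (r1, (int (n + 1), inp), (0, wtape ?D (cells ?D (\<lambda>_. {}) (\<lambda>j. j = ?D) ?cu (\<lambda>_. 0))), (0, mtape ?D (\<lambda>_ _. 0))) s'"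
      "r_fail (fst s') = (r_fail r1 \<or> (\<exists>c'. 0 \<le> c' \<and> c' < n \<and> \<not> elem_ok n K sel c'))"
      by blast
    have run: "runs main_prog (20 * (n + 2) + ((6 * ?D + 22) + (n * (20000 * (K + 1) * (2 * n + 1) ^ 2 + 2) + 1) + 1) + 1)
        (r0, (0, input_tape w), (0, \<lambda>_. None), (0, \<lambda>_. (Z0, False))) s'"
      unfolding main_prog_def by (rule runs_Seq[OF 1 runs_Seq[OF 2(1) 3(1)]])
    have time: "20 * (n + 2) + ((6 * ?D + 22) + (n * (20000 * (K + 1) * (2 * n + 1) ^ 2 + 2) + 1) + 1) + 1 + 2 \<le> poly p (length w)"
    proof -
      define X where "X = length w + 1"
      have X: "n + 2 \<le> X" "K + 1 \<le> X" "2 * n + 1 \<le> 2 * X" unfolding X_def lw by simp_all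
      have "(2 * n + 1) ^ 2 \<le> (2 * X) ^ 2" by (rule power_mono[OF X(3)]) simp
      then have "(K + 1) * (2 * n + 1) ^ 2 \<le> X * (2 * X) ^ 2" by (intro mult_le_mono X(2))
      then have "n * ((K + 1) * (2 * n + 1) ^ 2) \<le> X * (X * (2 * X) ^ 2)"
        by (rule mult_le_mono[rotated]) (use X(1) in simp)
      also have "\<dots> = 4 * X ^ 4" by (simp add: power2_eq_square power4_eq_xxxx)
      finally have a: "n * ((K + 1) * (2 * n + 1) ^ 2) \<le> 4 * X ^ 4" .
      have b: "X \<le> X ^ 4" using X(2) by (intro self_le_power) simp_all
      have m: "n * (20000 * (K + 1) * (2 * n + 1) ^ 2 + 2) = 20000 * (n * ((K + 1) * (2 * n + 1) ^ 2)) + 2 * n"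
        by (simp add: algebra_simps)
      have gen: "20 * (n + 2) + ((6 * ?D + 22) + (m + 1) + 1) + 1 + 2 \<le> 100000 * Y"
        if "m = 20000 * a + 2 * n" "a \<le> 4 * Y" "X \<le> Y" for m a Y :: nat
        using that X(1) by simp
      have "poly p (length w) = 100000 * X ^ 4" unfolding p X_def ..
      then show ?thesis using gen[OF m a b] by (simp only:)
    qed
    have res: "tm_state_after M (poly p (length w)) w = (if \<not> r_fail (fst s') then 1 else 2)"
      by (rule M[OF run]) (use time in simp)
    have "B \<in> CSP [12] tmpl \<longleftrightarrow> (\<forall>c<n. elem_ok n K sel c)"
    proof -
      have "B \<in> CSP [12] tmpl \<longleftrightarrow> (\<exists>h. (\<forall>b<n. h b < 7) \<and> (\<forall>t\<in>tuples n K sel. tmpl_tuple (h \<circ> t)))"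
        unfolding K_def sel_def[abs_def] us_def n_def by (rule CSP_tmpl_iff[OF B])
      also have "\<dots> \<longleftrightarrow> (\<forall>c<n. solvable n (tuples n K sel) 0 c \<and> (solvable n (tuples n K sel) 1 c \<or> solvable n (tuples n K sel) 2 c))"
      proof (rule hom_iff_solvable)
        fix t assume "t \<in> tuples n K sel"
        then obtain m where "m < K" "t = digit n m" unfolding tuples_def by blast
        then show "\<forall>j<12. t j < n" unfolding digit_def K_def by (cases "n = 0") simp_all
      qed
      finally show ?thesis unfolding elem_ok_def .
    qed
    then have "\<not> r_fail (fst s') \<longleftrightarrow> B \<in> CSP [12] tmpl" using 3(2) r1(2) by auto
    then show ?thesis using res unfolding w_def by simp
  qed
  then show ?thesis unfolding tractable_CSP_def using wf by blast
qed

theorem theorem1p1: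
  shows "(\<exists>(\<tau> :: vocabulary) (A :: nat rel_struct).
      template \<tau> A \<and> card (univ A) = 7 \<and> has_Maltsev \<tau> A \<and>
      (\<forall>k. sublinear_width k \<longrightarrow>
         \<not> solves_CSP (Z_affine_consistency k :: (nat, nat) csp_algorithm) \<tau> A) \<and>
      \<not> solves_CSP (BLP_AIP :: (nat, nat) csp_algorithm) \<tau> A \<and>
      (\<forall>k. sublinear_width k \<longrightarrow> \<not> solves_CSP (BA k :: (nat, nat) csp_algorithm) \<tau> A) \<and>
      \<not> solves_CSP (CLAP :: (nat, nat) csp_algorithm) \<tau> A) \<and>
    (\<forall>k. sublinear_width k \<longrightarrow> \<not> solves_all_tractable_CSPs (Z_affine_consistency k)) \<and>
    \<not> solves_all_tractable_CSPs BLP_AIP \<and>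
    (\<forall>k. sublinear_width k \<longrightarrow> \<not> solves_all_tractable_CSPs (BA k)) \<and>
    \<not> solves_all_tractable_CSPs CLAP"
proof -
  \<comment> \<open>BLP+AIP is BA of constant width 1, which is sublinear.\<close>
  have BLP: "\<not> solves_CSP (BLP_AIP :: (nat, nat) csp_algorithm) [12] tmpl"
    unfolding BLP_AIP_def by (rule tmpl_not_solved(2)[OF sublinear_width_1])
  have card: "card (univ tmpl) = 7" unfolding tmpl_def by simp
  have tract: "solves_CSP alg [12] tmpl" if "solves_all_tractable_CSPs alg" for alg :: "(nat, nat) csp_algorithm"
    using that template_tmpl tractable_tmpl unfolding solves_all_tractable_CSPs_def by blast
  show ?thesis
    using template_tmpl card has_Maltsev_tmpl tmpl_not_solved BLP tract by blast
qed

end
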